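(* Let $R$ be a commutative noetherian semilocal normal domain. If $R$ has a non-commutative resolution (NCR), then the class group $\operatorname{Cl}(R)$ is a finitely generated abelian group.
   Context: A finitely generated module $M$ over a commutative noetherian ring $R$ is said to give a non-commutative resolution (NCR) of $R$ if $M$ is faithful and $\operatorname{End}_R(M)$ has finite global dimension. $R$ has an NCR if such an $M$ exists. *)

theory Defs
  imports "HOL-Algebra.Algebra" "HOL-Library.Extended_Nat"
begin

section \<open>Modules over a not necessarily commutative ring\<close>

text \<open>The library locale \<^locale>\<open>Module.module\<close> demands a commutative ring of scalars. The
  following is the same notion over an arbitrary unital ring \<open>L\<close>, on the library's records.\<close>

locale left_module = L?: ring L + M?: abelian_group M
  for L :: "('l, 'k) ring_scheme" (structure) and M :: "('l, 'x, 'c) module_scheme" (structure) +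
  assumes smult_closed:
      "\<lbrakk>a \<in> carrier L; x \<in> carrier M\<rbrakk> \<Longrightarrow> a \<odot>\<^bsub>M\<^esub> x \<in> carrier M"
    and smult_l_distr:
      "\<lbrakk>a \<in> carrier L; b \<in> carrier L; x \<in> carrier M\<rbrakk> \<Longrightarrow>
        (a \<oplus>\<^bsub>L\<^esub> b) \<odot>\<^bsub>M\<^esub> x = a \<odot>\<^bsub>M\<^esub> x \<oplus>\<^bsub>M\<^esub> b \<odot>\<^bsub>M\<^esub> x"
    and smult_r_distr:
      "\<lbrakk>a \<in> carrier L; x \<in> carrier M; y \<in> carrier M\<rbrakk> \<Longrightarrow>
        a \<odot>\<^bsub>M\<^esub> (x \<oplus>\<^bsub>M\<^esub> y) = a \<odot>\<^bsub>M\<^esub> x \<oplus>\<^bsub>M\<^esub> a \<odot>\<^bsub>M\<^esub> y"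
    and smult_assoc:
      "\<lbrakk>a \<in> carrier L; b \<in> carrier L; x \<in> carrier M\<rbrakk> \<Longrightarrow>
        (a \<otimes>\<^bsub>L\<^esub> b) \<odot>\<^bsub>M\<^esub> x = a \<odot>\<^bsub>M\<^esub> (b \<odot>\<^bsub>M\<^esub> x)"
    and smult_one: "x \<in> carrier M \<Longrightarrow> \<one>\<^bsub>L\<^esub> \<odot>\<^bsub>M\<^esub> x = x"

definition lin_maps ::
  "('l, 'k) ring_scheme \<Rightarrow> ('l, 'a, 'c) module_scheme \<Rightarrow> ('l, 'b, 'd) module_scheme \<Rightarrow> ('a \<Rightarrow> 'b) set"
  where "lin_maps L M N =
    {f \<in> hom (add_monoid M) (add_monoid N).
       \<forall>a \<in> carrier L. \<forall>x \<in> carrier M. f (a \<odot>\<^bsub>M\<^esub> x) = a \<odot>\<^bsub>N\<^esub> f x}"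

definition lin_kernel :: "('l, 'a, 'c) module_scheme \<Rightarrow> ('l, 'b, 'd) module_scheme \<Rightarrow> ('a \<Rightarrow> 'b) \<Rightarrow> 'a set"
  where "lin_kernel M N f = {x \<in> carrier M. f x = \<zero>\<^bsub>N\<^esub>}"

definition fg_module :: "('r, 'k) ring_scheme \<Rightarrow> ('r, 'm, 'c) module_scheme \<Rightarrow> bool"
  where "fg_module R M \<longleftrightarrow>
    (\<exists>S \<subseteq> carrier M. finite S \<and> (\<forall>N. submodule N R M \<and> S \<subseteq> N \<longrightarrow> N = carrier M))"

definition faithful_module :: "('r, 'k) ring_scheme \<Rightarrow> ('r, 'm, 'c) module_scheme \<Rightarrow> bool"
  where "faithful_module R M \<longleftrightarrow>
    (\<forall>a \<in> carrier R. (\<forall>x \<in> carrier M. a \<odot>\<^bsub>M\<^esub> x = \<zero>\<^bsub>M\<^esub>) \<longrightarrow> a = \<zero>\<^bsub>R\<^esub>)"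

text \<open>Endomorphisms are taken extensional, so that each one is represented by exactly one
  HOL function.\<close>

definition End_ring :: "('r, 'k) ring_scheme \<Rightarrow> ('r, 'm, 'c) module_scheme \<Rightarrow> ('m \<Rightarrow> 'm) ring"
  where "End_ring R M =
    \<lparr>carrier = lin_maps R M M \<inter> extensional (carrier M),
     monoid.mult = compose (carrier M),
     monoid.one = (\<lambda>x \<in> carrier M. x),
     ring.zero = (\<lambda>x \<in> carrier M. \<zero>\<^bsub>M\<^esub>),
     ring.add = (\<lambda>f g. \<lambda>x \<in> carrier M. f x \<oplus>\<^bsub>M\<^esub> g x)\<rparr>"


section \<open>Projective and global dimension\<close>

text \<open>A HOL formula cannot quantify over types, so the next notions refer to modules whose
  elements are drawn from one type \<open>'x\<close>. They are the usual ones whenever \<open>'x\<close> is infinite and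
  at least as large as the ring, as then every module in \<open>'x\<close> has a free cover in \<open>'x\<close>.\<close>

definition projective_module :: "('l, 'k) ring_scheme \<Rightarrow> ('l, 'x) module \<Rightarrow> bool"
  where "projective_module L P \<longleftrightarrow> left_module L P \<and>
    (\<forall>(M :: ('l, 'x) module) (N :: ('l, 'x) module) g f.
       left_module L M \<and> left_module L N \<and>
       g \<in> lin_maps L M N \<and> g ` carrier M = carrier N \<and> f \<in> lin_maps L P N \<longrightarrow>
       (\<exists>h \<in> lin_maps L P M. \<forall>x \<in> carrier P. g (h x) = f x))"

text \<open>An exact sequence \<open>\<dots> \<rightarrow> P 1 \<rightarrow> P 0 \<rightarrow> M \<rightarrow> 0\<close> with maps \<open>d i : P (i + 1) \<rightarrow> P i\<close> and
  augmentation \<open>e : P 0 \<rightarrow> M\<close>.\<close>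

definition projective_resolution ::
  "('l, 'k) ring_scheme \<Rightarrow> ('l, 'x) module \<Rightarrow> (nat \<Rightarrow> ('l, 'x) module) \<Rightarrow> (nat \<Rightarrow> 'x \<Rightarrow> 'x) \<Rightarrow> ('x \<Rightarrow> 'x) \<Rightarrow> bool"
  where "projective_resolution L M P d e \<longleftrightarrow>
    (\<forall>i. projective_module L (P i)) \<and>
    (\<forall>i. d i \<in> lin_maps L (P (Suc i)) (P i)) \<and>
    e \<in> lin_maps L (P 0) M \<and>
    e ` carrier (P 0) = carrier M \<and>
    d 0 ` carrier (P 1) = lin_kernel (P 0) M e \<and>
    (\<forall>i. d (Suc i) ` carrier (P (Suc (Suc i))) = lin_kernel (P (Suc i)) (P i) (d i))"

definition proj_dim :: "('l, 'k) ring_scheme \<Rightarrow> ('l, 'x) module \<Rightarrow> enat"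
  where "proj_dim L M =
    Inf {enat n | n. \<exists>P d e. projective_resolution L M P d e \<and> (\<forall>i > n. carrier (P i) = {\<zero>\<^bsub>P i\<^esub>})}"

text \<open>The left global dimension. The supremum runs over all left modules with elements in
  \<open>(nat \<Rightarrow> 'l) set\<close>. This type has room for a copy of every countably generated module, in
  particular of every cyclic one (a quotient of the free module of countable rank, the elements
  being cosets), so by Auslander's theorem the supremum is the one over all modules. The left
  and right global dimensions agree for noetherian rings, which covers endomorphism rings of
  finitely generated modules over commutative noetherian rings.\<close>

definition gl_dim :: "('l, 'k) ring_scheme \<Rightarrow> enat"
  where "gl_dim L = (SUP M \<in> {M :: ('l, (nat \<Rightarrow> 'l) set) module. left_module L M}. proj_dim L M)"

definition gives_NCR :: "('r, 'k) ring_scheme \<Rightarrow> ('r, 'm, 'c) module_scheme \<Rightarrow> bool"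
  where "gives_NCR R M \<longleftrightarrow>
    module R M \<and> fg_module R M \<and> faithful_module R M \<and> gl_dim (End_ring R M) < \<infinity>"


section \<open>The field of fractions of a domain\<close>

definition frac_rel :: "('r, 'k) ring_scheme \<Rightarrow> (('r \<times> 'r) \<times> ('r \<times> 'r)) set"
  where "frac_rel R = {((a, b), (c, d)).
    a \<in> carrier R \<and> b \<in> carrier R - {\<zero>\<^bsub>R\<^esub>} \<and> c \<in> carrier R \<and> d \<in> carrier R - {\<zero>\<^bsub>R\<^esub>} \<and>
    a \<otimes>\<^bsub>R\<^esub> d = c \<otimes>\<^bsub>R\<^esub> b}"

definition frac_class :: "('r, 'k) ring_scheme \<Rightarrow> 'r \<Rightarrow> 'r \<Rightarrow> ('r \<times> 'r) set"
  where "frac_class R a b = frac_rel R `` {(a, b)}"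

definition Frac :: "('r, 'k) ring_scheme \<Rightarrow> ('r \<times> 'r) set ring"
  where "Frac R =
    \<lparr>carrier = (carrier R \<times> (carrier R - {\<zero>\<^bsub>R\<^esub>})) // frac_rel R,
     monoid.mult = (\<lambda>U V. \<Union>(a, b) \<in> U. \<Union>(c, d) \<in> V. frac_class R (a \<otimes>\<^bsub>R\<^esub> c) (b \<otimes>\<^bsub>R\<^esub> d)),
     monoid.one = frac_class R \<one>\<^bsub>R\<^esub> \<one>\<^bsub>R\<^esub>,
     ring.zero = frac_class R \<zero>\<^bsub>R\<^esub> \<one>\<^bsub>R\<^esub>,
     ring.add = (\<lambda>U V. \<Union>(a, b) \<in> U. \<Union>(c, d) \<in> V.
       frac_class R (a \<otimes>\<^bsub>R\<^esub> d \<oplus>\<^bsub>R\<^esub> c \<otimes>\<^bsub>R\<^esub> b) (b \<otimes>\<^bsub>R\<^esub> d))\<rparr>"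

text \<open>The copy of \<open>R\<close> inside its field of fractions.\<close>

definition Frac_base :: "('r, 'k) ring_scheme \<Rightarrow> ('r \<times> 'r) set set"
  where "Frac_base R = (\<lambda>a. frac_class R a \<one>\<^bsub>R\<^esub>) ` carrier R"

definition integral_over :: "('a, 'k) ring_scheme \<Rightarrow> 'a set \<Rightarrow> 'a \<Rightarrow> bool"
  where "integral_over K S x \<longleftrightarrow>
    (\<exists>p. polynomial\<^bsub>K\<^esub> S p \<and> p \<noteq> [] \<and> lead_coeff p = \<one>\<^bsub>K\<^esub> \<and> ring.eval K p x = \<zero>\<^bsub>K\<^esub>)"

definition normal_domain :: "('r, 'k) ring_scheme \<Rightarrow> bool"
  where "normal_domain R \<longleftrightarrow> domain R \<and>
    (\<forall>x \<in> carrier (Frac R). integral_over (Frac R) (Frac_base R) x \<longrightarrow> x \<in> Frac_base R)"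

definition semilocal :: "('r, 'k) ring_scheme \<Rightarrow> bool"
  where "semilocal R \<longleftrightarrow> finite {I. maximalideal I R}"


section \<open>The divisor class group\<close>

definition fractional_ideal :: "('r, 'k) ring_scheme \<Rightarrow> ('r \<times> 'r) set set \<Rightarrow> bool"
  where "fractional_ideal R I \<longleftrightarrow>
    subgroup I (add_monoid (Frac R)) \<and> I \<noteq> {\<zero>\<^bsub>Frac R\<^esub>} \<and>
    (\<forall>a \<in> Frac_base R. \<forall>x \<in> I. a \<otimes>\<^bsub>Frac R\<^esub> x \<in> I) \<and>
    (\<exists>c \<in> Frac_base R - {\<zero>\<^bsub>Frac R\<^esub>}. \<forall>x \<in> I. c \<otimes>\<^bsub>Frac R\<^esub> x \<in> Frac_base R)"

text \<open>The colon \<open>(R : I)\<close>, formed in the field of fractions.\<close>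

definition colon :: "('r, 'k) ring_scheme \<Rightarrow> ('r \<times> 'r) set set \<Rightarrow> ('r \<times> 'r) set set"
  where "colon R I = {x \<in> carrier (Frac R). \<forall>y \<in> I. x \<otimes>\<^bsub>Frac R\<^esub> y \<in> Frac_base R}"

text \<open>Divisorial (reflexive) fractional ideals, with product \<open>(R : (R : I J))\<close>.\<close>

definition divisor_group :: "('r, 'k) ring_scheme \<Rightarrow> ('r \<times> 'r) set set monoid"
  where "divisor_group R =
    \<lparr>carrier = {I. fractional_ideal R I \<and> colon R (colon R I) = I},
     monoid.mult = (\<lambda>I J. colon R (colon R (generate (add_monoid (Frac R)) (I <#>\<^bsub>Frac R\<^esub> J)))),
     monoid.one = Frac_base R\<rparr>"

definition principal_divisors :: "('r, 'k) ring_scheme \<Rightarrow> ('r \<times> 'r) set set set"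
  where "principal_divisors R =
    {x <#\<^bsub>Frac R\<^esub> Frac_base R | x. x \<in> carrier (Frac R) - {\<zero>\<^bsub>Frac R\<^esub>}}"

definition class_group :: "('r, 'k) ring_scheme \<Rightarrow> ('r \<times> 'r) set set set monoid"
  where "class_group R = divisor_group R Mod principal_divisors R"

definition fg_abelian_group :: "('a, 'k) monoid_scheme \<Rightarrow> bool"
  where "fg_abelian_group G \<longleftrightarrow>
    comm_group G \<and> (\<exists>S \<subseteq> carrier G. finite S \<and> generate G S = carrier G)"

end

theory Submission
  imports Defs
begin

text \<open>
  Let \<open>\<Lambda> = End\<^sub>R(M)\<close>. The idea is to compare \<open>Cl(R)\<close> with the Grothendieck group of finitely
  generated projective left \<open>\<Lambda>\<close>-modules: finite global dimension makes the comparison map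
  surjective, and semilocality makes its image finitely generated.

  A lattice \<open>Y\<close> over a normal domain has a determinant in \<open>Cl(R)\<close>. It is additive on exact
  sequences and does not change in codimension two. It is computed here by filtering \<open>Y\<close> by the
  kernels of finitely many functionals, the successive factors being ideals (\<open>lat\<close>); that the
  order of the functionals does not matter reduces to the case of rank two (\<open>plane_weight\<close>,
  \<open>class_weight\<close>). The rank is obtained from the same construction, with the weight of an ideal
  in \<open>\<nat>\<close> instead of \<open>Cl(R)\<close>.

  To a submodule \<open>Z\<close> of a free left \<open>\<Lambda>\<close>-module corresponds the \<open>R\<close>-lattice \<open>Hom\<^sub>\<Lambda>(M, Z)\<close>, whose
  determinant is the class of \<open>Z\<close>. The module \<open>M\<close> need not be a progenerator over \<open>\<Lambda>\<close>, but the
  image of the trace pairing \<open>M\<^sup>* \<otimes> M \<rightarrow> R\<close> lies in no prime of height one (\<open>dense_trace\<close>), as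
  \<open>R\<close> is completely integrally closed. Hence the functor is exact up to codimension two and the
  class is additive (\<open>module_class_exact\<close>). Every element of \<open>Cl(R)\<close> is the class of a left ideal
  of \<open>\<Lambda>\<close>, namely of the endomorphisms that look like \<open>m \<otimes> \<alpha>\<^sub>0\<close> with \<open>m \<in> I M\<close> for a fixed
  functional \<open>\<alpha>\<^sub>0\<close> (\<open>module_class_ideal_submodule\<close>).

  Every finitely generated left ideal has a finite projective resolution. A given resolution is
  compared with one by finitely generated free modules, and after finitely many steps the syzygy
  of the latter is projective. By additivity the classes of finitely generated projective modules
  generate \<open>Cl(R)\<close> (\<open>syzygy_class\<close>).

  Finally let \<open>R\<close> be semilocal. Then \<open>\<Lambda>\<close> has only finitely many simple modules, and a finitely
  generated projective module has finite length modulo its radical. If every simple module occurs in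
  \<open>P\<close> modulo its radical at least as often as in \<open>Q\<close>, then \<open>P\<close> maps onto \<open>Q\<close>
  (\<open>frame_surjection\<close>), so \<open>Q\<close> is a summand of \<open>P\<close> and the complement has smaller rank. By
  Dickson's lemma on the vectors of multiplicities, finitely many modules \<open>Q\<close> of positive rank
  serve for all \<open>P\<close>, and induction on the rank shows that their classes generate
  (\<open>projective_classes_finitely_generated\<close>).
\<close>

section \<open>The field of fractions\<close>

context domain
begin

lemma frac_equiv: "equiv (carrier R \<times> (carrier R - {\<zero>})) (frac_rel R)"
proof (rule equivI)
  show "frac_rel R \<subseteq> (carrier R \<times> (carrier R - {\<zero>})) \<times> (carrier R \<times> (carrier R - {\<zero>}))"
    by (auto simp: frac_rel_def)
  show "refl_on (carrier R \<times> (carrier R - {\<zero>})) (frac_rel R)"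
    by (auto simp: frac_rel_def refl_on_def)
  show "sym (frac_rel R)"
    by (auto simp: frac_rel_def sym_def)
  show "trans (frac_rel R)"
  proof (rule transI)
    fix x y z assume "(x, y) \<in> frac_rel R" "(y, z) \<in> frac_rel R"
    then obtain a b c d e f where
      xyz: "x = (a, b)" "y = (c, d)" "z = (e, f)" and
      cl: "a \<in> carrier R" "b \<in> carrier R" "c \<in> carrier R" "d \<in> carrier R" "e \<in> carrier R" "f \<in> carrier R"
        "b \<noteq> \<zero>" "d \<noteq> \<zero>" "f \<noteq> \<zero>" and
      eq: "a \<otimes> d = c \<otimes> b" "c \<otimes> f = e \<otimes> d"
      by (auto simp: frac_rel_def)
    have "d \<otimes> (a \<otimes> f) = (a \<otimes> d) \<otimes> f" using cl by (simp add: m_ac)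
    also have "\<dots> = (c \<otimes> f) \<otimes> b" using cl eq(1) by (simp add: m_ac)
    also have "\<dots> = d \<otimes> (e \<otimes> b)" using cl eq(2) by (simp add: m_ac)
    finally have "a \<otimes> f = e \<otimes> b" using cl m_lcancel[of d "a \<otimes> f" "e \<otimes> b"] by simp
    then show "(x, z) \<in> frac_rel R" using xyz cl by (simp add: frac_rel_def)
  qed
qed

lemma frac_class_eq_iff:
  assumes "a \<in> carrier R" "b \<in> carrier R" "b \<noteq> \<zero>" "c \<in> carrier R" "d \<in> carrier R" "d \<noteq> \<zero>"
  shows "frac_class R a b = frac_class R c d \<longleftrightarrow> a \<otimes> d = c \<otimes> b"
  using eq_equiv_class_iff[OF frac_equiv, of "(a, b)" "(c, d)"] assms
  by (auto simp: frac_class_def frac_rel_def)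

lemma frac_class_carrier:
  "\<lbrakk>a \<in> carrier R; b \<in> carrier R; b \<noteq> \<zero>\<rbrakk> \<Longrightarrow> frac_class R a b \<in> carrier (Frac R)"
  by (auto simp: Frac_def frac_class_def intro: quotientI)

lemma Frac_carrierE:
  assumes "x \<in> carrier (Frac R)"
  obtains a b where "a \<in> carrier R" "b \<in> carrier R" "b \<noteq> \<zero>" "x = frac_class R a b"
  using assms by (auto simp: Frac_def frac_class_def elim!: quotientE)

lemma mem_frac_class:
  "\<lbrakk>a \<in> carrier R; b \<in> carrier R; b \<noteq> \<zero>\<rbrakk> \<Longrightarrow>
    (p, q) \<in> frac_class R a b \<longleftrightarrow> p \<in> carrier R \<and> q \<in> carrier R \<and> q \<noteq> \<zero> \<and> a \<otimes> q = p \<otimes> b"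
  by (auto simp: frac_class_def frac_rel_def)

lemma frac_UN2:
  fixes f :: "'a \<Rightarrow> 'a \<Rightarrow> 'a \<Rightarrow> 'a \<Rightarrow> ('a \<times> 'a) set"
  assumes ab: "a \<in> carrier R" "b \<in> carrier R" "b \<noteq> \<zero>" and cd: "c \<in> carrier R" "d \<in> carrier R" "d \<noteq> \<zero>"
    and cong: "\<And>p q r s. \<lbrakk>p \<in> carrier R; q \<in> carrier R; q \<noteq> \<zero>; a \<otimes> q = p \<otimes> b;
        r \<in> carrier R; s \<in> carrier R; s \<noteq> \<zero>; c \<otimes> s = r \<otimes> d\<rbrakk> \<Longrightarrow> f p q r s = f a b c d"
  shows "(\<Union>(p, q) \<in> frac_class R a b. \<Union>(r, s) \<in> frac_class R c d. f p q r s) = f a b c d"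
proof -
  have const: "(\<Union>(r, s) \<in> U. g r s) = t"
    if "(r0, s0) \<in> U" "\<And>r s. (r, s) \<in> U \<Longrightarrow> g r s = t" for U r0 s0 and g :: "'a \<Rightarrow> 'a \<Rightarrow> ('a \<times> 'a) set" and t
  proof -
    have "(\<Union>(r, s) \<in> U. g r s) = (\<Union>z \<in> U. t)"
      using that(2) by (intro SUP_cong) auto
    then show ?thesis using that(1) by auto
  qed
  have "(\<Union>(r, s) \<in> frac_class R c d. f p q r s) = f a b c d" if "(p, q) \<in> frac_class R a b" for p q
  proof (rule const[of c d])
    show "(c, d) \<in> frac_class R c d" using cd by (simp add: mem_frac_class)
    fix r s assume "(r, s) \<in> frac_class R c d"
    with that show "f p q r s = f a b c d" by (intro cong) (simp_all add: mem_frac_class ab cd)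
  qed
  moreover have "(a, b) \<in> frac_class R a b" using ab by (simp add: mem_frac_class)
  ultimately show ?thesis by - (rule const[of a b])
qed

lemma frac_mult:
  assumes ab: "a \<in> carrier R" "b \<in> carrier R" "b \<noteq> \<zero>" and cd: "c \<in> carrier R" "d \<in> carrier R" "d \<noteq> \<zero>"
  shows "frac_class R a b \<otimes>\<^bsub>Frac R\<^esub> frac_class R c d = frac_class R (a \<otimes> c) (b \<otimes> d)"
proof -
  have "frac_class R (p \<otimes> r) (q \<otimes> s) = frac_class R (a \<otimes> c) (b \<otimes> d)"
    if h: "p \<in> carrier R" "q \<in> carrier R" "q \<noteq> \<zero>" "a \<otimes> q = p \<otimes> b"
        "r \<in> carrier R" "s \<in> carrier R" "s \<noteq> \<zero>" "c \<otimes> s = r \<otimes> d" for p q r s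
  proof -
    note hc = h(1-3,5-7)
    have "(p \<otimes> r) \<otimes> (b \<otimes> d) = (p \<otimes> b) \<otimes> (r \<otimes> d)" using hc ab cd by (simp add: m_ac)
    also have "\<dots> = (a \<otimes> q) \<otimes> (c \<otimes> s)" by (simp only: h)
    also have "\<dots> = (a \<otimes> c) \<otimes> (q \<otimes> s)" using hc ab cd by (simp add: m_ac)
    finally show ?thesis using hc ab cd by (simp add: frac_class_eq_iff integral_iff)
  qed
  then show ?thesis unfolding Frac_def by (simp add: frac_UN2[OF ab cd])
qed

lemma frac_add:
  assumes ab: "a \<in> carrier R" "b \<in> carrier R" "b \<noteq> \<zero>" and cd: "c \<in> carrier R" "d \<in> carrier R" "d \<noteq> \<zero>"
  shows "frac_class R a b \<oplus>\<^bsub>Frac R\<^esub> frac_class R c d = frac_class R (a \<otimes> d \<oplus> c \<otimes> b) (b \<otimes> d)"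
proof -
  have "frac_class R (p \<otimes> s \<oplus> r \<otimes> q) (q \<otimes> s) = frac_class R (a \<otimes> d \<oplus> c \<otimes> b) (b \<otimes> d)"
    if h: "p \<in> carrier R" "q \<in> carrier R" "q \<noteq> \<zero>" "a \<otimes> q = p \<otimes> b"
        "r \<in> carrier R" "s \<in> carrier R" "s \<noteq> \<zero>" "c \<otimes> s = r \<otimes> d" for p q r s
  proof -
    note hc = h(1-3,5-7)
    have "(p \<otimes> s \<oplus> r \<otimes> q) \<otimes> (b \<otimes> d) = (p \<otimes> b) \<otimes> (s \<otimes> d) \<oplus> (r \<otimes> d) \<otimes> (q \<otimes> b)"
      using hc ab cd by (simp add: m_ac l_distr r_distr)
    also have "\<dots> = (a \<otimes> q) \<otimes> (s \<otimes> d) \<oplus> (c \<otimes> s) \<otimes> (q \<otimes> b)" by (simp only: h)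
    also have "\<dots> = (a \<otimes> d \<oplus> c \<otimes> b) \<otimes> (q \<otimes> s)" using hc ab cd by (simp add: m_ac l_distr r_distr)
    finally show ?thesis using hc ab cd by (simp add: frac_class_eq_iff integral_iff)
  qed
  then show ?thesis unfolding Frac_def by (simp add: frac_UN2[OF ab cd])
qed

lemma frac_one: "\<one>\<^bsub>Frac R\<^esub> = frac_class R \<one> \<one>" and frac_zero: "\<zero>\<^bsub>Frac R\<^esub> = frac_class R \<zero> \<one>"
  by (simp_all add: Frac_def)

lemma frac_zero_iff:
  "\<lbrakk>a \<in> carrier R; b \<in> carrier R; b \<noteq> \<zero>\<rbrakk> \<Longrightarrow> frac_class R a b = \<zero>\<^bsub>Frac R\<^esub> \<longleftrightarrow> a = \<zero>"
  by (simp add: frac_zero frac_class_eq_iff)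

lemma Frac_cring: "cring (Frac R)"
proof (rule cringI)
  show "abelian_group (Frac R)"
  proof (rule abelian_groupI)
    fix x y assume "x \<in> carrier (Frac R)" "y \<in> carrier (Frac R)"
    then show "x \<oplus>\<^bsub>Frac R\<^esub> y \<in> carrier (Frac R)"
      by (elim Frac_carrierE) (simp add: frac_add frac_class_carrier integral_iff)
  next
    show "\<zero>\<^bsub>Frac R\<^esub> \<in> carrier (Frac R)" by (simp add: frac_zero frac_class_carrier)
  next
    fix x y z assume "x \<in> carrier (Frac R)" "y \<in> carrier (Frac R)" "z \<in> carrier (Frac R)"
    then obtain a b c d e f where
      ab: "a \<in> carrier R" "b \<in> carrier R" "b \<noteq> \<zero>" "x = frac_class R a b" and
      cd: "c \<in> carrier R" "d \<in> carrier R" "d \<noteq> \<zero>" "y = frac_class R c d" and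
      ef: "e \<in> carrier R" "f \<in> carrier R" "f \<noteq> \<zero>" "z = frac_class R e f"
      by (auto elim!: Frac_carrierE)
    have "(a \<otimes> d \<oplus> c \<otimes> b) \<otimes> f \<oplus> e \<otimes> (b \<otimes> d) = a \<otimes> (d \<otimes> f) \<oplus> (c \<otimes> f \<oplus> e \<otimes> d) \<otimes> b"
      using ab(1-3) cd(1-3) ef(1-3) by (simp add: l_distr r_distr m_ac a_ac)
    then show "x \<oplus>\<^bsub>Frac R\<^esub> y \<oplus>\<^bsub>Frac R\<^esub> z = x \<oplus>\<^bsub>Frac R\<^esub> (y \<oplus>\<^bsub>Frac R\<^esub> z)"
      using ab cd ef by (simp add: frac_add integral_iff m_assoc)
  next
    fix x y assume "x \<in> carrier (Frac R)" "y \<in> carrier (Frac R)"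
    then show "x \<oplus>\<^bsub>Frac R\<^esub> y = y \<oplus>\<^bsub>Frac R\<^esub> x"
      by (elim Frac_carrierE) (simp add: frac_add m_ac a_ac)
  next
    fix x assume "x \<in> carrier (Frac R)"
    then show "\<zero>\<^bsub>Frac R\<^esub> \<oplus>\<^bsub>Frac R\<^esub> x = x"
      by (elim Frac_carrierE) (simp add: frac_add frac_zero)
  next
    fix x assume "x \<in> carrier (Frac R)"
    then obtain a b where ab: "a \<in> carrier R" "b \<in> carrier R" "b \<noteq> \<zero>" "x = frac_class R a b"
      by (rule Frac_carrierE)
    then have "frac_class R (\<ominus> a) b \<oplus>\<^bsub>Frac R\<^esub> x = \<zero>\<^bsub>Frac R\<^esub>"
      by (simp add: frac_add frac_zero frac_class_eq_iff integral_iff l_minus l_neg)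
    then show "\<exists>y\<in>carrier (Frac R). y \<oplus>\<^bsub>Frac R\<^esub> x = \<zero>\<^bsub>Frac R\<^esub>"
      using ab by (intro bexI[of _ "frac_class R (\<ominus> a) b"]) (simp_all add: frac_class_carrier)
  qed
  show "Group.comm_monoid (Frac R)"
  proof (rule comm_monoidI)
    fix x y assume "x \<in> carrier (Frac R)" "y \<in> carrier (Frac R)"
    then show "x \<otimes>\<^bsub>Frac R\<^esub> y \<in> carrier (Frac R)"
      by (elim Frac_carrierE) (simp add: frac_mult frac_class_carrier integral_iff)
  next
    show "\<one>\<^bsub>Frac R\<^esub> \<in> carrier (Frac R)" by (simp add: frac_one frac_class_carrier)
  next
    fix x y z assume "x \<in> carrier (Frac R)" "y \<in> carrier (Frac R)" "z \<in> carrier (Frac R)"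
    then show "x \<otimes>\<^bsub>Frac R\<^esub> y \<otimes>\<^bsub>Frac R\<^esub> z = x \<otimes>\<^bsub>Frac R\<^esub> (y \<otimes>\<^bsub>Frac R\<^esub> z)"
      by (elim Frac_carrierE) (simp add: frac_mult integral_iff m_assoc)
  next
    fix x assume "x \<in> carrier (Frac R)"
    then show "\<one>\<^bsub>Frac R\<^esub> \<otimes>\<^bsub>Frac R\<^esub> x = x"
      by (elim Frac_carrierE) (simp add: frac_mult frac_one)
  next
    fix x y assume "x \<in> carrier (Frac R)" "y \<in> carrier (Frac R)"
    then show "x \<otimes>\<^bsub>Frac R\<^esub> y = y \<otimes>\<^bsub>Frac R\<^esub> x"
      by (elim Frac_carrierE) (simp add: frac_mult m_ac)
  qed
  fix x y z assume "x \<in> carrier (Frac R)" "y \<in> carrier (Frac R)" "z \<in> carrier (Frac R)"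
  then obtain a b c d e f where
    ab: "a \<in> carrier R" "b \<in> carrier R" "b \<noteq> \<zero>" "x = frac_class R a b" and
    cd: "c \<in> carrier R" "d \<in> carrier R" "d \<noteq> \<zero>" "y = frac_class R c d" and
    ef: "e \<in> carrier R" "f \<in> carrier R" "f \<noteq> \<zero>" "z = frac_class R e f"
    by (auto elim!: Frac_carrierE)
  define N D where "N = (a \<otimes> d \<oplus> c \<otimes> b) \<otimes> e" and "D = (b \<otimes> d) \<otimes> f"
  have ND: "N \<in> carrier R" "D \<in> carrier R" "D \<noteq> \<zero>"
    using ab cd ef by (simp_all add: N_def D_def integral_iff)
  have 1: "(a \<otimes> e) \<otimes> (d \<otimes> f) \<oplus> (c \<otimes> e) \<otimes> (b \<otimes> f) = N \<otimes> f"
    using ab(1-3) cd(1-3) ef(1-3) by (simp add: N_def l_distr r_distr m_ac)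
  have 2: "(b \<otimes> f) \<otimes> (d \<otimes> f) = D \<otimes> f"
    using ab(1-3) cd(1-3) ef(1-3) by (simp add: D_def m_ac)
  have "frac_class R N D = frac_class R (N \<otimes> f) (D \<otimes> f)"
    using ND ef(1-3) by (simp add: frac_class_eq_iff integral_iff m_ac)
  then show "(x \<oplus>\<^bsub>Frac R\<^esub> y) \<otimes>\<^bsub>Frac R\<^esub> z = x \<otimes>\<^bsub>Frac R\<^esub> z \<oplus>\<^bsub>Frac R\<^esub> y \<otimes>\<^bsub>Frac R\<^esub> z"
    unfolding ab(4) cd(4) ef(4) using ab(1-3) cd(1-3) ef(1-3) 1 2
    by (simp add: frac_add frac_mult integral_iff N_def D_def)
qed

lemma Frac_inverse:
  assumes "x \<in> carrier (Frac R)" "x \<noteq> \<zero>\<^bsub>Frac R\<^esub>"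
  shows "\<exists>y \<in> carrier (Frac R). y \<noteq> \<zero>\<^bsub>Frac R\<^esub> \<and> x \<otimes>\<^bsub>Frac R\<^esub> y = \<one>\<^bsub>Frac R\<^esub>"
proof -
  obtain a b where ab: "a \<in> carrier R" "b \<in> carrier R" "b \<noteq> \<zero>" "x = frac_class R a b"
    using assms(1) by (rule Frac_carrierE)
  with assms(2) have "a \<noteq> \<zero>" by (auto simp: frac_zero_iff)
  with ab show ?thesis
    by (intro bexI[of _ "frac_class R b a"])
      (auto simp: frac_zero_iff frac_mult frac_one frac_class_eq_iff integral_iff m_comm frac_class_carrier)
qed

lemma Frac_domain: "domain (Frac R)"
proof -
  interpret F: cring "Frac R" by (rule Frac_cring)
  show ?thesis
  proof (rule domain.intro[OF Frac_cring], unfold_locales)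
    show "\<one>\<^bsub>Frac R\<^esub> \<noteq> \<zero>\<^bsub>Frac R\<^esub>" by (simp add: frac_one frac_zero_iff)
    fix x y assume "x \<otimes>\<^bsub>Frac R\<^esub> y = \<zero>\<^bsub>Frac R\<^esub>" "x \<in> carrier (Frac R)" "y \<in> carrier (Frac R)"
    then show "x = \<zero>\<^bsub>Frac R\<^esub> \<or> y = \<zero>\<^bsub>Frac R\<^esub>"
      by (elim Frac_carrierE) (auto simp: frac_mult frac_zero_iff integral_iff)
  qed
qed

end

section \<open>Noetherian normal domains are completely integrally closed\<close>

lemma (in noetherian_ring) sequence_in_ideal_of_predecessors:
  fixes a :: "nat \<Rightarrow> 'a"
  assumes a: "\<And>n. a n \<in> carrier R"
  shows "\<exists>n. a n \<in> Idl (a ` {..<n})"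
proof -
  define C where "C = (\<lambda>n. Idl (a ` {..<n})) ` UNIV"
  have sub: "a ` {..<n} \<subseteq> carrier R" for n using a by auto
  have mono: "Idl (a ` {..<m}) \<subseteq> Idl (a ` {..<n})" if "m \<le> n" for m n
    by (rule genideal_minimal[OF genideal_ideal[OF sub]])
      (use genideal_self[OF sub, of n] that in auto)
  have "subset.chain {I. ideal I R} C"
    unfolding subset_chain_def
  proof (intro conjI ballI)
    show "C \<subseteq> {I. ideal I R}" using genideal_ideal[OF sub] by (auto simp: C_def)
    fix I J assume "I \<in> C" "J \<in> C"
    then obtain m n where "I = Idl (a ` {..<m})" "J = Idl (a ` {..<n})" by (auto simp: C_def)
    then show "I \<subseteq> J \<or> J \<subseteq> I" using mono[of m n] mono[of n m] by (cases "m \<le> n") auto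
  qed
  then have "\<Union>C \<in> C" by (intro ideal_chain_is_trivial) (auto simp: C_def)
  then obtain n where "\<Union>C = Idl (a ` {..<n})" by (auto simp: C_def)
  moreover have "a n \<in> \<Union>C"
    using genideal_self[OF sub, of "Suc n"] by (auto simp: C_def)
  ultimately show ?thesis by auto
qed

locale noetherian_normal_domain = noetherian_domain R for R (structure) +
  assumes normal: "normal_domain R"

sublocale noetherian_normal_domain \<subseteq> K: domain "Frac R" by (rule Frac_domain)

context noetherian_normal_domain
begin

abbreviation emb :: "'a \<Rightarrow> ('a \<times> 'a) set" where "emb a \<equiv> frac_class R a \<one>"

lemma emb_closed [simp]: "a \<in> carrier R \<Longrightarrow> emb a \<in> carrier (Frac R)"
  by (simp add: frac_class_carrier)

lemma emb_eq_iff [simp]: "\<lbrakk>a \<in> carrier R; b \<in> carrier R\<rbrakk> \<Longrightarrow> emb a = emb b \<longleftrightarrow> a = b"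
  by (simp add: frac_class_eq_iff)

lemma emb_mult: "\<lbrakk>a \<in> carrier R; b \<in> carrier R\<rbrakk> \<Longrightarrow> emb (a \<otimes> b) = emb a \<otimes>\<^bsub>Frac R\<^esub> emb b"
  by (simp add: frac_mult)

lemma emb_add: "\<lbrakk>a \<in> carrier R; b \<in> carrier R\<rbrakk> \<Longrightarrow> emb (a \<oplus> b) = emb a \<oplus>\<^bsub>Frac R\<^esub> emb b"
  by (simp add: frac_add)

lemma emb_one: "emb \<one> = \<one>\<^bsub>Frac R\<^esub>" and emb_zero: "emb \<zero> = \<zero>\<^bsub>Frac R\<^esub>"
  by (simp_all add: frac_one frac_zero)

lemma emb_zero_iff [simp]: "a \<in> carrier R \<Longrightarrow> emb a = \<zero>\<^bsub>Frac R\<^esub> \<longleftrightarrow> a = \<zero>"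
  by (simp add: frac_zero_iff)

lemma emb_base [simp]: "a \<in> carrier R \<Longrightarrow> emb a \<in> Frac_base R"
  by (simp add: Frac_base_def)

lemma baseE:
  assumes "x \<in> Frac_base R" obtains a where "a \<in> carrier R" "x = emb a"
  using assms by (auto simp: Frac_base_def)

lemma base_subset: "Frac_base R \<subseteq> carrier (Frac R)"
  by (auto elim: baseE)

lemma base_zero [simp]: "\<zero>\<^bsub>Frac R\<^esub> \<in> Frac_base R" and base_one [simp]: "\<one>\<^bsub>Frac R\<^esub> \<in> Frac_base R"
  by (simp_all flip: emb_zero emb_one)

lemma base_mult: "\<lbrakk>x \<in> Frac_base R; y \<in> Frac_base R\<rbrakk> \<Longrightarrow> x \<otimes>\<^bsub>Frac R\<^esub> y \<in> Frac_base R"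
  by (auto elim!: baseE simp flip: emb_mult)

lemma base_add: "\<lbrakk>x \<in> Frac_base R; y \<in> Frac_base R\<rbrakk> \<Longrightarrow> x \<oplus>\<^bsub>Frac R\<^esub> y \<in> Frac_base R"
  by (auto elim!: baseE simp flip: emb_add)

lemma emb_minus: "a \<in> carrier R \<Longrightarrow> emb (\<ominus> a) = \<ominus>\<^bsub>Frac R\<^esub> emb a"
  by (rule K.minus_equality[symmetric]) (simp_all add: l_neg flip: emb_add emb_zero)

lemma base_minus: "x \<in> Frac_base R \<Longrightarrow> \<ominus>\<^bsub>Frac R\<^esub> x \<in> Frac_base R"
  by (auto elim!: baseE simp flip: emb_minus)

lemma denominator:
  assumes "x \<in> carrier (Frac R)"
  obtains a b where "a \<in> carrier R" "b \<in> carrier R" "b \<noteq> \<zero>" "emb b \<otimes>\<^bsub>Frac R\<^esub> x = emb a"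
proof -
  obtain a b where ab: "a \<in> carrier R" "b \<in> carrier R" "b \<noteq> \<zero>" "x = frac_class R a b"
    using assms by (rule Frac_carrierE)
  then have "emb b \<otimes>\<^bsub>Frac R\<^esub> x = emb a" by (simp add: frac_mult frac_class_eq_iff m_comm)
  with ab that show ?thesis by blast
qed

text \<open>The values \<open>c\<^sub>0 + c\<^sub>1 x + \<dots> + c\<^sub>n\<^sub>-\<^sub>1 x\<^sup>n\<^sup>-\<^sup>1\<close> with coefficients in \<open>R\<close>.\<close>

primrec poly_values :: "('a \<times> 'a) set \<Rightarrow> nat \<Rightarrow> ('a \<times> 'a) set set" where
  "poly_values x 0 = {\<zero>\<^bsub>Frac R\<^esub>}"
| "poly_values x (Suc n) =
    {c \<otimes>\<^bsub>Frac R\<^esub> x [^]\<^bsub>Frac R\<^esub> n \<oplus>\<^bsub>Frac R\<^esub> y | c y. c \<in> Frac_base R \<and> y \<in> poly_values x n}"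

lemma poly_values_closed: "x \<in> carrier (Frac R) \<Longrightarrow> poly_values x n \<subseteq> carrier (Frac R)"
  using base_subset by (induction n) auto

lemma poly_values_SucI:
  "\<lbrakk>c \<in> Frac_base R; y \<in> poly_values x n\<rbrakk> \<Longrightarrow> c \<otimes>\<^bsub>Frac R\<^esub> x [^]\<^bsub>Frac R\<^esub> n \<oplus>\<^bsub>Frac R\<^esub> y \<in> poly_values x (Suc n)"
  by auto

lemma poly_values_add:
  assumes "x \<in> carrier (Frac R)"
  shows "\<lbrakk>y \<in> poly_values x n; z \<in> poly_values x n\<rbrakk> \<Longrightarrow> y \<oplus>\<^bsub>Frac R\<^esub> z \<in> poly_values x n"
proof (induction n arbitrary: y z)
  case (Suc n)
  then obtain c d y' z' where *: "c \<in> Frac_base R" "d \<in> Frac_base R" "y' \<in> poly_values x n" "z' \<in> poly_values x n"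
    "y = c \<otimes>\<^bsub>Frac R\<^esub> x [^]\<^bsub>Frac R\<^esub> n \<oplus>\<^bsub>Frac R\<^esub> y'" "z = d \<otimes>\<^bsub>Frac R\<^esub> x [^]\<^bsub>Frac R\<^esub> n \<oplus>\<^bsub>Frac R\<^esub> z'"
    by auto
  have mem: "c \<in> carrier (Frac R)" "d \<in> carrier (Frac R)" "y' \<in> carrier (Frac R)" "z' \<in> carrier (Frac R)"
    using * base_subset poly_values_closed[OF assms] by auto
  have "y \<oplus>\<^bsub>Frac R\<^esub> z = (c \<oplus>\<^bsub>Frac R\<^esub> d) \<otimes>\<^bsub>Frac R\<^esub> x [^]\<^bsub>Frac R\<^esub> n \<oplus>\<^bsub>Frac R\<^esub> (y' \<oplus>\<^bsub>Frac R\<^esub> z')"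
    using mem assms by (simp add: *(5,6) K.l_distr K.a_ac)
  then show ?case using *(1-4) Suc.IH base_add poly_values_SucI by (simp del: poly_values.simps)
qed simp

lemma poly_values_smult:
  assumes "x \<in> carrier (Frac R)" "r \<in> Frac_base R"
  shows "y \<in> poly_values x n \<Longrightarrow> r \<otimes>\<^bsub>Frac R\<^esub> y \<in> poly_values x n"
proof (induction n arbitrary: y)
  case 0
  then show ?case using assms base_subset by auto
next
  case (Suc n)
  then obtain c y' where *: "c \<in> Frac_base R" "y' \<in> poly_values x n"
    "y = c \<otimes>\<^bsub>Frac R\<^esub> x [^]\<^bsub>Frac R\<^esub> n \<oplus>\<^bsub>Frac R\<^esub> y'"
    by auto
  have mem: "c \<in> carrier (Frac R)" "r \<in> carrier (Frac R)" "y' \<in> carrier (Frac R)"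
    using * assms base_subset poly_values_closed[OF assms(1)] by auto
  have "r \<otimes>\<^bsub>Frac R\<^esub> y = (r \<otimes>\<^bsub>Frac R\<^esub> c) \<otimes>\<^bsub>Frac R\<^esub> x [^]\<^bsub>Frac R\<^esub> n \<oplus>\<^bsub>Frac R\<^esub> r \<otimes>\<^bsub>Frac R\<^esub> y'"
    using mem assms by (simp add: *(3) K.r_distr K.m_ac)
  then show ?case using *(1,2) Suc.IH base_mult assms poly_values_SucI by (simp del: poly_values.simps)
qed

lemma poly_values_power:
  assumes x: "x \<in> carrier (Frac R)"
  shows "j < n \<Longrightarrow> x [^]\<^bsub>Frac R\<^esub> j \<in> poly_values x n"
proof (induction n)
  case (Suc n)
  have z: "\<zero>\<^bsub>Frac R\<^esub> \<in> poly_values x n" for n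
    by (induction n) (use x base_zero in \<open>auto intro!: exI[of _ "\<zero>\<^bsub>Frac R\<^esub>"]\<close>)
  show ?case
  proof (cases "j = n")
    case True
    have "x [^]\<^bsub>Frac R\<^esub> j = \<one>\<^bsub>Frac R\<^esub> \<otimes>\<^bsub>Frac R\<^esub> x [^]\<^bsub>Frac R\<^esub> n \<oplus>\<^bsub>Frac R\<^esub> \<zero>\<^bsub>Frac R\<^esub>" using x True by simp
    then show ?thesis using z base_one poly_values_SucI by (metis)
  next
    case False
    then have "x [^]\<^bsub>Frac R\<^esub> j \<in> poly_values x n" using Suc by simp
    moreover have "x [^]\<^bsub>Frac R\<^esub> j = \<zero>\<^bsub>Frac R\<^esub> \<otimes>\<^bsub>Frac R\<^esub> x [^]\<^bsub>Frac R\<^esub> n \<oplus>\<^bsub>Frac R\<^esub> x [^]\<^bsub>Frac R\<^esub> j" using x by simp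
    ultimately show ?thesis using base_zero poly_values_SucI by metis
  qed
qed simp

lemma poly_values_eval:
  assumes x: "x \<in> carrier (Frac R)"
  shows "y \<in> poly_values x n \<Longrightarrow> \<exists>p. length p = n \<and> set p \<subseteq> Frac_base R \<and> K.eval p x = y"
proof (induction n arbitrary: y)
  case (Suc n)
  then obtain c y' where *: "c \<in> Frac_base R" "y' \<in> poly_values x n"
    "y = c \<otimes>\<^bsub>Frac R\<^esub> x [^]\<^bsub>Frac R\<^esub> n \<oplus>\<^bsub>Frac R\<^esub> y'"
    by auto
  then obtain p where "length p = n" "set p \<subseteq> Frac_base R" "K.eval p x = y'" using Suc.IH by blast
  then show ?case using * by (intro exI[of _ "c # p"]) auto
qed simp

lemma integral_overI:
  assumes x: "x \<in> carrier (Frac R)" and "x [^]\<^bsub>Frac R\<^esub> n \<in> poly_values x n"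
  shows "integral_over (Frac R) (Frac_base R) x"
proof -
  have "\<ominus>\<^bsub>Frac R\<^esub> (x [^]\<^bsub>Frac R\<^esub> n) = (\<ominus>\<^bsub>Frac R\<^esub> \<one>\<^bsub>Frac R\<^esub>) \<otimes>\<^bsub>Frac R\<^esub> (x [^]\<^bsub>Frac R\<^esub> n)"
    using x by (simp add: K.l_minus)
  also have "\<dots> \<in> poly_values x n"
    using assms by (intro poly_values_smult base_minus) auto
  finally obtain p where p: "length p = n" "set p \<subseteq> Frac_base R" "K.eval p x = \<ominus>\<^bsub>Frac R\<^esub> (x [^]\<^bsub>Frac R\<^esub> n)"
    using poly_values_eval[OF x] by blast
  show ?thesis
    unfolding integral_over_def
  proof (intro exI conjI)
    show "polynomial\<^bsub>Frac R\<^esub> (Frac_base R) (\<one>\<^bsub>Frac R\<^esub> # p)"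
      using p by (auto simp: polynomial_def)
    show "K.eval (\<one>\<^bsub>Frac R\<^esub> # p) x = \<zero>\<^bsub>Frac R\<^esub>" using p x by (simp add: K.r_neg)
  qed auto
qed

text \<open>All \<open>d x\<^sup>n\<close> lie in \<open>R\<close>, so noetherianity makes some \<open>d x\<^sup>n\<close> a combination of the earlier
  ones; dividing by \<open>d\<close> gives an integral equation for \<open>x\<close>.\<close>

lemma almost_integral:
  assumes x: "x \<in> carrier (Frac R)" and d: "d \<in> carrier (Frac R)" "d \<noteq> \<zero>\<^bsub>Frac R\<^esub>"
    and powers: "\<And>n::nat. d \<otimes>\<^bsub>Frac R\<^esub> x [^]\<^bsub>Frac R\<^esub> n \<in> Frac_base R"
  shows "x \<in> Frac_base R"
proof -
  obtain a where a: "\<And>n. a n \<in> carrier R" "\<And>n::nat. d \<otimes>\<^bsub>Frac R\<^esub> x [^]\<^bsub>Frac R\<^esub> n = emb (a n)"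
    using powers unfolding Frac_base_def image_iff Bex_def by metis
  obtain n where n: "a n \<in> Idl (a ` {..<n})"
    using sequence_in_ideal_of_predecessors[of a] a by blast
  define I where "I = {r \<in> carrier R. \<exists>y \<in> poly_values x n. emb r = d \<otimes>\<^bsub>Frac R\<^esub> y}"
  have pv: "y \<in> carrier (Frac R)" if "y \<in> poly_values x n" for y
    using that poly_values_closed[OF x] by blast
  have "ideal I R"
  proof (rule idealI)
    show "ring R" by (rule ring_axioms)
    have smult: "r \<otimes> s \<in> I" if rs: "r \<in> carrier R" "s \<in> I" for r s
    proof -
      obtain y where y: "y \<in> poly_values x n" "emb s = d \<otimes>\<^bsub>Frac R\<^esub> y" "s \<in> carrier R"
        using rs(2) unfolding I_def by blast
      then have "emb (r \<otimes> s) = d \<otimes>\<^bsub>Frac R\<^esub> (emb r \<otimes>\<^bsub>Frac R\<^esub> y)"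
        using rs d pv by (simp add: emb_mult K.m_ac)
      then show ?thesis using y rs poly_values_smult[OF x, of "emb r"] by (auto simp: I_def)
    qed
    then show "r \<otimes> s \<in> I" "s \<otimes> r \<in> I" if "s \<in> I" "r \<in> carrier R" for r s
      using that m_comm[of s r] by (auto simp: I_def)
    have add: "r \<oplus> s \<in> I" if rs: "r \<in> I" "s \<in> I" for r s
    proof -
      obtain y z where "y \<in> poly_values x n" "emb r = d \<otimes>\<^bsub>Frac R\<^esub> y" "z \<in> poly_values x n"
          "emb s = d \<otimes>\<^bsub>Frac R\<^esub> z" "r \<in> carrier R" "s \<in> carrier R"
        using rs by (auto simp: I_def)
      then show ?thesis using d pv poly_values_add[OF x, of y n z]
        by (auto simp: I_def emb_add K.r_distr intro!: bexI[of _ "y \<oplus>\<^bsub>Frac R\<^esub> z"])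
    qed
    have zero: "\<zero> \<in> I"
    proof -
      have "\<zero>\<^bsub>Frac R\<^esub> \<in> poly_values x n"
        by (induction n) (use x base_zero in \<open>auto intro!: exI[of _ "\<zero>\<^bsub>Frac R\<^esub>"]\<close>)
      then show ?thesis
        using d unfolding I_def by (intro CollectI conjI bexI[of _ "\<zero>\<^bsub>Frac R\<^esub>"]) (simp_all add: emb_zero)
    qed
    show "subgroup I (add_monoid R)"
    proof (rule add.subgroupI)
      show "I \<subseteq> carrier R" by (auto simp: I_def)
      show "I \<noteq> {}" using zero by auto
      show "\<ominus> s \<in> I" if "s \<in> I" for s
        using smult[of "\<ominus> \<one>" s] that by (auto simp: I_def l_minus)
    qed (rule add)
  qed
  moreover have "a ` {..<n} \<subseteq> I"
  proof (intro image_subsetI)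
    fix j assume "j \<in> {..<n}"
    then show "a j \<in> I" unfolding I_def using a(1) poly_values_power[OF x, of j n]
      by (intro CollectI conjI bexI[of _ "x [^]\<^bsub>Frac R\<^esub> j"] a(2)[symmetric]) auto
  qed
  ultimately have "a n \<in> I" using n genideal_minimal by blast
  then obtain y where y: "y \<in> poly_values x n" "emb (a n) = d \<otimes>\<^bsub>Frac R\<^esub> y" by (auto simp: I_def)
  then have "d \<otimes>\<^bsub>Frac R\<^esub> x [^]\<^bsub>Frac R\<^esub> n = d \<otimes>\<^bsub>Frac R\<^esub> y" using a by simp
  then have "x [^]\<^bsub>Frac R\<^esub> n = y" using K.m_lcancel[of d] d x y pv by simp
  then have "integral_over (Frac R) (Frac_base R) x" using integral_overI[OF x] y by blast
  then show ?thesis using normal x by (simp add: normal_domain_def)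
qed

text \<open>The form used below: a fraction \<open>a / b\<close> carrying a nonzero set \<open>J\<close> of ring elements into
  itself lies in \<open>R\<close>.\<close>

lemma divides_if_stabilizes:
  assumes a: "a \<in> carrier R" and b: "b \<in> carrier R" "b \<noteq> \<zero>"
    and J: "J \<subseteq> carrier R" "j0 \<in> J" "j0 \<noteq> \<zero>"
    and stab: "\<And>j. j \<in> J \<Longrightarrow> \<exists>j' \<in> J. a \<otimes> j = b \<otimes> j'"
  shows "\<exists>c \<in> carrier R. a = b \<otimes> c"
proof -
  define x where "x = frac_class R a b"
  have x: "x \<in> carrier (Frac R)" using a b by (simp add: x_def frac_class_carrier)
  have bx: "emb b \<otimes>\<^bsub>Frac R\<^esub> x = emb a" using a b by (simp add: x_def frac_mult frac_class_eq_iff m_comm)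
  have step: "\<exists>j' \<in> J. emb j \<otimes>\<^bsub>Frac R\<^esub> x = emb j'" if "j \<in> J" for j
  proof -
    obtain j' where j': "j' \<in> J" "a \<otimes> j = b \<otimes> j'" using stab[OF \<open>j \<in> J\<close>] by blast
    have cl: "j \<in> carrier R" "j' \<in> carrier R" using J that j' by auto
    have "emb b \<otimes>\<^bsub>Frac R\<^esub> (emb j \<otimes>\<^bsub>Frac R\<^esub> x) = emb j \<otimes>\<^bsub>Frac R\<^esub> emb a"
      using b x cl bx by (metis K.m_lcomm emb_closed)
    also have "\<dots> = emb (a \<otimes> j)" using cl a by (simp add: emb_mult K.m_comm)
    also have "\<dots> = emb b \<otimes>\<^bsub>Frac R\<^esub> emb j'" using cl b by (simp add: j'(2) emb_mult)
    finally have "emb j \<otimes>\<^bsub>Frac R\<^esub> x = emb j'" using K.m_lcancel[of "emb b"] b cl x by simp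
    then show ?thesis using j' by blast
  qed
  have "\<exists>j \<in> J. emb j0 \<otimes>\<^bsub>Frac R\<^esub> x [^]\<^bsub>Frac R\<^esub> n = emb j" for n :: nat
  proof (induction n)
    case 0
    then show ?case using J by (intro bexI[of _ j0]) (auto simp: subset_iff)
  next
    case (Suc n)
    then obtain j where j: "j \<in> J" "emb j0 \<otimes>\<^bsub>Frac R\<^esub> x [^]\<^bsub>Frac R\<^esub> n = emb j" by blast
    then have "emb j0 \<otimes>\<^bsub>Frac R\<^esub> x [^]\<^bsub>Frac R\<^esub> Suc n = emb j \<otimes>\<^bsub>Frac R\<^esub> x"
      using x J by (simp add: subset_iff flip: K.m_assoc)
    then show ?case using step[OF j(1)] by auto
  qed
  then have "x \<in> Frac_base R"
    using J by (intro almost_integral[OF x, of "emb j0"]) (fastforce simp: Frac_base_def)+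
  then obtain c where "c \<in> carrier R" "x = emb c" by (rule baseE)
  then have "emb a = emb (b \<otimes> c)" using bx b by (simp add: emb_mult)
  then show ?thesis using \<open>c \<in> carrier R\<close> a b by auto
qed

end

section \<open>The divisor class group\<close>

context noetherian_normal_domain
begin

abbreviation col :: "('a \<times> 'a) set set \<Rightarrow> ('a \<times> 'a) set set" where "col \<equiv> colon R"

text \<open>The subsets of the field of fractions whose divisorial hull is a divisorial fractional
  ideal: they need not be closed under anything.\<close>

definition admissible :: "('a \<times> 'a) set set \<Rightarrow> bool" where
  "admissible S \<longleftrightarrow> S \<subseteq> carrier (Frac R) \<and> (\<exists>s \<in> S. s \<noteq> \<zero>\<^bsub>Frac R\<^esub>) \<and>
    (\<exists>c \<in> Frac_base R - {\<zero>\<^bsub>Frac R\<^esub>}. c \<in> col S)"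

lemma mem_col: "x \<in> col S \<longleftrightarrow> x \<in> carrier (Frac R) \<and> (\<forall>y \<in> S. x \<otimes>\<^bsub>Frac R\<^esub> y \<in> Frac_base R)"
  by (simp add: colon_def)

lemma col_antimono: "S \<subseteq> T \<Longrightarrow> col T \<subseteq> col S"
  unfolding colon_def by blast

lemma col_subset: "col S \<subseteq> carrier (Frac R)"
  by (auto simp: mem_col)

lemma subset_col_col: "S \<subseteq> carrier (Frac R) \<Longrightarrow> S \<subseteq> col (col S)"
  unfolding colon_def by (auto simp: subset_iff) (metis K.m_comm)

lemma col_col_col [simp]: "S \<subseteq> carrier (Frac R) \<Longrightarrow> col (col (col S)) = col S"
  using subset_col_col[of S] subset_col_col[OF col_subset, of S] col_antimono by blast

lemma set_mult_subset: "\<lbrakk>S \<subseteq> carrier (Frac R); T \<subseteq> carrier (Frac R)\<rbrakk> \<Longrightarrow> S <#>\<^bsub>Frac R\<^esub> T \<subseteq> carrier (Frac R)"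
  by (auto simp: set_mult_def)

lemma mem_col_set_mult:
  assumes "S \<subseteq> carrier (Frac R)" "T \<subseteq> carrier (Frac R)" "x \<in> carrier (Frac R)"
  shows "x \<in> col (S <#>\<^bsub>Frac R\<^esub> T) \<longleftrightarrow> (\<forall>t \<in> T. x \<otimes>\<^bsub>Frac R\<^esub> t \<in> col S)"
proof -
  have "x \<otimes>\<^bsub>Frac R\<^esub> (s \<otimes>\<^bsub>Frac R\<^esub> t) = x \<otimes>\<^bsub>Frac R\<^esub> t \<otimes>\<^bsub>Frac R\<^esub> s" if "s \<in> S" "t \<in> T" for s t
    using assms that by (simp add: subset_iff K.m_ac)
  then show ?thesis using assms by (auto simp: mem_col set_mult_def subset_iff)
qed

lemma col_set_mult_hull:
  assumes "S \<subseteq> carrier (Frac R)" "T \<subseteq> carrier (Frac R)"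
  shows "col (col (col S) <#>\<^bsub>Frac R\<^esub> T) = col (S <#>\<^bsub>Frac R\<^esub> T)"
proof -
  have "x \<in> col (col (col S) <#>\<^bsub>Frac R\<^esub> T) \<longleftrightarrow> x \<in> col (S <#>\<^bsub>Frac R\<^esub> T)"
    if "x \<in> carrier (Frac R)" for x
    using assms mem_col_set_mult[of "col (col S)" T x] mem_col_set_mult[of S T x] col_subset that by simp
  then show ?thesis using col_subset by blast
qed

lemma K_set_mult_comm:
  "\<lbrakk>S \<subseteq> carrier (Frac R); T \<subseteq> carrier (Frac R)\<rbrakk> \<Longrightarrow> S <#>\<^bsub>Frac R\<^esub> T = T <#>\<^bsub>Frac R\<^esub> S"
  unfolding set_mult_def by (auto simp: subset_iff) (metis K.m_comm)+

lemma K_set_mult_assoc: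
  assumes "S \<subseteq> carrier (Frac R)" "T \<subseteq> carrier (Frac R)" "U \<subseteq> carrier (Frac R)"
  shows "S <#>\<^bsub>Frac R\<^esub> T <#>\<^bsub>Frac R\<^esub> U = S <#>\<^bsub>Frac R\<^esub> (T <#>\<^bsub>Frac R\<^esub> U)"
  using assms unfolding set_mult_def by (auto simp: subset_iff) (metis K.m_assoc)+

lemma col_generate:
  assumes S: "S \<subseteq> carrier (Frac R)"
  shows "col (generate (add_monoid (Frac R)) S) = col S"
proof
  show "col (generate (add_monoid (Frac R)) S) \<subseteq> col S"
    by (rule col_antimono) (auto intro: generate.incl)
  show "col S \<subseteq> col (generate (add_monoid (Frac R)) S)"
  proof
    fix x assume x: "x \<in> col S"
    have "y \<in> carrier (Frac R) \<and> x \<otimes>\<^bsub>Frac R\<^esub> y \<in> Frac_base R" if "y \<in> generate (add_monoid (Frac R)) S" for y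
      using that
    proof induction
      case (inv h)
      have "\<ominus>\<^bsub>Frac R\<^esub> h \<in> carrier (Frac R) \<and> x \<otimes>\<^bsub>Frac R\<^esub> (\<ominus>\<^bsub>Frac R\<^esub> h) \<in> Frac_base R"
        using x S inv base_minus by (auto simp: mem_col K.r_minus)
      then show ?case by (simp add: a_inv_def)
    qed (use x S base_add in \<open>auto simp: mem_col K.r_distr\<close>)
    then show "x \<in> col (generate (add_monoid (Frac R)) S)" using x by (auto simp: mem_col)
  qed
qed

lemma divisor_mult:
  assumes "S \<subseteq> carrier (Frac R)" "T \<subseteq> carrier (Frac R)"
  shows "S \<otimes>\<^bsub>divisor_group R\<^esub> T = col (col (S <#>\<^bsub>Frac R\<^esub> T))"
  using assms unfolding divisor_group_def
  by (simp add: col_generate[OF set_mult_subset, simplified] set_mult_subset)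

lemma divisor_mult_hull:
  assumes "S \<subseteq> carrier (Frac R)" "T \<subseteq> carrier (Frac R)"
  shows "col (col S) \<otimes>\<^bsub>divisor_group R\<^esub> col (col T) = col (col (S <#>\<^bsub>Frac R\<^esub> T))"
proof -
  have "col (col (col S) <#>\<^bsub>Frac R\<^esub> col (col T)) = col (S <#>\<^bsub>Frac R\<^esub> col (col T))"
    using assms col_subset by (intro col_set_mult_hull)
  also have "\<dots> = col (col (col T) <#>\<^bsub>Frac R\<^esub> S)"
    using assms col_subset by (simp add: K_set_mult_comm)
  also have "\<dots> = col (S <#>\<^bsub>Frac R\<^esub> T)"
    using assms by (simp add: col_set_mult_hull K_set_mult_comm)
  finally show ?thesis using col_subset by (simp add: divisor_mult)
qed

lemma base_mult_col: "\<lbrakk>a \<in> Frac_base R; x \<in> col S; S \<subseteq> carrier (Frac R)\<rbrakk> \<Longrightarrow> a \<otimes>\<^bsub>Frac R\<^esub> x \<in> col S"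
  using base_mult base_subset by (auto simp: mem_col K.m_assoc subset_iff)

lemma fractional_ideal_col:
  assumes S: "admissible S"
  shows "fractional_ideal R (col S)"
proof -
  obtain s c where s: "s \<in> S" "s \<noteq> \<zero>\<^bsub>Frac R\<^esub>" and c: "c \<in> Frac_base R" "c \<noteq> \<zero>\<^bsub>Frac R\<^esub>" "c \<in> col S"
    and sub: "S \<subseteq> carrier (Frac R)"
    using S by (auto simp: admissible_def)
  have "s \<in> carrier (Frac R)" using s sub by auto
  then obtain a b where ab: "a \<in> carrier R" "b \<in> carrier R" "b \<noteq> \<zero>" "emb b \<otimes>\<^bsub>Frac R\<^esub> s = emb a"
    by (rule denominator)
  show ?thesis
    unfolding fractional_ideal_def
  proof (intro conjI ballI)
    show "subgroup (col S) (add_monoid (Frac R))"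
    proof (rule K.add.subgroupI)
      show "col S \<noteq> {}" using c by auto
      show "\<ominus>\<^bsub>Frac R\<^esub> x \<in> col S" if "x \<in> col S" for x
        using that sub base_minus by (auto simp: mem_col K.l_minus subset_iff)
      show "x \<oplus>\<^bsub>Frac R\<^esub> y \<in> col S" if "x \<in> col S" "y \<in> col S" for x y
        using that sub base_add by (auto simp: mem_col K.l_distr subset_iff)
    qed (rule col_subset)
    show "col S \<noteq> {\<zero>\<^bsub>Frac R\<^esub>}" using c by auto
    show "a \<otimes>\<^bsub>Frac R\<^esub> x \<in> col S" if "a \<in> Frac_base R" "x \<in> col S" for a x
      using base_mult_col that sub by blast
    have "a \<noteq> \<zero>" using ab s sub by (auto simp: subset_iff K.integral_iff simp flip: emb_zero_iff)
    moreover have "emb a \<otimes>\<^bsub>Frac R\<^esub> x \<in> Frac_base R" if x: "x \<in> col S" for x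
    proof -
      have "emb a \<otimes>\<^bsub>Frac R\<^esub> x = emb b \<otimes>\<^bsub>Frac R\<^esub> (x \<otimes>\<^bsub>Frac R\<^esub> s)"
        using x \<open>s \<in> carrier (Frac R)\<close> ab(2) by (simp flip: ab(4) add: mem_col K.m_ac)
      then show ?thesis using x s ab base_mult by (simp add: mem_col)
    qed
    ultimately show "\<exists>c\<in>Frac_base R - {\<zero>\<^bsub>Frac R\<^esub>}. \<forall>x\<in>col S. c \<otimes>\<^bsub>Frac R\<^esub> x \<in> Frac_base R"
      using ab by (intro bexI[of _ "emb a"]) auto
  qed
qed

lemma fractional_ideal_imp_admissible:
  assumes "fractional_ideal R I" shows "admissible I"
proof -
  have "I \<subseteq> carrier (Frac R)" "\<zero>\<^bsub>Frac R\<^esub> \<in> I"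
    using assms subgroup.subset[of I "add_monoid (Frac R)"] subgroup.one_closed[of I "add_monoid (Frac R)"]
    by (auto simp: fractional_ideal_def)
  then show ?thesis
    using assms base_subset unfolding fractional_ideal_def admissible_def mem_col by blast
qed

lemma admissible_col: "admissible S \<Longrightarrow> admissible (col S)"
  by (simp add: fractional_ideal_col fractional_ideal_imp_admissible)

lemma admissible_subset: "admissible S \<Longrightarrow> S \<subseteq> carrier (Frac R)"
  by (simp add: admissible_def)

lemma divisor_carrier: "admissible S \<Longrightarrow> col (col S) \<in> carrier (divisor_group R)"
  by (simp add: divisor_group_def fractional_ideal_col admissible_col admissible_subset col_subset)

lemma divisor_carrierE:
  assumes "I \<in> carrier (divisor_group R)"
  shows "admissible I" "I \<subseteq> carrier (Frac R)" "col (col I) = I" "fractional_ideal R I"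
  using assms admissible_subset[of I] fractional_ideal_imp_admissible[of I] by (simp_all add: divisor_group_def)

lemma admissible_mult:
  assumes "admissible S" "admissible T"
  shows "admissible (S <#>\<^bsub>Frac R\<^esub> T)"
proof -
  obtain s c t d where s: "s \<in> S" "s \<noteq> \<zero>\<^bsub>Frac R\<^esub>" "c \<in> Frac_base R" "c \<noteq> \<zero>\<^bsub>Frac R\<^esub>" "c \<in> col S"
    and t: "t \<in> T" "t \<noteq> \<zero>\<^bsub>Frac R\<^esub>" "d \<in> Frac_base R" "d \<noteq> \<zero>\<^bsub>Frac R\<^esub>" "d \<in> col T"
    and sub: "S \<subseteq> carrier (Frac R)" "T \<subseteq> carrier (Frac R)"
    using assms by (auto simp: admissible_def)
  have "c \<otimes>\<^bsub>Frac R\<^esub> d \<in> col (S <#>\<^bsub>Frac R\<^esub> T)"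
  proof -
    have "c \<otimes>\<^bsub>Frac R\<^esub> d \<otimes>\<^bsub>Frac R\<^esub> (x \<otimes>\<^bsub>Frac R\<^esub> y) = (c \<otimes>\<^bsub>Frac R\<^esub> x) \<otimes>\<^bsub>Frac R\<^esub> (d \<otimes>\<^bsub>Frac R\<^esub> y)"
      if "x \<in> S" "y \<in> T" for x y
      using that sub s t col_subset by (simp add: K.m_ac subset_iff)
    then show ?thesis using s(5) t(5) base_mult by (auto simp: mem_col set_mult_def)
  qed
  moreover have "c \<otimes>\<^bsub>Frac R\<^esub> d \<in> Frac_base R" "c \<otimes>\<^bsub>Frac R\<^esub> d \<noteq> \<zero>\<^bsub>Frac R\<^esub>"
    using s t base_mult base_subset by (auto simp: K.integral_iff subset_iff)
  moreover have "s \<otimes>\<^bsub>Frac R\<^esub> t \<in> S <#>\<^bsub>Frac R\<^esub> T" "s \<otimes>\<^bsub>Frac R\<^esub> t \<noteq> \<zero>\<^bsub>Frac R\<^esub>"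
    using s t sub by (auto simp: K.integral_iff subset_iff set_mult_def)
  ultimately show ?thesis using sub set_mult_subset by (auto simp: admissible_def)
qed

lemma admissible_singleton:
  assumes x: "x \<in> carrier (Frac R)" "x \<noteq> \<zero>\<^bsub>Frac R\<^esub>"
  shows "admissible {x}"
proof -
  obtain a b where ab: "a \<in> carrier R" "b \<in> carrier R" "b \<noteq> \<zero>" "emb b \<otimes>\<^bsub>Frac R\<^esub> x = emb a"
    using x(1) by (rule denominator)
  then show ?thesis using x by (auto simp: admissible_def mem_col intro!: bexI[of _ "emb b"])
qed

lemma col_base: "col (Frac_base R) = Frac_base R"
proof
  show "col (Frac_base R) \<subseteq> Frac_base R"
  proof
    fix x assume "x \<in> col (Frac_base R)"
    then have "x \<in> carrier (Frac R)" "x \<otimes>\<^bsub>Frac R\<^esub> \<one>\<^bsub>Frac R\<^esub> \<in> Frac_base R"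
      using base_one unfolding mem_col by blast+
    then show "x \<in> Frac_base R" by simp
  qed
  show "Frac_base R \<subseteq> col (Frac_base R)"
    using base_mult base_subset unfolding colon_def by blast
qed

lemma col_one: "col {\<one>\<^bsub>Frac R\<^esub>} = Frac_base R"
  using base_subset by (auto simp: mem_col)

lemma col_singleton:
  assumes "x \<in> carrier (Frac R)" "y \<in> carrier (Frac R)" "x \<otimes>\<^bsub>Frac R\<^esub> y = \<one>\<^bsub>Frac R\<^esub>"
  shows "col {x} = y <#\<^bsub>Frac R\<^esub> Frac_base R"
proof
  show "col {x} \<subseteq> y <#\<^bsub>Frac R\<^esub> Frac_base R"
  proof
    fix z assume z: "z \<in> col {x}"
    then have "z \<in> carrier (Frac R)" by (simp add: mem_col)
    then have "y \<otimes>\<^bsub>Frac R\<^esub> (z \<otimes>\<^bsub>Frac R\<^esub> x) = z \<otimes>\<^bsub>Frac R\<^esub> (x \<otimes>\<^bsub>Frac R\<^esub> y)"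
      using assms(1,2) by (simp only: K.m_ac K.m_closed)
    then have "z = y \<otimes>\<^bsub>Frac R\<^esub> (z \<otimes>\<^bsub>Frac R\<^esub> x)"
      using assms(3) \<open>z \<in> carrier (Frac R)\<close> by simp
    then show "z \<in> y <#\<^bsub>Frac R\<^esub> Frac_base R" using z unfolding mem_col l_coset_def by blast
  qed
  show "y <#\<^bsub>Frac R\<^esub> Frac_base R \<subseteq> col {x}"
  proof
    fix z assume "z \<in> y <#\<^bsub>Frac R\<^esub> Frac_base R"
    then obtain b where b: "b \<in> Frac_base R" "z = y \<otimes>\<^bsub>Frac R\<^esub> b" by (auto simp: l_coset_def)
    then have bc: "b \<in> carrier (Frac R)" using base_subset by auto
    then have "z \<otimes>\<^bsub>Frac R\<^esub> x = (x \<otimes>\<^bsub>Frac R\<^esub> y) \<otimes>\<^bsub>Frac R\<^esub> b" using assms(1,2) b by (simp add: K.m_ac)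
    then show "z \<in> col {x}" using assms b bc by (simp add: mem_col)
  qed
qed

lemma hull_singleton:
  assumes x: "x \<in> carrier (Frac R)" "x \<noteq> \<zero>\<^bsub>Frac R\<^esub>"
  shows "col (col {x}) = x <#\<^bsub>Frac R\<^esub> Frac_base R"
proof -
  obtain y where y: "y \<in> carrier (Frac R)" "x \<otimes>\<^bsub>Frac R\<^esub> y = \<one>\<^bsub>Frac R\<^esub>"
    using Frac_inverse[OF x] by blast
  have "col {x} = col (col {y})"
  proof -
    have "col {x} = y <#\<^bsub>Frac R\<^esub> Frac_base R" using x y by (intro col_singleton) simp_all
    also have "\<dots> = {y} <#>\<^bsub>Frac R\<^esub> Frac_base R" by (auto simp: l_coset_def set_mult_def)
    finally have eq: "col {x} = {y} <#>\<^bsub>Frac R\<^esub> Frac_base R" .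
    have "col (Frac_base R <#>\<^bsub>Frac R\<^esub> {y}) = col (col (col {\<one>\<^bsub>Frac R\<^esub>}) <#>\<^bsub>Frac R\<^esub> {y})"
      by (simp add: col_one col_base)
    also have "\<dots> = col ({\<one>\<^bsub>Frac R\<^esub>} <#>\<^bsub>Frac R\<^esub> {y})" using y by (intro col_set_mult_hull) auto
    also have "\<dots> = col {y}" using y by (simp add: set_mult_def)
    finally have "col (col {x}) = col {y}" using y base_subset by (simp add: eq K_set_mult_comm)
    moreover have "col (col (col {x})) = col {x}" using x by simp
    ultimately show ?thesis by simp
  qed
  then have "col (col {x}) = col {y}" using y by simp
  also have "\<dots> = x <#\<^bsub>Frac R\<^esub> Frac_base R"
    using x y K.m_comm[of y x] by (intro col_singleton) simp_all
  finally show ?thesis .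
qed

lemma principal_divisors_eq:
  "principal_divisors R = {col (col {x}) | x. x \<in> carrier (Frac R) \<and> x \<noteq> \<zero>\<^bsub>Frac R\<^esub>}"
  unfolding principal_divisors_def Diff_iff singleton_iff
  by (intro Collect_cong ex_cong1) (metis hull_singleton)

text \<open>Invertibility is where complete integral closedness enters: if \<open>x I I\<^sup>-\<^sup>1 \<subseteq> R\<close> then
  \<open>x I\<^sup>-\<^sup>1 \<subseteq> I\<^sup>-\<^sup>1\<close>, so all powers of \<open>x\<close> have a common denominator.\<close>

lemma col_mult_col:
  assumes S: "admissible S"
  shows "col (S <#>\<^bsub>Frac R\<^esub> col S) = Frac_base R"
proof
  note sub = admissible_subset[OF S]
  show "Frac_base R \<subseteq> col (S <#>\<^bsub>Frac R\<^esub> col S)"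
  proof
    fix x assume x: "x \<in> Frac_base R"
    then show "x \<in> col (S <#>\<^bsub>Frac R\<^esub> col S)"
      using mem_col_set_mult[of S "col S" x] sub col_subset base_subset base_mult_col by auto
  qed
  show "col (S <#>\<^bsub>Frac R\<^esub> col S) \<subseteq> Frac_base R"
  proof
    fix x assume "x \<in> col (S <#>\<^bsub>Frac R\<^esub> col S)"
    then have x: "x \<in> carrier (Frac R)" "\<And>t. t \<in> col S \<Longrightarrow> x \<otimes>\<^bsub>Frac R\<^esub> t \<in> col S"
      using mem_col_set_mult[of S "col S" x] sub col_subset by (auto simp: mem_col[of x])
    obtain s c where s: "s \<in> S" "s \<noteq> \<zero>\<^bsub>Frac R\<^esub>" and c: "c \<noteq> \<zero>\<^bsub>Frac R\<^esub>" "c \<in> col S"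
      using S by (auto simp: admissible_def)
    have cl: "s \<in> carrier (Frac R)" "c \<in> carrier (Frac R)" using s c sub col_subset by auto
    have pow: "c \<otimes>\<^bsub>Frac R\<^esub> x [^]\<^bsub>Frac R\<^esub> n \<in> col S" for n :: nat
    proof (induction n)
      case 0 then show ?case using c cl by simp
    next
      case (Suc n)
      have "c \<otimes>\<^bsub>Frac R\<^esub> x [^]\<^bsub>Frac R\<^esub> Suc n = x \<otimes>\<^bsub>Frac R\<^esub> (c \<otimes>\<^bsub>Frac R\<^esub> x [^]\<^bsub>Frac R\<^esub> n)"
        using cl x(1) by (simp add: K.m_ac)
      then show ?case using x(2) Suc by simp
    qed
    show "x \<in> Frac_base R"
    proof (rule almost_integral[OF x(1), of "s \<otimes>\<^bsub>Frac R\<^esub> c"])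
      fix n :: nat
      have "s \<otimes>\<^bsub>Frac R\<^esub> c \<otimes>\<^bsub>Frac R\<^esub> x [^]\<^bsub>Frac R\<^esub> n = c \<otimes>\<^bsub>Frac R\<^esub> x [^]\<^bsub>Frac R\<^esub> n \<otimes>\<^bsub>Frac R\<^esub> s"
        using cl x(1) by (simp add: K.m_ac)
      then show "s \<otimes>\<^bsub>Frac R\<^esub> c \<otimes>\<^bsub>Frac R\<^esub> x [^]\<^bsub>Frac R\<^esub> n \<in> Frac_base R"
        using pow[of n] s by (simp add: mem_col)
    qed (use cl s c in \<open>auto simp: K.integral_iff\<close>)
  qed
qed

lemma divisor_group_comm_group: "comm_group (divisor_group R)"
proof (rule comm_groupI)
  fix I J assume I: "I \<in> carrier (divisor_group R)" and J: "J \<in> carrier (divisor_group R)"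
  note sub = divisor_carrierE[OF I] divisor_carrierE[OF J]
  show "I \<otimes>\<^bsub>divisor_group R\<^esub> J \<in> carrier (divisor_group R)"
    using sub by (simp add: divisor_mult divisor_carrier admissible_mult)
  show "I \<otimes>\<^bsub>divisor_group R\<^esub> J = J \<otimes>\<^bsub>divisor_group R\<^esub> I"
    using sub by (simp add: divisor_mult K_set_mult_comm)
  fix L assume L: "L \<in> carrier (divisor_group R)"
  note sub = sub divisor_carrierE[OF L]
  have "col (col (I <#>\<^bsub>Frac R\<^esub> J)) \<otimes>\<^bsub>divisor_group R\<^esub> col (col L) =
      col (col I) \<otimes>\<^bsub>divisor_group R\<^esub> col (col (J <#>\<^bsub>Frac R\<^esub> L))"
    using sub(2,6,10) by (simp add: divisor_mult_hull set_mult_subset K_set_mult_assoc)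
  then show "I \<otimes>\<^bsub>divisor_group R\<^esub> J \<otimes>\<^bsub>divisor_group R\<^esub> L =
      I \<otimes>\<^bsub>divisor_group R\<^esub> (J \<otimes>\<^bsub>divisor_group R\<^esub> L)"
    using sub by (simp add: divisor_mult)
next
  have "col (col {\<one>\<^bsub>Frac R\<^esub>}) \<in> carrier (divisor_group R)"
    by (intro divisor_carrier admissible_singleton) auto
  then show "\<one>\<^bsub>divisor_group R\<^esub> \<in> carrier (divisor_group R)"
    by (simp add: col_one col_base) (simp add: divisor_group_def)
next
  fix I assume I: "I \<in> carrier (divisor_group R)"
  note sub = divisor_carrierE[OF I]
  have one: "\<one>\<^bsub>divisor_group R\<^esub> = col (col {\<one>\<^bsub>Frac R\<^esub>})"
    by (simp add: col_one col_base) (simp add: divisor_group_def)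
  have "col (col {\<one>\<^bsub>Frac R\<^esub>}) \<otimes>\<^bsub>divisor_group R\<^esub> col (col I) = col (col ({\<one>\<^bsub>Frac R\<^esub>} <#>\<^bsub>Frac R\<^esub> I))"
    using sub by (intro divisor_mult_hull) auto
  also have "{\<one>\<^bsub>Frac R\<^esub>} <#>\<^bsub>Frac R\<^esub> I = I"
  proof -
    have "{\<one>\<^bsub>Frac R\<^esub>} <#>\<^bsub>Frac R\<^esub> I = (\<lambda>x. \<one>\<^bsub>Frac R\<^esub> \<otimes>\<^bsub>Frac R\<^esub> x) ` I" unfolding set_mult_def by blast
    also have "\<dots> = (\<lambda>x. x) ` I" using sub(2) by (intro image_cong) auto
    finally show ?thesis by simp
  qed
  finally show "\<one>\<^bsub>divisor_group R\<^esub> \<otimes>\<^bsub>divisor_group R\<^esub> I = I" using sub by (simp add: one)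
  have "col I \<otimes>\<^bsub>divisor_group R\<^esub> I = \<one>\<^bsub>divisor_group R\<^esub>"
    using sub col_mult_col[of I] col_subset by (simp add: divisor_mult K_set_mult_comm col_base)
      (simp add: divisor_group_def)
  moreover have "col I \<in> carrier (divisor_group R)"
    using divisor_carrier[OF admissible_col[OF sub(1)]] sub by simp
  ultimately show "\<exists>J\<in>carrier (divisor_group R). J \<otimes>\<^bsub>divisor_group R\<^esub> I = \<one>\<^bsub>divisor_group R\<^esub>"
    by blast
qed

sublocale D: comm_group "divisor_group R" by (rule divisor_group_comm_group)

lemma hull_singleton_mult:
  assumes "x \<in> carrier (Frac R)" "y \<in> carrier (Frac R)"
  shows "col (col {x}) \<otimes>\<^bsub>divisor_group R\<^esub> col (col {y}) = col (col {x \<otimes>\<^bsub>Frac R\<^esub> y})"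
  using assms by (simp add: divisor_mult_hull set_mult_def)

lemma one_divisor: "\<one>\<^bsub>divisor_group R\<^esub> = col (col {\<one>\<^bsub>Frac R\<^esub>})"
  by (simp add: col_one col_base) (simp add: divisor_group_def)

lemma principal_divisors_subgroup: "subgroup (principal_divisors R) (divisor_group R)"
proof (rule D.subgroupI)
  show "principal_divisors R \<subseteq> carrier (divisor_group R)"
    using divisor_carrier[OF admissible_singleton] unfolding principal_divisors_eq by blast
  show "principal_divisors R \<noteq> {}"
    unfolding principal_divisors_eq using K.one_not_zero by blast
next
  fix I assume "I \<in> principal_divisors R"
  then obtain x where x: "I = col (col {x})" "x \<in> carrier (Frac R)" "x \<noteq> \<zero>\<^bsub>Frac R\<^esub>"
    unfolding principal_divisors_eq by blast
  obtain y where y: "y \<in> carrier (Frac R)" "y \<noteq> \<zero>\<^bsub>Frac R\<^esub>" "x \<otimes>\<^bsub>Frac R\<^esub> y = \<one>\<^bsub>Frac R\<^esub>"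
    using Frac_inverse[OF x(2,3)] by blast
  have "col (col {y}) \<otimes>\<^bsub>divisor_group R\<^esub> I = \<one>\<^bsub>divisor_group R\<^esub>"
    using x y by (simp add: hull_singleton_mult one_divisor K.m_comm)
  then have "inv\<^bsub>divisor_group R\<^esub> I = col (col {y})"
    using x y by (intro D.inv_equality) (simp_all add: divisor_carrier admissible_singleton)
  then show "inv\<^bsub>divisor_group R\<^esub> I \<in> principal_divisors R"
    using y unfolding principal_divisors_eq by blast
next
  fix I J assume "I \<in> principal_divisors R" "J \<in> principal_divisors R"
  then obtain x y where "I = col (col {x})" "x \<in> carrier (Frac R)" "x \<noteq> \<zero>\<^bsub>Frac R\<^esub>"
    "J = col (col {y})" "y \<in> carrier (Frac R)" "y \<noteq> \<zero>\<^bsub>Frac R\<^esub>"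
    unfolding principal_divisors_eq by blast
  then have "I \<otimes>\<^bsub>divisor_group R\<^esub> J = col (col {x \<otimes>\<^bsub>Frac R\<^esub> y})"
    "x \<otimes>\<^bsub>Frac R\<^esub> y \<in> carrier (Frac R)" "x \<otimes>\<^bsub>Frac R\<^esub> y \<noteq> \<zero>\<^bsub>Frac R\<^esub>"
    by (simp_all add: hull_singleton_mult K.integral_iff)
  then show "I \<otimes>\<^bsub>divisor_group R\<^esub> J \<in> principal_divisors R"
    unfolding principal_divisors_eq by blast
qed

sublocale Cl: comm_group "class_group R"
  unfolding class_group_def by (rule D.abelian_FactGroup[OF principal_divisors_subgroup])

end

section \<open>Weights of sets of ring elements\<close>

context cring
begin

text \<open>The submodules of \<open>R\<^sup>2\<close>.\<close>

definition plane :: "('a \<times> 'a) set \<Rightarrow> bool" where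
  "plane U \<longleftrightarrow> U \<noteq> {} \<and> U \<subseteq> carrier R \<times> carrier R \<and>
    (\<forall>x y x' y' r. (x, y) \<in> U \<longrightarrow> (x', y') \<in> U \<longrightarrow> r \<in> carrier R \<longrightarrow>
      (x \<oplus> r \<otimes> x', y \<oplus> r \<otimes> y') \<in> U)"

text \<open>Over a noetherian normal domain these are the sets contained in no prime of height at most one;
  the last condition says \<open>(R : T) = R\<close>.\<close>

definition dense :: "'a set \<Rightarrow> bool" where
  "dense T \<longleftrightarrow> T \<subseteq> carrier R \<and> (\<exists>t \<in> T. t \<noteq> \<zero>) \<and>
    (\<forall>a \<in> carrier R. \<forall>b \<in> carrier R - {\<zero>}. (\<forall>t \<in> T. b divides (a \<otimes> t)) \<longrightarrow> b divides a)"

lemma plane_comb: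
  "\<lbrakk>plane U; (x, y) \<in> U; (x', y') \<in> U; r \<in> carrier R; s \<in> carrier R\<rbrakk> \<Longrightarrow>
    (r \<otimes> x \<ominus> s \<otimes> x', r \<otimes> y \<ominus> s \<otimes> y') \<in> U"
proof -
  assume U: "plane U" "(x, y) \<in> U" "(x', y') \<in> U" "r \<in> carrier R" "s \<in> carrier R"
  then have cl: "x \<in> carrier R" "y \<in> carrier R" "x' \<in> carrier R" "y' \<in> carrier R"
    by (auto simp: plane_def)
  have step: "(a \<oplus> t \<otimes> c, b \<oplus> t \<otimes> d) \<in> U" if "(a, b) \<in> U" "(c, d) \<in> U" "t \<in> carrier R" for a b c d t
    using U(1) that unfolding plane_def by blast
  have "(x \<oplus> (r \<ominus> \<one>) \<otimes> x, y \<oplus> (r \<ominus> \<one>) \<otimes> y) \<in> U" using U by (intro step) auto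
  moreover have "z \<oplus> (r \<ominus> \<one>) \<otimes> z = r \<otimes> z" if "z \<in> carrier R" for z
    using that U by (simp add: minus_eq l_distr l_minus a_comm[of "r \<otimes> z"] r_neg2)
  ultimately have "(r \<otimes> x, r \<otimes> y) \<in> U" using cl by simp
  from step[OF this U(3), of "\<ominus> s"] show ?thesis using U cl by (simp add: minus_eq l_minus)
qed

lemma plane_swap: "plane U \<Longrightarrow> plane (prod.swap ` U)"
proof -
  assume U: "plane U"
  have sw: "(u, v) \<in> prod.swap ` U \<longleftrightarrow> (v, u) \<in> U" for u v by force
  show ?thesis
    unfolding plane_def sw using U unfolding plane_def by (auto simp: subset_iff)
qed

end

context noetherian_normal_domain
begin

definition cl :: "'a set \<Rightarrow> ('a \<times> 'a) set set set" where
  "cl S = principal_divisors R #>\<^bsub>divisor_group R\<^esub> col (col (emb ` S))"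

definition has_nonzero :: "'a set \<Rightarrow> bool" where
  "has_nonzero S \<longleftrightarrow> S \<subseteq> carrier R \<and> (\<exists>s \<in> S. s \<noteq> \<zero>)"

lemma admissible_emb: "has_nonzero S \<Longrightarrow> admissible (emb ` S)"
  unfolding admissible_def has_nonzero_def
proof (intro conjI)
  assume S: "S \<subseteq> carrier R \<and> (\<exists>s\<in>S. s \<noteq> \<zero>)"
  then show "emb ` S \<subseteq> carrier (Frac R)" by (intro image_subsetI emb_closed) blast
  obtain s where "s \<in> S" "s \<noteq> \<zero>" "s \<in> carrier R" using S by blast
  then show "\<exists>s\<in>emb ` S. s \<noteq> \<zero>\<^bsub>Frac R\<^esub>"
    by (intro bexI[of _ "emb s"] imageI) simp_all
  have "\<one>\<^bsub>Frac R\<^esub> \<otimes>\<^bsub>Frac R\<^esub> emb s \<in> Frac_base R" if "s \<in> S" for s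
    using S that by (simp add: subset_iff)
  then show "\<exists>c\<in>Frac_base R - {\<zero>\<^bsub>Frac R\<^esub>}. c \<in> col (emb ` S)"
    by (intro bexI[of _ "\<one>\<^bsub>Frac R\<^esub>"]) (simp_all add: mem_col)
qed

lemma frac_class_mem_col:
  assumes S: "S \<subseteq> carrier R" and a: "a \<in> carrier R" "b \<in> carrier R" "b \<noteq> \<zero>"
  shows "frac_class R a b \<in> col (emb ` S) \<longleftrightarrow> (\<forall>s \<in> S. b divides (a \<otimes> s))"
proof -
  have "frac_class R a b \<otimes>\<^bsub>Frac R\<^esub> emb s \<in> Frac_base R \<longleftrightarrow> b divides (a \<otimes> s)" if "s \<in> carrier R" for s
  proof
    assume "frac_class R a b \<otimes>\<^bsub>Frac R\<^esub> emb s \<in> Frac_base R"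
    then have "frac_class R (a \<otimes> s) b \<in> Frac_base R" using a that by (simp add: frac_mult)
    then obtain c where "c \<in> carrier R" "frac_class R (a \<otimes> s) b = emb c" by (elim baseE)
    then show "b divides (a \<otimes> s)"
      using a that by (intro dividesI[of c]) (simp_all add: frac_class_eq_iff m_comm)
  next
    assume "b divides (a \<otimes> s)"
    then obtain c where "c \<in> carrier R" "a \<otimes> s = b \<otimes> c" by (rule dividesE)
    then have "frac_class R (a \<otimes> s) b = emb c"
      using a that by (simp add: frac_class_eq_iff m_comm)
    then show "frac_class R a b \<otimes>\<^bsub>Frac R\<^esub> emb s \<in> Frac_base R"
      using a that \<open>c \<in> carrier R\<close> by (simp add: frac_mult)
  qed
  then show ?thesis using a S by (simp add: mem_col frac_class_carrier subset_iff)
qed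

lemma cl_cong:
  assumes "S \<subseteq> carrier R" "T \<subseteq> carrier R"
    and "\<And>a b. \<lbrakk>a \<in> carrier R; b \<in> carrier R; b \<noteq> \<zero>\<rbrakk> \<Longrightarrow>
      (\<forall>s \<in> S. b divides (a \<otimes> s)) \<longleftrightarrow> (\<forall>t \<in> T. b divides (a \<otimes> t))"
  shows "cl S = cl T"
proof -
  have "x \<in> col (emb ` S) \<longleftrightarrow> x \<in> col (emb ` T)" if x: "x \<in> carrier (Frac R)" for x
    using x by (rule Frac_carrierE) (simp add: frac_class_mem_col assms)
  then have "col (emb ` S) = col (emb ` T)" using col_subset by blast
  then show ?thesis by (simp add: cl_def)
qed

lemma principal_normal: "principal_divisors R \<lhd> divisor_group R"
  using principal_divisors_subgroup by (simp add: D.normal_iff_subgroup)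

lemma cl_closed: "has_nonzero S \<Longrightarrow> cl S \<in> carrier (class_group R)"
  unfolding cl_def class_group_def carrier_FactGroup by (intro imageI divisor_carrier admissible_emb)

lemma cl_mult:
  assumes S: "has_nonzero S" and T: "has_nonzero T"
  shows "cl S \<otimes>\<^bsub>class_group R\<^esub> cl T = cl (S <#> T)"
proof -
  have sub: "S \<subseteq> carrier R" "T \<subseteq> carrier R" using S T by (auto simp: has_nonzero_def)
  have "emb ` (S <#> T) = (\<Union>s\<in>S. \<Union>t\<in>T. {emb (s \<otimes> t)})" unfolding set_mult_def by blast
  also have "\<dots> = (\<Union>s\<in>S. \<Union>t\<in>T. {emb s \<otimes>\<^bsub>Frac R\<^esub> emb t})"
    using sub by (intro SUP_cong refl) (simp add: subset_iff emb_mult)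
  also have "\<dots> = (emb ` S) <#>\<^bsub>Frac R\<^esub> (emb ` T)" unfolding set_mult_def by blast
  finally have "emb ` (S <#> T) = (emb ` S) <#>\<^bsub>Frac R\<^esub> (emb ` T)" .
  moreover have "col (col (emb ` S)) \<otimes>\<^bsub>divisor_group R\<^esub> col (col (emb ` T)) = col (col ((emb ` S) <#>\<^bsub>Frac R\<^esub> (emb ` T)))"
    using S T by (intro divisor_mult_hull admissible_subset admissible_emb)
  ultimately show ?thesis
    unfolding cl_def class_group_def mult_FactGroup
    using S T by (subst normal.rcos_sum[OF principal_normal]) (simp_all add: divisor_carrier admissible_emb)
qed

lemma cl_singleton:
  assumes "a \<in> carrier R" "a \<noteq> \<zero>" shows "cl {a} = \<one>\<^bsub>class_group R\<^esub>"
proof -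
  have "col (col {emb a}) \<in> principal_divisors R"
    unfolding principal_divisors_eq using assms emb_closed emb_zero_iff by blast
  then show ?thesis
    unfolding cl_def class_group_def one_FactGroup
    using principal_divisors_subgroup by (simp add: D.coset_join2 subgroup.mem_carrier)
qed

lemma set_mult_singleton: "{a} <#> S = (\<lambda>s. a \<otimes> s) ` S"
  by (auto simp: set_mult_def)

lemma cl_scale:
  assumes "a \<in> carrier R" "a \<noteq> \<zero>" "has_nonzero S"
  shows "cl ((\<lambda>s. a \<otimes> s) ` S) = cl S"
proof -
  have "has_nonzero {a}" using assms by (simp add: has_nonzero_def)
  then have "cl ({a} <#> S) = cl {a} \<otimes>\<^bsub>class_group R\<^esub> cl S" using assms by (simp add: cl_mult)
  then show ?thesis using assms by (simp add: cl_singleton cl_closed set_mult_singleton)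
qed

text \<open>Every divisorial fractional ideal becomes an ideal of \<open>R\<close> after multiplication by a denominator.\<close>

lemma class_group_carrierE:
  assumes "C \<in> carrier (class_group R)"
  obtains I where "ideal I R" "has_nonzero I" "C = cl I"
proof -
  obtain J where J: "J \<in> carrier (divisor_group R)" and C: "C = principal_divisors R #>\<^bsub>divisor_group R\<^esub> J"
    using assms by (auto simp: class_group_def carrier_FactGroup)
  note J = divisor_carrierE[OF J] J
  from J(4) obtain c where c: "c \<in> Frac_base R" "c \<noteq> \<zero>\<^bsub>Frac R\<^esub>" "\<And>x. x \<in> J \<Longrightarrow> c \<otimes>\<^bsub>Frac R\<^esub> x \<in> Frac_base R"
    unfolding fractional_ideal_def by blast
  have cK: "c \<in> carrier (Frac R)" using c base_subset by blast
  have Jsub: "subgroup J (add_monoid (Frac R))" "\<And>a x. a \<in> Frac_base R \<Longrightarrow> x \<in> J \<Longrightarrow> a \<otimes>\<^bsub>Frac R\<^esub> x \<in> J"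
    using J(4) unfolding fractional_ideal_def by blast+
  define I where "I = {a \<in> carrier R. \<exists>x \<in> J. emb a = c \<otimes>\<^bsub>Frac R\<^esub> x}"
  have smult: "r \<otimes> s \<in> I" if rs: "r \<in> carrier R" "s \<in> I" for r s
  proof -
    obtain x where x: "x \<in> J" "emb s = c \<otimes>\<^bsub>Frac R\<^esub> x" "s \<in> carrier R" using rs(2) unfolding I_def by blast
    moreover have "x \<in> carrier (Frac R)" using x J(2) by blast
    ultimately have "emb (r \<otimes> s) = c \<otimes>\<^bsub>Frac R\<^esub> (emb r \<otimes>\<^bsub>Frac R\<^esub> x)"
      using rs(1) cK by (simp add: emb_mult K.m_lcomm)
    moreover have "emb r \<otimes>\<^bsub>Frac R\<^esub> x \<in> J" using Jsub(2) x rs by simp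
    ultimately show ?thesis using x rs unfolding I_def by blast
  qed
  have "ideal I R"
  proof (rule idealI)
    show "ring R" by (rule ring_axioms)
    show "r \<otimes> s \<in> I" "s \<otimes> r \<in> I" if "s \<in> I" "r \<in> carrier R" for r s
    proof -
      have "s \<in> carrier R" using that(1) unfolding I_def by blast
      then show "r \<otimes> s \<in> I" "s \<otimes> r \<in> I" using that smult m_comm[of s r] by simp_all
    qed
    show "subgroup I (add_monoid R)"
    proof (rule add.subgroupI)
      show "I \<subseteq> carrier R" unfolding I_def by blast
      have "\<zero>\<^bsub>Frac R\<^esub> \<in> J" using subgroup.one_closed[OF Jsub(1)] by simp
      then have "\<zero> \<in> I" unfolding I_def using cK
        by (intro CollectI conjI bexI[of _ "\<zero>\<^bsub>Frac R\<^esub>"]) (simp_all add: emb_zero)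
      then show "I \<noteq> {}" by blast
      show "\<ominus> s \<in> I" if "s \<in> I" for s
      proof -
        have "s \<in> carrier R" using that unfolding I_def by blast
        then show ?thesis using smult[of "\<ominus> \<one>" s] that by (simp add: l_minus)
      qed
      show "r \<oplus> s \<in> I" if rs: "r \<in> I" "s \<in> I" for r s
      proof -
        obtain x y where x: "x \<in> J" "emb r = c \<otimes>\<^bsub>Frac R\<^esub> x" "r \<in> carrier R"
          and y: "y \<in> J" "emb s = c \<otimes>\<^bsub>Frac R\<^esub> y" "s \<in> carrier R"
          using rs unfolding I_def by blast
        have "x \<oplus>\<^bsub>Frac R\<^esub> y \<in> J" using subgroup.m_closed[OF Jsub(1) x(1) y(1)] by simp
        moreover have "x \<in> carrier (Frac R)" "y \<in> carrier (Frac R)" using x y J(2) by blast+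
        then have "emb (r \<oplus> s) = c \<otimes>\<^bsub>Frac R\<^esub> (x \<oplus>\<^bsub>Frac R\<^esub> y)"
          using x y cK by (simp add: emb_add K.r_distr)
        ultimately show ?thesis using x y unfolding I_def by blast
      qed
    qed
  qed
  have "emb ` I = {c} <#>\<^bsub>Frac R\<^esub> J"
  proof
    show "emb ` I \<subseteq> {c} <#>\<^bsub>Frac R\<^esub> J" unfolding I_def set_mult_def by blast
    show "{c} <#>\<^bsub>Frac R\<^esub> J \<subseteq> emb ` I"
    proof
      fix z assume "z \<in> {c} <#>\<^bsub>Frac R\<^esub> J"
      then obtain x where x: "x \<in> J" "z = c \<otimes>\<^bsub>Frac R\<^esub> x" unfolding set_mult_def by blast
      then have "z \<in> Frac_base R" using c(3) by simp
      then obtain a where "a \<in> carrier R" "z = emb a" by (elim baseE)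
      then show "z \<in> emb ` I" using x unfolding I_def by blast
    qed
  qed
  then have "col (col (emb ` I)) = col (col {c}) \<otimes>\<^bsub>divisor_group R\<^esub> col (col J)"
    using cK J(2) by (simp add: divisor_mult_hull)
  also have "\<dots> = J \<otimes>\<^bsub>divisor_group R\<^esub> col (col {c})"
    using J cK c divisor_carrier[OF admissible_singleton[of c]] by (simp add: D.m_comm)
  finally have hull: "col (col (emb ` I)) = J \<otimes>\<^bsub>divisor_group R\<^esub> col (col {c})" .
  obtain x where x: "x \<in> J" "x \<noteq> \<zero>\<^bsub>Frac R\<^esub>" using J(1) unfolding admissible_def by blast
  obtain a where a: "a \<in> carrier R" "c \<otimes>\<^bsub>Frac R\<^esub> x = emb a" using c(3)[OF x(1)] by (rule baseE)
  have "emb a \<noteq> \<zero>\<^bsub>Frac R\<^esub>"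
    using x c(2) J(2) cK unfolding a(2)[symmetric] by (simp add: subset_iff K.integral_iff)
  then have "a \<noteq> \<zero>" using a by simp
  moreover have "a \<in> I" unfolding I_def using a x by (intro CollectI conjI bexI[of _ x]) simp_all
  moreover have "I \<subseteq> carrier R" unfolding I_def by blast
  ultimately have nz: "has_nonzero I" unfolding has_nonzero_def by blast
  have p: "col (col {c}) \<in> principal_divisors R" unfolding principal_divisors_eq using c cK by blast
  have "cl I = principal_divisors R #>\<^bsub>divisor_group R\<^esub> (col (col {c}) \<otimes>\<^bsub>divisor_group R\<^esub> J)"
    using J p subgroup.mem_carrier[OF principal_divisors_subgroup] by (simp add: cl_def hull D.m_comm)
  also have "\<dots> = (principal_divisors R #>\<^bsub>divisor_group R\<^esub> col (col {c})) #>\<^bsub>divisor_group R\<^esub> J"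
    using J p subgroup.mem_carrier[OF principal_divisors_subgroup] subgroup.subset[OF principal_divisors_subgroup]
    by (simp add: D.coset_mult_assoc)
  also have "\<dots> = C"
    using p C subgroup.mem_carrier[OF principal_divisors_subgroup] principal_divisors_subgroup
    by (simp add: D.coset_join2)
  finally show ?thesis using that \<open>ideal I R\<close> nz by blast
qed

text \<open>Multiplicativity of the class in the two exact sequences that the projections of a rank two
  lattice \<open>U \<subseteq> R\<^sup>2\<close> give. Both sides are the class of the divisorial hull of the minors of \<open>U\<close>; the
  next lemma is one half of this.\<close>

lemma plane_divides:
  assumes U: "plane U" and p: "p \<in> carrier R" "q \<in> carrier R" "q \<noteq> \<zero>"
    and div: "\<And>x y a. \<lbrakk>(x, y) \<in> U; (a, \<zero>) \<in> U\<rbrakk> \<Longrightarrow> q divides (p \<otimes> (y \<otimes> a))"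
    and xy: "(x, y) \<in> U" and b: "(\<zero>, b) \<in> U"
  shows "q divides (p \<otimes> (x \<otimes> b))"
proof (cases "b = \<zero>")
  case True
  then show ?thesis using U xy p by (auto simp: plane_def intro!: dividesI[of \<zero>])
next
  case False
  have Ucl: "u \<in> carrier R" "v \<in> carrier R" if "(u, v) \<in> U" for u v
    using U that by (auto simp: plane_def)
  note cl = Ucl[OF xy] Ucl[OF b] p
  \<comment> \<open>The ideal \<open>b (R : I)\<close> for \<open>I\<close> the second projection of \<open>U\<close>.\<close>
  define J where "J = {t \<in> carrier R. \<forall>u v. (u, v) \<in> U \<longrightarrow> b divides (t \<otimes> v)}"
  have "\<exists>c \<in> carrier R. p \<otimes> (x \<otimes> b) = q \<otimes> c"
  proof (rule divides_if_stabilizes)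
    show "J \<subseteq> carrier R" by (auto simp: J_def)
    show "b \<in> J" using Ucl cl by (auto simp: J_def factor_def)
    fix t assume t: "t \<in> J"
    then have tc: "t \<in> carrier R" by (simp add: J_def)
    have "b divides (t \<otimes> y)" using t xy unfolding J_def by blast
    then obtain c where c: "c \<in> carrier R" "t \<otimes> y = b \<otimes> c" by (elim dividesE)
    \<comment> \<open>Eliminating the second coordinate of \<open>t / b\<close> times the row \<open>(x, y)\<close> against \<open>(0, b)\<close>.\<close>
    have "(t \<otimes> x \<ominus> c \<otimes> \<zero>, t \<otimes> y \<ominus> c \<otimes> b) \<in> U" by (rule plane_comb[OF U xy b tc c(1)])
    then have "(t \<otimes> x, \<zero>) \<in> U" using c tc cl by (simp add: m_comm minus_eq r_neg)
    from div[OF b this] have "q divides (p \<otimes> (b \<otimes> (t \<otimes> x)))" .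
    then obtain t' where t': "t' \<in> carrier R" "p \<otimes> (b \<otimes> (t \<otimes> x)) = q \<otimes> t'" by (elim dividesE)
    have "t' \<in> J"
      unfolding J_def
    proof (intro CollectI conjI allI impI t'(1))
      fix u v assume uv: "(u, v) \<in> U"
      from div[OF uv \<open>(t \<otimes> x, \<zero>) \<in> U\<close>] obtain d where d: "d \<in> carrier R" "p \<otimes> (v \<otimes> (t \<otimes> x)) = q \<otimes> d"
        by (elim dividesE)
      have "q \<otimes> (t' \<otimes> v) = (q \<otimes> t') \<otimes> v" using t' p Ucl[OF uv] by (simp add: m_assoc)
      also have "\<dots> = b \<otimes> (p \<otimes> (v \<otimes> (t \<otimes> x)))"
        unfolding t'(2)[symmetric] using cl tc Ucl[OF uv] by (simp add: m_ac)
      also have "\<dots> = q \<otimes> (b \<otimes> d)" unfolding d(2) using cl d by (simp add: m_lcomm)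
      finally have "t' \<otimes> v = b \<otimes> d" using p t' d cl Ucl[OF uv] m_lcancel[of q] by simp
      then show "b divides (t' \<otimes> v)" using d by (intro dividesI)
    qed
    moreover have "p \<otimes> (x \<otimes> b) \<otimes> t = q \<otimes> t'" unfolding t'(2)[symmetric] using cl tc by (simp add: m_ac)
    ultimately show "\<exists>j'\<in>J. p \<otimes> (x \<otimes> b) \<otimes> t = q \<otimes> j'" by blast
  qed (use cl False in auto)
  then show ?thesis by (auto intro: dividesI)
qed

end

context domain
begin

text \<open>The relation between the weights of the two projections of \<open>U\<close> and of the kernels of these
  projections. It has content only if both kernels are nonzero: otherwise \<open>U\<close> is contained in one
  of the axes, or is a line with proportional projections.\<close>

lemma plane_weight:
  fixes G (structure)
  assumes G: "Group.comm_monoid G" and U: "plane U"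
    and closed: "\<And>S. S \<subseteq> carrier R \<Longrightarrow> w S \<in> carrier G"
    and zero: "w {\<zero>\<^bsub>R\<^esub>} = \<one>\<^bsub>G\<^esub>"
    and scale: "\<And>a S. \<lbrakk>a \<in> carrier R; a \<noteq> \<zero>\<^bsub>R\<^esub>; S \<subseteq> carrier R\<rbrakk> \<Longrightarrow> w ((\<lambda>s. a \<otimes>\<^bsub>R\<^esub> s) ` S) = w S"
    and minors: "\<And>a b. \<lbrakk>(a, \<zero>\<^bsub>R\<^esub>) \<in> U; a \<noteq> \<zero>\<^bsub>R\<^esub>; (\<zero>\<^bsub>R\<^esub>, b) \<in> U; b \<noteq> \<zero>\<^bsub>R\<^esub>\<rbrakk> \<Longrightarrow>
      w (snd ` U) \<otimes>\<^bsub>G\<^esub> w {a. (a, \<zero>\<^bsub>R\<^esub>) \<in> U} = w (fst ` U) \<otimes>\<^bsub>G\<^esub> w {b. (\<zero>\<^bsub>R\<^esub>, b) \<in> U}"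
  shows "w (snd ` U) \<otimes>\<^bsub>G\<^esub> w {a. (a, \<zero>\<^bsub>R\<^esub>) \<in> U} = w (fst ` U) \<otimes>\<^bsub>G\<^esub> w {b. (\<zero>\<^bsub>R\<^esub>, b) \<in> U}"
proof -
  interpret G: comm_monoid G by (rule G)
  have Ucl: "u \<in> carrier R" "v \<in> carrier R" if "(u, v) \<in> U" for u v
    using U that by (auto simp: plane_def)
  have sub: "snd ` U \<subseteq> carrier R" "fst ` U \<subseteq> carrier R" using Ucl by auto
  obtain u v where "(u, v) \<in> U" using U by (auto simp: plane_def)
  from plane_comb[OF U this this, of \<open>\<zero>\<^bsub>R\<^esub>\<close> \<open>\<zero>\<^bsub>R\<^esub>\<close>] Ucl[OF this] have zz: "(\<zero>\<^bsub>R\<^esub>, \<zero>\<^bsub>R\<^esub>) \<in> U"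
    by (simp add: minus_eq)
  show ?thesis
  proof (cases "\<exists>b. (\<zero>\<^bsub>R\<^esub>, b) \<in> U \<and> b \<noteq> \<zero>\<^bsub>R\<^esub>"; cases "\<exists>a. (a, \<zero>\<^bsub>R\<^esub>) \<in> U \<and> a \<noteq> \<zero>\<^bsub>R\<^esub>")
    assume "\<exists>b. (\<zero>\<^bsub>R\<^esub>, b) \<in> U \<and> b \<noteq> \<zero>\<^bsub>R\<^esub>" "\<exists>a. (a, \<zero>\<^bsub>R\<^esub>) \<in> U \<and> a \<noteq> \<zero>\<^bsub>R\<^esub>"
    then show ?thesis using minors by blast
  next
    assume "\<exists>b. (\<zero>\<^bsub>R\<^esub>, b) \<in> U \<and> b \<noteq> \<zero>\<^bsub>R\<^esub>" and a: "\<not> (\<exists>a. (a, \<zero>\<^bsub>R\<^esub>) \<in> U \<and> a \<noteq> \<zero>\<^bsub>R\<^esub>)"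
    then obtain b where b: "(\<zero>\<^bsub>R\<^esub>, b) \<in> U" "b \<noteq> \<zero>\<^bsub>R\<^esub>" by blast
    have x0: "x = \<zero>\<^bsub>R\<^esub>" if xy: "(x, y) \<in> U" for x y
    proof -
      have "(b \<otimes>\<^bsub>R\<^esub> x, \<zero>\<^bsub>R\<^esub>) \<in> U"
        using plane_comb[OF U xy b(1), of b y] Ucl[OF b(1)] Ucl[OF xy] by (simp add: minus_eq r_neg m_comm)
      then have "b \<otimes>\<^bsub>R\<^esub> x = \<zero>\<^bsub>R\<^esub>" using a by blast
      then show ?thesis using b Ucl[OF b(1)] Ucl[OF xy] integral by blast
    qed
    have "fst ` U = {\<zero>\<^bsub>R\<^esub>}"
    proof
      show "fst ` U \<subseteq> {\<zero>\<^bsub>R\<^esub>}" using x0 by auto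
      show "{\<zero>\<^bsub>R\<^esub>} \<subseteq> fst ` U" using imageI[OF zz, of fst] by simp
    qed
    moreover have "snd ` U = {b. (\<zero>\<^bsub>R\<^esub>, b) \<in> U}"
    proof
      show "snd ` U \<subseteq> {b. (\<zero>\<^bsub>R\<^esub>, b) \<in> U}" using x0 by auto
      show "{b. (\<zero>\<^bsub>R\<^esub>, b) \<in> U} \<subseteq> snd ` U" proof
        fix c assume "c \<in> {b. (\<zero>\<^bsub>R\<^esub>, b) \<in> U}"
        then show "c \<in> snd ` U" using imageI[of "(\<zero>\<^bsub>R\<^esub>, c)" U snd] by simp
      qed
    qed
    moreover have "{a. (a, \<zero>\<^bsub>R\<^esub>) \<in> U} = {\<zero>\<^bsub>R\<^esub>}" using zz a by blast
    ultimately show ?thesis using zero closed[OF sub(1)] by simp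
  next
    assume b: "\<not> (\<exists>b. (\<zero>\<^bsub>R\<^esub>, b) \<in> U \<and> b \<noteq> \<zero>\<^bsub>R\<^esub>)" and "\<exists>a. (a, \<zero>\<^bsub>R\<^esub>) \<in> U \<and> a \<noteq> \<zero>\<^bsub>R\<^esub>"
    then obtain a where a: "(a, \<zero>\<^bsub>R\<^esub>) \<in> U" "a \<noteq> \<zero>\<^bsub>R\<^esub>" by blast
    have y0: "y = \<zero>\<^bsub>R\<^esub>" if xy: "(x, y) \<in> U" for x y
    proof -
      have "(\<zero>\<^bsub>R\<^esub>, a \<otimes>\<^bsub>R\<^esub> y) \<in> U"
        using plane_comb[OF U xy a(1), of a x] Ucl[OF a(1)] Ucl[OF xy] by (simp add: minus_eq r_neg m_comm)
      then have "a \<otimes>\<^bsub>R\<^esub> y = \<zero>\<^bsub>R\<^esub>" using b by blast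
      then show ?thesis using a Ucl[OF a(1)] Ucl[OF xy] integral by blast
    qed
    have "snd ` U = {\<zero>\<^bsub>R\<^esub>}"
    proof
      show "snd ` U \<subseteq> {\<zero>\<^bsub>R\<^esub>}" using y0 by auto
      show "{\<zero>\<^bsub>R\<^esub>} \<subseteq> snd ` U" using imageI[OF zz, of snd] by simp
    qed
    moreover have "fst ` U = {a. (a, \<zero>\<^bsub>R\<^esub>) \<in> U}"
    proof
      show "fst ` U \<subseteq> {a. (a, \<zero>\<^bsub>R\<^esub>) \<in> U}" using y0 by auto
      show "{a. (a, \<zero>\<^bsub>R\<^esub>) \<in> U} \<subseteq> fst ` U" proof
        fix c assume "c \<in> {a. (a, \<zero>\<^bsub>R\<^esub>) \<in> U}"
        then show "c \<in> fst ` U" using imageI[of "(c, \<zero>\<^bsub>R\<^esub>)" U fst] by simp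
      qed
    qed
    moreover have "{b. (\<zero>\<^bsub>R\<^esub>, b) \<in> U} = {\<zero>\<^bsub>R\<^esub>}" using zz b by blast
    ultimately show ?thesis using zero closed[OF sub(2)] by simp
  next
    assume b: "\<not> (\<exists>b. (\<zero>\<^bsub>R\<^esub>, b) \<in> U \<and> b \<noteq> \<zero>\<^bsub>R\<^esub>)" and a: "\<not> (\<exists>a. (a, \<zero>\<^bsub>R\<^esub>) \<in> U \<and> a \<noteq> \<zero>\<^bsub>R\<^esub>)"
    have axes: "{b. (\<zero>\<^bsub>R\<^esub>, b) \<in> U} = {\<zero>\<^bsub>R\<^esub>}" "{a. (a, \<zero>\<^bsub>R\<^esub>) \<in> U} = {\<zero>\<^bsub>R\<^esub>}"
      using zz b a by auto
    have "w (snd ` U) = w (fst ` U)"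
    proof (cases "U = {(\<zero>\<^bsub>R\<^esub>, \<zero>\<^bsub>R\<^esub>)}")
      case False
      then obtain c d where cd: "(c, d) \<in> U" "(c, d) \<noteq> (\<zero>\<^bsub>R\<^esub>, \<zero>\<^bsub>R\<^esub>)" using zz by auto
      then have nz: "c \<noteq> \<zero>\<^bsub>R\<^esub>" "d \<noteq> \<zero>\<^bsub>R\<^esub>" using a b by auto
      have proportional: "d \<otimes>\<^bsub>R\<^esub> x = c \<otimes>\<^bsub>R\<^esub> y" if xy: "(x, y) \<in> U" for x y
      proof -
        have "(d \<otimes>\<^bsub>R\<^esub> x \<ominus>\<^bsub>R\<^esub> y \<otimes>\<^bsub>R\<^esub> c, \<zero>\<^bsub>R\<^esub>) \<in> U"
          using plane_comb[OF U xy cd(1), of d y] Ucl[OF cd(1)] Ucl[OF xy] by (simp add: minus_eq r_neg m_comm)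
        then have "d \<otimes>\<^bsub>R\<^esub> x \<ominus>\<^bsub>R\<^esub> y \<otimes>\<^bsub>R\<^esub> c = \<zero>\<^bsub>R\<^esub>" using a by blast
        then show ?thesis using Ucl[OF cd(1)] Ucl[OF xy] by (simp add: m_comm)
      qed
      have "(\<lambda>s. c \<otimes>\<^bsub>R\<^esub> s) ` snd ` U = (\<lambda>s. d \<otimes>\<^bsub>R\<^esub> s) ` fst ` U"
        unfolding image_image by (rule image_cong) (use proportional in auto)
      then show ?thesis using scale[of c "snd ` U"] scale[of d "fst ` U"] sub nz Ucl[OF cd(1)] by simp
    qed simp
    then show ?thesis by (simp add: axes)
  qed
qed

end

text \<open>An invariant of the submodules of \<open>R\<close> up to isomorphism outside codimension two.\<close>

locale ideal_weight = domain R + G: comm_monoid G for R (structure) and G :: "('g, 'h) monoid_scheme" (structure) +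
  fixes w :: "'a set \<Rightarrow> 'g"
  assumes w_closed: "S \<subseteq> carrier R \<Longrightarrow> w S \<in> carrier G"
    and w_zero: "w {\<zero>\<^bsub>R\<^esub>} = \<one>\<^bsub>G\<^esub>"
    and w_plane: "plane U \<Longrightarrow> w (snd ` U) \<otimes>\<^bsub>G\<^esub> w {a. (a, \<zero>\<^bsub>R\<^esub>) \<in> U} = w (fst ` U) \<otimes>\<^bsub>G\<^esub> w {b. (\<zero>\<^bsub>R\<^esub>, b) \<in> U}"
    and w_dense: "\<lbrakk>S' \<subseteq> S; S \<subseteq> carrier R; dense T; \<And>t s. \<lbrakk>t \<in> T; s \<in> S\<rbrakk> \<Longrightarrow> t \<otimes>\<^bsub>R\<^esub> s \<in> S'\<rbrakk> \<Longrightarrow> w S' = w S"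

definition additive_nat :: "nat monoid" where
  "additive_nat = \<lparr>carrier = UNIV, monoid.mult = (+), one = 0\<rparr>"

lemma additive_nat_simps [simp]:
  "carrier additive_nat = UNIV" "x \<otimes>\<^bsub>additive_nat\<^esub> y = x + y" "\<one>\<^bsub>additive_nat\<^esub> = 0"
  by (simp_all add: additive_nat_def)

definition (in ring) rank_weight :: "'a set \<Rightarrow> nat" where
  "rank_weight S = (if S \<subseteq> {\<zero>} then 0 else 1)"

text \<open>The rank of \<open>U\<close>, computed along either of the two coordinates.\<close>

lemma (in domain) rank_weight: "ideal_weight R additive_nat rank_weight"
proof -
  have G: "Group.comm_monoid additive_nat" by (rule comm_monoidI) auto
  interpret G: comm_monoid additive_nat by (rule G)
  show ?thesis
  proof (unfold_locales)
    fix U assume U: "plane U"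
    have sub: "U \<subseteq> carrier R \<times> carrier R" using U by (simp add: plane_def)
    show "rank_weight (snd ` U) \<otimes>\<^bsub>additive_nat\<^esub> rank_weight {a. (a, \<zero>\<^bsub>R\<^esub>) \<in> U} =
        rank_weight (fst ` U) \<otimes>\<^bsub>additive_nat\<^esub> rank_weight {b. (\<zero>\<^bsub>R\<^esub>, b) \<in> U}"
    proof (rule plane_weight[OF G U])
      show "rank_weight ((\<lambda>s. a \<otimes>\<^bsub>R\<^esub> s) ` S) = rank_weight S"
        if "a \<in> carrier R" "a \<noteq> \<zero>\<^bsub>R\<^esub>" "S \<subseteq> carrier R" for a S
        using that integral_iff by (auto simp: rank_weight_def subset_iff)
    qed (force simp: rank_weight_def)+
  next
    fix S' S T assume "S' \<subseteq> S" "S \<subseteq> carrier R" "dense T" and TS: "\<And>t s. \<lbrakk>t \<in> T; s \<in> S\<rbrakk> \<Longrightarrow> t \<otimes> s \<in> S'"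
    moreover obtain t where "t \<in> T" "t \<noteq> \<zero>" "t \<in> carrier R" using \<open>dense T\<close> by (auto simp: dense_def)
    moreover have "s = \<zero>" if "S' \<subseteq> {\<zero>}" "s \<in> S" for s
      using that TS[OF \<open>t \<in> T\<close> \<open>s \<in> S\<close>] \<open>t \<noteq> \<zero>\<close> \<open>t \<in> carrier R\<close> \<open>S \<subseteq> carrier R\<close> integral_iff[of t s] by auto
    ultimately show "rank_weight S' = rank_weight S" by (auto simp: rank_weight_def)
  qed (auto simp: rank_weight_def)
qed

context noetherian_normal_domain
begin

definition class_weight :: "'a set \<Rightarrow> ('a \<times> 'a) set set set" where
  "class_weight S = (if S \<subseteq> {\<zero>} then \<one>\<^bsub>class_group R\<^esub> else cl S)"

lemma class_weight_closed: "S \<subseteq> carrier R \<Longrightarrow> class_weight S \<in> carrier (class_group R)"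
  using cl_closed[of S] by (auto simp: class_weight_def has_nonzero_def)

lemma class_weight_scale:
  assumes "a \<in> carrier R" "a \<noteq> \<zero>" "S \<subseteq> carrier R"
  shows "class_weight ((\<lambda>s. a \<otimes> s) ` S) = class_weight S"
proof -
  have "(\<lambda>s. a \<otimes> s) ` S \<subseteq> {\<zero>} \<longleftrightarrow> S \<subseteq> {\<zero>}"
    using assms integral_iff by (auto simp: subset_iff)
  moreover have "has_nonzero S" if "\<not> S \<subseteq> {\<zero>}" using that assms by (auto simp: has_nonzero_def)
  ultimately show ?thesis using assms cl_scale by (simp add: class_weight_def)
qed

text \<open>Divisorial hulls only see codimension one, which gives the invariance under dense sets; the relation for
  the two projections is proved by applying \<open>plane_divides\<close> to \<open>U\<close> and to its mirror image.\<close>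

lemma class_weight: "ideal_weight R (class_group R) class_weight"
proof (unfold_locales)
  fix U assume U: "plane U"
  have sub: "snd ` U \<subseteq> carrier R" "fst ` U \<subseteq> carrier R" using U by (auto simp: plane_def)
  have ax: "{a. (a, \<zero>) \<in> U} \<subseteq> carrier R" "{b. (\<zero>, b) \<in> U} \<subseteq> carrier R" using U by (auto simp: plane_def)
  show "class_weight (snd ` U) \<otimes>\<^bsub>class_group R\<^esub> class_weight {a. (a, \<zero>) \<in> U} =
      class_weight (fst ` U) \<otimes>\<^bsub>class_group R\<^esub> class_weight {b. (\<zero>, b) \<in> U}"
  proof (rule plane_weight[OF Cl.comm_monoid_axioms U])
    fix a b assume a: "(a, \<zero>) \<in> U" "a \<noteq> \<zero>" and b: "(\<zero>, b) \<in> U" "b \<noteq> \<zero>"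
    have nz: "has_nonzero (snd ` U)" "has_nonzero (fst ` U)" "has_nonzero {a. (a, \<zero>) \<in> U}" "has_nonzero {b. (\<zero>, b) \<in> U}"
      using a b sub ax by (force simp: has_nonzero_def)+
    then have cw: "class_weight (snd ` U) = cl (snd ` U)" "class_weight (fst ` U) = cl (fst ` U)"
      "class_weight {a. (a, \<zero>) \<in> U} = cl {a. (a, \<zero>) \<in> U}" "class_weight {b. (\<zero>, b) \<in> U} = cl {b. (\<zero>, b) \<in> U}"
      by (auto simp: class_weight_def has_nonzero_def)
    have "cl (snd ` U <#> {a. (a, \<zero>) \<in> U}) = cl (fst ` U <#> {b. (\<zero>, b) \<in> U})"
    proof (rule cl_cong)
      have Ucl: "u \<in> carrier R" "v \<in> carrier R" if "(u, v) \<in> U" for u v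
        using U that by (auto simp: plane_def)
      show "snd ` U <#> {a. (a, \<zero>) \<in> U} \<subseteq> carrier R" "fst ` U <#> {b. (\<zero>, b) \<in> U} \<subseteq> carrier R"
        unfolding set_mult_def using Ucl by auto
      fix p q assume p: "p \<in> carrier R" "q \<in> carrier R" "q \<noteq> \<zero>"
      have sw: "(u, v) \<in> prod.swap ` U \<longleftrightarrow> (v, u) \<in> U" for u v by force
      have mem: "y \<otimes> a \<in> snd ` U <#> {a. (a, \<zero>) \<in> U}" if "(x, y) \<in> U" "(a, \<zero>) \<in> U" for x y a
        unfolding set_mult_def using that by force
      have mem': "x \<otimes> b \<in> fst ` U <#> {b. (\<zero>, b) \<in> U}" if "(x, y) \<in> U" "(\<zero>, b) \<in> U" for x y b
        unfolding set_mult_def using that by force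
      show "(\<forall>s \<in> snd ` U <#> {a. (a, \<zero>) \<in> U}. q divides (p \<otimes> s)) \<longleftrightarrow>
          (\<forall>s \<in> fst ` U <#> {b. (\<zero>, b) \<in> U}. q divides (p \<otimes> s))"
      proof (intro iffI ballI)
        fix s assume *: "\<forall>s \<in> snd ` U <#> {a. (a, \<zero>) \<in> U}. q divides (p \<otimes> s)" "s \<in> fst ` U <#> {b. (\<zero>, b) \<in> U}"
        then obtain x y b where s: "s = x \<otimes> b" "(x, y) \<in> U" "(\<zero>, b) \<in> U" unfolding set_mult_def by force
        show "q divides (p \<otimes> s)"
          unfolding s(1) by (rule plane_divides[OF U p _ s(2,3)]) (use *(1) mem in blast)
      next
        fix s assume *: "\<forall>s \<in> fst ` U <#> {b. (\<zero>, b) \<in> U}. q divides (p \<otimes> s)" "s \<in> snd ` U <#> {a. (a, \<zero>) \<in> U}"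
        then obtain x y a where s: "s = y \<otimes> a" "(x, y) \<in> U" "(a, \<zero>) \<in> U" unfolding set_mult_def by force
        show "q divides (p \<otimes> s)"
          unfolding s(1)
        proof (rule plane_divides[OF plane_swap[OF U] p])
          show "(y, x) \<in> prod.swap ` U" "(\<zero>, a) \<in> prod.swap ` U" using s by (simp_all only: sw)
          show "q divides (p \<otimes> (v \<otimes> c))" if "(u, v) \<in> prod.swap ` U" "(c, \<zero>) \<in> prod.swap ` U" for u v c
            using that unfolding sw using *(1) mem' by blast
        qed
      qed
    qed
    then show "class_weight (snd ` U) \<otimes>\<^bsub>class_group R\<^esub> class_weight {a. (a, \<zero>) \<in> U} =
        class_weight (fst ` U) \<otimes>\<^bsub>class_group R\<^esub> class_weight {b. (\<zero>, b) \<in> U}"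
      using nz by (simp add: cw cl_mult)
  next
    show "class_weight {\<zero>} = \<one>\<^bsub>class_group R\<^esub>" by (simp add: class_weight_def)
  qed (simp_all add: class_weight_closed class_weight_scale)
next
  fix S' S T assume S: "S' \<subseteq> S" "S \<subseteq> carrier R" and T: "dense T" and TS: "\<And>t s. \<lbrakk>t \<in> T; s \<in> S\<rbrakk> \<Longrightarrow> t \<otimes> s \<in> S'"
  have Tcl: "T \<subseteq> carrier R" using T by (simp add: dense_def)
  have "cl S' = cl S"
  proof (rule cl_cong)
    fix a b assume ab: "a \<in> carrier R" "b \<in> carrier R" "b \<noteq> \<zero>"
    show "(\<forall>s\<in>S'. b divides (a \<otimes> s)) \<longleftrightarrow> (\<forall>t\<in>S. b divides (a \<otimes> t))"
    proof
      assume S': "\<forall>s\<in>S'. b divides (a \<otimes> s)"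
      show "\<forall>t\<in>S. b divides (a \<otimes> t)"
      proof
        fix s assume s: "s \<in> S"
        have "b divides (a \<otimes> s \<otimes> t)" if "t \<in> T" for t
        proof -
          have "a \<otimes> s \<otimes> t = a \<otimes> (t \<otimes> s)" using ab s S(2) that Tcl by (simp add: subset_iff m_ac)
          then show ?thesis using S' TS[OF that s] by simp
        qed
        moreover have "a \<otimes> s \<in> carrier R" using ab s S(2) by auto
        ultimately show "b divides (a \<otimes> s)" using T ab unfolding dense_def by blast
      qed
    qed (use S in blast)
  qed (use S in auto)
  moreover obtain t where t: "t \<in> T" "t \<noteq> \<zero>" "t \<in> carrier R" using T by (auto simp: dense_def)
  have "S' \<subseteq> {\<zero>} \<longleftrightarrow> S \<subseteq> {\<zero>}"
  proof
    assume "S' \<subseteq> {\<zero>}"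
    then have "t \<otimes> s = \<zero>" if "s \<in> S" for s using TS[OF t(1) that] by blast
    then show "S \<subseteq> {\<zero>}" using t S(2) integral_iff by auto
  qed (use S in blast)
  ultimately show "class_weight S' = class_weight S" by (simp add: class_weight_def)
qed (simp_all add: class_weight_closed class_weight_def[of "{\<zero>}"])

end

section \<open>The determinant class of a lattice\<close>

context ideal_weight
begin

text \<open>A module \<open>Y\<close> is only seen through functionals: \<open>linear_on Y \<Phi>\<close> says that the vectors
  of values of all functionals in \<open>\<Phi>\<close> form a submodule.\<close>

definition linear_on :: "'y set \<Rightarrow> ('y \<Rightarrow> 'a) set \<Rightarrow> bool" where
  "linear_on Y \<Phi> \<longleftrightarrow> Y \<noteq> {} \<and> (\<forall>\<phi> \<in> \<Phi>. \<phi> ` Y \<subseteq> carrier R) \<and>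
    (\<forall>y \<in> Y. \<forall>y' \<in> Y. \<forall>r \<in> carrier R. \<exists>y'' \<in> Y. \<forall>\<phi> \<in> \<Phi>. \<phi> y'' = \<phi> y \<oplus>\<^bsub>R\<^esub> r \<otimes>\<^bsub>R\<^esub> \<phi> y')"

text \<open>The functionals filter \<open>Y\<close> by their successive kernels, with ideals as the factors. If they
  are jointly injective, the product of the weights of these ideals plays the role of the weight of
  the determinant of \<open>Y\<close>.\<close>

primrec lat :: "'y set \<Rightarrow> ('y \<Rightarrow> 'a) list \<Rightarrow> 'g" where
  "lat Y [] = \<one>\<^bsub>G\<^esub>"
| "lat Y (\<phi> # \<phi>s) = w (\<phi> ` Y) \<otimes>\<^bsub>G\<^esub> lat {y \<in> Y. \<phi> y = \<zero>\<^bsub>R\<^esub>} \<phi>s"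

lemma linear_on_values: "\<lbrakk>linear_on Y \<Phi>; \<phi> \<in> \<Phi>; y \<in> Y\<rbrakk> \<Longrightarrow> \<phi> y \<in> carrier R"
  unfolding linear_on_def by blast

lemma linear_on_comb:
  "\<lbrakk>linear_on Y \<Phi>; y \<in> Y; y' \<in> Y; r \<in> carrier R\<rbrakk> \<Longrightarrow>
    \<exists>y'' \<in> Y. \<forall>\<phi> \<in> \<Phi>. \<phi> y'' = \<phi> y \<oplus>\<^bsub>R\<^esub> r \<otimes>\<^bsub>R\<^esub> \<phi> y'"
  unfolding linear_on_def by blast

lemma linear_on_zero:
  assumes Y: "linear_on Y \<Phi>"
  shows "\<exists>y \<in> Y. \<forall>\<phi> \<in> \<Phi>. \<phi> y = \<zero>\<^bsub>R\<^esub>"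
proof -
  obtain y where y: "y \<in> Y" using Y unfolding linear_on_def by blast
  have "\<ominus>\<^bsub>R\<^esub> \<one>\<^bsub>R\<^esub> \<in> carrier R" by simp
  from linear_on_comb[OF Y y y this] obtain z where
    z: "z \<in> Y" "\<forall>\<phi> \<in> \<Phi>. \<phi> z = \<phi> y \<oplus>\<^bsub>R\<^esub> (\<ominus>\<^bsub>R\<^esub> \<one>\<^bsub>R\<^esub>) \<otimes>\<^bsub>R\<^esub> \<phi> y" by blast
  have "\<phi> z = \<zero>\<^bsub>R\<^esub>" if "\<phi> \<in> \<Phi>" for \<phi>
  proof -
    have "\<phi> z = \<phi> y \<oplus>\<^bsub>R\<^esub> (\<ominus>\<^bsub>R\<^esub> \<one>\<^bsub>R\<^esub>) \<otimes>\<^bsub>R\<^esub> \<phi> y" using z(2) that by blast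
    then show ?thesis using linear_on_values[OF Y that y] by (simp add: l_minus r_neg)
  qed
  then show ?thesis using z(1) by blast
qed

lemma linear_on_kernel:
  assumes Y: "linear_on Y \<Phi>" and \<psi>: "\<psi> \<in> \<Phi>"
  shows "linear_on {y \<in> Y. \<psi> y = \<zero>\<^bsub>R\<^esub>} \<Phi>"
  unfolding linear_on_def
proof (intro conjI ballI)
  show "{y \<in> Y. \<psi> y = \<zero>\<^bsub>R\<^esub>} \<noteq> {}" using linear_on_zero[OF Y] \<psi> by blast
  show "\<phi> ` {y \<in> Y. \<psi> y = \<zero>\<^bsub>R\<^esub>} \<subseteq> carrier R" if "\<phi> \<in> \<Phi>" for \<phi>
    using linear_on_values[OF Y that] by blast
  fix y y' r assume y: "y \<in> {y \<in> Y. \<psi> y = \<zero>\<^bsub>R\<^esub>}" "y' \<in> {y \<in> Y. \<psi> y = \<zero>\<^bsub>R\<^esub>}" "r \<in> carrier R"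
  then obtain y'' where y'': "y'' \<in> Y" "\<forall>\<phi> \<in> \<Phi>. \<phi> y'' = \<phi> y \<oplus>\<^bsub>R\<^esub> r \<otimes>\<^bsub>R\<^esub> \<phi> y'"
    using linear_on_comb[OF Y, of y y' r] by blast
  then have "\<psi> y'' = \<psi> y \<oplus>\<^bsub>R\<^esub> r \<otimes>\<^bsub>R\<^esub> \<psi> y'" using \<psi> by blast
  then have "\<psi> y'' = \<zero>\<^bsub>R\<^esub>" using y by simp
  with y'' show "\<exists>y'' \<in> {y \<in> Y. \<psi> y = \<zero>\<^bsub>R\<^esub>}. \<forall>\<phi> \<in> \<Phi>. \<phi> y'' = \<phi> y \<oplus>\<^bsub>R\<^esub> r \<otimes>\<^bsub>R\<^esub> \<phi> y'"
    by (intro bexI[of _ y'']) simp_all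
qed

lemma lat_closed [simp]:
  "\<lbrakk>linear_on Y \<Phi>; set \<phi>s \<subseteq> \<Phi>\<rbrakk> \<Longrightarrow> lat Y \<phi>s \<in> carrier G"
proof (induction \<phi>s arbitrary: Y)
  case (Cons \<phi> \<phi>s)
  then have "\<phi> ` Y \<subseteq> carrier R" unfolding linear_on_def by simp
  then show ?case using Cons.IH[OF linear_on_kernel[OF Cons.prems(1), of \<phi>]] Cons.prems w_closed by simp
qed simp

text \<open>This is the relation \<open>w_plane\<close> for the image of \<open>Y\<close> in \<open>R\<^sup>2\<close> under the two functionals.\<close>

lemma lat_swap:
  assumes Y: "linear_on Y \<Phi>" and \<phi>: "\<phi> \<in> \<Phi>" and \<psi>: "\<psi> \<in> \<Phi>" and \<chi>: "set \<chi>s \<subseteq> \<Phi>"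
  shows "lat Y (\<phi> # \<psi> # \<chi>s) = lat Y (\<psi> # \<phi> # \<chi>s)"
proof -
  define U where "U = (\<lambda>y. (\<psi> y, \<phi> y)) ` Y"
  have "plane U"
    unfolding plane_def
  proof (intro conjI allI impI)
    show "U \<noteq> {}" using Y unfolding U_def linear_on_def by blast
    show "U \<subseteq> carrier R \<times> carrier R" using linear_on_values[OF Y] \<phi> \<psi> unfolding U_def by blast
    fix a b c d r assume "(a, b) \<in> U" "(c, d) \<in> U" and r: "r \<in> carrier R"
    then obtain y y' where y: "y \<in> Y" "y' \<in> Y" "a = \<psi> y" "b = \<phi> y" "c = \<psi> y'" "d = \<phi> y'"
      unfolding U_def by blast
    then obtain z where "z \<in> Y" "\<forall>\<phi> \<in> \<Phi>. \<phi> z = \<phi> y \<oplus>\<^bsub>R\<^esub> r \<otimes>\<^bsub>R\<^esub> \<phi> y'"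
      using linear_on_comb[OF Y _ _ r] by blast
    then show "(a \<oplus>\<^bsub>R\<^esub> r \<otimes>\<^bsub>R\<^esub> c, b \<oplus>\<^bsub>R\<^esub> r \<otimes>\<^bsub>R\<^esub> d) \<in> U"
      using \<phi> \<psi> unfolding U_def y by (intro image_eqI[of _ _ z]) simp_all
  qed
  from w_plane[OF this]
  have "w (\<phi> ` Y) \<otimes>\<^bsub>G\<^esub> w (\<psi> ` {y \<in> Y. \<phi> y = \<zero>\<^bsub>R\<^esub>}) = w (\<psi> ` Y) \<otimes>\<^bsub>G\<^esub> w (\<phi> ` {y \<in> Y. \<psi> y = \<zero>\<^bsub>R\<^esub>})"
  proof -
    have "snd ` U = \<phi> ` Y" "fst ` U = \<psi> ` Y" unfolding U_def by (simp_all add: image_image)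
    moreover have "{a. (a, \<zero>\<^bsub>R\<^esub>) \<in> U} = \<psi> ` {y \<in> Y. \<phi> y = \<zero>\<^bsub>R\<^esub>}" "{b. (\<zero>\<^bsub>R\<^esub>, b) \<in> U} = \<phi> ` {y \<in> Y. \<psi> y = \<zero>\<^bsub>R\<^esub>}"
      unfolding U_def image_def by force+
    ultimately show ?thesis using \<open>w (snd ` U) \<otimes>\<^bsub>G\<^esub> _ = _\<close> by simp
  qed
  moreover have "{y \<in> {y \<in> Y. \<phi> y = \<zero>\<^bsub>R\<^esub>}. \<psi> y = \<zero>\<^bsub>R\<^esub>} = {y \<in> {y \<in> Y. \<psi> y = \<zero>\<^bsub>R\<^esub>}. \<phi> y = \<zero>\<^bsub>R\<^esub>}" by blast
  moreover have "lat {y \<in> {y \<in> Y. \<psi> y = \<zero>\<^bsub>R\<^esub>}. \<phi> y = \<zero>\<^bsub>R\<^esub>} \<chi>s \<in> carrier G"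
    by (rule lat_closed[OF linear_on_kernel[OF linear_on_kernel[OF Y \<psi>] \<phi>] \<chi>])
  moreover have "\<theta> ` {y \<in> Y. P y} \<subseteq> carrier R" if "\<theta> \<in> \<Phi>" for \<theta> P
    using linear_on_values[OF Y that] by blast
  moreover have "\<theta> ` Y \<subseteq> carrier R" if "\<theta> \<in> \<Phi>" for \<theta>
    using linear_on_values[OF Y that] by blast
  ultimately show ?thesis
    using \<phi> \<psi> w_closed by (simp flip: G.m_assoc)
qed

lemma lat_move:
  "\<lbrakk>linear_on Y \<Phi>; set \<phi>s \<subseteq> \<Phi>; \<psi> \<in> \<Phi>; set \<chi>s \<subseteq> \<Phi>\<rbrakk> \<Longrightarrow>
    lat Y (\<phi>s @ \<psi> # \<chi>s) = lat Y (\<psi> # \<phi>s @ \<chi>s)"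
proof (induction \<phi>s arbitrary: Y)
  case (Cons \<phi> \<phi>s)
  have "lat Y ((\<phi> # \<phi>s) @ \<psi> # \<chi>s) = lat Y (\<phi> # \<psi> # \<phi>s @ \<chi>s)"
    using Cons.IH[OF linear_on_kernel[OF Cons.prems(1), of \<phi>]] Cons.prems by simp
  also have "\<dots> = lat Y (\<psi> # \<phi> # \<phi>s @ \<chi>s)"
    by (rule lat_swap[OF Cons.prems(1)]) (use Cons.prems in auto)
  finally show ?case by simp
qed simp

lemma lat_append_comm:
  "\<lbrakk>linear_on Y \<Phi>; set \<phi>s \<subseteq> \<Phi>; set \<psi>s \<subseteq> \<Phi>\<rbrakk> \<Longrightarrow> lat Y (\<phi>s @ \<psi>s) = lat Y (\<psi>s @ \<phi>s)"
proof (induction \<phi>s arbitrary: Y)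
  case (Cons \<phi> \<phi>s)
  have "lat Y (\<psi>s @ \<phi> # \<phi>s) = lat Y (\<phi> # \<psi>s @ \<phi>s)"
    by (rule lat_move) (use Cons.prems in auto)
  then show ?case
    using Cons.IH[OF linear_on_kernel[OF Cons.prems(1), of \<phi>]] Cons.prems by simp
qed simp

lemma lat_append:
  "\<lbrakk>linear_on Y \<Phi>; set \<phi>s \<subseteq> \<Phi>; set \<psi>s \<subseteq> \<Phi>\<rbrakk> \<Longrightarrow>
    lat Y (\<phi>s @ \<psi>s) = lat Y \<phi>s \<otimes>\<^bsub>G\<^esub> lat {y \<in> Y. \<forall>\<phi> \<in> set \<phi>s. \<phi> y = \<zero>\<^bsub>R\<^esub>} \<psi>s"
proof (induction \<phi>s arbitrary: Y)
  case Nil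
  then show ?case by simp
next
  case (Cons \<phi> \<phi>s)
  define Y' where "Y' = {y \<in> Y. \<phi> y = \<zero>\<^bsub>R\<^esub>}"
  have Y': "linear_on Y' \<Phi>" unfolding Y'_def by (rule linear_on_kernel) (use Cons.prems in auto)
  define Y'' where "Y'' = {y \<in> Y'. \<forall>\<phi> \<in> set \<phi>s. \<phi> y = \<zero>\<^bsub>R\<^esub>}"
  have eq: "Y'' = {y \<in> Y. \<phi> y = \<zero>\<^bsub>R\<^esub> \<and> (\<forall>\<phi> \<in> set \<phi>s. \<phi> y = \<zero>\<^bsub>R\<^esub>)}" unfolding Y''_def Y'_def by auto
  have "linear_on {y \<in> Y'. \<forall>\<phi> \<in> S. \<phi> y = \<zero>\<^bsub>R\<^esub>} \<Phi>" if "finite S" "S \<subseteq> \<Phi>" for S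
    using that
  proof (induction S rule: finite_induct)
    case (insert \<theta> S)
    have "{y \<in> Y'. \<forall>\<phi> \<in> insert \<theta> S. \<phi> y = \<zero>\<^bsub>R\<^esub>} = {y \<in> {y \<in> Y'. \<forall>\<phi> \<in> S. \<phi> y = \<zero>\<^bsub>R\<^esub>}. \<theta> y = \<zero>\<^bsub>R\<^esub>}" by blast
    moreover have "linear_on {y \<in> {y \<in> Y'. \<forall>\<phi> \<in> S. \<phi> y = \<zero>\<^bsub>R\<^esub>}. \<theta> y = \<zero>\<^bsub>R\<^esub>} \<Phi>"
      by (rule linear_on_kernel) (use insert in auto)
    ultimately show ?case by (simp only:)
  qed (use Y' in simp)
  then have "linear_on Y'' \<Phi>" using Cons.prems unfolding Y''_def by simp
  then have cl: "lat Y'' \<psi>s \<in> carrier G" using Cons.prems by simp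
  have "lat Y' (\<phi>s @ \<psi>s) = lat Y' \<phi>s \<otimes>\<^bsub>G\<^esub> lat Y'' \<psi>s"
    unfolding Y''_def by (rule Cons.IH) (use Y' Cons.prems in auto)
  moreover have "w (\<phi> ` Y) \<in> carrier G" "lat Y' \<phi>s \<in> carrier G"
    using Cons.prems Y' linear_on_values[OF Cons.prems(1), of \<phi>] by (auto intro!: w_closed)
  ultimately show ?case using cl by (simp add: G.m_assoc Y'_def[symmetric] eq[symmetric])
qed

lemma lat_zero:
  "\<lbrakk>Y \<noteq> {}; \<And>y \<phi>. \<lbrakk>y \<in> Y; \<phi> \<in> set \<phi>s\<rbrakk> \<Longrightarrow> \<phi> y = \<zero>\<^bsub>R\<^esub>\<rbrakk> \<Longrightarrow> lat Y \<phi>s = \<one>\<^bsub>G\<^esub>"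
proof (induction \<phi>s)
  case (Cons \<phi> \<phi>s)
  have 0: "\<phi> y = \<zero>\<^bsub>R\<^esub>" if "y \<in> Y" for y using Cons.prems(2)[OF that, of \<phi>] by simp
  then have "\<phi> ` Y = (\<lambda>_. \<zero>\<^bsub>R\<^esub>) ` Y" by (intro image_cong) auto
  then have "{y \<in> Y. \<phi> y = \<zero>\<^bsub>R\<^esub>} = Y" "\<phi> ` Y = {\<zero>\<^bsub>R\<^esub>}" using 0 Cons.prems(1) by auto
  then show ?case using Cons by (simp add: w_zero)
qed simp

text \<open>Additivity. Applied with \<open>\<psi>s\<close> also jointly injective, it shows that the class does not
  depend on the functionals.\<close>

lemma lat_exact:
  assumes Y: "linear_on Y \<Phi>" and \<phi>s: "set \<phi>s \<subseteq> \<Phi>" and \<psi>s: "set \<psi>s \<subseteq> \<Phi>"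
    and inj: "\<And>y \<psi>. \<lbrakk>y \<in> Y; \<forall>\<phi> \<in> set \<phi>s. \<phi> y = \<zero>\<^bsub>R\<^esub>; \<psi> \<in> set \<psi>s\<rbrakk> \<Longrightarrow> \<psi> y = \<zero>\<^bsub>R\<^esub>"
  shows "lat Y \<phi>s = lat Y \<psi>s \<otimes>\<^bsub>G\<^esub> lat {y \<in> Y. \<forall>\<psi> \<in> set \<psi>s. \<psi> y = \<zero>\<^bsub>R\<^esub>} \<phi>s"
proof -
  have "lat {y \<in> Y. \<forall>\<phi> \<in> set \<phi>s. \<phi> y = \<zero>\<^bsub>R\<^esub>} \<psi>s = \<one>\<^bsub>G\<^esub>"
    using linear_on_zero[OF Y] \<phi>s inj by (intro lat_zero) blast+
  then have "lat Y \<phi>s = lat Y (\<phi>s @ \<psi>s)" using Y \<phi>s \<psi>s by (simp add: lat_append)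
  also have "\<dots> = lat Y (\<psi>s @ \<phi>s)" using Y \<phi>s \<psi>s by (rule lat_append_comm)
  also have "\<dots> = lat Y \<psi>s \<otimes>\<^bsub>G\<^esub> lat {y \<in> Y. \<forall>\<psi> \<in> set \<psi>s. \<psi> y = \<zero>\<^bsub>R\<^esub>} \<phi>s"
    using Y \<psi>s \<phi>s by (rule lat_append)
  finally show ?thesis .
qed

lemma lat_image: "lat (F ` Y) \<psi>s = lat Y (map (\<lambda>\<psi> y. \<psi> (F y)) \<psi>s)"
proof (induction \<psi>s arbitrary: Y)
  case (Cons \<psi> \<psi>s)
  have "{z \<in> F ` Y. \<psi> z = \<zero>\<^bsub>R\<^esub>} = F ` {y \<in> Y. \<psi> (F y) = \<zero>\<^bsub>R\<^esub>}" by blast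
  then show ?case using Cons by (simp add: image_image)
qed simp

text \<open>If \<open>T Y \<subseteq> Y' \<subseteq> Y\<close> for a dense set \<open>T\<close>, then \<open>Y\<close> and \<open>Y'\<close> agree at the primes of height one. As only
  the values of the functionals matter, the inclusions are stated for these.\<close>

lemma lat_dense:
  assumes T: "dense T"
  shows "\<lbrakk>\<forall>y \<in> Y. \<forall>\<phi> \<in> \<Phi>. \<phi> y \<in> carrier R; \<forall>y' \<in> Y'. \<exists>y \<in> Y. \<forall>\<phi> \<in> \<Phi>. \<phi> y' = \<phi> y;
      \<forall>t \<in> T. \<forall>y \<in> Y. \<exists>y' \<in> Y'. \<forall>\<phi> \<in> \<Phi>. \<phi> y' = t \<otimes>\<^bsub>R\<^esub> \<phi> y; set \<phi>s \<subseteq> \<Phi>\<rbrakk> \<Longrightarrow> lat Y' \<phi>s = lat Y \<phi>s"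
proof (induction \<phi>s arbitrary: Y Y')
  case (Cons \<phi> \<phi>s)
  have \<phi>: "\<phi> \<in> \<Phi>" using Cons.prems(4) by simp
  have Tcl: "t \<in> carrier R" if "t \<in> T" for t using T that unfolding dense_def by blast
  have "w (\<phi> ` Y') = w (\<phi> ` Y)"
  proof (rule w_dense[OF _ _ T])
    show "\<phi> ` Y' \<subseteq> \<phi> ` Y" using Cons.prems(2) \<phi> by fastforce
    show "\<phi> ` Y \<subseteq> carrier R" using Cons.prems(1) \<phi> by blast
    fix t s assume "t \<in> T" "s \<in> \<phi> ` Y"
    then obtain y where "y \<in> Y" "s = \<phi> y" by blast
    with Cons.prems(3) \<open>t \<in> T\<close> obtain y' where "y' \<in> Y'" "\<forall>\<phi> \<in> \<Phi>. \<phi> y' = t \<otimes>\<^bsub>R\<^esub> \<phi> y" by blast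
    then show "t \<otimes>\<^bsub>R\<^esub> s \<in> \<phi> ` Y'" using \<phi> \<open>s = \<phi> y\<close> by (intro image_eqI[of _ _ y']) simp_all
  qed
  moreover have "lat {y \<in> Y'. \<phi> y = \<zero>\<^bsub>R\<^esub>} \<phi>s = lat {y \<in> Y. \<phi> y = \<zero>\<^bsub>R\<^esub>} \<phi>s"
  proof (rule Cons.IH)
    show "\<forall>y \<in> {y \<in> Y. \<phi> y = \<zero>\<^bsub>R\<^esub>}. \<forall>\<phi> \<in> \<Phi>. \<phi> y \<in> carrier R" using Cons.prems(1) by blast
    show "\<forall>y' \<in> {y \<in> Y'. \<phi> y = \<zero>\<^bsub>R\<^esub>}. \<exists>y \<in> {y \<in> Y. \<phi> y = \<zero>\<^bsub>R\<^esub>}. \<forall>\<phi> \<in> \<Phi>. \<phi> y' = \<phi> y"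
    proof
      fix y' assume "y' \<in> {y \<in> Y'. \<phi> y = \<zero>\<^bsub>R\<^esub>}"
      then have y': "y' \<in> Y'" "\<phi> y' = \<zero>\<^bsub>R\<^esub>" by auto
      then obtain y where y: "y \<in> Y" "\<forall>\<phi> \<in> \<Phi>. \<phi> y' = \<phi> y" using Cons.prems(2) by blast
      then have "\<phi> y' = \<phi> y" using \<phi> by blast
      with y y' show "\<exists>y \<in> {y \<in> Y. \<phi> y = \<zero>\<^bsub>R\<^esub>}. \<forall>\<phi> \<in> \<Phi>. \<phi> y' = \<phi> y" by (intro bexI[of _ y]) simp_all
    qed
    show "\<forall>t \<in> T. \<forall>y \<in> {y \<in> Y. \<phi> y = \<zero>\<^bsub>R\<^esub>}. \<exists>y' \<in> {y \<in> Y'. \<phi> y = \<zero>\<^bsub>R\<^esub>}. \<forall>\<phi> \<in> \<Phi>. \<phi> y' = t \<otimes>\<^bsub>R\<^esub> \<phi> y"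
    proof (intro ballI)
      fix t y assume t: "t \<in> T" and "y \<in> {y \<in> Y. \<phi> y = \<zero>\<^bsub>R\<^esub>}"
      then have y: "y \<in> Y" "\<phi> y = \<zero>\<^bsub>R\<^esub>" by auto
      then obtain y' where y': "y' \<in> Y'" "\<forall>\<phi> \<in> \<Phi>. \<phi> y' = t \<otimes>\<^bsub>R\<^esub> \<phi> y" using Cons.prems(3) t by blast
      then have "\<phi> y' = t \<otimes>\<^bsub>R\<^esub> \<phi> y" using \<phi> by blast
      then have "\<phi> y' = \<zero>\<^bsub>R\<^esub>" using y Tcl[OF t] by simp
      with y' show "\<exists>y' \<in> {y \<in> Y'. \<phi> y = \<zero>\<^bsub>R\<^esub>}. \<forall>\<phi> \<in> \<Phi>. \<phi> y' = t \<otimes>\<^bsub>R\<^esub> \<phi> y"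
        by (intro bexI[of _ y']) simp_all
    qed
    show "set \<phi>s \<subseteq> \<Phi>" using Cons.prems(4) by simp
  qed
  ultimately show ?case by simp
qed simp

end

text \<open>Vanishing of the rank means that all the functionals vanish on \<open>Y\<close>.\<close>

lemma (in domain) rank_zero_imp_class_one:
  assumes "ideal_weight R G w" "Y \<noteq> {}" "ideal_weight.lat R additive_nat rank_weight Y \<phi>s = 0"
  shows "ideal_weight.lat R G w Y \<phi>s = \<one>\<^bsub>G\<^esub>"
proof -
  interpret rk: ideal_weight R additive_nat rank_weight by (rule rank_weight)
  interpret iw: ideal_weight R G w by (rule assms(1))
  have "\<forall>y \<in> Y. \<forall>\<phi> \<in> set \<phi>s. \<phi> y = \<zero>" if "rk.lat Y \<phi>s = 0"
    using that
  proof (induction \<phi>s)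
    case (Cons \<phi> \<phi>s)
    then have "rank_weight (\<phi> ` Y) = 0" "rk.lat {y \<in> Y. \<phi> y = \<zero>} \<phi>s = 0"
      unfolding rk.lat.simps additive_nat_simps by simp_all
    then have "\<phi> ` Y \<subseteq> {\<zero>}" by (simp add: rank_weight_def split: if_splits)
    then have 0: "\<phi> y = \<zero>" if "y \<in> Y" for y using that by blast
    then have "{y \<in> Y. \<phi> y = \<zero>} = Y" by blast
    then show ?case using Cons.IH \<open>rk.lat {y \<in> Y. \<phi> y = \<zero>} \<phi>s = 0\<close> 0 by simp
  qed simp
  then show ?thesis using assms(2,3) by (intro iw.lat_zero) blast+
qed

section \<open>Left modules\<close>

context left_module
begin

lemma smult_zero_right: "a \<in> carrier L \<Longrightarrow> a \<odot>\<^bsub>M\<^esub> \<zero>\<^bsub>M\<^esub> = \<zero>\<^bsub>M\<^esub>"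
  using smult_r_distr[of a "\<zero>\<^bsub>M\<^esub>" "\<zero>\<^bsub>M\<^esub>"] smult_closed[of a "\<zero>\<^bsub>M\<^esub>"] M.add.l_cancel_one by fastforce

lemma smult_zero_left: "x \<in> carrier M \<Longrightarrow> \<zero>\<^bsub>L\<^esub> \<odot>\<^bsub>M\<^esub> x = \<zero>\<^bsub>M\<^esub>"
  using smult_l_distr[of "\<zero>\<^bsub>L\<^esub>" "\<zero>\<^bsub>L\<^esub>" x] smult_closed[of "\<zero>\<^bsub>L\<^esub>" x] M.add.l_cancel_one by fastforce

lemma smult_minus_left:
  assumes "a \<in> carrier L" "x \<in> carrier M"
  shows "(\<ominus>\<^bsub>L\<^esub> a) \<odot>\<^bsub>M\<^esub> x = \<ominus>\<^bsub>M\<^esub> (a \<odot>\<^bsub>M\<^esub> x)"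
proof -
  have "(\<ominus>\<^bsub>L\<^esub> a) \<odot>\<^bsub>M\<^esub> x \<oplus>\<^bsub>M\<^esub> a \<odot>\<^bsub>M\<^esub> x = (\<ominus>\<^bsub>L\<^esub> a \<oplus>\<^bsub>L\<^esub> a) \<odot>\<^bsub>M\<^esub> x"
    using assms smult_l_distr by simp
  also have "\<dots> = \<zero>\<^bsub>M\<^esub>" using assms smult_zero_left by (simp add: L.l_neg)
  finally show ?thesis using assms smult_closed M.minus_equality[of "(\<ominus>\<^bsub>L\<^esub> a) \<odot>\<^bsub>M\<^esub> x" "a \<odot>\<^bsub>M\<^esub> x"] by simp
qed

lemma smult_minus_one: "x \<in> carrier M \<Longrightarrow> (\<ominus>\<^bsub>L\<^esub> \<one>\<^bsub>L\<^esub>) \<odot>\<^bsub>M\<^esub> x = \<ominus>\<^bsub>M\<^esub> x"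
  by (simp add: smult_minus_left smult_one)

lemma finsum_smult:
  "\<lbrakk>finite A; a \<in> carrier L; f \<in> A \<rightarrow> carrier M\<rbrakk> \<Longrightarrow>
    a \<odot>\<^bsub>M\<^esub> finsum M f A = (\<Oplus>\<^bsub>M\<^esub>i\<in>A. a \<odot>\<^bsub>M\<^esub> f i)"
  by (induction set: finite) (simp_all add: smult_zero_right smult_r_distr smult_closed Pi_def)

end

lemma module_imp_left_module: "module R M \<Longrightarrow> left_module R M"
proof -
  assume M: "module R M"
  interpret module R M by (rule M)
  show ?thesis
    unfolding left_module_def left_module_axioms_def
    by (simp add: R.ring_axioms M.abelian_group_axioms smult_l_distr smult_r_distr smult_assoc1)
qed

definition lsub :: "('l, 'k) ring_scheme \<Rightarrow> ('l, 'x, 'c) module_scheme \<Rightarrow> 'x set \<Rightarrow> bool" where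
  "lsub L M N \<longleftrightarrow> N \<subseteq> carrier M \<and> \<zero>\<^bsub>M\<^esub> \<in> N \<and> (\<forall>x \<in> N. \<forall>y \<in> N. x \<oplus>\<^bsub>M\<^esub> y \<in> N) \<and>
    (\<forall>a \<in> carrier L. \<forall>x \<in> N. a \<odot>\<^bsub>M\<^esub> x \<in> N)"

lemma lsub_subset: "lsub L M N \<Longrightarrow> x \<in> N \<Longrightarrow> x \<in> carrier M"
  and lsub_zero: "lsub L M N \<Longrightarrow> \<zero>\<^bsub>M\<^esub> \<in> N"
  and lsub_add: "lsub L M N \<Longrightarrow> x \<in> N \<Longrightarrow> y \<in> N \<Longrightarrow> x \<oplus>\<^bsub>M\<^esub> y \<in> N"
  and lsub_smult: "lsub L M N \<Longrightarrow> a \<in> carrier L \<Longrightarrow> x \<in> N \<Longrightarrow> a \<odot>\<^bsub>M\<^esub> x \<in> N"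
  unfolding lsub_def by blast+

lemma (in left_module) lsub_uminus: "lsub L M N \<Longrightarrow> x \<in> N \<Longrightarrow> \<ominus>\<^bsub>M\<^esub> x \<in> N"
  using lsub_smult[of L M N "\<ominus>\<^bsub>L\<^esub> \<one>\<^bsub>L\<^esub>" x] lsub_subset[of L M N x] by (simp add: smult_minus_one)

lemma (in left_module) lsub_diff: "lsub L M N \<Longrightarrow> x \<in> N \<Longrightarrow> y \<in> N \<Longrightarrow> x \<ominus>\<^bsub>M\<^esub> y \<in> N"
  by (simp add: a_minus_def lsub_uminus lsub_add)

lemma (in left_module) lsub_carrier: "lsub L M (carrier M)"
  by (simp add: lsub_def smult_closed)

lemma (in left_module) lsub_finsum:
  "\<lbrakk>lsub L M N; finite A; f \<in> A \<rightarrow> N\<rbrakk> \<Longrightarrow> finsum M f A \<in> N"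
proof (rotate_tac 1, induction set: finite)
  case (insert a A)
  then have "f \<in> A \<rightarrow> carrier M" "f a \<in> carrier M" by (auto intro: lsub_subset)
  then show ?case using insert by (simp add: lsub_add Pi_def)
qed (simp add: lsub_zero)

lemma (in left_module) restrict_left_module:
  assumes N: "lsub L M N" shows "left_module L (M\<lparr>carrier := N\<rparr>)"
proof -
  note cl = lsub_subset[OF N]
  have "abelian_group (M\<lparr>carrier := N\<rparr>)"
  proof (rule abelian_groupI)
    fix x y z assume xyz: "x \<in> carrier (M\<lparr>carrier := N\<rparr>)" "y \<in> carrier (M\<lparr>carrier := N\<rparr>)" "z \<in> carrier (M\<lparr>carrier := N\<rparr>)"
    then show "x \<oplus>\<^bsub>M\<lparr>carrier := N\<rparr>\<^esub> y \<oplus>\<^bsub>M\<lparr>carrier := N\<rparr>\<^esub> z = x \<oplus>\<^bsub>M\<lparr>carrier := N\<rparr>\<^esub> (y \<oplus>\<^bsub>M\<lparr>carrier := N\<rparr>\<^esub> z)"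
      using cl by (simp add: M.a_assoc)
  next
    fix x y assume "x \<in> carrier (M\<lparr>carrier := N\<rparr>)" "y \<in> carrier (M\<lparr>carrier := N\<rparr>)"
    then show "x \<oplus>\<^bsub>M\<lparr>carrier := N\<rparr>\<^esub> y = y \<oplus>\<^bsub>M\<lparr>carrier := N\<rparr>\<^esub> x" using cl by (simp add: M.a_comm)
  next
    fix x assume x: "x \<in> carrier (M\<lparr>carrier := N\<rparr>)"
    then show "\<zero>\<^bsub>M\<lparr>carrier := N\<rparr>\<^esub> \<oplus>\<^bsub>M\<lparr>carrier := N\<rparr>\<^esub> x = x" using cl by simp
    show "\<exists>y\<in>carrier (M\<lparr>carrier := N\<rparr>). y \<oplus>\<^bsub>M\<lparr>carrier := N\<rparr>\<^esub> x = \<zero>\<^bsub>M\<lparr>carrier := N\<rparr>\<^esub>"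
      using x cl lsub_uminus[OF N] by (intro bexI[of _ "\<ominus>\<^bsub>M\<^esub> x"]) (simp_all add: M.l_neg)
  qed (use N in \<open>auto simp: lsub_def\<close>)
  then show ?thesis
    using N cl unfolding left_module_def left_module_axioms_def
    by (simp add: L.ring_axioms lsub_smult smult_l_distr smult_r_distr smult_assoc smult_one)
qed

lemma lin_mapsI:
  "\<lbrakk>\<And>x. x \<in> carrier M \<Longrightarrow> f x \<in> carrier N;
    \<And>x y. \<lbrakk>x \<in> carrier M; y \<in> carrier M\<rbrakk> \<Longrightarrow> f (x \<oplus>\<^bsub>M\<^esub> y) = f x \<oplus>\<^bsub>N\<^esub> f y;
    \<And>a x. \<lbrakk>a \<in> carrier L; x \<in> carrier M\<rbrakk> \<Longrightarrow> f (a \<odot>\<^bsub>M\<^esub> x) = a \<odot>\<^bsub>N\<^esub> f x\<rbrakk> \<Longrightarrow> f \<in> lin_maps L M N"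
  by (auto simp: lin_maps_def hom_def)

lemma lin_maps_closed: "f \<in> lin_maps L M N \<Longrightarrow> x \<in> carrier M \<Longrightarrow> f x \<in> carrier N"
  and lin_maps_add: "f \<in> lin_maps L M N \<Longrightarrow> x \<in> carrier M \<Longrightarrow> y \<in> carrier M \<Longrightarrow> f (x \<oplus>\<^bsub>M\<^esub> y) = f x \<oplus>\<^bsub>N\<^esub> f y"
  and lin_maps_smult: "f \<in> lin_maps L M N \<Longrightarrow> a \<in> carrier L \<Longrightarrow> x \<in> carrier M \<Longrightarrow> f (a \<odot>\<^bsub>M\<^esub> x) = a \<odot>\<^bsub>N\<^esub> f x"
  by (auto simp: lin_maps_def hom_def)

lemma lin_maps_zero:
  assumes "left_module L M" "left_module L N" "f \<in> lin_maps L M N"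
  shows "f \<zero>\<^bsub>M\<^esub> = \<zero>\<^bsub>N\<^esub>"
proof -
  interpret M: left_module L M by fact
  interpret N: left_module L N by fact
  have "f \<zero>\<^bsub>M\<^esub> = f (\<zero>\<^bsub>L\<^esub> \<odot>\<^bsub>M\<^esub> \<zero>\<^bsub>M\<^esub>)" by (simp add: M.smult_zero_right)
  also have "\<dots> = \<zero>\<^bsub>L\<^esub> \<odot>\<^bsub>N\<^esub> f \<zero>\<^bsub>M\<^esub>" using assms(3) by (simp add: lin_maps_smult[of f L M N])
  finally show ?thesis using lin_maps_closed[OF assms(3), of "\<zero>\<^bsub>M\<^esub>"] by (simp add: N.smult_zero_left)
qed

lemma lin_maps_minus:
  assumes "left_module L M" "left_module L N" "f \<in> lin_maps L M N" "x \<in> carrier M" "y \<in> carrier M"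
  shows "f (x \<ominus>\<^bsub>M\<^esub> y) = f x \<ominus>\<^bsub>N\<^esub> f y"
proof -
  interpret M: left_module L M by fact
  interpret N: left_module L N by fact
  have "f (\<ominus>\<^bsub>M\<^esub> y) = \<ominus>\<^bsub>N\<^esub> f y"
    using assms lin_maps_smult[OF assms(3), of "\<ominus>\<^bsub>L\<^esub> \<one>\<^bsub>L\<^esub>" y] lin_maps_closed[OF assms(3), of y]
    by (simp add: M.smult_minus_one N.smult_minus_one)
  then show ?thesis using assms lin_maps_add[OF assms(3), of x "\<ominus>\<^bsub>M\<^esub> y"] by (simp add: a_minus_def)
qed

lemma lin_maps_finsum:
  assumes "left_module L M" "left_module L N" "f \<in> lin_maps L M N"
  shows "\<lbrakk>finite A; g \<in> A \<rightarrow> carrier M\<rbrakk> \<Longrightarrow> f (finsum M g A) = (\<Oplus>\<^bsub>N\<^esub>i\<in>A. f (g i))"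
proof (induction set: finite)
  case empty
  interpret M: left_module L M by fact
  interpret N: left_module L N by fact
  show ?case using lin_maps_zero[OF assms] by simp
next
  case (insert a A)
  interpret M: left_module L M by fact
  interpret N: left_module L N by fact
  have g: "g \<in> A \<rightarrow> carrier M" "g a \<in> carrier M" using insert by auto
  then have "(\<lambda>i. f (g i)) \<in> A \<rightarrow> carrier N" "f (g a) \<in> carrier N"
    using lin_maps_closed[OF assms(3)] by auto
  then show ?case using insert g lin_maps_add[OF assms(3), of "g a" "finsum M g A"] by simp
qed

lemma lin_maps_comp:
  "\<lbrakk>f \<in> lin_maps L M N; g \<in> lin_maps L N P\<rbrakk> \<Longrightarrow> (\<lambda>x. g (f x)) \<in> lin_maps L M P"
  by (intro lin_mapsI) (simp_all add: lin_maps_closed lin_maps_add lin_maps_smult)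

lemma lin_maps_restrict_dom: "\<lbrakk>f \<in> lin_maps L M N; K \<subseteq> carrier M\<rbrakk> \<Longrightarrow> f \<in> lin_maps L (M\<lparr>carrier := K\<rparr>) N"
  by (intro lin_mapsI)
    (auto simp: subset_iff lin_maps_closed[of f L M N] lin_maps_add[of f L M N] lin_maps_smult[of f L M N])

lemma lin_maps_restrict_cod:
  "\<lbrakk>f \<in> lin_maps L M N; \<And>x. x \<in> carrier M \<Longrightarrow> f x \<in> K\<rbrakk> \<Longrightarrow> f \<in> lin_maps L M (N\<lparr>carrier := K\<rparr>)"
  by (intro lin_mapsI) (auto simp: lin_maps_closed lin_maps_add lin_maps_smult)

lemma lin_maps_extend_cod:
  "\<lbrakk>f \<in> lin_maps L M (N\<lparr>carrier := K\<rparr>); K \<subseteq> carrier N\<rbrakk> \<Longrightarrow> f \<in> lin_maps L M N"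
proof (intro lin_mapsI)
  assume f: "f \<in> lin_maps L M (N\<lparr>carrier := K\<rparr>)" "K \<subseteq> carrier N"
  show "f x \<in> carrier N" if "x \<in> carrier M" for x
    using lin_maps_closed[OF f(1) that] f(2) by auto
qed (auto simp: lin_maps_add lin_maps_smult)

lemma lsub_kernel:
  assumes "left_module L M" "left_module L N" "f \<in> lin_maps L M N"
  shows "lsub L M {x \<in> carrier M. f x = \<zero>\<^bsub>N\<^esub>}"
proof -
  interpret M: left_module L M by fact
  interpret N: left_module L N by fact
  show ?thesis
    using lin_maps_zero[OF assms] assms(3)
    by (auto simp: lsub_def lin_maps_add lin_maps_smult M.smult_closed N.smult_zero_right)
qed

lemma lsub_image:
  assumes "left_module L M" "left_module L N" "f \<in> lin_maps L M N" "lsub L M K"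
  shows "lsub L N (f ` K)"
proof -
  have K: "x \<in> carrier M" if "x \<in> K" for x using lsub_subset[OF assms(4) that] .
  have "f x \<oplus>\<^bsub>N\<^esub> f y \<in> f ` K" if "x \<in> K" "y \<in> K" for x y
    using that K lin_maps_add[OF assms(3), of x y] lsub_add[OF assms(4), of x y] by (metis image_eqI)
  moreover have "a \<odot>\<^bsub>N\<^esub> f x \<in> f ` K" if "x \<in> K" "a \<in> carrier L" for x a
    using that K lin_maps_smult[OF assms(3), of a x] lsub_smult[OF assms(4), of a x] by (metis image_eqI)
  moreover have "\<zero>\<^bsub>N\<^esub> \<in> f ` K"
    using lin_maps_zero[OF assms(1-3)] lsub_zero[OF assms(4)] by (metis image_eqI)
  moreover have "f ` K \<subseteq> carrier N" using K lin_maps_closed[OF assms(3)] by blast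
  ultimately show ?thesis unfolding lsub_def by blast
qed

lemma lsub_Int: "\<lbrakk>lsub L M N; lsub L M N'\<rbrakk> \<Longrightarrow> lsub L M (N \<inter> N')"
  by (auto simp: lsub_def)

subsection \<open>Free modules\<close>

text \<open>Rows over a ring, each wrapped into a singleton so that the elements have the type over
  which the global dimension is formed.\<close>

definition rows :: "('l, 'k) ring_scheme \<Rightarrow> ('l, (nat \<Rightarrow> 'l) set) module" where
  "rows L = \<lparr>carrier = {{v} | v. \<forall>i. v i \<in> carrier L}, monoid.mult = (\<lambda>_ _. {}), monoid.one = {},
    ring.zero = {\<lambda>_. \<zero>\<^bsub>L\<^esub>}, ring.add = (\<lambda>U V. {\<lambda>i. the_elem U i \<oplus>\<^bsub>L\<^esub> the_elem V i}),
    module.smult = (\<lambda>a U. {\<lambda>i. a \<otimes>\<^bsub>L\<^esub> the_elem U i})\<rparr>"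

abbreviation co :: "(nat \<Rightarrow> 'l) set \<Rightarrow> nat \<Rightarrow> 'l" where "co \<equiv> the_elem"

definition free_carrier :: "('l, 'k) ring_scheme \<Rightarrow> nat \<Rightarrow> (nat \<Rightarrow> 'l) set set" where
  "free_carrier L k = {{v} | v. (\<forall>i. v i \<in> carrier L) \<and> (\<forall>i \<ge> k. v i = \<zero>\<^bsub>L\<^esub>)}"

abbreviation sub_rows :: "('l, 'k) ring_scheme \<Rightarrow> (nat \<Rightarrow> 'l) set set \<Rightarrow> ('l, (nat \<Rightarrow> 'l) set) module" where
  "sub_rows L Z \<equiv> (rows L)\<lparr>carrier := Z\<rparr>"

abbreviation free :: "('l, 'k) ring_scheme \<Rightarrow> nat \<Rightarrow> ('l, (nat \<Rightarrow> 'l) set) module" where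
  "free L k \<equiv> sub_rows L (free_carrier L k)"

definition unit_row :: "('l, 'k) ring_scheme \<Rightarrow> nat \<Rightarrow> (nat \<Rightarrow> 'l) set" where
  "unit_row L i = {\<lambda>j. if j = i then \<one>\<^bsub>L\<^esub> else \<zero>\<^bsub>L\<^esub>}"

definition free_map :: "('l, 'x, 'c) module_scheme \<Rightarrow> nat \<Rightarrow> (nat \<Rightarrow> 'x) \<Rightarrow> (nat \<Rightarrow> 'l) set \<Rightarrow> 'x" where
  "free_map N k y U = (\<Oplus>\<^bsub>N\<^esub>i\<in>{..<k}. co U i \<odot>\<^bsub>N\<^esub> y i)"

lemma rows_simps [simp]:
  "\<zero>\<^bsub>rows L\<^esub> = {\<lambda>_. \<zero>\<^bsub>L\<^esub>}"
  "U \<oplus>\<^bsub>rows L\<^esub> V = {\<lambda>i. co U i \<oplus>\<^bsub>L\<^esub> co V i}"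
  "a \<odot>\<^bsub>rows L\<^esub> U = {\<lambda>i. a \<otimes>\<^bsub>L\<^esub> co U i}"
  by (simp_all add: rows_def)

lemma rows_carrier: "U \<in> carrier (rows L) \<longleftrightarrow> (\<exists>v. U = {v} \<and> (\<forall>i. v i \<in> carrier L))"
  by (auto simp: rows_def)

lemma rows_co: "U \<in> carrier (rows L) \<Longrightarrow> co U i \<in> carrier L"
  by (auto simp: rows_carrier)

lemma rows_eqI: "\<lbrakk>U \<in> carrier (rows L); V \<in> carrier (rows L); \<And>i. co U i = co V i\<rbrakk> \<Longrightarrow> U = V"
  by (auto simp: rows_carrier)

lemma free_carrier_subset: "free_carrier L k \<subseteq> carrier (rows L)"
  by (auto simp: free_carrier_def rows_carrier)

lemma mem_free_carrier: "U \<in> free_carrier L k \<longleftrightarrow> U \<in> carrier (rows L) \<and> (\<forall>i \<ge> k. co U i = \<zero>\<^bsub>L\<^esub>)"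
  by (auto simp: free_carrier_def rows_carrier)

context ring
begin

lemma rows_left_module: "left_module R (rows R)"
proof -
  have "abelian_group (rows R)"
  proof (rule abelian_groupI)
    fix x assume "x \<in> carrier (rows R)"
    then obtain v where v: "x = {v}" "\<forall>i. v i \<in> carrier R" by (auto simp: rows_carrier)
    then show "\<exists>y\<in>carrier (rows R). y \<oplus>\<^bsub>rows R\<^esub> x = \<zero>\<^bsub>rows R\<^esub>"
      by (intro bexI[of _ "{\<lambda>i. \<ominus> v i}"]) (auto simp: rows_carrier l_neg)
  qed (auto simp: rows_carrier a_ac)
  then show ?thesis
    unfolding left_module_def left_module_axioms_def
    by (auto simp: ring_axioms rows_carrier l_distr r_distr m_assoc)
qed

sublocale rows: left_module R "rows R" by (rule rows_left_module)

lemma lsub_free: "lsub R (rows R) (free_carrier R k)"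
  by (auto simp: lsub_def mem_free_carrier rows_carrier)

lemma sub_rows_module: "lsub R (rows R) Z \<Longrightarrow> left_module R (sub_rows R Z)"
  by (rule rows.restrict_left_module)

lemma free_module: "left_module R (free R k)"
  by (rule sub_rows_module[OF lsub_free])

lemma unit_row_free: "i < k \<Longrightarrow> unit_row R i \<in> free_carrier R k"
  by (auto simp: unit_row_def free_carrier_def)

lemma co_finsum:
  "\<lbrakk>finite A; f \<in> A \<rightarrow> carrier (rows R)\<rbrakk> \<Longrightarrow> co (finsum (rows R) f A) i = (\<Oplus>a\<in>A. co (f a) i)"
proof (induction set: finite)
  case (insert a A)
  then have "f a \<in> carrier (rows R)" "f \<in> A \<rightarrow> carrier (rows R)" by auto
  then show ?case using insert by (simp add: rows_co Pi_def)
qed simp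

lemma finsum_restrict:
  assumes "left_module R N" "lsub R N K" "finite A" "f \<in> A \<rightarrow> K"
  shows "finsum (N\<lparr>carrier := K\<rparr>) f A = finsum N f A"
proof -
  interpret N: left_module R N by fact
  interpret K: left_module R "N\<lparr>carrier := K\<rparr>" by (rule N.restrict_left_module[OF assms(2)])
  show ?thesis using assms(3,4)
  proof (induction set: finite)
    case (insert a A)
    then have "f \<in> A \<rightarrow> K" "f a \<in> K" "f \<in> A \<rightarrow> carrier N" "f a \<in> carrier N"
      using lsub_subset[OF assms(2)] by auto
    then show ?case using insert by simp
  qed simp
qed

lemma free_expansion:
  assumes "U \<in> free_carrier R k"
  shows "(\<Oplus>\<^bsub>rows R\<^esub>i\<in>{..<k}. co U i \<odot>\<^bsub>rows R\<^esub> unit_row R i) = U"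
proof (rule rows_eqI)
  have U: "co U i \<in> carrier R" for i using assms by (simp add: mem_free_carrier rows_co)
  have u: "unit_row R i \<in> carrier (rows R)" for i by (auto simp: unit_row_def rows_carrier)
  show "(\<Oplus>\<^bsub>rows R\<^esub>i\<in>{..<k}. co U i \<odot>\<^bsub>rows R\<^esub> unit_row R i) \<in> carrier (rows R)"
    using U u by (intro rows.M.finsum_closed) (auto intro!: rows.smult_closed simp del: rows_simps)
  show "U \<in> carrier (rows R)" using assms by (simp add: mem_free_carrier)
  fix j
  have "co (\<Oplus>\<^bsub>rows R\<^esub>i\<in>{..<k}. co U i \<odot>\<^bsub>rows R\<^esub> unit_row R i) j
      = (\<Oplus>i\<in>{..<k}. co (co U i \<odot>\<^bsub>rows R\<^esub> unit_row R i) j)"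
    using U u by (intro co_finsum) (auto intro!: rows.smult_closed simp del: rows_simps)
  also have "\<dots> = (\<Oplus>i\<in>{..<k}. if j = i then co U i else \<zero>)"
    using U by (intro finsum_cong') (auto simp: unit_row_def)
  also have "\<dots> = co U j"
  proof (cases "j < k")
    case True
    then show ?thesis using U by (simp add: finsum_singleton[of j "{..<k}" "co U"])
  next
    case False
    then have "(\<Oplus>i\<in>{..<k}. if j = i then co U i else \<zero>) = (\<Oplus>i\<in>{..<k}. \<zero>)"
      by (intro finsum_cong') auto
    then show ?thesis using False assms by (simp add: mem_free_carrier)
  qed
  finally show "co (\<Oplus>\<^bsub>rows R\<^esub>i\<in>{..<k}. co U i \<odot>\<^bsub>rows R\<^esub> unit_row R i) j = co U j" .
qed

lemma free_map_linear:
  assumes "left_module R N" "\<And>i. i < k \<Longrightarrow> y i \<in> carrier N"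
  shows "free_map N k y \<in> lin_maps R (rows R) N"
proof (rule lin_mapsI)
  interpret N: left_module R N by fact
  note [simp] = N.smult_closed assms(2) rows_co
  show "free_map N k y U \<in> carrier N" if "U \<in> carrier (rows R)" for U
    using that by (auto simp: free_map_def)
  show "free_map N k y (U \<oplus>\<^bsub>rows R\<^esub> V) = free_map N k y U \<oplus>\<^bsub>N\<^esub> free_map N k y V"
    if "U \<in> carrier (rows R)" "V \<in> carrier (rows R)" for U V
  proof -
    have "free_map N k y (U \<oplus>\<^bsub>rows R\<^esub> V) = (\<Oplus>\<^bsub>N\<^esub>i\<in>{..<k}. co U i \<odot>\<^bsub>N\<^esub> y i \<oplus>\<^bsub>N\<^esub> co V i \<odot>\<^bsub>N\<^esub> y i)"
      unfolding free_map_def using that by (intro N.M.finsum_cong') (auto simp: N.smult_l_distr)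
    also have "\<dots> = free_map N k y U \<oplus>\<^bsub>N\<^esub> free_map N k y V"
      unfolding free_map_def using that by (intro N.M.finsum_addf) auto
    finally show ?thesis .
  qed
  show "free_map N k y (a \<odot>\<^bsub>rows R\<^esub> U) = a \<odot>\<^bsub>N\<^esub> free_map N k y U"
    if "a \<in> carrier R" "U \<in> carrier (rows R)" for a U
  proof -
    have "a \<odot>\<^bsub>N\<^esub> free_map N k y U = (\<Oplus>\<^bsub>N\<^esub>i\<in>{..<k}. a \<odot>\<^bsub>N\<^esub> (co U i \<odot>\<^bsub>N\<^esub> y i))"
      unfolding free_map_def using that by (intro N.finsum_smult) auto
    also have "\<dots> = free_map N k y (a \<odot>\<^bsub>rows R\<^esub> U)"
      unfolding free_map_def using that by (intro N.M.finsum_cong') (auto simp: N.smult_assoc)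
    finally show ?thesis by simp
  qed
qed

lemma lin_maps_free_eq:
  assumes N: "left_module R N" and f: "f \<in> lin_maps R (free R k) N" and U: "U \<in> free_carrier R k"
  shows "f U = free_map N k (\<lambda>i. f (unit_row R i)) U"
proof -
  have Uc: "co U i \<in> carrier R" for i using U by (simp add: mem_free_carrier rows_co)
  have mem: "co U i \<odot>\<^bsub>rows R\<^esub> unit_row R i \<in> free_carrier R k" if "i < k" for i
    using lsub_smult[OF lsub_free Uc unit_row_free[OF that]] .
  have "U = (\<Oplus>\<^bsub>free R k\<^esub>i\<in>{..<k}. co U i \<odot>\<^bsub>rows R\<^esub> unit_row R i)"
    using free_expansion[OF U] finsum_restrict[OF rows_left_module lsub_free, of "{..<k}" _ k] mem
    by (simp add: Pi_def del: rows_simps)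
  then have "f U = f (\<Oplus>\<^bsub>free R k\<^esub>i\<in>{..<k}. co U i \<odot>\<^bsub>rows R\<^esub> unit_row R i)" by (rule arg_cong)
  also have "\<dots> = (\<Oplus>\<^bsub>N\<^esub>i\<in>{..<k}. f (co U i \<odot>\<^bsub>rows R\<^esub> unit_row R i))"
    by (rule lin_maps_finsum[OF free_module N f]) (use mem in \<open>simp_all add: Pi_def del: rows_simps\<close>)
  also have "\<dots> = (\<Oplus>\<^bsub>N\<^esub>i\<in>{..<k}. co U i \<odot>\<^bsub>N\<^esub> f (unit_row R i))"
  proof -
    interpret N: left_module R N by fact
    have "f (co U i \<odot>\<^bsub>rows R\<^esub> unit_row R i) = co U i \<odot>\<^bsub>N\<^esub> f (unit_row R i)" if "i < k" for i
      using lin_maps_smult[OF f Uc, of "unit_row R i" i] unit_row_free[OF that] by (simp del: rows_simps)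
    moreover have "co U i \<odot>\<^bsub>N\<^esub> f (unit_row R i) \<in> carrier N" if "i < k" for i
      using lin_maps_closed[OF f, of "unit_row R i"] unit_row_free[OF that] Uc by (simp add: N.smult_closed)
    ultimately show ?thesis by (intro N.M.finsum_cong') (simp_all add: Pi_def del: rows_simps)
  qed
  finally show ?thesis by (simp add: free_map_def)
qed

lemma free_map_unit:
  assumes "left_module R N" "\<And>i. i < k \<Longrightarrow> y i \<in> carrier N" "j < k"
  shows "free_map N k y (unit_row R j) = y j"
proof -
  interpret N: left_module R N by fact
  have "free_map N k y (unit_row R j) = (\<Oplus>\<^bsub>N\<^esub>i\<in>{..<k}. if j = i then y i else \<zero>\<^bsub>N\<^esub>)"
    unfolding free_map_def using assms
    by (intro N.M.finsum_cong') (auto simp: unit_row_def N.smult_one N.smult_zero_left)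
  also have "\<dots> = y j" using assms by (simp add: N.M.finsum_singleton[of j "{..<k}" y] Pi_def)
  finally show ?thesis .
qed

lemma free_lift:
  assumes N: "left_module R N" and K: "left_module R K" and f: "f \<in> lin_maps R (free R k) N"
    and g: "g \<in> lin_maps R K N" and im: "\<And>U. U \<in> free_carrier R k \<Longrightarrow> f U \<in> g ` carrier K"
  obtains h where "h \<in> lin_maps R (free R k) K" "\<And>U. U \<in> free_carrier R k \<Longrightarrow> g (h U) = f U"
proof -
  have "\<exists>y. y \<in> carrier K \<and> g y = f (unit_row R i)" if "i < k" for i
    using im[OF unit_row_free[OF that]] by (auto simp: image_iff)
  then obtain y where y: "\<And>i. i < k \<Longrightarrow> y i \<in> carrier K" "\<And>i. i < k \<Longrightarrow> g (y i) = f (unit_row R i)"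
    by metis
  define h where "h = free_map K k y"
  have h: "h \<in> lin_maps R (free R k) K"
    unfolding h_def by (rule lin_maps_restrict_dom[OF free_map_linear[OF K y(1)] free_carrier_subset])
  have gh: "(\<lambda>U. g (h U)) \<in> lin_maps R (free R k) N" by (rule lin_maps_comp[OF h g])
  have "g (h U) = f U" if U: "U \<in> free_carrier R k" for U
  proof -
    interpret N: left_module R N by fact
    have Uc: "co U i \<in> carrier R" for i using U by (simp add: mem_free_carrier rows_co)
    have "g (h (unit_row R i)) = f (unit_row R i)" if "i < k" for i
      using free_map_unit[OF K y(1) that] y(2)[OF that] by (simp add: h_def)
    moreover have "f (unit_row R i) \<in> carrier N" if "i < k" for i
      using lin_maps_closed[OF f, of "unit_row R i"] unit_row_free[OF that] by simp
    ultimately show ?thesis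
      unfolding lin_maps_free_eq[OF N gh U] lin_maps_free_eq[OF N f U] free_map_def
      using Uc by (intro N.M.finsum_cong') (simp_all add: Pi_def N.smult_closed)
  qed
  then show ?thesis using that h by blast
qed

end

section \<open>Endomorphism rings and the trace pairing\<close>

locale faithful_fg_module = noetherian_normal_domain R for R :: "('a, 'b) ring_scheme" (structure) +
  fixes M :: "('a, 'm, 'd) module_scheme"
  assumes M_module: "module R M" and M_fg: "fg_module R M" and M_faithful: "faithful_module R M"

sublocale faithful_fg_module \<subseteq> Mod: left_module R M
  by (rule module_imp_left_module[OF M_module])

context faithful_fg_module
begin

abbreviation \<Lambda> :: "('m \<Rightarrow> 'm) ring" where "\<Lambda> \<equiv> End_ring R M"

lemma End_carrier: "f \<in> carrier \<Lambda> \<longleftrightarrow> f \<in> lin_maps R M M \<and> f \<in> extensional (carrier M)"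
  by (simp add: End_ring_def)

lemma End_closed: "\<lbrakk>f \<in> carrier \<Lambda>; x \<in> carrier M\<rbrakk> \<Longrightarrow> f x \<in> carrier M"
  and End_add: "\<lbrakk>f \<in> carrier \<Lambda>; x \<in> carrier M; y \<in> carrier M\<rbrakk> \<Longrightarrow> f (x \<oplus>\<^bsub>M\<^esub> y) = f x \<oplus>\<^bsub>M\<^esub> f y"
  and End_smult: "\<lbrakk>f \<in> carrier \<Lambda>; a \<in> carrier R; x \<in> carrier M\<rbrakk> \<Longrightarrow> f (a \<odot>\<^bsub>M\<^esub> x) = a \<odot>\<^bsub>M\<^esub> f x"
  by (auto simp: End_carrier lin_maps_closed lin_maps_add lin_maps_smult)

lemma End_eqI:
  "\<lbrakk>f \<in> carrier \<Lambda>; g \<in> carrier \<Lambda>; \<And>x. x \<in> carrier M \<Longrightarrow> f x = g x\<rbrakk> \<Longrightarrow> f = g"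
  unfolding End_carrier by (meson extensionalityI)

lemma End_memI:
  "\<lbrakk>\<And>x. x \<in> carrier M \<Longrightarrow> h x \<in> carrier M;
    \<And>x y. \<lbrakk>x \<in> carrier M; y \<in> carrier M\<rbrakk> \<Longrightarrow> h (x \<oplus>\<^bsub>M\<^esub> y) = h x \<oplus>\<^bsub>M\<^esub> h y;
    \<And>a x. \<lbrakk>a \<in> carrier R; x \<in> carrier M\<rbrakk> \<Longrightarrow> h (a \<odot>\<^bsub>M\<^esub> x) = a \<odot>\<^bsub>M\<^esub> h x\<rbrakk> \<Longrightarrow>
    (\<lambda>x \<in> carrier M. h x) \<in> carrier \<Lambda>"
  unfolding End_carrier by (auto intro!: lin_mapsI simp: Mod.smult_closed)

lemma End_mult_apply: "x \<in> carrier M \<Longrightarrow> (f \<otimes>\<^bsub>\<Lambda>\<^esub> g) x = f (g x)"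
  and End_add_apply: "x \<in> carrier M \<Longrightarrow> (f \<oplus>\<^bsub>\<Lambda>\<^esub> g) x = f x \<oplus>\<^bsub>M\<^esub> g x"
  and End_one_apply: "x \<in> carrier M \<Longrightarrow> \<one>\<^bsub>\<Lambda>\<^esub> x = x"
  and End_zero_apply: "x \<in> carrier M \<Longrightarrow> \<zero>\<^bsub>\<Lambda>\<^esub> x = \<zero>\<^bsub>M\<^esub>"
  by (simp_all add: End_ring_def compose_def)

lemma End_mult_closed: "\<lbrakk>f \<in> carrier \<Lambda>; g \<in> carrier \<Lambda>\<rbrakk> \<Longrightarrow> f \<otimes>\<^bsub>\<Lambda>\<^esub> g \<in> carrier \<Lambda>"
proof -
  assume fg: "f \<in> carrier \<Lambda>" "g \<in> carrier \<Lambda>"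
  have "(\<lambda>x \<in> carrier M. f (g x)) \<in> carrier \<Lambda>"
    by (rule End_memI) (simp_all add: fg End_closed End_add End_smult)
  then show ?thesis by (simp add: End_ring_def compose_def)
qed

lemma End_add_closed: "\<lbrakk>f \<in> carrier \<Lambda>; g \<in> carrier \<Lambda>\<rbrakk> \<Longrightarrow> f \<oplus>\<^bsub>\<Lambda>\<^esub> g \<in> carrier \<Lambda>"
proof -
  assume fg: "f \<in> carrier \<Lambda>" "g \<in> carrier \<Lambda>"
  have "(\<lambda>x \<in> carrier M. f x \<oplus>\<^bsub>M\<^esub> g x) \<in> carrier \<Lambda>"
    by (rule End_memI) (simp_all add: fg End_closed End_add End_smult Mod.smult_r_distr Mod.M.a_ac)
  then show ?thesis by (simp add: End_ring_def)
qed

lemma End_one_closed: "\<one>\<^bsub>\<Lambda>\<^esub> \<in> carrier \<Lambda>" and End_zero_closed: "\<zero>\<^bsub>\<Lambda>\<^esub> \<in> carrier \<Lambda>"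
proof -
  have "(\<lambda>x \<in> carrier M. x) \<in> carrier \<Lambda>" by (rule End_memI) simp_all
  then show "\<one>\<^bsub>\<Lambda>\<^esub> \<in> carrier \<Lambda>" by (simp add: End_ring_def)
  have "(\<lambda>x \<in> carrier M. \<zero>\<^bsub>M\<^esub>) \<in> carrier \<Lambda>" by (rule End_memI) (simp_all add: Mod.smult_zero_right)
  then show "\<zero>\<^bsub>\<Lambda>\<^esub> \<in> carrier \<Lambda>" by (simp add: End_ring_def)
qed

lemma scalar_closed: "a \<in> carrier R \<Longrightarrow> (\<lambda>x \<in> carrier M. a \<odot>\<^bsub>M\<^esub> x) \<in> carrier \<Lambda>"
  by (rule End_memI) (simp_all add: Mod.smult_closed Mod.smult_r_distr m_comm flip: Mod.smult_assoc)

lemma End_ring: "ring \<Lambda>"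
proof (rule ringI)
  note [simp] = End_mult_closed End_add_closed End_one_closed End_zero_closed End_closed
    End_mult_apply End_add_apply End_one_apply End_zero_apply End_add
  show "abelian_group \<Lambda>"
  proof (rule abelian_groupI)
    fix f assume f: "f \<in> carrier \<Lambda>"
    have "(\<lambda>x \<in> carrier M. \<ominus>\<^bsub>R\<^esub> \<one>\<^bsub>R\<^esub> \<odot>\<^bsub>M\<^esub> f x) \<in> carrier \<Lambda>"
      using f by (intro End_memI) (simp_all add: Mod.smult_closed Mod.smult_r_distr End_smult l_minus r_minus flip: Mod.smult_assoc)
    moreover from this have "(\<lambda>x \<in> carrier M. \<ominus>\<^bsub>R\<^esub> \<one>\<^bsub>R\<^esub> \<odot>\<^bsub>M\<^esub> f x) \<oplus>\<^bsub>\<Lambda>\<^esub> f = \<zero>\<^bsub>\<Lambda>\<^esub>"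
      using f by (intro End_eqI) (simp_all add: Mod.smult_minus_one Mod.M.l_neg)
    ultimately show "\<exists>g \<in> carrier \<Lambda>. g \<oplus>\<^bsub>\<Lambda>\<^esub> f = \<zero>\<^bsub>\<Lambda>\<^esub>" by blast
  qed (auto intro!: End_eqI simp: Mod.M.a_ac)
  show "monoid \<Lambda>" by (rule monoidI) (auto intro!: End_eqI)
  fix f g h assume "f \<in> carrier \<Lambda>" "g \<in> carrier \<Lambda>" "h \<in> carrier \<Lambda>"
  then show "(f \<oplus>\<^bsub>\<Lambda>\<^esub> g) \<otimes>\<^bsub>\<Lambda>\<^esub> h = f \<otimes>\<^bsub>\<Lambda>\<^esub> h \<oplus>\<^bsub>\<Lambda>\<^esub> g \<otimes>\<^bsub>\<Lambda>\<^esub> h"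
    "h \<otimes>\<^bsub>\<Lambda>\<^esub> (f \<oplus>\<^bsub>\<Lambda>\<^esub> g) = h \<otimes>\<^bsub>\<Lambda>\<^esub> f \<oplus>\<^bsub>\<Lambda>\<^esub> h \<otimes>\<^bsub>\<Lambda>\<^esub> g"
    by (auto intro!: End_eqI)
qed

sublocale \<Lambda>: ring "End_ring R M" by (rule End_ring)

lemma End_finsum_apply:
  "\<lbrakk>finite A; f \<in> A \<rightarrow> carrier \<Lambda>; x \<in> carrier M\<rbrakk> \<Longrightarrow> finsum \<Lambda> f A x = (\<Oplus>\<^bsub>M\<^esub>a\<in>A. f a x)"
proof (induction set: finite)
  case (insert a A)
  then have "f \<in> A \<rightarrow> carrier \<Lambda>" "f a \<in> carrier \<Lambda>" by auto
  then show ?case using insert by (simp add: End_add_apply End_closed Pi_def)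
qed (simp add: End_zero_apply)

definition gens :: "'m list" where
  "gens = (SOME xs. set xs \<subseteq> carrier M \<and> (\<forall>N. submodule N R M \<and> set xs \<subseteq> N \<longrightarrow> N = carrier M))"

lemma gens: "set gens \<subseteq> carrier M" "\<And>N. \<lbrakk>submodule N R M; set gens \<subseteq> N\<rbrakk> \<Longrightarrow> N = carrier M"
proof -
  obtain S where "S \<subseteq> carrier M" "finite S" "\<forall>N. submodule N R M \<and> S \<subseteq> N \<longrightarrow> N = carrier M"
    using M_fg by (auto simp: fg_module_def)
  moreover obtain xs where "set xs = S" using finite_list[OF \<open>finite S\<close>] by blast
  ultimately have "\<exists>xs. set xs \<subseteq> carrier M \<and> (\<forall>N. submodule N R M \<and> set xs \<subseteq> N \<longrightarrow> N = carrier M)" by auto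
  from someI_ex[OF this] show "set gens \<subseteq> carrier M" "\<And>N. \<lbrakk>submodule N R M; set gens \<subseteq> N\<rbrakk> \<Longrightarrow> N = carrier M"
    unfolding gens_def by blast+
qed

lemma lsub_imp_submodule:
  assumes "lsub R M N" shows "submodule N R M"
proof (rule module.submoduleI[OF M_module])
  show "\<ominus>\<^bsub>M\<^esub> a \<in> N" if "a \<in> N" for a using Mod.lsub_uminus[OF assms that] .
qed (use assms in \<open>auto simp: lsub_def\<close>)

lemma gens_span: "\<lbrakk>lsub R M N; set gens \<subseteq> N; x \<in> carrier M\<rbrakk> \<Longrightarrow> x \<in> N"
  using gens(2)[OF lsub_imp_submodule] by blast

text \<open>A functional is any HOL function that is linear on \<open>M\<close>, with arbitrary values elsewhere.\<close>

definition dual :: "('m \<Rightarrow> 'a) set" where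
  "dual = {\<alpha>. (\<forall>x \<in> carrier M. \<alpha> x \<in> carrier R) \<and>
     (\<forall>x \<in> carrier M. \<forall>y \<in> carrier M. \<alpha> (x \<oplus>\<^bsub>M\<^esub> y) = \<alpha> x \<oplus> \<alpha> y) \<and>
     (\<forall>a \<in> carrier R. \<forall>x \<in> carrier M. \<alpha> (a \<odot>\<^bsub>M\<^esub> x) = a \<otimes> \<alpha> x)}"

lemma dual_closed: "\<lbrakk>\<alpha> \<in> dual; x \<in> carrier M\<rbrakk> \<Longrightarrow> \<alpha> x \<in> carrier R"
  and dual_add: "\<lbrakk>\<alpha> \<in> dual; x \<in> carrier M; y \<in> carrier M\<rbrakk> \<Longrightarrow> \<alpha> (x \<oplus>\<^bsub>M\<^esub> y) = \<alpha> x \<oplus> \<alpha> y"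
  and dual_smult: "\<lbrakk>\<alpha> \<in> dual; a \<in> carrier R; x \<in> carrier M\<rbrakk> \<Longrightarrow> \<alpha> (a \<odot>\<^bsub>M\<^esub> x) = a \<otimes> \<alpha> x"
  by (auto simp: dual_def)

lemma dual_zero: "\<alpha> \<in> dual \<Longrightarrow> \<alpha> \<zero>\<^bsub>M\<^esub> = \<zero>"
  using dual_smult[of \<alpha> \<zero> "\<zero>\<^bsub>M\<^esub>"] dual_closed[of \<alpha> "\<zero>\<^bsub>M\<^esub>"] by (simp add: Mod.smult_zero_right)

lemma dual_finsum:
  "\<lbrakk>finite A; \<alpha> \<in> dual; f \<in> A \<rightarrow> carrier M\<rbrakk> \<Longrightarrow> \<alpha> (finsum M f A) = (\<Oplus>a\<in>A. \<alpha> (f a))"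
proof (induction set: finite)
  case (insert a A)
  then have "f \<in> A \<rightarrow> carrier M" "f a \<in> carrier M" by auto
  then show ?case using insert by (simp add: dual_add dual_closed Pi_def)
qed (simp add: dual_zero)

lemma dual_eq_zero:
  assumes \<alpha>: "\<alpha> \<in> dual" and z: "\<And>x. x \<in> set gens \<Longrightarrow> \<alpha> x = \<zero>" and x: "x \<in> carrier M"
  shows "\<alpha> x = \<zero>"
proof -
  have "lsub R M {x \<in> carrier M. \<alpha> x = \<zero>}"
    by (auto simp: lsub_def dual_zero[OF \<alpha>] dual_add[OF \<alpha>] dual_smult[OF \<alpha>] Mod.smult_closed)
  from gens_span[OF this _ x] show ?thesis using z gens(1) by auto
qed

lemma finsum_smult_right:
  "\<lbrakk>finite A; f \<in> A \<rightarrow> carrier R; m \<in> carrier M\<rbrakk> \<Longrightarrow> finsum R f A \<odot>\<^bsub>M\<^esub> m = (\<Oplus>\<^bsub>M\<^esub>a\<in>A. f a \<odot>\<^bsub>M\<^esub> m)"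
proof (induction set: finite)
  case (insert a A)
  then have "f \<in> A \<rightarrow> carrier R" "f a \<in> carrier R" by auto
  then show ?case using insert by (simp add: Mod.smult_l_distr Mod.smult_closed Pi_def)
qed (simp add: Mod.smult_zero_left)

definition tensor :: "'m \<Rightarrow> ('m \<Rightarrow> 'a) \<Rightarrow> 'm \<Rightarrow> 'm" where
  "tensor m \<alpha> = (\<lambda>x \<in> carrier M. \<alpha> x \<odot>\<^bsub>M\<^esub> m)"

lemma tensor_apply: "x \<in> carrier M \<Longrightarrow> tensor m \<alpha> x = \<alpha> x \<odot>\<^bsub>M\<^esub> m"
  by (simp add: tensor_def)

lemma tensor_closed: "\<lbrakk>m \<in> carrier M; \<alpha> \<in> dual\<rbrakk> \<Longrightarrow> tensor m \<alpha> \<in> carrier \<Lambda>"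
  unfolding tensor_def
  by (rule End_memI) (simp_all add: dual_closed dual_add dual_smult Mod.smult_closed Mod.smult_l_distr Mod.smult_assoc)

lemma faithful_zero: "\<lbrakk>a \<in> carrier R; \<And>x. x \<in> carrier M \<Longrightarrow> a \<odot>\<^bsub>M\<^esub> x = \<zero>\<^bsub>M\<^esub>\<rbrakk> \<Longrightarrow> a = \<zero>"
  using M_faithful unfolding faithful_module_def by blast

text \<open>A functional is obtained from a maximal linearly independent set of generators: a nonzero
  multiple of \<open>M\<close> lies in its free span, and some coordinate of that multiple is not zero.\<close>

definition combs :: "'m list \<Rightarrow> (nat \<Rightarrow> 'a) \<Rightarrow> 'm" where
  "combs xs c = (\<Oplus>\<^bsub>M\<^esub>i\<in>{..<length xs}. c i \<odot>\<^bsub>M\<^esub> xs ! i)"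

definition independent_list :: "'m list \<Rightarrow> bool" where
  "independent_list xs \<longleftrightarrow> set xs \<subseteq> carrier M \<and>
    (\<forall>c. (\<forall>i. c i \<in> carrier R) \<longrightarrow> combs xs c = \<zero>\<^bsub>M\<^esub> \<longrightarrow> (\<forall>i < length xs. c i = \<zero>))"

lemma combs_closed: "\<lbrakk>set xs \<subseteq> carrier M; \<And>i. c i \<in> carrier R\<rbrakk> \<Longrightarrow> combs xs c \<in> carrier M"
  unfolding combs_def by (intro Mod.M.finsum_closed) (auto intro!: Mod.smult_closed nth_mem)

lemma combs_add:
  assumes "set xs \<subseteq> carrier M" "\<And>i. c i \<in> carrier R" "\<And>i. d i \<in> carrier R"
  shows "combs xs (\<lambda>i. c i \<oplus> d i) = combs xs c \<oplus>\<^bsub>M\<^esub> combs xs d"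
proof -
  have n: "xs ! i \<in> carrier M" if "i < length xs" for i using assms(1) that nth_mem by blast
  have "combs xs (\<lambda>i. c i \<oplus> d i) = (\<Oplus>\<^bsub>M\<^esub>i\<in>{..<length xs}. c i \<odot>\<^bsub>M\<^esub> xs ! i \<oplus>\<^bsub>M\<^esub> d i \<odot>\<^bsub>M\<^esub> xs ! i)"
    unfolding combs_def using assms n by (intro Mod.M.finsum_cong') (auto simp: Mod.smult_l_distr Mod.smult_closed)
  also have "\<dots> = combs xs c \<oplus>\<^bsub>M\<^esub> combs xs d"
    unfolding combs_def using assms n by (intro Mod.M.finsum_addf) (auto simp: Mod.smult_closed)
  finally show ?thesis .
qed

lemma combs_smult:
  assumes "set xs \<subseteq> carrier M" "\<And>i. c i \<in> carrier R" "a \<in> carrier R"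
  shows "combs xs (\<lambda>i. a \<otimes> c i) = a \<odot>\<^bsub>M\<^esub> combs xs c"
proof -
  have n: "xs ! i \<in> carrier M" if "i < length xs" for i using assms(1) that nth_mem by blast
  have "a \<odot>\<^bsub>M\<^esub> combs xs c = (\<Oplus>\<^bsub>M\<^esub>i\<in>{..<length xs}. a \<odot>\<^bsub>M\<^esub> (c i \<odot>\<^bsub>M\<^esub> xs ! i))"
    unfolding combs_def using assms n by (intro Mod.finsum_smult) (auto simp: Mod.smult_closed)
  also have "\<dots> = combs xs (\<lambda>i. a \<otimes> c i)"
    unfolding combs_def using assms n by (intro Mod.M.finsum_cong') (auto simp: Mod.smult_assoc Mod.smult_closed)
  finally show ?thesis by simp
qed

lemma combs_snoc:
  assumes "set xs \<subseteq> carrier M" "x \<in> carrier M" "\<And>i. c i \<in> carrier R"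
  shows "combs (xs @ [x]) c = c (length xs) \<odot>\<^bsub>M\<^esub> x \<oplus>\<^bsub>M\<^esub> combs xs c"
proof -
  have n: "xs ! i \<in> carrier M" if "i < length xs" for i using assms(1) that nth_mem by blast
  have "combs (xs @ [x]) c = c (length xs) \<odot>\<^bsub>M\<^esub> (xs @ [x]) ! length xs \<oplus>\<^bsub>M\<^esub>
      (\<Oplus>\<^bsub>M\<^esub>i\<in>{..<length xs}. c i \<odot>\<^bsub>M\<^esub> (xs @ [x]) ! i)"
    unfolding combs_def using assms n
    by (simp add: lessThan_Suc nth_append Mod.smult_closed Pi_def)
  also have "(\<Oplus>\<^bsub>M\<^esub>i\<in>{..<length xs}. c i \<odot>\<^bsub>M\<^esub> (xs @ [x]) ! i) = combs xs c"
    unfolding combs_def using assms n by (intro Mod.M.finsum_cong') (auto simp: nth_append Mod.smult_closed)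
  finally show ?thesis by simp
qed

text \<open>The elements with a nonzero multiple in the span of \<open>xs\<close>.\<close>

definition rational_span :: "'m list \<Rightarrow> 'm set" where
  "rational_span xs = {x \<in> carrier M. \<exists>d \<in> carrier R. d \<noteq> \<zero> \<and>
    (\<exists>c. (\<forall>i. c i \<in> carrier R) \<and> d \<odot>\<^bsub>M\<^esub> x = combs xs c)}"

lemma rational_span_extend:
  assumes xs: "independent_list xs" and x: "x \<in> carrier M" "x \<notin> rational_span xs"
  shows "independent_list (xs @ [x])"
  unfolding independent_list_def
proof (intro conjI allI impI)
  note sub = xs[unfolded independent_list_def, THEN conjunct1]
  show "set (xs @ [x]) \<subseteq> carrier M" using sub x by simp
  fix c i assume c: "\<forall>i. c i \<in> carrier R" and z: "combs (xs @ [x]) c = \<zero>\<^bsub>M\<^esub>" and i: "i < length (xs @ [x])"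
  have eq: "c (length xs) \<odot>\<^bsub>M\<^esub> x \<oplus>\<^bsub>M\<^esub> combs xs c = \<zero>\<^bsub>M\<^esub>" using z combs_snoc[OF sub x(1), of c] c by simp
  have cl: "c (length xs) \<odot>\<^bsub>M\<^esub> x \<in> carrier M" "combs xs c \<in> carrier M"
    using c x sub by (auto intro!: Mod.smult_closed combs_closed)
  have "c (length xs) = \<zero>"
  proof (rule ccontr)
    assume nz: "c (length xs) \<noteq> \<zero>"
    have "combs xs (\<lambda>i. \<ominus> \<one> \<otimes> c i) = \<ominus> \<one> \<odot>\<^bsub>M\<^esub> combs xs c"
      using c sub by (intro combs_smult) auto
    also have "\<dots> = c (length xs) \<odot>\<^bsub>M\<^esub> x"
      using eq cl Mod.M.minus_equality[of "c (length xs) \<odot>\<^bsub>M\<^esub> x" "combs xs c"] by (simp add: Mod.smult_minus_one)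
    finally have "c (length xs) \<odot>\<^bsub>M\<^esub> x = combs xs (\<lambda>i. \<ominus> \<one> \<otimes> c i)" by simp
    then have "x \<in> rational_span xs"
      unfolding rational_span_def using x(1) nz c
      by (intro CollectI conjI bexI[of _ "c (length xs)"] exI[of _ "\<lambda>i. \<ominus> \<one> \<otimes> c i"]) simp_all
    then show False using x(2) by simp
  qed
  moreover from this have "combs xs c = \<zero>\<^bsub>M\<^esub>" using eq cl x by (simp add: Mod.smult_zero_left)
  then have "\<forall>i < length xs. c i = \<zero>"
    using xs[unfolded independent_list_def, THEN conjunct2, rule_format, of c] c by simp
  ultimately show "c i = \<zero>" using i by (cases "i = length xs") auto
qed

text \<open>A generator that is independent of the previous choice is added to it; any other one already has a
  nonzero multiple in the span.\<close>

lemma exists_maximal_independent: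
  "set ys \<subseteq> carrier M \<Longrightarrow> \<exists>xs. independent_list xs \<and> set ys \<subseteq> rational_span xs"
proof (induction ys)
  case Nil
  have "independent_list []" by (simp add: independent_list_def)
  then show ?case by (intro exI[of _ "[]"]) simp
next
  case (Cons y ys)
  then obtain xs where xs: "independent_list xs" "set ys \<subseteq> rational_span xs" by auto
  show ?case
  proof (cases "y \<in> rational_span xs")
    case False
    have y: "y \<in> carrier M" and sub: "set xs \<subseteq> carrier M" using Cons xs by (auto simp: independent_list_def)
    have "x \<in> rational_span (xs @ [y])" if hx: "x \<in> rational_span xs" for x
    proof -
      obtain d c where x: "x \<in> carrier M" "d \<in> carrier R" "d \<noteq> \<zero>" "\<forall>i. c i \<in> carrier R" "d \<odot>\<^bsub>M\<^esub> x = combs xs c"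
        using hx unfolding rational_span_def by blast
      have "combs (xs @ [y]) (\<lambda>i. if i < length xs then c i else \<zero>) = combs xs (\<lambda>i. if i < length xs then c i else \<zero>)"
        using x y sub combs_closed[OF sub, of "\<lambda>i. if i < length xs then c i else \<zero>"]
        by (simp add: combs_snoc Mod.smult_zero_left)
      also have "\<dots> = combs xs c"
        unfolding combs_def using x sub by (intro Mod.M.finsum_cong') (auto intro!: Mod.smult_closed nth_mem)
      finally show ?thesis
        using x unfolding rational_span_def
        by (intro CollectI conjI bexI[of _ d] exI[of _ "\<lambda>i. if i < length xs then c i else \<zero>"]) auto
    qed
    moreover have "y \<in> rational_span (xs @ [y])"
    proof -
      have "combs (xs @ [y]) (\<lambda>i. if i = length xs then \<one> else \<zero>) = y \<oplus>\<^bsub>M\<^esub> combs xs (\<lambda>i. if i = length xs then \<one> else \<zero>)"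
        using y sub by (simp add: combs_snoc Mod.smult_one)
      also have "combs xs (\<lambda>i. if i = length xs then \<one> else \<zero>) = (\<Oplus>\<^bsub>M\<^esub>i\<in>{..<length xs}. \<zero>\<^bsub>M\<^esub>)"
      proof -
        have "xs ! i \<in> carrier M" if "i < length xs" for i using sub that nth_mem by blast
        then show ?thesis unfolding combs_def by (intro Mod.M.finsum_cong') (auto simp: Mod.smult_zero_left)
      qed
      finally have "\<one> \<odot>\<^bsub>M\<^esub> y = combs (xs @ [y]) (\<lambda>i. if i = length xs then \<one> else \<zero>)"
        using y by (simp add: Mod.smult_one)
      then show ?thesis
        using y unfolding rational_span_def
        by (intro CollectI conjI bexI[of _ \<one>] exI[of _ "\<lambda>i. if i = length xs then \<one> else \<zero>"]) auto
    qed
    ultimately show ?thesis using rational_span_extend[OF xs(1) y False] xs(2)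
      by (intro exI[of _ "xs @ [y]"]) auto
  qed (use xs in auto)
qed

lemma common_denominator:
  assumes sub: "set xs \<subseteq> carrier M" and ys: "set ys \<subseteq> rational_span xs"
  shows "\<exists>d \<in> carrier R. d \<noteq> \<zero> \<and> (\<forall>y \<in> set ys. \<exists>c. (\<forall>i. c i \<in> carrier R) \<and> d \<odot>\<^bsub>M\<^esub> y = combs xs c)"
  using ys
proof (induction ys)
  case (Cons y ys)
  then obtain d where d: "d \<in> carrier R" "d \<noteq> \<zero>"
    "\<And>y. y \<in> set ys \<Longrightarrow> \<exists>c. (\<forall>i. c i \<in> carrier R) \<and> d \<odot>\<^bsub>M\<^esub> y = combs xs c" by auto
  obtain d' c' where y: "y \<in> carrier M" "d' \<in> carrier R" "d' \<noteq> \<zero>" "\<forall>i. c' i \<in> carrier R" "d' \<odot>\<^bsub>M\<^esub> y = combs xs c'"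
    using Cons.prems unfolding rational_span_def by auto
  have "\<exists>c. (\<forall>i. c i \<in> carrier R) \<and> (d \<otimes> d') \<odot>\<^bsub>M\<^esub> z = combs xs c" if z: "z \<in> set (y # ys)" for z
  proof (cases "z = y")
    case True
    then have "(d \<otimes> d') \<odot>\<^bsub>M\<^esub> z = combs xs (\<lambda>i. d \<otimes> c' i)"
      using d y sub by (simp add: Mod.smult_assoc combs_smult)
    then show ?thesis using d y by (intro exI[of _ "\<lambda>i. d \<otimes> c' i"]) simp
  next
    case False
    then have "z \<in> set ys" using z by simp
    then obtain c where c: "\<forall>i. c i \<in> carrier R" "d \<odot>\<^bsub>M\<^esub> z = combs xs c" using d(3) by blast
    have "z \<in> carrier M" using \<open>z \<in> set ys\<close> Cons.prems by (auto simp: rational_span_def)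
    then have "(d' \<otimes> d) \<odot>\<^bsub>M\<^esub> z = combs xs (\<lambda>i. d' \<otimes> c i)"
      using d y sub c by (simp add: Mod.smult_assoc combs_smult)
    then show ?thesis using d y c by (intro exI[of _ "\<lambda>i. d' \<otimes> c i"]) (simp add: m_comm)
  qed
  then show ?case using d y by (intro bexI[of _ "d \<otimes> d'"]) (auto simp: integral_iff)
qed (auto intro!: bexI[of _ \<one>])

lemma exists_nonzero_functional:
  obtains \<alpha> x where "\<alpha> \<in> dual" "x \<in> carrier M" "\<alpha> x \<noteq> \<zero>"
proof -
  obtain xs where xs: "independent_list xs" "set gens \<subseteq> rational_span xs"
    using exists_maximal_independent[OF gens(1)] by blast
  have sub: "set xs \<subseteq> carrier M" using xs by (simp add: independent_list_def)
  obtain d where d: "d \<in> carrier R" "d \<noteq> \<zero>"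
    "\<And>y. y \<in> set gens \<Longrightarrow> \<exists>c. (\<forall>i. c i \<in> carrier R) \<and> d \<odot>\<^bsub>M\<^esub> y = combs xs c"
    using common_denominator[OF sub xs(2)] by blast
  define N where "N = {x \<in> carrier M. \<exists>c. (\<forall>i. c i \<in> carrier R) \<and> d \<odot>\<^bsub>M\<^esub> x = combs xs c}"
  have "lsub R M N"
    unfolding lsub_def
  proof (intro conjI ballI)
    show "N \<subseteq> carrier M" by (auto simp: N_def)
    have "combs xs (\<lambda>_. \<zero> \<otimes> \<zero>) = \<zero> \<odot>\<^bsub>M\<^esub> combs xs (\<lambda>_. \<zero>)" using sub by (intro combs_smult) auto
    then have "d \<odot>\<^bsub>M\<^esub> \<zero>\<^bsub>M\<^esub> = combs xs (\<lambda>_. \<zero>)"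
      using d combs_closed[OF sub, of "\<lambda>_. \<zero>"] by (simp add: Mod.smult_zero_left Mod.smult_zero_right)
    then show "\<zero>\<^bsub>M\<^esub> \<in> N" unfolding N_def by (intro CollectI conjI exI[of _ "\<lambda>_. \<zero>"]) auto
    fix x assume "x \<in> N"
    then obtain c where x: "x \<in> carrier M" "\<forall>i. c i \<in> carrier R" "d \<odot>\<^bsub>M\<^esub> x = combs xs c" by (auto simp: N_def)
    {
      fix a assume a: "a \<in> carrier R"
      have "d \<odot>\<^bsub>M\<^esub> (a \<odot>\<^bsub>M\<^esub> x) = a \<odot>\<^bsub>M\<^esub> combs xs c"
        using a x d by (simp add: m_comm flip: Mod.smult_assoc x(3))
      also have "\<dots> = combs xs (\<lambda>i. a \<otimes> c i)" using a x sub by (simp add: combs_smult)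
      finally show "a \<odot>\<^bsub>M\<^esub> x \<in> N"
        using a x unfolding N_def by (intro CollectI conjI exI[of _ "\<lambda>i. a \<otimes> c i"]) (auto simp: Mod.smult_closed)
    }
    fix y assume "y \<in> N"
    then obtain c' where y: "y \<in> carrier M" "\<forall>i. c' i \<in> carrier R" "d \<odot>\<^bsub>M\<^esub> y = combs xs c'" by (auto simp: N_def)
    have "d \<odot>\<^bsub>M\<^esub> (x \<oplus>\<^bsub>M\<^esub> y) = combs xs (\<lambda>i. c i \<oplus> c' i)"
      using x y d sub by (simp add: Mod.smult_r_distr combs_add)
    then show "x \<oplus>\<^bsub>M\<^esub> y \<in> N"
      using x y unfolding N_def by (intro CollectI conjI exI[of _ "\<lambda>i. c i \<oplus> c' i"]) auto
  qed
  then have all: "\<exists>c. (\<forall>i. c i \<in> carrier R) \<and> d \<odot>\<^bsub>M\<^esub> x = combs xs c" if "x \<in> carrier M" for x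
    using gens_span[of N x] that d(3) gens(1) by (auto simp: N_def)
  then obtain C where C: "\<And>x i. x \<in> carrier M \<Longrightarrow> C x i \<in> carrier R" "\<And>x. x \<in> carrier M \<Longrightarrow> d \<odot>\<^bsub>M\<^esub> x = combs xs (C x)"
    by metis
  have uniq: "c i = c' i" if "\<forall>i. c i \<in> carrier R" "\<forall>i. c' i \<in> carrier R" "combs xs c = combs xs c'" "i < length xs" for c c' i
  proof -
    have "combs xs (\<lambda>i. c i \<oplus> \<ominus> \<one> \<otimes> c' i) = combs xs c \<oplus>\<^bsub>M\<^esub> combs xs (\<lambda>i. \<ominus> \<one> \<otimes> c' i)"
      using that(1,2) by (intro combs_add[OF sub]) auto
    also have "combs xs (\<lambda>i. \<ominus> \<one> \<otimes> c' i) = \<ominus> \<one> \<odot>\<^bsub>M\<^esub> combs xs c'"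
      using that(2) by (intro combs_smult[OF sub]) auto
    also have "combs xs c \<oplus>\<^bsub>M\<^esub> \<ominus> \<one> \<odot>\<^bsub>M\<^esub> combs xs c' = \<zero>\<^bsub>M\<^esub>"
      using combs_closed[OF sub, of c'] that(2) unfolding that(3) by (simp add: Mod.smult_minus_one Mod.M.r_neg)
    finally have z: "combs xs (\<lambda>i. c i \<oplus> \<ominus> \<one> \<otimes> c' i) = \<zero>\<^bsub>M\<^esub>" .
    have cl: "\<forall>i. c i \<oplus> \<ominus> \<one> \<otimes> c' i \<in> carrier R" using that(1,2) by simp
    have "\<forall>i < length xs. c i \<oplus> \<ominus> \<one> \<otimes> c' i = \<zero>"
      using xs(1)[unfolded independent_list_def, THEN conjunct2, THEN spec, THEN mp, OF cl, THEN mp, OF z] .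
    then have "c i \<oplus> \<ominus> \<one> \<otimes> c' i = \<zero>" using that(4) by simp
    moreover have "c i \<in> carrier R" "c' i \<in> carrier R" using that(1,2) by simp_all
    ultimately show ?thesis by (simp add: l_minus flip: minus_eq)
  qed
  have lin: "(\<lambda>x. C x i) \<in> dual" if i: "i < length xs" for i
    unfolding dual_def
  proof (intro CollectI conjI ballI)
    show "C x i \<in> carrier R" if "x \<in> carrier M" for x using C that by simp
    show "C (x \<oplus>\<^bsub>M\<^esub> y) i = C x i \<oplus> C y i" if "x \<in> carrier M" "y \<in> carrier M" for x y
    proof (rule uniq[OF _ _ _ i])
      have "combs xs (C (x \<oplus>\<^bsub>M\<^esub> y)) = combs xs (C x) \<oplus>\<^bsub>M\<^esub> combs xs (C y)"
        using that d by (simp add: Mod.smult_r_distr flip: C(2))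
      then show "combs xs (C (x \<oplus>\<^bsub>M\<^esub> y)) = combs xs (\<lambda>i. C x i \<oplus> C y i)" using that C sub by (simp add: combs_add)
    qed (use that C in auto)
    show "C (a \<odot>\<^bsub>M\<^esub> x) i = a \<otimes> C x i" if "a \<in> carrier R" "x \<in> carrier M" for a x
    proof (rule uniq[OF _ _ _ i])
      have "combs xs (C (a \<odot>\<^bsub>M\<^esub> x)) = d \<odot>\<^bsub>M\<^esub> (a \<odot>\<^bsub>M\<^esub> x)" using that C(2) by (simp add: Mod.smult_closed)
      also have "\<dots> = a \<odot>\<^bsub>M\<^esub> combs xs (C x)"
        using that d by (simp add: m_comm flip: Mod.smult_assoc C(2))
      finally show "combs xs (C (a \<odot>\<^bsub>M\<^esub> x)) = combs xs (\<lambda>i. a \<otimes> C x i)" using that C sub by (simp add: combs_smult)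
    qed (use that C in \<open>auto simp: Mod.smult_closed\<close>)
  qed
  have "\<exists>x \<in> carrier M. \<exists>i < length xs. C x i \<noteq> \<zero>"
  proof (rule ccontr)
    assume none: "\<not> ?thesis"
    have "d \<odot>\<^bsub>M\<^esub> x = \<zero>\<^bsub>M\<^esub>" if "x \<in> carrier M" for x
    proof -
      have n: "xs ! i \<in> carrier M" if "i < length xs" for i using sub that nth_mem by blast
      have "C x i = \<zero>" if "i < length xs" for i using none that \<open>x \<in> carrier M\<close> by blast
      with n have "combs xs (C x) = (\<Oplus>\<^bsub>M\<^esub>i\<in>{..<length xs}. \<zero>\<^bsub>M\<^esub>)"
        unfolding combs_def by (intro Mod.M.finsum_cong') (auto simp: Mod.smult_zero_left)
      then show ?thesis using C(2)[OF that] by simp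
    qed
    then show False using faithful_zero[OF d(1)] d(2) by blast
  qed
  then show ?thesis using that lin by blast
qed

definition trace_values :: "'a set" where
  "trace_values = {\<alpha> x | \<alpha> x. \<alpha> \<in> dual \<and> x \<in> carrier M}"

text \<open>If \<open>a / b\<close> carries the trace into \<open>R\<close>, it carries every functional to a functional, hence
  the trace into itself.\<close>

lemma dense_trace: "dense trace_values"
  unfolding dense_def
proof (intro conjI ballI impI)
  show sub: "trace_values \<subseteq> carrier R" by (auto simp: trace_values_def dual_closed)
  obtain \<alpha> x where ax: "\<alpha> \<in> dual" "x \<in> carrier M" "\<alpha> x \<noteq> \<zero>" by (rule exists_nonzero_functional)
  then have mem: "\<alpha> x \<in> trace_values" by (auto simp: trace_values_def)
  then show "\<exists>t\<in>trace_values. t \<noteq> \<zero>" using ax by blast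
  fix a b assume a: "a \<in> carrier R" and b: "b \<in> carrier R - {\<zero>}" and div: "\<forall>t\<in>trace_values. b divides (a \<otimes> t)"
  have "\<exists>c\<in>carrier R. a = b \<otimes> c"
  proof (rule divides_if_stabilizes[OF a _ _ sub mem ax(3)])
    fix t assume "t \<in> trace_values"
    then obtain \<beta> y where t: "t = \<beta> y" "\<beta> \<in> dual" "y \<in> carrier M" by (auto simp: trace_values_def)
    have "\<exists>c. c \<in> carrier R \<and> a \<otimes> \<beta> z = b \<otimes> c" if "z \<in> carrier M" for z
    proof -
      have "b divides (a \<otimes> \<beta> z)" using div t(2) that by (auto simp: trace_values_def)
      then show ?thesis by (auto simp: factor_def)
    qed
    then obtain \<gamma> where \<gamma>: "\<And>z. z \<in> carrier M \<Longrightarrow> \<gamma> z \<in> carrier R" "\<And>z. z \<in> carrier M \<Longrightarrow> a \<otimes> \<beta> z = b \<otimes> \<gamma> z"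
      by metis
    have cancel: "u = v" if "u \<in> carrier R" "v \<in> carrier R" "b \<otimes> u = b \<otimes> v" for u v
      using that b m_lcancel[of b u v] by simp
    have "\<gamma> \<in> dual"
      unfolding dual_def
    proof (intro CollectI conjI ballI)
      show "\<gamma> (u \<oplus>\<^bsub>M\<^esub> v) = \<gamma> u \<oplus> \<gamma> v" if "u \<in> carrier M" "v \<in> carrier M" for u v
      proof (rule cancel)
        have uv: "u \<oplus>\<^bsub>M\<^esub> v \<in> carrier M" using that by simp
        show "\<gamma> (u \<oplus>\<^bsub>M\<^esub> v) \<in> carrier R" "\<gamma> u \<oplus> \<gamma> v \<in> carrier R" using uv that \<gamma>(1) by simp_all
        have "b \<otimes> (\<gamma> u \<oplus> \<gamma> v) = a \<otimes> \<beta> u \<oplus> a \<otimes> \<beta> v"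
          using that b \<gamma>(1) by (simp add: r_distr \<gamma>(2))
        then show "b \<otimes> \<gamma> (u \<oplus>\<^bsub>M\<^esub> v) = b \<otimes> (\<gamma> u \<oplus> \<gamma> v)"
          using that a t(2) by (simp add: r_distr dual_add dual_closed flip: \<gamma>(2)[OF uv])
      qed
      show "\<gamma> (r \<odot>\<^bsub>M\<^esub> u) = r \<otimes> \<gamma> u" if "r \<in> carrier R" "u \<in> carrier M" for r u
      proof (rule cancel)
        have ru: "r \<odot>\<^bsub>M\<^esub> u \<in> carrier M" using that by (simp add: Mod.smult_closed)
        show "\<gamma> (r \<odot>\<^bsub>M\<^esub> u) \<in> carrier R" "r \<otimes> \<gamma> u \<in> carrier R" using ru that \<gamma>(1) by simp_all
        have "b \<otimes> (r \<otimes> \<gamma> u) = r \<otimes> (a \<otimes> \<beta> u)"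
          using that b \<gamma>(1) by (simp add: m_lcomm \<gamma>(2))
        also have "\<dots> = b \<otimes> \<gamma> (r \<odot>\<^bsub>M\<^esub> u)"
          using that a t(2) by (simp add: m_lcomm dual_smult dual_closed flip: \<gamma>(2)[OF ru])
        finally show "b \<otimes> \<gamma> (r \<odot>\<^bsub>M\<^esub> u) = b \<otimes> (r \<otimes> \<gamma> u)" by simp
      qed
    qed (use \<gamma> in simp)
    then have "\<gamma> y \<in> trace_values" using t by (auto simp: trace_values_def)
    then show "\<exists>j'\<in>trace_values. a \<otimes> t = b \<otimes> j'" using \<gamma>(2)[OF t(3)] t(1) by blast
  qed (use b in auto)
  then show "b divides a" by (auto simp: factor_def)
qed

end

section \<open>The class of a left module over the endomorphism ring\<close>

context faithful_fg_module
begin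

definition dual_rows :: "nat \<Rightarrow> (nat \<Rightarrow> 'm \<Rightarrow> 'a) set" where
  "dual_rows k = {y. \<forall>i < k. y i \<in> dual}"

definition row_tensor :: "nat \<Rightarrow> 'm \<Rightarrow> (nat \<Rightarrow> 'm \<Rightarrow> 'a) \<Rightarrow> (nat \<Rightarrow> 'm \<Rightarrow> 'm) set" where
  "row_tensor k m y = {\<lambda>i. if i < k then tensor m (y i) else \<zero>\<^bsub>\<Lambda>\<^esub>}"

text \<open>Up to codimension two this is the \<open>R\<close>-module \<open>Hom\<^sub>\<Lambda>(M, Z)\<close>, the Morita partner of \<open>Z\<close>:
  a row \<open>y\<close> of functionals is the homomorphism \<open>m \<mapsto> m \<otimes> y\<close>. Unlike \<open>Z\<close> it is always torsion-free.\<close>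

definition partner :: "nat \<Rightarrow> (nat \<Rightarrow> 'm \<Rightarrow> 'm) set set \<Rightarrow> (nat \<Rightarrow> 'm \<Rightarrow> 'a) set" where
  "partner k Z = {y \<in> dual_rows k. \<forall>m \<in> carrier M. row_tensor k m y \<in> Z}"

definition row_comb :: "(nat \<Rightarrow> 'm \<Rightarrow> 'a) \<Rightarrow> 'a \<Rightarrow> (nat \<Rightarrow> 'm \<Rightarrow> 'a) \<Rightarrow> nat \<Rightarrow> 'm \<Rightarrow> 'a" where
  "row_comb y r y' = (\<lambda>i x. y i x \<oplus> r \<otimes> y' i x)"

definition linear_functionals :: "nat \<Rightarrow> ((nat \<Rightarrow> 'm \<Rightarrow> 'a) \<Rightarrow> 'a) set" where
  "linear_functionals k = {\<phi>. (\<forall>y \<in> dual_rows k. \<phi> y \<in> carrier R) \<and>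
    (\<forall>y \<in> dual_rows k. \<forall>y' \<in> dual_rows k. \<forall>r \<in> carrier R. \<phi> (row_comb y r y') = \<phi> y \<oplus> r \<otimes> \<phi> y')}"

definition entry :: "nat \<Rightarrow> 'm \<Rightarrow> (nat \<Rightarrow> 'm \<Rightarrow> 'a) \<Rightarrow> 'a" where
  "entry i x = (\<lambda>y. y i x)"

lemma entry_apply [simp]: "entry i x y = y i x"
  by (simp add: entry_def)

definition evaluations :: "nat \<Rightarrow> ((nat \<Rightarrow> 'm \<Rightarrow> 'a) \<Rightarrow> 'a) list" where
  "evaluations k = concat (map (\<lambda>i. map (entry i) gens) [0..<k])"

lemma set_evaluations: "set (evaluations k) = {entry i x | i x. i < k \<and> x \<in> set gens}"
  unfolding evaluations_def by fastforce

lemma dual_comb: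
  assumes "\<alpha> \<in> dual" "\<beta> \<in> dual" and r: "r \<in> carrier R"
  shows "(\<lambda>x. \<alpha> x \<oplus> r \<otimes> \<beta> x) \<in> dual"
  unfolding dual_def
proof (intro CollectI conjI ballI)
  note \<alpha> = dual_closed[OF assms(1)] dual_add[OF assms(1)] dual_smult[OF assms(1)]
    and \<beta> = dual_closed[OF assms(2)] dual_add[OF assms(2)] dual_smult[OF assms(2)]
  show "\<alpha> x \<oplus> r \<otimes> \<beta> x \<in> carrier R" if "x \<in> carrier M" for x using \<alpha> \<beta> r that by simp
  show "\<alpha> (x \<oplus>\<^bsub>M\<^esub> y) \<oplus> r \<otimes> \<beta> (x \<oplus>\<^bsub>M\<^esub> y) = \<alpha> x \<oplus> r \<otimes> \<beta> x \<oplus> (\<alpha> y \<oplus> r \<otimes> \<beta> y)"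
    if "x \<in> carrier M" "y \<in> carrier M" for x y using \<alpha> \<beta> r that by (simp add: r_distr a_ac)
  show "\<alpha> (a \<odot>\<^bsub>M\<^esub> x) \<oplus> r \<otimes> \<beta> (a \<odot>\<^bsub>M\<^esub> x) = a \<otimes> (\<alpha> x \<oplus> r \<otimes> \<beta> x)"
    if "a \<in> carrier R" "x \<in> carrier M" for a x using \<alpha> \<beta> r that by (simp add: r_distr m_lcomm)
qed

lemma row_comb_dual: "\<lbrakk>y \<in> dual_rows k; y' \<in> dual_rows k; r \<in> carrier R\<rbrakk> \<Longrightarrow> row_comb y r y' \<in> dual_rows k"
  by (simp add: dual_rows_def row_comb_def dual_comb)

lemma row_tensor_free: "\<lbrakk>m \<in> carrier M; y \<in> dual_rows k\<rbrakk> \<Longrightarrow> row_tensor k m y \<in> free_carrier \<Lambda> k"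
  by (auto simp: row_tensor_def free_carrier_def dual_rows_def tensor_closed)

lemma row_tensor_comb:
  assumes m: "m \<in> carrier M" and y: "y \<in> dual_rows k" "y' \<in> dual_rows k" and r: "r \<in> carrier R"
  shows "row_tensor k m (row_comb y r y') = row_tensor k m y \<oplus>\<^bsub>rows \<Lambda>\<^esub> row_tensor k (r \<odot>\<^bsub>M\<^esub> m) y'"
proof -
  have "tensor m (row_comb y r y' i) = tensor m (y i) \<oplus>\<^bsub>\<Lambda>\<^esub> tensor (r \<odot>\<^bsub>M\<^esub> m) (y' i)" if "i < k" for i
  proof (rule End_eqI)
    have d: "y i \<in> dual" "y' i \<in> dual" "row_comb y r y' i \<in> dual"
      using y r that row_comb_dual[OF y r] by (auto simp: dual_rows_def)
    then show "tensor m (row_comb y r y' i) \<in> carrier \<Lambda>"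
      "tensor m (y i) \<oplus>\<^bsub>\<Lambda>\<^esub> tensor (r \<odot>\<^bsub>M\<^esub> m) (y' i) \<in> carrier \<Lambda>"
      using m r by (simp_all add: tensor_closed Mod.smult_closed)
    fix x assume x: "x \<in> carrier M"
    then show "tensor m (row_comb y r y' i) x = (tensor m (y i) \<oplus>\<^bsub>\<Lambda>\<^esub> tensor (r \<odot>\<^bsub>M\<^esub> m) (y' i)) x"
      using m r d dual_closed[OF d(1) x] dual_closed[OF d(2) x]
      by (simp add: tensor_apply End_add_apply row_comb_def Mod.smult_l_distr m_comm flip: Mod.smult_assoc)
  qed
  then show ?thesis by (auto simp: row_tensor_def fun_eq_iff)
qed

lemma zero_dual: "(\<lambda>x. \<zero>) \<in> dual"
  by (simp add: dual_def)

lemma row_tensor_zero: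
  assumes "m \<in> carrier M" "\<And>i x. \<lbrakk>i < k; x \<in> carrier M\<rbrakk> \<Longrightarrow> y i x = \<zero>"
  shows "row_tensor k m y = \<zero>\<^bsub>rows \<Lambda>\<^esub>"
proof -
  have "tensor m (y i) = \<zero>\<^bsub>\<Lambda>\<^esub>" if "i < k" for i
    unfolding tensor_def End_ring_def using assms that by (auto simp: Mod.smult_zero_left)
  then show ?thesis by (auto simp: row_tensor_def)
qed

lemma evaluations_linear: "i < k \<Longrightarrow> x \<in> carrier M \<Longrightarrow> entry i x \<in> linear_functionals k"
  by (auto simp: linear_functionals_def dual_rows_def row_comb_def dual_closed)

lemma set_evaluations_linear: "set (evaluations k) \<subseteq> linear_functionals k"
  using gens(1) by (auto simp: set_evaluations intro: evaluations_linear)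

lemma row_zero_if_evaluations_zero:
  assumes y: "y \<in> dual_rows k" and z: "\<forall>\<phi> \<in> set (evaluations k). \<phi> y = \<zero>" and i: "i < k" and x: "x \<in> carrier M"
  shows "y i x = \<zero>"
proof (rule dual_eq_zero[OF _ _ x])
  show "y i \<in> dual" using y i by (simp add: dual_rows_def)
  show "y i x = \<zero>" if "x \<in> set gens" for x
  proof -
    have "entry i x \<in> set (evaluations k)" using i that unfolding set_evaluations by blast
    from bspec[OF z this] show ?thesis by simp
  qed
qed

definition row_apply :: "('m \<Rightarrow> 'a) \<Rightarrow> (nat \<Rightarrow> 'm \<Rightarrow> 'm) set \<Rightarrow> nat \<Rightarrow> 'm \<Rightarrow> 'a" where
  "row_apply \<alpha> u = (\<lambda>i x. \<alpha> (co u i x))"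

lemma dual_comp: "\<lbrakk>\<alpha> \<in> dual; f \<in> carrier \<Lambda>\<rbrakk> \<Longrightarrow> (\<lambda>x. \<alpha> (f x)) \<in> dual"
  unfolding dual_def
  by (simp add: End_closed End_add End_smult)

lemma row_apply_dual: "\<lbrakk>\<alpha> \<in> dual; u \<in> carrier (rows \<Lambda>)\<rbrakk> \<Longrightarrow> row_apply \<alpha> u \<in> dual_rows k"
  by (simp add: dual_rows_def row_apply_def dual_comp rows_co)

lemma tensor_comp:
  assumes "m \<in> carrier M" "\<alpha> \<in> dual" "f \<in> carrier \<Lambda>"
  shows "tensor m (\<lambda>x. \<alpha> (f x)) = tensor m \<alpha> \<otimes>\<^bsub>\<Lambda>\<^esub> f"
  using assms by (intro End_eqI) (simp_all add: tensor_closed dual_comp tensor_apply End_mult_apply End_closed)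

text \<open>This relates the two constructions: an element \<open>u\<close> of \<open>Z\<close> and a functional \<open>\<alpha>\<close> give the row \<open>\<alpha> u\<close>, which
  lies in the partner of \<open>Z\<close> because \<open>m \<otimes> (\<alpha> u) = (m \<otimes> \<alpha>) u\<close>. In this way a row \<open>y\<close> whose tensors lie in
  an image \<open>F Z\<close> is, after multiplication by a value of the trace pairing, itself an image.\<close>

lemma row_tensor_row_apply:
  assumes "m \<in> carrier M" "\<alpha> \<in> dual" "u \<in> free_carrier \<Lambda> k"
  shows "row_tensor k m (row_apply \<alpha> u) = tensor m \<alpha> \<odot>\<^bsub>rows \<Lambda>\<^esub> u"
proof -
  have u: "u \<in> carrier (rows \<Lambda>)" "\<And>i. i \<ge> k \<Longrightarrow> co u i = \<zero>\<^bsub>\<Lambda>\<^esub>" using assms by (auto simp: mem_free_carrier)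
  have "(if i < k then tensor m (row_apply \<alpha> u i) else \<zero>\<^bsub>\<Lambda>\<^esub>) = tensor m \<alpha> \<otimes>\<^bsub>\<Lambda>\<^esub> co u i" for i
    using assms u rows_co[OF u(1), of i] by (simp add: row_apply_def tensor_comp tensor_closed)
  then show ?thesis by (simp add: row_tensor_def)
qed

lemma row_apply_partner:
  assumes Z: "lsub \<Lambda> (rows \<Lambda>) Z" "Z \<subseteq> free_carrier \<Lambda> k" and \<alpha>: "\<alpha> \<in> dual" and u: "u \<in> Z"
  shows "row_apply \<alpha> u \<in> partner k Z"
  unfolding partner_def
proof (intro CollectI conjI ballI)
  have uf: "u \<in> free_carrier \<Lambda> k" using Z u by blast
  then show "row_apply \<alpha> u \<in> dual_rows k" using \<alpha> by (intro row_apply_dual) (simp_all add: mem_free_carrier)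
  fix m assume m: "m \<in> carrier M"
  show "row_tensor k m (row_apply \<alpha> u) \<in> Z"
    unfolding row_tensor_row_apply[OF m \<alpha> uf] by (rule lsub_smult[OF Z(1) tensor_closed[OF m \<alpha>] u])
qed

text \<open>Right multiplication of a row of functionals by the matrix of \<open>F\<close>.\<close>

definition row_mult :: "nat \<Rightarrow> ((nat \<Rightarrow> 'm \<Rightarrow> 'm) set \<Rightarrow> (nat \<Rightarrow> 'm \<Rightarrow> 'm) set) \<Rightarrow> (nat \<Rightarrow> 'm \<Rightarrow> 'a) \<Rightarrow> nat \<Rightarrow> 'm \<Rightarrow> 'a" where
  "row_mult k F y = (\<lambda>j x. \<Oplus>i\<in>{..<k}. y i (co (F (unit_row \<Lambda> i)) j x))"

context
  fixes k l F
  assumes F: "F \<in> lin_maps \<Lambda> (free \<Lambda> k) (free \<Lambda> l)"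
begin

lemma F_entry: "i < k \<Longrightarrow> co (F (unit_row \<Lambda> i)) j \<in> carrier \<Lambda>"
proof -
  assume "i < k"
  then have "F (unit_row \<Lambda> i) \<in> free_carrier \<Lambda> l"
    using lin_maps_closed[OF F, of "unit_row \<Lambda> i"] \<Lambda>.unit_row_free[of i k] by simp
  then show ?thesis by (simp add: mem_free_carrier rows_co)
qed

lemma F_coord:
  assumes u: "u \<in> free_carrier \<Lambda> k"
  shows "co (F u) j = (\<Oplus>\<^bsub>\<Lambda>\<^esub>i\<in>{..<k}. co u i \<otimes>\<^bsub>\<Lambda>\<^esub> co (F (unit_row \<Lambda> i)) j)"
proof -
  have uc: "co u i \<in> carrier \<Lambda>" for i using u by (simp add: mem_free_carrier rows_co)
  have mem: "co u i \<odot>\<^bsub>rows \<Lambda>\<^esub> F (unit_row \<Lambda> i) \<in> free_carrier \<Lambda> l" if "i < k" for i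
  proof -
    have "F (unit_row \<Lambda> i) \<in> free_carrier \<Lambda> l"
      using lin_maps_closed[OF F, of "unit_row \<Lambda> i"] \<Lambda>.unit_row_free[OF that] by simp
    then show ?thesis by (rule lsub_smult[OF \<Lambda>.lsub_free uc])
  qed
  have "F u = (\<Oplus>\<^bsub>free \<Lambda> l\<^esub>i\<in>{..<k}. co u i \<odot>\<^bsub>rows \<Lambda>\<^esub> F (unit_row \<Lambda> i))"
  proof -
    have "smult (free \<Lambda> l) = smult (rows \<Lambda>)" by simp
    then show ?thesis
      using \<Lambda>.lin_maps_free_eq[OF \<Lambda>.free_module F u] unfolding free_map_def by (simp only:)
  qed
  also have "\<dots> = (\<Oplus>\<^bsub>rows \<Lambda>\<^esub>i\<in>{..<k}. co u i \<odot>\<^bsub>rows \<Lambda>\<^esub> F (unit_row \<Lambda> i))"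
    by (rule \<Lambda>.finsum_restrict[OF \<Lambda>.rows_left_module \<Lambda>.lsub_free finite_lessThan], rule Pi_I, rule mem, erule lessThan_iff[THEN iffD1])
  finally have eq: "F u = (\<Oplus>\<^bsub>rows \<Lambda>\<^esub>i\<in>{..<k}. co u i \<odot>\<^bsub>rows \<Lambda>\<^esub> F (unit_row \<Lambda> i))" .
  have "(\<lambda>i. co u i \<odot>\<^bsub>rows \<Lambda>\<^esub> F (unit_row \<Lambda> i)) \<in> {..<k} \<rightarrow> carrier (rows \<Lambda>)"
    by (rule Pi_I, rule subsetD[OF free_carrier_subset], rule mem, erule lessThan_iff[THEN iffD1])
  from \<Lambda>.co_finsum[OF finite_lessThan this, of j]
  have "co (F u) j = (\<Oplus>\<^bsub>\<Lambda>\<^esub>i\<in>{..<k}. co (co u i \<odot>\<^bsub>rows \<Lambda>\<^esub> F (unit_row \<Lambda> i)) j)"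
    unfolding eq .
  then show ?thesis by (simp only: rows_simps the_elem_eq)
qed

lemma row_mult_dual: "y \<in> dual_rows k \<Longrightarrow> row_mult k F y \<in> dual_rows l"
  unfolding dual_rows_def[of l]
proof (intro CollectI allI impI)
  fix j assume y: "y \<in> dual_rows k"
  have d: "(\<lambda>x. y i (co (F (unit_row \<Lambda> i)) j x)) \<in> dual" if "i < k" for i
  proof (rule dual_comp)
    show "y i \<in> dual" using y that by (simp add: dual_rows_def)
    show "co (F (unit_row \<Lambda> i)) j \<in> carrier \<Lambda>" using F_entry that .
  qed
  show "row_mult k F y j \<in> dual"
    unfolding dual_def row_mult_def
  proof (intro CollectI conjI ballI)
    show "(\<Oplus>i\<in>{..<k}. y i (co (F (unit_row \<Lambda> i)) j x)) \<in> carrier R" if "x \<in> carrier M" for x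
      using dual_closed[OF d that] by (intro finsum_closed) auto
    show "(\<Oplus>i\<in>{..<k}. y i (co (F (unit_row \<Lambda> i)) j (x \<oplus>\<^bsub>M\<^esub> z))) =
        (\<Oplus>i\<in>{..<k}. y i (co (F (unit_row \<Lambda> i)) j x)) \<oplus> (\<Oplus>i\<in>{..<k}. y i (co (F (unit_row \<Lambda> i)) j z))"
      if xz: "x \<in> carrier M" "z \<in> carrier M" for x z
    proof -
      have "(\<Oplus>i\<in>{..<k}. y i (co (F (unit_row \<Lambda> i)) j (x \<oplus>\<^bsub>M\<^esub> z))) =
          (\<Oplus>i\<in>{..<k}. y i (co (F (unit_row \<Lambda> i)) j x) \<oplus> y i (co (F (unit_row \<Lambda> i)) j z))"
        using dual_add[OF d xz] dual_closed[OF d xz(1)] dual_closed[OF d xz(2)] by (intro finsum_cong') auto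
      also have "\<dots> = (\<Oplus>i\<in>{..<k}. y i (co (F (unit_row \<Lambda> i)) j x)) \<oplus> (\<Oplus>i\<in>{..<k}. y i (co (F (unit_row \<Lambda> i)) j z))"
        using dual_closed[OF d xz(1)] dual_closed[OF d xz(2)] by (intro finsum_addf) auto
      finally show ?thesis .
    qed
    show "(\<Oplus>i\<in>{..<k}. y i (co (F (unit_row \<Lambda> i)) j (a \<odot>\<^bsub>M\<^esub> x))) = a \<otimes> (\<Oplus>i\<in>{..<k}. y i (co (F (unit_row \<Lambda> i)) j x))"
      if ax: "a \<in> carrier R" "x \<in> carrier M" for a x
    proof -
      have "a \<otimes> (\<Oplus>i\<in>{..<k}. y i (co (F (unit_row \<Lambda> i)) j x)) = (\<Oplus>i\<in>{..<k}. a \<otimes> y i (co (F (unit_row \<Lambda> i)) j x))"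
        using dual_closed[OF d ax(2)] ax by (intro finsum_rdistr) auto
      also have "\<dots> = (\<Oplus>i\<in>{..<k}. y i (co (F (unit_row \<Lambda> i)) j (a \<odot>\<^bsub>M\<^esub> x)))"
        using dual_smult[OF d ax] dual_closed[OF d ax(2)] ax by (intro finsum_cong') auto
      finally show ?thesis by simp
    qed
  qed
qed

lemma row_mult_linear:
  assumes j: "j < l" and x: "x \<in> carrier M"
  shows "(\<lambda>y. row_mult k F y j x) \<in> linear_functionals k"
  unfolding linear_functionals_def
proof (intro CollectI conjI ballI)
  have d: "y i (co (F (unit_row \<Lambda> i)) j x) \<in> carrier R" if "i < k" "y \<in> dual_rows k" for i y
    using that x End_closed[OF F_entry] by (simp add: dual_rows_def dual_closed)
  show "row_mult k F y j x \<in> carrier R" if "y \<in> dual_rows k" for y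
    unfolding row_mult_def using d that by (intro finsum_closed) auto
  fix y y' r assume y: "y \<in> dual_rows k" "y' \<in> dual_rows k" and r: "r \<in> carrier R"
  have "r \<otimes> row_mult k F y' j x = (\<Oplus>i\<in>{..<k}. r \<otimes> y' i (co (F (unit_row \<Lambda> i)) j x))"
    unfolding row_mult_def using d y r by (intro finsum_rdistr) auto
  then have "row_mult k F y j x \<oplus> r \<otimes> row_mult k F y' j x =
      (\<Oplus>i\<in>{..<k}. y i (co (F (unit_row \<Lambda> i)) j x) \<oplus> r \<otimes> y' i (co (F (unit_row \<Lambda> i)) j x))"
    unfolding row_mult_def using d y r by (subst finsum_addf) auto
  then show "row_mult k F (row_comb y r y') j x = row_mult k F y j x \<oplus> r \<otimes> row_mult k F y' j x"
    by (simp add: row_mult_def row_comb_def)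
qed

lemma row_tensor_row_mult:
  assumes m: "m \<in> carrier M" and y: "y \<in> dual_rows k"
  shows "row_tensor l m (row_mult k F y) = F (row_tensor k m y)"
proof (rule rows_eqI)
  show "row_tensor l m (row_mult k F y) \<in> carrier (rows \<Lambda>)"
    using row_tensor_free[OF m row_mult_dual[OF y]] by (simp add: mem_free_carrier)
  have Ff: "F (row_tensor k m y) \<in> free_carrier \<Lambda> l"
    using lin_maps_closed[OF F, of "row_tensor k m y"] row_tensor_free[OF m y] by simp
  then show "F (row_tensor k m y) \<in> carrier (rows \<Lambda>)" by (simp add: mem_free_carrier)
  fix j
  show "co (row_tensor l m (row_mult k F y)) j = co (F (row_tensor k m y)) j"
  proof (cases "j < l")
    case False
    then show ?thesis using Ff by (simp add: row_tensor_def mem_free_carrier)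
  next
    case True
    have t: "tensor m (y i) \<in> carrier \<Lambda>" if "i < k" for i using m y that by (simp add: dual_rows_def tensor_closed)
    have "tensor m (row_mult k F y j) = co (F (row_tensor k m y)) j"
    proof (rule End_eqI)
      show "tensor m (row_mult k F y j) \<in> carrier \<Lambda>"
        using m row_mult_dual[OF y] True by (simp add: tensor_closed dual_rows_def)
      show "co (F (row_tensor k m y)) j \<in> carrier \<Lambda>" using Ff by (simp add: mem_free_carrier rows_co)
      fix x assume x: "x \<in> carrier M"
      have d: "y i (co (F (unit_row \<Lambda> i)) j x) \<in> carrier R" if "i < k" for i
        using that x y End_closed[OF F_entry] by (simp add: dual_rows_def dual_closed)
      have "co (F (row_tensor k m y)) j = (\<Oplus>\<^bsub>\<Lambda>\<^esub>i\<in>{..<k}. co (row_tensor k m y) i \<otimes>\<^bsub>\<Lambda>\<^esub> co (F (unit_row \<Lambda> i)) j)"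
        by (rule F_coord[OF row_tensor_free[OF m y]])
      also have "\<dots> = (\<Oplus>\<^bsub>\<Lambda>\<^esub>i\<in>{..<k}. tensor m (y i) \<otimes>\<^bsub>\<Lambda>\<^esub> co (F (unit_row \<Lambda> i)) j)"
        using t F_entry by (intro \<Lambda>.finsum_cong') (auto simp: row_tensor_def)
      finally have "co (F (row_tensor k m y)) j x = (\<Oplus>\<^bsub>M\<^esub>i\<in>{..<k}. (tensor m (y i) \<otimes>\<^bsub>\<Lambda>\<^esub> co (F (unit_row \<Lambda> i)) j) x)"
        using t F_entry x by (simp add: End_finsum_apply Pi_def)
      also have "\<dots> = (\<Oplus>\<^bsub>M\<^esub>i\<in>{..<k}. y i (co (F (unit_row \<Lambda> i)) j x) \<odot>\<^bsub>M\<^esub> m)"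
        using d m x End_closed[OF F_entry] by (intro Mod.M.finsum_cong') (auto simp: End_mult_apply tensor_apply Mod.smult_closed)
      also have "\<dots> = row_mult k F y j x \<odot>\<^bsub>M\<^esub> m"
        unfolding row_mult_def using d m by (subst finsum_smult_right) auto
      finally show "tensor m (row_mult k F y j) x = co (F (row_tensor k m y)) j x" using x by (simp add: tensor_apply)
    qed
    then show ?thesis using True by (simp add: row_tensor_def)
  qed
qed

lemma row_apply_image:
  assumes \<alpha>: "\<alpha> \<in> dual" and u: "u \<in> free_carrier \<Lambda> k" and x: "x \<in> carrier M"
  shows "row_apply \<alpha> (F u) j x = row_mult k F (row_apply \<alpha> u) j x"
proof -
  have uc: "co u i \<in> carrier \<Lambda>" for i using u by (simp add: mem_free_carrier rows_co)
  have "co (F u) j x = (\<Oplus>\<^bsub>M\<^esub>i\<in>{..<k}. (co u i \<otimes>\<^bsub>\<Lambda>\<^esub> co (F (unit_row \<Lambda> i)) j) x)"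
    unfolding F_coord[OF u] using uc F_entry x by (intro End_finsum_apply) auto
  also have "\<dots> = (\<Oplus>\<^bsub>M\<^esub>i\<in>{..<k}. co u i (co (F (unit_row \<Lambda> i)) j x))"
    using uc End_closed[OF F_entry x] by (intro Mod.M.finsum_cong') (auto simp: End_mult_apply x End_closed)
  finally have "\<alpha> (co (F u) j x) = (\<Oplus>i\<in>{..<k}. \<alpha> (co u i (co (F (unit_row \<Lambda> i)) j x)))"
    using uc End_closed[OF F_entry x] \<alpha> by (subst dual_finsum[symmetric]) (auto simp: End_closed)
  then show ?thesis by (simp add: row_apply_def row_mult_def)
qed

end

end

locale weighted_module = faithful_fg_module R M + ideal_weight R G w
  for R :: "('a, 'b) ring_scheme" (structure) and M :: "('a, 'm, 'd) module_scheme"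
    and G :: "('g, 'h) monoid_scheme" (structure) and w
begin

definition module_class :: "nat \<Rightarrow> (nat \<Rightarrow> 'm \<Rightarrow> 'm) set set \<Rightarrow> 'g" where
  "module_class k Z = lat (partner k Z) (evaluations k)"

lemma partner_linear:
  assumes Z: "lsub \<Lambda> (rows \<Lambda>) Z"
  shows "linear_on (partner k Z) (linear_functionals k)"
  unfolding linear_on_def
proof (intro conjI ballI)
  have "row_tensor k m (\<lambda>i x. \<zero>\<^bsub>R\<^esub>) \<in> Z" if "m \<in> carrier M" for m
    using row_tensor_zero[OF that, of k "\<lambda>i x. \<zero>\<^bsub>R\<^esub>"] lsub_zero[OF Z] by simp
  then have "(\<lambda>i x. \<zero>\<^bsub>R\<^esub>) \<in> partner k Z" by (simp add: partner_def dual_rows_def zero_dual)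
  then show "partner k Z \<noteq> {}" by blast
  show "\<phi> ` partner k Z \<subseteq> carrier R" if "\<phi> \<in> linear_functionals k" for \<phi>
    using that by (auto simp: linear_functionals_def partner_def)
  fix y y' r assume y: "y \<in> partner k Z" "y' \<in> partner k Z" and r: "r \<in> carrier R"
  then have d: "y \<in> dual_rows k" "y' \<in> dual_rows k" by (auto simp: partner_def)
  have "row_tensor k m (row_comb y r y') \<in> Z" if m: "m \<in> carrier M" for m
    unfolding row_tensor_comb[OF m d r]
    using y m r by (intro lsub_add[OF Z]) (simp_all add: partner_def Mod.smult_closed)
  then have "row_comb y r y' \<in> partner k Z" using row_comb_dual[OF d r] by (simp add: partner_def)
  moreover have "\<forall>\<phi>\<in>linear_functionals k. \<phi> (row_comb y r y') = \<phi> y \<oplus>\<^bsub>R\<^esub> r \<otimes>\<^bsub>R\<^esub> \<phi> y'"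
    using d r by (simp add: linear_functionals_def)
  ultimately show "\<exists>y''\<in>partner k Z. \<forall>\<phi>\<in>linear_functionals k. \<phi> y'' = \<phi> y \<oplus>\<^bsub>R\<^esub> r \<otimes>\<^bsub>R\<^esub> \<phi> y'" by blast
qed

lemma module_class_closed: "lsub \<Lambda> (rows \<Lambda>) Z \<Longrightarrow> module_class k Z \<in> carrier G"
  unfolding module_class_def by (rule lat_closed[OF partner_linear set_evaluations_linear])

text \<open>Additivity. The functor \<open>partner\<close> is left exact; on the right it is exact only up to
  multiplication by values of the trace pairing, which the weight does not see.\<close>

lemma module_class_exact:
  assumes F: "F \<in> lin_maps \<Lambda> (free \<Lambda> k) (free \<Lambda> l)"
    and Z: "lsub \<Lambda> (rows \<Lambda>) Z" "Z \<subseteq> free_carrier \<Lambda> k"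
  shows "module_class k Z = module_class l (F ` Z) \<otimes>\<^bsub>G\<^esub> module_class k {u \<in> Z. F u = \<zero>\<^bsub>rows \<Lambda>\<^esub>}"
proof -
  define \<psi>s where "\<psi>s = map (\<lambda>\<psi> y. \<psi> (row_mult k F y)) (evaluations l)"
  have \<psi>set: "\<exists>j x. j < l \<and> x \<in> set gens \<and> \<psi> = (\<lambda>y. row_mult k F y j x)" if \<psi>: "\<psi> \<in> set \<psi>s" for \<psi>
  proof -
    obtain \<chi> where "\<chi> \<in> set (evaluations l)" "\<psi> = (\<lambda>y. \<chi> (row_mult k F y))" using \<psi> by (auto simp: \<psi>s_def)
    moreover from this(1) obtain j x where "\<chi> = entry j x" "j < l" "x \<in> set gens" unfolding set_evaluations by blast
    ultimately show ?thesis by (intro exI[of _ j] exI[of _ x]) simp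
  qed
  have \<psi>lin: "set \<psi>s \<subseteq> linear_functionals k"
  proof
    fix \<psi> assume "\<psi> \<in> set \<psi>s"
    then obtain j x where "j < l" "x \<in> set gens" "\<psi> = (\<lambda>y. row_mult k F y j x)" using \<psi>set by blast
    then show "\<psi> \<in> linear_functionals k" using gens(1) row_mult_linear[OF F, of j x] by auto
  qed
  have dr: "y \<in> dual_rows k" if "y \<in> partner k Z" for y using that by (simp add: partner_def)
  have "module_class k Z = lat (partner k Z) \<psi>s \<otimes>\<^bsub>G\<^esub>
      lat {y \<in> partner k Z. \<forall>\<psi>\<in>set \<psi>s. \<psi> y = \<zero>\<^bsub>R\<^esub>} (evaluations k)"
    unfolding module_class_def
  proof (rule lat_exact[OF partner_linear[OF Z(1)] set_evaluations_linear \<psi>lin])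
    fix y \<psi> assume y: "y \<in> partner k Z" "\<forall>\<phi>\<in>set (evaluations k). \<phi> y = \<zero>\<^bsub>R\<^esub>" and "\<psi> \<in> set \<psi>s"
    then obtain j x where \<psi>: "\<psi> = (\<lambda>y. row_mult k F y j x)" "j < l" "x \<in> set gens" using \<psi>set by blast
    then have x: "x \<in> carrier M" using gens(1) by blast
    have "y i (co (F (unit_row \<Lambda> i)) j x) = \<zero>\<^bsub>R\<^esub>" if "i < k" for i
      by (rule row_zero_if_evaluations_zero[OF dr[OF y(1)] y(2) that End_closed[OF F_entry[OF F that] x]])
    then have "row_mult k F y j x = (\<Oplus>\<^bsub>R\<^esub>i\<in>{..<k}. \<zero>\<^bsub>R\<^esub>)"
      unfolding row_mult_def by (intro finsum_cong') auto
    then show "\<psi> y = \<zero>\<^bsub>R\<^esub>" by (simp add: \<psi>(1))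
  qed
  also have "{y \<in> partner k Z. \<forall>\<psi>\<in>set \<psi>s. \<psi> y = \<zero>\<^bsub>R\<^esub>} = partner k {u \<in> Z. F u = \<zero>\<^bsub>rows \<Lambda>\<^esub>}"
  proof -
    have "(\<forall>\<psi>\<in>set \<psi>s. \<psi> y = \<zero>\<^bsub>R\<^esub>) \<longleftrightarrow> (\<forall>m \<in> carrier M. F (row_tensor k m y) = \<zero>\<^bsub>rows \<Lambda>\<^esub>)"
      if y: "y \<in> dual_rows k" for y
    proof
      assume *: "\<forall>\<psi>\<in>set \<psi>s. \<psi> y = \<zero>\<^bsub>R\<^esub>"
      have "\<forall>\<phi> \<in> set (evaluations l). \<phi> (row_mult k F y) = \<zero>\<^bsub>R\<^esub>"
      proof
        fix \<phi> assume "\<phi> \<in> set (evaluations l)"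
        then have "(\<lambda>y. \<phi> (row_mult k F y)) \<in> set \<psi>s" unfolding \<psi>s_def set_map by (rule imageI)
        from bspec[OF * this] show "\<phi> (row_mult k F y) = \<zero>\<^bsub>R\<^esub>" .
      qed
      then have "row_mult k F y j x = \<zero>\<^bsub>R\<^esub>" if "j < l" "x \<in> carrier M" for j x
        by (rule row_zero_if_evaluations_zero[OF row_mult_dual[OF F y] _ that])
      then show "\<forall>m \<in> carrier M. F (row_tensor k m y) = \<zero>\<^bsub>rows \<Lambda>\<^esub>"
        using row_tensor_row_mult[OF F _ y, symmetric] row_tensor_zero[of _ l "row_mult k F y"] by simp
    next
      assume *: "\<forall>m \<in> carrier M. F (row_tensor k m y) = \<zero>\<^bsub>rows \<Lambda>\<^esub>"
      have "row_mult k F y j x = \<zero>\<^bsub>R\<^esub>" if jx: "j < l" "x \<in> carrier M" for j x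
      proof (rule faithful_zero)
        have d: "row_mult k F y j \<in> dual" using row_mult_dual[OF F y] jx by (simp add: dual_rows_def)
        show "row_mult k F y j x \<in> carrier R" by (rule dual_closed[OF d jx(2)])
        fix m assume m: "m \<in> carrier M"
        have "row_tensor l m (row_mult k F y) = {\<lambda>_. \<zero>\<^bsub>\<Lambda>\<^esub>}"
          using * m row_tensor_row_mult[OF F m y] by simp
        then have "tensor m (row_mult k F y j) = \<zero>\<^bsub>\<Lambda>\<^esub>"
          using jx(1) by (auto simp: row_tensor_def fun_eq_iff split: if_splits)
        then have "tensor m (row_mult k F y j) x = \<zero>\<^bsub>M\<^esub>" using jx by (simp add: End_zero_apply)
        then show "row_mult k F y j x \<odot>\<^bsub>M\<^esub> m = \<zero>\<^bsub>M\<^esub>" using jx by (simp add: tensor_apply)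
      qed
      note zero = this
      show "\<forall>\<psi>\<in>set \<psi>s. \<psi> y = \<zero>\<^bsub>R\<^esub>"
      proof
        fix \<psi> assume "\<psi> \<in> set \<psi>s"
        then obtain j x where "j < l" "x \<in> set gens" "\<psi> = (\<lambda>y. row_mult k F y j x)" using \<psi>set by blast
        moreover from this(2) have "x \<in> carrier M" using gens(1) by blast
        ultimately show "\<psi> y = \<zero>\<^bsub>R\<^esub>" using zero by simp
      qed
    qed
    note kernel = this
    show ?thesis
    proof (rule Set.set_eqI)
      fix y
      show "y \<in> {y \<in> partner k Z. \<forall>\<psi>\<in>set \<psi>s. \<psi> y = \<zero>\<^bsub>R\<^esub>} \<longleftrightarrow> y \<in> partner k {u \<in> Z. F u = \<zero>\<^bsub>rows \<Lambda>\<^esub>}"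
        unfolding partner_def mem_Collect_eq using kernel[of y] by blast
    qed
  qed
  also have "lat (partner k Z) \<psi>s = lat (row_mult k F ` partner k Z) (evaluations l)"
    unfolding \<psi>s_def by (rule lat_image[symmetric])
  also have "\<dots> = module_class l (F ` Z)"
    unfolding module_class_def
  proof (rule lat_dense[OF dense_trace, where \<Phi> = "{entry j x | j x. j < l \<and> x \<in> carrier M}"])
    show "set (evaluations l) \<subseteq> {entry j x | j x. j < l \<and> x \<in> carrier M}"
      using gens(1) by (auto simp: set_evaluations)
    show "\<forall>y\<in>partner l (F ` Z). \<forall>\<phi>\<in>{entry j x | j x. j < l \<and> x \<in> carrier M}. \<phi> y \<in> carrier R"
      by (auto simp: partner_def dual_rows_def dual_closed)
    show "\<forall>y'\<in>row_mult k F ` partner k Z. \<exists>y\<in>partner l (F ` Z). \<forall>\<phi>\<in>{entry j x | j x. j < l \<and> x \<in> carrier M}. \<phi> y' = \<phi> y"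
    proof
      fix y' assume "y' \<in> row_mult k F ` partner k Z"
      then obtain y where y: "y' = row_mult k F y" "y \<in> partner k Z" by blast
      have "row_tensor l m y' \<in> F ` Z" if "m \<in> carrier M" for m
        unfolding y(1) row_tensor_row_mult[OF F that dr[OF y(2)]] using y(2) that by (simp add: partner_def)
      then have "y' \<in> partner l (F ` Z)" using row_mult_dual[OF F dr[OF y(2)]] by (simp add: partner_def y(1))
      then show "\<exists>y\<in>partner l (F ` Z). \<forall>\<phi>\<in>{entry j x | j x. j < l \<and> x \<in> carrier M}. \<phi> y' = \<phi> y"
        by (intro bexI[of _ y']) simp_all
    qed
    show "\<forall>t\<in>trace_values. \<forall>y\<in>partner l (F ` Z). \<exists>y'\<in>row_mult k F ` partner k Z.
        \<forall>\<phi>\<in>{entry j x | j x. j < l \<and> x \<in> carrier M}. \<phi> y' = t \<otimes>\<^bsub>R\<^esub> \<phi> y"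
    proof (intro ballI)
      fix t y assume "t \<in> trace_values" and y: "y \<in> partner l (F ` Z)"
      then obtain \<alpha> m where t: "t = \<alpha> m" "\<alpha> \<in> dual" "m \<in> carrier M" by (auto simp: trace_values_def)
      obtain u where u: "u \<in> Z" "row_tensor l m y = F u" using y t(3) by (auto simp: partner_def)
      have "row_mult k F (row_apply \<alpha> u) j x = t \<otimes>\<^bsub>R\<^esub> y j x" if jx: "j < l" "x \<in> carrier M" for j x
      proof -
        have yd: "y j x \<in> carrier R" using y jx by (simp add: partner_def dual_rows_def dual_closed)
        have "row_mult k F (row_apply \<alpha> u) j x = \<alpha> (co (row_tensor l m y) j x)"
          using row_apply_image[OF F t(2) _ jx(2), of u j] u Z(2) by (auto simp: row_apply_def)
        also have "\<dots> = \<alpha> (y j x \<odot>\<^bsub>M\<^esub> m)" using jx by (simp add: row_tensor_def tensor_apply)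
        also have "\<dots> = t \<otimes>\<^bsub>R\<^esub> y j x" using t yd by (simp add: dual_smult dual_closed m_comm)
        finally show ?thesis .
      qed
      moreover have "row_apply \<alpha> u \<in> partner k Z" by (rule row_apply_partner[OF Z t(2) u(1)])
      ultimately show "\<exists>y'\<in>row_mult k F ` partner k Z.
          \<forall>\<phi>\<in>{entry j x | j x. j < l \<and> x \<in> carrier M}. \<phi> y' = t \<otimes>\<^bsub>R\<^esub> \<phi> y"
      proof (intro bexI[of _ "row_mult k F (row_apply \<alpha> u)"] ballI)
        fix \<phi> assume "\<phi> \<in> {entry j x | j x. j < l \<and> x \<in> carrier M}"
        then obtain j x where "\<phi> = entry j x" "j < l" "x \<in> carrier M" by blast
        then show "\<phi> (row_mult k F (row_apply \<alpha> u)) = t \<otimes>\<^bsub>R\<^esub> \<phi> y"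
          using \<open>\<And>x j. \<lbrakk>j < l; x \<in> carrier M\<rbrakk> \<Longrightarrow> row_mult k F (row_apply \<alpha> u) j x = t \<otimes>\<^bsub>R\<^esub> y j x\<close> by simp
      qed blast
    qed
  qed
  finally show ?thesis unfolding module_class_def[of k "{u \<in> Z. F u = \<zero>\<^bsub>rows \<Lambda>\<^esub>}"] .
qed


subsection \<open>Left ideals attached to ideals of the base ring\<close>

text \<open>At primes of height one and modulo torsion, an endomorphism with \<open>\<alpha> \<circ> u \<in> I \<alpha>\<^sub>0\<close> for all \<open>\<alpha>\<close> has
  the form \<open>m \<otimes> \<alpha>\<^sub>0\<close> with \<open>m \<in> I M\<close>. So the partner is the copy \<open>I \<alpha>\<^sub>0\<close> of \<open>I\<close>.\<close>

definition ideal_submodule :: "('m \<Rightarrow> 'a) \<Rightarrow> 'a set \<Rightarrow> (nat \<Rightarrow> 'm \<Rightarrow> 'm) set set" where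
  "ideal_submodule \<alpha>0 I = {u \<in> free_carrier \<Lambda> 1. \<forall>\<alpha> \<in> dual. \<exists>a \<in> I. \<forall>x \<in> carrier M. \<alpha> (co u 0 x) = a \<otimes>\<^bsub>R\<^esub> \<alpha>0 x}"

lemma ideal_submodule_lsub:
  assumes \<alpha>0: "\<alpha>0 \<in> dual" and I: "ideal I R"
  shows "lsub \<Lambda> (rows \<Lambda>) (ideal_submodule \<alpha>0 I)"
  unfolding lsub_def
proof (intro conjI ballI)
  interpret I: ideal I R by (rule I)
  have I0: "\<zero>\<^bsub>R\<^esub> \<in> I" by simp
  have Ic: "a \<in> carrier R" if "a \<in> I" for a using I.a_subset that by blast
  have D: "u \<in> free_carrier \<Lambda> 1" "\<And>\<alpha>. \<alpha> \<in> dual \<Longrightarrow> \<exists>a \<in> I. \<forall>x \<in> carrier M. \<alpha> (co u 0 x) = a \<otimes>\<^bsub>R\<^esub> \<alpha>0 x"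
    if "u \<in> ideal_submodule \<alpha>0 I" for u using that unfolding ideal_submodule_def by blast+
  show "ideal_submodule \<alpha>0 I \<subseteq> carrier (rows \<Lambda>)"
    using D(1) free_carrier_subset by blast
  have "\<exists>a \<in> I. \<forall>x \<in> carrier M. \<alpha> (co \<zero>\<^bsub>rows \<Lambda>\<^esub> 0 x) = a \<otimes>\<^bsub>R\<^esub> \<alpha>0 x" if "\<alpha> \<in> dual" for \<alpha>
    using that I0 \<alpha>0 by (intro bexI[of _ "\<zero>\<^bsub>R\<^esub>"]) (simp_all add: End_zero_apply dual_zero dual_closed)
  then show "\<zero>\<^bsub>rows \<Lambda>\<^esub> \<in> ideal_submodule \<alpha>0 I"
    using lsub_zero[OF \<Lambda>.lsub_free, of 1] unfolding ideal_submodule_def by blast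
  fix u assume u: "u \<in> ideal_submodule \<alpha>0 I"
  have uc: "co u 0 \<in> carrier \<Lambda>" using D(1)[OF u] by (simp add: mem_free_carrier rows_co)
  {
    fix f assume f: "f \<in> carrier \<Lambda>"
    have "\<exists>a \<in> I. \<forall>x \<in> carrier M. \<alpha> (co (f \<odot>\<^bsub>rows \<Lambda>\<^esub> u) 0 x) = a \<otimes>\<^bsub>R\<^esub> \<alpha>0 x" if \<alpha>: "\<alpha> \<in> dual" for \<alpha>
    proof -
      obtain a where "a \<in> I" "\<forall>x \<in> carrier M. \<alpha> (f (co u 0 x)) = a \<otimes>\<^bsub>R\<^esub> \<alpha>0 x"
        using D(2)[OF u dual_comp[OF \<alpha> f]] by blast
      then show ?thesis by (intro bexI[of _ a]) (simp_all add: End_mult_apply)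
    qed
    then show "f \<odot>\<^bsub>rows \<Lambda>\<^esub> u \<in> ideal_submodule \<alpha>0 I"
      using lsub_smult[OF \<Lambda>.lsub_free f D(1)[OF u]] unfolding ideal_submodule_def by blast
  }
  fix v assume v: "v \<in> ideal_submodule \<alpha>0 I"
  have vc: "co v 0 \<in> carrier \<Lambda>" using D(1)[OF v] by (simp add: mem_free_carrier rows_co)
  have "\<exists>a \<in> I. \<forall>x \<in> carrier M. \<alpha> (co (u \<oplus>\<^bsub>rows \<Lambda>\<^esub> v) 0 x) = a \<otimes>\<^bsub>R\<^esub> \<alpha>0 x" if \<alpha>: "\<alpha> \<in> dual" for \<alpha>
  proof -
    obtain a b where a: "a \<in> I" "\<forall>x \<in> carrier M. \<alpha> (co u 0 x) = a \<otimes>\<^bsub>R\<^esub> \<alpha>0 x"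
      and b: "b \<in> I" "\<forall>x \<in> carrier M. \<alpha> (co v 0 x) = b \<otimes>\<^bsub>R\<^esub> \<alpha>0 x"
      using D(2)[OF u \<alpha>] D(2)[OF v \<alpha>] by blast
    have "\<alpha> (co (u \<oplus>\<^bsub>rows \<Lambda>\<^esub> v) 0 x) = (a \<oplus>\<^bsub>R\<^esub> b) \<otimes>\<^bsub>R\<^esub> \<alpha>0 x" if x: "x \<in> carrier M" for x
      using a b x Ic[OF a(1)] Ic[OF b(1)] dual_closed[OF \<alpha>0 x] \<open>\<alpha> \<in> dual\<close> End_closed[OF uc x] End_closed[OF vc x]
      by (simp add: End_add_apply dual_add l_distr)
    then show ?thesis using a(1) b(1) by (intro bexI[of _ "a \<oplus>\<^bsub>R\<^esub> b"]) simp_all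
  qed
  then show "u \<oplus>\<^bsub>rows \<Lambda>\<^esub> v \<in> ideal_submodule \<alpha>0 I"
    using lsub_add[OF \<Lambda>.lsub_free D(1)[OF u] D(1)[OF v]] unfolding ideal_submodule_def by blast
qed

lemma module_class_ideal_submodule:
  assumes \<alpha>0: "\<alpha>0 \<in> dual" and x0: "x0 \<in> carrier M" "\<alpha>0 x0 \<noteq> \<zero>\<^bsub>R\<^esub>" and I: "ideal I R"
    and scale: "w ((\<lambda>s. \<alpha>0 x0 \<otimes>\<^bsub>R\<^esub> s) ` I) = w I"
  shows "module_class 1 (ideal_submodule \<alpha>0 I) = w I"
proof -
  interpret I: ideal I R by (rule I)
  have Ic: "a \<in> carrier R" if "a \<in> I" for a using I.a_subset that by blast
  define Y where "Y = {\<lambda>(i::nat) x. a \<otimes>\<^bsub>R\<^esub> \<alpha>0 x | a. a \<in> I}"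
  define \<Phi> where "\<Phi> = {entry 0 x | x. x \<in> carrier M}"
  have ev: "set (evaluations 1) \<subseteq> \<Phi>" using gens(1) unfolding set_evaluations \<Phi>_def by fastforce
  have \<alpha>0c: "\<alpha>0 x \<in> carrier R" if "x \<in> carrier M" for x using \<alpha>0 that by (rule dual_closed)
  have Ydual: "y \<in> dual_rows 1" if y: "y \<in> Y" for y
  proof -
    obtain a where a: "y = (\<lambda>i x. a \<otimes>\<^bsub>R\<^esub> \<alpha>0 x)" "a \<in> I" using y unfolding Y_def by blast
    then have ac: "a \<in> carrier R" using Ic by simp
    have "(\<lambda>x. a \<otimes>\<^bsub>R\<^esub> \<alpha>0 x) \<in> dual"
      using ac \<alpha>0 unfolding dual_def by (simp add: r_distr m_lcomm)
    then show ?thesis by (simp add: dual_rows_def a)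
  qed
  have Ylin: "linear_on Y \<Phi>"
    unfolding linear_on_def
  proof (intro conjI ballI)
    show "Y \<noteq> {}" using I.zero_closed unfolding Y_def by blast
    show "\<phi> ` Y \<subseteq> carrier R" if "\<phi> \<in> \<Phi>" for \<phi>
      using that Ic \<alpha>0c unfolding \<Phi>_def Y_def by auto
    fix y y' r assume "y \<in> Y" "y' \<in> Y" and r: "r \<in> carrier R"
    then obtain a b where ab: "y = (\<lambda>i x. a \<otimes>\<^bsub>R\<^esub> \<alpha>0 x)" "y' = (\<lambda>i x. b \<otimes>\<^bsub>R\<^esub> \<alpha>0 x)" "a \<in> I" "b \<in> I"
      unfolding Y_def by blast
    have "a \<oplus>\<^bsub>R\<^esub> r \<otimes>\<^bsub>R\<^esub> b \<in> I" using ab r by (simp add: I.I_l_closed)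
    then have "(\<lambda>i x. (a \<oplus>\<^bsub>R\<^esub> r \<otimes>\<^bsub>R\<^esub> b) \<otimes>\<^bsub>R\<^esub> \<alpha>0 x) \<in> Y" unfolding Y_def by blast
    moreover have "\<phi> (\<lambda>i x. (a \<oplus>\<^bsub>R\<^esub> r \<otimes>\<^bsub>R\<^esub> b) \<otimes>\<^bsub>R\<^esub> \<alpha>0 x) = \<phi> y \<oplus>\<^bsub>R\<^esub> r \<otimes>\<^bsub>R\<^esub> \<phi> y'" if "\<phi> \<in> \<Phi>" for \<phi>
      using that Ic[OF ab(3)] Ic[OF ab(4)] r \<alpha>0c unfolding \<Phi>_def ab(1,2) by (auto simp: l_distr m_assoc)
    ultimately show "\<exists>y''\<in>Y. \<forall>\<phi>\<in>\<Phi>. \<phi> y'' = \<phi> y \<oplus>\<^bsub>R\<^esub> r \<otimes>\<^bsub>R\<^esub> \<phi> y'" by blast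
  qed
  have "module_class 1 (ideal_submodule \<alpha>0 I) = lat Y (evaluations 1)"
    unfolding module_class_def
  proof (rule lat_dense[OF dense_trace _ _ _ ev, symmetric])
    show "\<forall>y\<in>partner 1 (ideal_submodule \<alpha>0 I). \<forall>\<phi>\<in>\<Phi>. \<phi> y \<in> carrier R"
      unfolding \<Phi>_def by (auto simp: partner_def dual_rows_def dual_closed)
    show "\<forall>y'\<in>Y. \<exists>y\<in>partner 1 (ideal_submodule \<alpha>0 I). \<forall>\<phi>\<in>\<Phi>. \<phi> y' = \<phi> y"
    proof
      fix y assume y: "y \<in> Y"
      then obtain a where a: "y = (\<lambda>i x. a \<otimes>\<^bsub>R\<^esub> \<alpha>0 x)" "a \<in> I" unfolding Y_def by blast
      have "row_tensor 1 m y \<in> ideal_submodule \<alpha>0 I" if m: "m \<in> carrier M" for m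
        unfolding ideal_submodule_def
      proof (intro CollectI conjI ballI)
        show "row_tensor 1 m y \<in> free_carrier \<Lambda> 1" by (rule row_tensor_free[OF m Ydual[OF y]])
        fix \<alpha> assume \<alpha>: "\<alpha> \<in> dual"
        have "\<alpha> (co (row_tensor 1 m y) 0 x) = (a \<otimes>\<^bsub>R\<^esub> \<alpha> m) \<otimes>\<^bsub>R\<^esub> \<alpha>0 x" if x: "x \<in> carrier M" for x
          using a Ic[OF a(2)] \<alpha> m x \<alpha>0c[OF x] dual_closed[OF \<alpha> m]
          by (simp add: row_tensor_def tensor_apply dual_smult m_ac)
        then show "\<exists>a\<in>I. \<forall>x\<in>carrier M. \<alpha> (co (row_tensor 1 m y) 0 x) = a \<otimes>\<^bsub>R\<^esub> \<alpha>0 x"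
          using I.I_r_closed[OF a(2) dual_closed[OF \<alpha> m]] by (intro bexI[of _ "a \<otimes>\<^bsub>R\<^esub> \<alpha> m"]) simp_all
      qed
      then have "y \<in> partner 1 (ideal_submodule \<alpha>0 I)" using Ydual[OF y] by (simp add: partner_def)
      then show "\<exists>z\<in>partner 1 (ideal_submodule \<alpha>0 I). \<forall>\<phi>\<in>\<Phi>. \<phi> y = \<phi> z" by (intro bexI[of _ y]) simp_all
    qed
    show "\<forall>t\<in>trace_values. \<forall>y\<in>partner 1 (ideal_submodule \<alpha>0 I). \<exists>y'\<in>Y. \<forall>\<phi>\<in>\<Phi>. \<phi> y' = t \<otimes>\<^bsub>R\<^esub> \<phi> y"
    proof (intro ballI)
      fix t y assume "t \<in> trace_values" and y: "y \<in> partner 1 (ideal_submodule \<alpha>0 I)"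
      then obtain \<alpha> m where t: "t = \<alpha> m" "\<alpha> \<in> dual" "m \<in> carrier M" by (auto simp: trace_values_def)
      have "row_tensor 1 m y \<in> ideal_submodule \<alpha>0 I" using y t by (simp add: partner_def)
      then obtain a where a: "a \<in> I" "\<forall>x\<in>carrier M. \<alpha> (co (row_tensor 1 m y) 0 x) = a \<otimes>\<^bsub>R\<^esub> \<alpha>0 x"
        using t(2) unfolding ideal_submodule_def by blast
      have yd: "y 0 \<in> dual" using y by (simp add: partner_def dual_rows_def)
      have eq: "a \<otimes>\<^bsub>R\<^esub> \<alpha>0 x = t \<otimes>\<^bsub>R\<^esub> y 0 x" if x: "x \<in> carrier M" for x
      proof -
        have "a \<otimes>\<^bsub>R\<^esub> \<alpha>0 x = \<alpha> (co (row_tensor 1 m y) 0 x)" using a(2) x by simp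
        also have "\<dots> = t \<otimes>\<^bsub>R\<^esub> y 0 x"
          using x t dual_closed[OF yd x] by (simp add: row_tensor_def tensor_apply dual_smult dual_closed m_comm)
        finally show ?thesis .
      qed
      show "\<exists>y'\<in>Y. \<forall>\<phi>\<in>\<Phi>. \<phi> y' = t \<otimes>\<^bsub>R\<^esub> \<phi> y"
      proof (intro bexI[of _ "\<lambda>i x. a \<otimes>\<^bsub>R\<^esub> \<alpha>0 x"] ballI)
        fix \<phi> assume "\<phi> \<in> \<Phi>"
        then obtain x where "\<phi> = entry 0 x" "x \<in> carrier M" unfolding \<Phi>_def by blast
        then show "\<phi> (\<lambda>i x. a \<otimes>\<^bsub>R\<^esub> \<alpha>0 x) = t \<otimes>\<^bsub>R\<^esub> \<phi> y" using eq by simp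
      qed (use a(1) in \<open>auto simp: Y_def\<close>)
    qed
  qed
  also have "lat Y (evaluations 1) = lat Y [entry 0 x0] \<otimes>\<^bsub>G\<^esub> lat {y \<in> Y. \<forall>\<psi>\<in>set [entry 0 x0]. \<psi> y = \<zero>\<^bsub>R\<^esub>} (evaluations 1)"
  proof (rule lat_exact[OF Ylin ev])
    show "set [entry 0 x0] \<subseteq> \<Phi>" using x0 unfolding \<Phi>_def by auto
    fix y \<psi> assume y: "y \<in> Y" "\<forall>\<phi>\<in>set (evaluations 1). \<phi> y = \<zero>\<^bsub>R\<^esub>" and "\<psi> \<in> set [entry 0 x0]"
    then have "\<psi> y = y 0 x0" by simp
    also have "\<dots> = \<zero>\<^bsub>R\<^esub>" by (rule row_zero_if_evaluations_zero[OF Ydual[OF y(1)] y(2) _ x0(1)]) simp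
    finally show "\<psi> y = \<zero>\<^bsub>R\<^esub>" .
  qed
  also have "lat {y \<in> Y. \<forall>\<psi>\<in>set [entry 0 x0]. \<psi> y = \<zero>\<^bsub>R\<^esub>} (evaluations 1) = \<one>\<^bsub>G\<^esub>"
  proof (rule lat_zero)
    have "(\<lambda>i x. \<zero>\<^bsub>R\<^esub> \<otimes>\<^bsub>R\<^esub> \<alpha>0 x) \<in> Y" unfolding Y_def using I.zero_closed by blast
    then have "(\<lambda>i x. \<zero>\<^bsub>R\<^esub> \<otimes>\<^bsub>R\<^esub> \<alpha>0 x) \<in> {y \<in> Y. \<forall>\<psi>\<in>set [entry 0 x0]. \<psi> y = \<zero>\<^bsub>R\<^esub>}"
      using \<alpha>0c[OF x0(1)] by simp
    then show "{y \<in> Y. \<forall>\<psi>\<in>set [entry 0 x0]. \<psi> y = \<zero>\<^bsub>R\<^esub>} \<noteq> {}" by blast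
    fix y \<phi> assume "y \<in> {y \<in> Y. \<forall>\<psi>\<in>set [entry 0 x0]. \<psi> y = \<zero>\<^bsub>R\<^esub>}" and \<phi>: "\<phi> \<in> set (evaluations 1)"
    then obtain a where a: "y = (\<lambda>i x. a \<otimes>\<^bsub>R\<^esub> \<alpha>0 x)" "a \<in> I" "a \<otimes>\<^bsub>R\<^esub> \<alpha>0 x0 = \<zero>\<^bsub>R\<^esub>" unfolding Y_def by auto
    then have "a = \<zero>\<^bsub>R\<^esub>" using x0 \<alpha>0c[OF x0(1)] Ic[OF a(2)] integral by blast
    moreover obtain x where "\<phi> = entry 0 x" "x \<in> carrier M" using \<phi> ev unfolding \<Phi>_def by blast
    ultimately show "\<phi> y = \<zero>\<^bsub>R\<^esub>" using \<alpha>0c by (simp add: a(1))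
  qed
  also have "lat Y [entry 0 x0] \<otimes>\<^bsub>G\<^esub> \<one>\<^bsub>G\<^esub> = w I"
  proof -
    have "entry 0 x0 ` Y = (\<lambda>s. \<alpha>0 x0 \<otimes>\<^bsub>R\<^esub> s) ` I"
    proof -
      have "entry 0 x0 ` Y = (\<lambda>a. a \<otimes>\<^bsub>R\<^esub> \<alpha>0 x0) ` I"
        unfolding Y_def image_def by auto
      also have "\<dots> = (\<lambda>s. \<alpha>0 x0 \<otimes>\<^bsub>R\<^esub> s) ` I"
        using Ic \<alpha>0c[OF x0(1)] by (intro image_cong) (simp_all add: m_comm)
      finally show ?thesis .
    qed
    then show ?thesis using scale w_closed[OF I.a_subset] by simp
  qed
  finally show ?thesis .
qed

end

section \<open>Syzygies of modules of finite projective dimension\<close>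

text \<open>There is an exact sequence \<open>0 \<rightarrow> P\<^sub>n\<^sub>-\<^sub>1 \<rightarrow> \<dots> \<rightarrow> P\<^sub>0 \<rightarrow> K \<rightarrow> 0\<close> with all \<open>P\<^sub>i\<close> projective.\<close>

primrec pd_below :: "('l, 'k) ring_scheme \<Rightarrow> nat \<Rightarrow> ('l, 'x) module \<Rightarrow> bool" where
  "pd_below L 0 K \<longleftrightarrow> carrier K = {\<zero>\<^bsub>K\<^esub>}"
| "pd_below L (Suc n) K \<longleftrightarrow> (\<exists>P \<rho>. projective_module L P \<and> \<rho> \<in> lin_maps L P K \<and>
    \<rho> ` carrier P = carrier K \<and> pd_below L n (P\<lparr>carrier := lin_kernel P K \<rho>\<rparr>))"

lemma pd_below_if_resolution:
  assumes res: "projective_resolution L K P d e" and fin: "\<forall>i > n. carrier (P i) = {\<zero>\<^bsub>P i\<^esub>}"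
  shows "pd_below L (Suc n) K"
proof -
  have proj: "projective_module L (P i)" and d: "d i \<in> lin_maps L (P (Suc i)) (P i)"
    and ex: "d (Suc i) ` carrier (P (Suc (Suc i))) = lin_kernel (P (Suc i)) (P i) (d i)" for i
    using res by (auto simp: projective_resolution_def)
  have mod: "left_module L (P i)" for i using proj[of i] by (simp add: projective_module_def)
  have "pd_below L j ((P i)\<lparr>carrier := d i ` carrier (P (Suc i))\<rparr>)" if "i + j = n" for i j
    using that
  proof (induction j arbitrary: i)
    case 0
    then have "carrier (P (Suc i)) = {\<zero>\<^bsub>P (Suc i)\<^esub>}" using fin by simp
    then show ?case using lin_maps_zero[OF mod mod d[of i]] by simp
  next
    case (Suc j)
    let ?K = "(P i)\<lparr>carrier := d i ` carrier (P (Suc i))\<rparr>"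
    have "lin_kernel (P (Suc i)) ?K (d i) = d (Suc i) ` carrier (P (Suc (Suc i)))"
      unfolding ex by (simp add: lin_kernel_def)
    moreover have "pd_below L j ((P (Suc i))\<lparr>carrier := d (Suc i) ` carrier (P (Suc (Suc i)))\<rparr>)"
      using Suc by simp
    moreover have "d i \<in> lin_maps L (P (Suc i)) ?K" by (rule lin_maps_restrict_cod[OF d]) simp
    ultimately show ?case unfolding pd_below.simps
      by (intro exI[of _ "P (Suc i)"] exI[of _ "d i"]) (simp add: proj)
  qed
  from this[of 0 n] have "pd_below L n ((P 0)\<lparr>carrier := lin_kernel (P 0) K e\<rparr>)"
    using res by (simp add: projective_resolution_def)
  then show ?thesis
    unfolding pd_below.simps using res
    by (intro exI[of _ "P 0"] exI[of _ e] conjI) (simp_all add: projective_resolution_def)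
qed

text \<open>The one place where the global dimension enters. Submodules of free modules have their elements in the
  type over which it is formed.\<close>

lemma pd_below_if_gl_dim:
  fixes K :: "('l, (nat \<Rightarrow> 'l) set) module"
  assumes gl: "gl_dim L < \<infinity>" and K: "left_module L K"
  shows "\<exists>n. pd_below L n K"
proof -
  have "proj_dim L K \<le> gl_dim L" unfolding gl_dim_def using K by (intro SUP_upper) simp
  then have "proj_dim L K < \<infinity>" using gl by (rule le_less_trans)
  then have "{enat n | n. \<exists>P d e. projective_resolution L K P d e \<and> (\<forall>i > n. carrier (P i) = {\<zero>\<^bsub>P i\<^esub>})} \<noteq> {}"
    unfolding proj_dim_def
  proof (intro notI)
    assume less: "Inf {enat n | n. \<exists>P d e. projective_resolution L K P d e \<and> (\<forall>i > n. carrier (P i) = {\<zero>\<^bsub>P i\<^esub>})} < \<infinity>"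
      and empty: "{enat n | n. \<exists>P d e. projective_resolution L K P d e \<and> (\<forall>i > n. carrier (P i) = {\<zero>\<^bsub>P i\<^esub>})} = {}"
    show False using less unfolding empty by (simp add: Inf_enat_def)
  qed
  then obtain n P d e where "projective_resolution L K P d e" "\<forall>i > n. carrier (P i) = {\<zero>\<^bsub>P i\<^esub>}"
    by blast
  from pd_below_if_resolution[OF this] show ?thesis by blast
qed

lemma projective_lift:
  fixes P A B :: "('l, 'x) module"
  assumes "projective_module L P" "left_module L A" "left_module L B" "g \<in> lin_maps L A B"
    "g ` carrier A = carrier B" "f \<in> lin_maps L P B"
  obtains h where "h \<in> lin_maps L P A" "\<And>x. x \<in> carrier P \<Longrightarrow> g (h x) = f x"
proof -
  have "\<exists>h \<in> lin_maps L P A. \<forall>x \<in> carrier P. g (h x) = f x"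
    using assms(1)[unfolded projective_module_def, THEN conjunct2, THEN spec, THEN spec, THEN spec, THEN spec,
      THEN mp, of A B g f] assms(2-) by simp
  then show ?thesis using that by blast
qed

lemma lin_maps_diff:
  assumes A: "left_module L A" and B: "left_module L B" and f: "f \<in> lin_maps L A B" and g: "g \<in> lin_maps L A B"
  shows "(\<lambda>x. f x \<oplus>\<^bsub>B\<^esub> (\<ominus>\<^bsub>L\<^esub> \<one>\<^bsub>L\<^esub>) \<odot>\<^bsub>B\<^esub> g x) \<in> lin_maps L A B"
proof (rule lin_mapsI)
  interpret A: left_module L A by (rule A)
  interpret B: left_module L B by (rule B)
  note cl = lin_maps_closed[OF f] lin_maps_closed[OF g]
  show "f x \<oplus>\<^bsub>B\<^esub> (\<ominus>\<^bsub>L\<^esub> \<one>\<^bsub>L\<^esub>) \<odot>\<^bsub>B\<^esub> g x \<in> carrier B" if "x \<in> carrier A" for x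
    using that cl by (simp add: B.smult_closed)
  show "f (x \<oplus>\<^bsub>A\<^esub> y) \<oplus>\<^bsub>B\<^esub> (\<ominus>\<^bsub>L\<^esub> \<one>\<^bsub>L\<^esub>) \<odot>\<^bsub>B\<^esub> g (x \<oplus>\<^bsub>A\<^esub> y) =
      f x \<oplus>\<^bsub>B\<^esub> (\<ominus>\<^bsub>L\<^esub> \<one>\<^bsub>L\<^esub>) \<odot>\<^bsub>B\<^esub> g x \<oplus>\<^bsub>B\<^esub> (f y \<oplus>\<^bsub>B\<^esub> (\<ominus>\<^bsub>L\<^esub> \<one>\<^bsub>L\<^esub>) \<odot>\<^bsub>B\<^esub> g y)"
    if "x \<in> carrier A" "y \<in> carrier A" for x y
    using that cl lin_maps_add[OF f that] lin_maps_add[OF g that]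
    by (simp add: B.smult_r_distr B.smult_closed B.M.a_ac)
  show "f (a \<odot>\<^bsub>A\<^esub> x) \<oplus>\<^bsub>B\<^esub> (\<ominus>\<^bsub>L\<^esub> \<one>\<^bsub>L\<^esub>) \<odot>\<^bsub>B\<^esub> g (a \<odot>\<^bsub>A\<^esub> x) =
      a \<odot>\<^bsub>B\<^esub> (f x \<oplus>\<^bsub>B\<^esub> (\<ominus>\<^bsub>L\<^esub> \<one>\<^bsub>L\<^esub>) \<odot>\<^bsub>B\<^esub> g x)"
    if "a \<in> carrier L" "x \<in> carrier A" for a x
    using that cl lin_maps_smult[OF f that] lin_maps_smult[OF g that]
    by (simp add: B.smult_r_distr B.smult_closed A.l_minus A.r_minus flip: B.smult_assoc)
qed

context ring
begin

text \<open>Up to isomorphism, the finitely generated projective modules.\<close>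

definition retract :: "nat \<Rightarrow> (nat \<Rightarrow> 'a) set set \<Rightarrow> bool" where
  "retract k P \<longleftrightarrow> lsub R (rows R) P \<and> P \<subseteq> free_carrier R k \<and>
    (\<exists>e \<in> lin_maps R (free R k) (free R k). e ` free_carrier R k \<subseteq> P \<and> (\<forall>x \<in> P. e x = x))"

lemma retract_free: "retract k (free_carrier R k)"
  unfolding retract_def
  by (intro conjI bexI[of _ "\<lambda>x. x"]) (auto intro!: lin_mapsI simp: lsub_free)

text \<open>The homotopy argument behind Schanuel's lemma, as a statement that can be iterated: \<open>Z\<close> and
  \<open>K\<close> are syzygies of the same module in two resolutions, \<open>a\<close> and \<open>b\<close> are comparison maps, and
  \<open>h\<close> is a homotopy from \<open>b a\<close> to the identity.\<close>

definition comparison ::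
  "nat \<Rightarrow> (nat \<Rightarrow> 'a) set set \<Rightarrow> ('a, (nat \<Rightarrow> 'a) set) module \<Rightarrow> bool" where
  "comparison k Z K \<longleftrightarrow> lsub R (rows R) Z \<and> Z \<subseteq> free_carrier R k \<and> left_module R K \<and>
    (\<exists>a \<in> lin_maps R (sub_rows R Z) K. \<exists>b \<in> lin_maps R K (sub_rows R Z). \<exists>h \<in> lin_maps R (free R k) (sub_rows R Z).
      \<forall>z \<in> Z. z = b (a z) \<oplus>\<^bsub>rows R\<^esub> h z)"

text \<open>If \<open>K = 0\<close>, the homotopy retracts the free module onto \<open>Z\<close>.\<close>

lemma comparison_zero:
  assumes c: "comparison k Z K" and K: "carrier K = {\<zero>\<^bsub>K\<^esub>}"
  shows "retract k Z"
proof -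
  from c obtain a b h where Z: "lsub R (rows R) Z" "Z \<subseteq> free_carrier R k" and Km: "left_module R K"
    and a: "a \<in> lin_maps R (sub_rows R Z) K" and b: "b \<in> lin_maps R K (sub_rows R Z)"
    and h: "h \<in> lin_maps R (free R k) (sub_rows R Z)" and eq: "\<forall>z \<in> Z. z = b (a z) \<oplus>\<^bsub>rows R\<^esub> h z"
    unfolding comparison_def by blast
  have hZ: "h x \<in> Z" if "x \<in> free_carrier R k" for x using lin_maps_closed[OF h, of x] that by simp
  have "h z = z" if z: "z \<in> Z" for z
  proof -
    have "a z = \<zero>\<^bsub>K\<^esub>" using lin_maps_closed[OF a, of z] z K by simp
    then have "b (a z) = \<zero>\<^bsub>rows R\<^esub>" using lin_maps_zero[OF Km sub_rows_module[OF Z(1)] b] by simp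
    with bspec[OF eq z] have "z = \<zero>\<^bsub>rows R\<^esub> \<oplus>\<^bsub>rows R\<^esub> h z" by (simp del: rows_simps)
    moreover have "h z \<in> carrier (rows R)" using hZ Z z lsub_subset[OF Z(1)] by blast
    then have "\<zero>\<^bsub>rows R\<^esub> \<oplus>\<^bsub>rows R\<^esub> h z = h z" by (rule rows.M.l_zero)
    ultimately show ?thesis by (simp del: rows_simps)
  qed
  moreover have "h \<in> lin_maps R (free R k) (free R k)"
  proof -
    have "h \<in> lin_maps R (free R k) (rows R)"
      by (rule lin_maps_extend_cod[OF h]) (use Z(2) free_carrier_subset in blast)
    then show ?thesis
      by (rule lin_maps_restrict_cod) (use hZ Z(2) in auto)
  qed
  ultimately show ?thesis unfolding retract_def using Z hZ by (intro conjI bexI[of _ h]) auto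
qed

text \<open>The comparison maps lift through \<open>\<rho>\<close> and \<open>F\<close>, because \<open>P\<close> and the free modules are projective, and the
  lifts restrict to the kernels.\<close>

lemma comparison_step:
  assumes c: "comparison k Z K" and P: "projective_module R P" and \<rho>: "\<rho> \<in> lin_maps R P K"
    and surj: "\<rho> ` carrier P = carrier K"
    and F: "F \<in> lin_maps R (free R k') (free R k)" and FZ: "F ` free_carrier R k' = Z"
  shows "comparison k' {u \<in> free_carrier R k'. F u = \<zero>\<^bsub>rows R\<^esub>} (P\<lparr>carrier := lin_kernel P K \<rho>\<rparr>)"
proof -
  from c obtain a b h where Z: "lsub R (rows R) Z" "Z \<subseteq> free_carrier R k" and Km: "left_module R K"
    and a: "a \<in> lin_maps R (sub_rows R Z) K" and b: "b \<in> lin_maps R K (sub_rows R Z)"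
    and h: "h \<in> lin_maps R (free R k) (sub_rows R Z)" and eq: "\<forall>z \<in> Z. z = b (a z) \<oplus>\<^bsub>rows R\<^esub> h z"
    unfolding comparison_def by blast
  note Zm = sub_rows_module[OF Z(1)] and F'm = free_module[of k'] and Fkm = free_module[of k]
  have Pm: "left_module R P" using P by (simp add: projective_module_def)
  let ?Z' = "{u \<in> free_carrier R k'. F u = \<zero>\<^bsub>rows R\<^esub>}"
  let ?K' = "P\<lparr>carrier := lin_kernel P K \<rho>\<rparr>"
  have FZmem: "F u \<in> Z" if "u \<in> free_carrier R k'" for u using FZ that by blast
  have FinZ: "F \<in> lin_maps R (free R k') (sub_rows R Z)"
    using lin_maps_restrict_cod[OF F, of Z] FZmem by simp
  have Fonto: "F ` carrier (free R k') = carrier (sub_rows R Z)" using FZ by simp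
  have aF: "(\<lambda>u. a (F u)) \<in> lin_maps R (free R k') K" by (rule lin_maps_comp[OF FinZ a])
  obtain a' where a': "a' \<in> lin_maps R (free R k') P" "\<And>u. u \<in> free_carrier R k' \<Longrightarrow> \<rho> (a' u) = a (F u)"
  proof (rule free_lift[OF Km Pm aF \<rho>])
    show "a (F u) \<in> \<rho> ` carrier P" if "u \<in> free_carrier R k'" for u
      unfolding surj using lin_maps_closed[OF aF] that by simp
  qed blast
  have b\<rho>: "(\<lambda>x. b (\<rho> x)) \<in> lin_maps R P (sub_rows R Z)" by (rule lin_maps_comp[OF \<rho> b])
  obtain b' where b': "b' \<in> lin_maps R P (free R k')" "\<And>x. x \<in> carrier P \<Longrightarrow> F (b' x) = b (\<rho> x)"
    by (rule projective_lift[OF P F'm Zm FinZ Fonto b\<rho>]) blast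
  obtain h' where h': "h' \<in> lin_maps R (free R k) (free R k')" "\<And>u. u \<in> free_carrier R k \<Longrightarrow> F (h' u) = h u"
  proof (rule free_lift[OF Zm F'm h FinZ])
    show "h u \<in> F ` carrier (free R k')" if "u \<in> free_carrier R k" for u
      unfolding Fonto using lin_maps_closed[OF h] that by simp
  qed blast
  have h'F: "(\<lambda>u. h' (F u)) \<in> lin_maps R (free R k') (free R k')"
    by (rule lin_maps_comp[OF F h'(1)])
  have b'a': "(\<lambda>u. b' (a' u)) \<in> lin_maps R (free R k') (free R k')"
    by (rule lin_maps_comp[OF a'(1) b'(1)])
  have idl: "(\<lambda>u. u) \<in> lin_maps R (free R k') (free R k')" by (rule lin_mapsI) simp_all
  \<comment> \<open>The new homotopy is \<open>1 - b' a' - h' F\<close>.\<close>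
  define h1 where "h1 = (\<lambda>u. u \<oplus>\<^bsub>free R k'\<^esub> (\<ominus> \<one>) \<odot>\<^bsub>free R k'\<^esub> b' (a' u))"
  have h1: "h1 \<in> lin_maps R (free R k') (free R k')"
    unfolding h1_def by (rule lin_maps_diff[OF F'm F'm idl b'a'])
  define h2 where "h2 = (\<lambda>u. h1 u \<oplus>\<^bsub>free R k'\<^esub> (\<ominus> \<one>) \<odot>\<^bsub>free R k'\<^esub> h' (F u))"
  have h2: "h2 \<in> lin_maps R (free R k') (free R k')"
    unfolding h2_def by (rule lin_maps_diff[OF F'm F'm h1 h'F])
  interpret E: left_module R "free R k'" by (rule F'm)
  have sub: "x \<in> carrier (rows R)" if "x \<in> free_carrier R j" for x j
    using that free_carrier_subset by blast
  have F_h2: "F (h2 u) = \<zero>\<^bsub>rows R\<^esub>" if u: "u \<in> free_carrier R k'" for u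
  proof -
    have cl: "u \<in> carrier (free R k')" "b' (a' u) \<in> carrier (free R k')" "h' (F u) \<in> carrier (free R k')"
        "h1 u \<in> carrier (free R k')"
      using u lin_maps_closed[OF b'a'] lin_maps_closed[OF h'F] lin_maps_closed[OF h1] by simp_all
    have sm: "(\<ominus> \<one>) \<odot>\<^bsub>free R k'\<^esub> x \<in> carrier (free R k')" if "x \<in> carrier (free R k')" for x
      using E.smult_closed[OF _ that, of "\<ominus> \<one>"] by simp
    have Fm: "F (x \<oplus>\<^bsub>free R k'\<^esub> (\<ominus> \<one>) \<odot>\<^bsub>free R k'\<^esub> y) = F x \<oplus>\<^bsub>rows R\<^esub> (\<ominus> \<one>) \<odot>\<^bsub>rows R\<^esub> F y"
      if "x \<in> carrier (free R k')" "y \<in> carrier (free R k')" for x y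
      using lin_maps_add[OF F that(1) sm[OF that(2)]] lin_maps_smult[OF F _ that(2), of "\<ominus> \<one>"]
      by (simp del: rows_simps)
    have a'u: "a' u \<in> carrier P" using lin_maps_closed[OF a'(1), of u] u by simp
    have Fu: "F u \<in> Z" using FZmem u .
    have zF: "b (a (F u)) \<oplus>\<^bsub>rows R\<^esub> h (F u) = F u" using bspec[OF eq Fu] by (rule sym)
    have cl': "b (a (F u)) \<in> carrier (rows R)" "h (F u) \<in> carrier (rows R)" "F u \<in> carrier (rows R)"
      using Fu lin_maps_closed[OF lin_maps_comp[OF a b], of "F u"] lin_maps_closed[OF h, of "F u"] Z lsub_subset[OF Z(1)]
      by auto
    have "F (h2 u) = (F u \<oplus>\<^bsub>rows R\<^esub> (\<ominus> \<one>) \<odot>\<^bsub>rows R\<^esub> F (b' (a' u))) \<oplus>\<^bsub>rows R\<^esub> (\<ominus> \<one>) \<odot>\<^bsub>rows R\<^esub> F (h' (F u))"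
      unfolding h2_def Fm[OF cl(4,3)] unfolding h1_def Fm[OF cl(1,2)] ..
    also have "F (b' (a' u)) = b (a (F u))" using b'(2)[OF a'u] a'(2)[OF u] by simp
    also have "F (h' (F u)) = h (F u)" using h'(2)[of "F u"] Fu Z(2) by blast
    also have "(F u \<oplus>\<^bsub>rows R\<^esub> (\<ominus> \<one>) \<odot>\<^bsub>rows R\<^esub> b (a (F u))) \<oplus>\<^bsub>rows R\<^esub> (\<ominus> \<one>) \<odot>\<^bsub>rows R\<^esub> h (F u) = \<zero>\<^bsub>rows R\<^esub>"
    proof -
      have "b (a (F u)) \<oplus>\<^bsub>rows R\<^esub> h (F u) \<oplus>\<^bsub>rows R\<^esub> \<ominus>\<^bsub>rows R\<^esub> b (a (F u)) \<oplus>\<^bsub>rows R\<^esub> \<ominus>\<^bsub>rows R\<^esub> h (F u) = \<zero>\<^bsub>rows R\<^esub>"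
        using cl'(1,2) by (simp add: rows.M.a_ac rows.M.r_neg rows.M.r_neg1 rows.M.r_neg2 del: rows_simps)
      then show ?thesis unfolding zF rows.smult_minus_one[OF cl'(1)] rows.smult_minus_one[OF cl'(2)] .
    qed
    finally show ?thesis .
  qed
  have Z'sub: "lsub R (rows R) ?Z'"
  proof -
    have "lsub R (free R k') {u \<in> carrier (free R k'). F u = \<zero>\<^bsub>free R k\<^esub>}" by (rule lsub_kernel[OF F'm Fkm F])
    then show ?thesis using free_carrier_subset by (auto simp: lsub_def)
  qed
  have K'sub: "lsub R P (lin_kernel P K \<rho>)" unfolding lin_kernel_def by (rule lsub_kernel[OF Pm Km \<rho>])
  have zF0: "a \<zero>\<^bsub>rows R\<^esub> = \<zero>\<^bsub>K\<^esub>" using lin_maps_zero[OF Zm Km a] by simp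
  have zb0: "b \<zero>\<^bsub>K\<^esub> = \<zero>\<^bsub>rows R\<^esub>" using lin_maps_zero[OF Km Zm b] by simp
  have A: "a' \<in> lin_maps R (sub_rows R ?Z') ?K'"
  proof (rule lin_maps_restrict_cod)
    show "a' \<in> lin_maps R (sub_rows R ?Z') P"
      using lin_maps_restrict_dom[OF a'(1), of ?Z'] by simp
    show "a' u \<in> lin_kernel P K \<rho>" if u: "u \<in> carrier (sub_rows R ?Z')" for u
    proof -
      have "u \<in> free_carrier R k'" "F u = \<zero>\<^bsub>rows R\<^esub>" using u by auto
      then have "\<rho> (a' u) = \<zero>\<^bsub>K\<^esub>" "a' u \<in> carrier P"
        using a'(2)[of u] zF0 lin_maps_closed[OF a'(1), of u] by (auto simp del: rows_simps)
      then show ?thesis by (simp add: lin_kernel_def)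
    qed
  qed
  have B: "b' \<in> lin_maps R ?K' (sub_rows R ?Z')"
  proof -
    have "b' \<in> lin_maps R ?K' (free R k')"
      by (rule lin_maps_restrict_dom[OF b'(1)]) (auto simp: lin_kernel_def)
    moreover have "b' x \<in> ?Z'" if x: "x \<in> carrier ?K'" for x
    proof -
      have "x \<in> carrier P" "\<rho> x = \<zero>\<^bsub>K\<^esub>" using x by (auto simp: lin_kernel_def)
      then have "F (b' x) = \<zero>\<^bsub>rows R\<^esub>" "b' x \<in> free_carrier R k'"
        using b'(2)[of x] zb0 lin_maps_closed[OF b'(1), of x] by (auto simp del: rows_simps)
      then show ?thesis by blast
    qed
    ultimately show ?thesis using lin_maps_restrict_cod[of b' R ?K' "free R k'" ?Z'] by simp
  qed
  have H: "h2 \<in> lin_maps R (free R k') (sub_rows R ?Z')"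
    using lin_maps_restrict_cod[OF h2, of ?Z'] F_h2 lin_maps_closed[OF h2] by simp
  have E: "z = b' (a' z) \<oplus>\<^bsub>rows R\<^esub> h2 z" if z: "z \<in> ?Z'" for z
  proof -
    have zf: "z \<in> free_carrier R k'" "F z = \<zero>\<^bsub>rows R\<^esub>" using z by auto
    have "h' (F z) = \<zero>\<^bsub>rows R\<^esub>" using zf lin_maps_zero[OF Fkm F'm h'(1)] by simp
    then have "h2 z = (z \<oplus>\<^bsub>rows R\<^esub> (\<ominus> \<one>) \<odot>\<^bsub>rows R\<^esub> b' (a' z)) \<oplus>\<^bsub>rows R\<^esub> (\<ominus> \<one>) \<odot>\<^bsub>rows R\<^esub> \<zero>\<^bsub>rows R\<^esub>"
      unfolding h2_def h1_def by (simp del: rows_simps add: rows_simps(1)[symmetric])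
    moreover have cl: "z \<in> carrier (rows R)" "b' (a' z) \<in> carrier (rows R)"
      using zf lin_maps_closed[OF b'a', of z] sub by auto
    ultimately have "h2 z = z \<oplus>\<^bsub>rows R\<^esub> \<ominus>\<^bsub>rows R\<^esub> b' (a' z)"
      using rows.smult_minus_one[OF cl(2)] rows.smult_zero_right[of "\<ominus> \<one>"] by (simp del: rows_simps)
    then show ?thesis using cl by (simp add: rows.M.a_lcomm rows.M.r_neg del: rows_simps)
  qed
  have "left_module R ?K'" by (rule left_module.restrict_left_module[OF Pm K'sub])
  then show ?thesis unfolding comparison_def using Z'sub A B H E by blast
qed

end

context weighted_module
begin

definition projective_classes :: "'g set" where
  "projective_classes = {module_class k P | k P. \<Lambda>.retract k P}"

text \<open>By additivity the class of \<open>Z\<close> is that of a free module divided by that of the next syzygy, which is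
  comparable with a module of smaller projective dimension.\<close>

lemma syzygy_class:
  assumes G: "comm_group G"
    and cover: "\<And>k Z. \<lbrakk>lsub \<Lambda> (rows \<Lambda>) Z; Z \<subseteq> free_carrier \<Lambda> k\<rbrakk> \<Longrightarrow>
      \<exists>k' F. F \<in> lin_maps \<Lambda> (free \<Lambda> k') (free \<Lambda> k) \<and> F ` free_carrier \<Lambda> k' = Z"
  shows "\<lbrakk>pd_below \<Lambda> n K; \<Lambda>.comparison k Z K\<rbrakk> \<Longrightarrow> module_class k Z \<in> generate G projective_classes"
proof (induction n arbitrary: K k Z)
  case 0
  then have "\<Lambda>.retract k Z" using \<Lambda>.comparison_zero by simp
  then show ?case by (intro generate.incl) (auto simp: projective_classes_def)
next
  case (Suc n)
  interpret G: comm_group G by (rule G)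
  obtain P :: "('m \<Rightarrow> 'm, (nat \<Rightarrow> 'm \<Rightarrow> 'm) set) module" and \<rho> where P: "projective_module \<Lambda> P" "\<rho> \<in> lin_maps \<Lambda> P K" "\<rho> ` carrier P = carrier K"
    "pd_below \<Lambda> n (P\<lparr>carrier := lin_kernel P K \<rho>\<rparr>)"
    using Suc.prems(1) by auto
  have Z: "lsub \<Lambda> (rows \<Lambda>) Z" "Z \<subseteq> free_carrier \<Lambda> k" using Suc.prems(2) by (auto simp: \<Lambda>.comparison_def)
  obtain k' F where F: "F \<in> lin_maps \<Lambda> (free \<Lambda> k') (free \<Lambda> k)" "F ` free_carrier \<Lambda> k' = Z"
    using cover[OF Z] by blast
  define Z' where "Z' = {u \<in> free_carrier \<Lambda> k'. F u = \<zero>\<^bsub>rows \<Lambda>\<^esub>}"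
  have c': "\<Lambda>.comparison k' Z' (P\<lparr>carrier := lin_kernel P K \<rho>\<rparr>)"
    unfolding Z'_def by (rule \<Lambda>.comparison_step[OF Suc.prems(2) P(1-3) F])
  have IH: "module_class k' Z' \<in> generate G projective_classes" by (rule Suc.IH[OF P(4) c'])
  have "module_class k' (free_carrier \<Lambda> k') = module_class k Z \<otimes>\<^bsub>G\<^esub> module_class k' Z'"
    using module_class_exact[OF F(1) \<Lambda>.lsub_free] by (simp add: F(2) Z'_def del: rows_simps)
  moreover have cl: "module_class k Z \<in> carrier G" "module_class k' Z' \<in> carrier G"
    using Z c' by (auto simp: \<Lambda>.comparison_def intro!: module_class_closed)
  ultimately have eq: "module_class k Z = module_class k' (free_carrier \<Lambda> k') \<otimes>\<^bsub>G\<^esub> inv\<^bsub>G\<^esub> module_class k' Z'"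
    by (simp add: G.m_assoc)
  have sub: "projective_classes \<subseteq> carrier G"
    by (auto simp: projective_classes_def \<Lambda>.retract_def intro!: module_class_closed)
  have "module_class k' (free_carrier \<Lambda> k') \<in> projective_classes"
    using \<Lambda>.retract_free by (auto simp: projective_classes_def)
  then show ?case unfolding eq
    by (intro generate.eng generate.incl G.generate_m_inv_closed[OF sub IH])
qed

end

section \<open>Finitely generated submodules\<close>

definition fin_gen :: "('l, 'k) ring_scheme \<Rightarrow> ('l, 'x, 'c) module_scheme \<Rightarrow> 'x set \<Rightarrow> bool" where
  "fin_gen L Q N \<longleftrightarrow> (\<exists>S. finite S \<and> S \<subseteq> N \<and> (\<forall>N'. lsub L Q N' \<longrightarrow> S \<subseteq> N' \<longrightarrow> N \<subseteq> N'))"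

lemma fin_genI: "\<lbrakk>finite S; S \<subseteq> N; \<And>N'. \<lbrakk>lsub L Q N'; S \<subseteq> N'\<rbrakk> \<Longrightarrow> N \<subseteq> N'\<rbrakk> \<Longrightarrow> fin_gen L Q N"
  unfolding fin_gen_def by blast

lemma fin_genE:
  assumes "fin_gen L Q N"
  obtains S where "finite S" "S \<subseteq> N" "\<And>N'. \<lbrakk>lsub L Q N'; S \<subseteq> N'\<rbrakk> \<Longrightarrow> N \<subseteq> N'"
  using assms unfolding fin_gen_def by blast

text \<open>Generators of the image, lifted, together with generators of the kernel.\<close>

lemma fin_gen_extension:
  assumes Q: "left_module L Q" and Q': "left_module L Q'" and N: "lsub L Q N"
    and \<phi>: "\<phi> \<in> lin_maps L Q Q'"
    and im: "fin_gen L Q' (\<phi> ` N)" and ker: "fin_gen L Q {x \<in> N. \<phi> x = \<zero>\<^bsub>Q'\<^esub>}"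
  shows "fin_gen L Q N"
proof -
  interpret Q: left_module L Q by (rule Q)
  interpret Q': left_module L Q' by (rule Q')
  obtain S where S: "finite S" "S \<subseteq> \<phi> ` N" "\<And>N'. \<lbrakk>lsub L Q' N'; S \<subseteq> N'\<rbrakk> \<Longrightarrow> \<phi> ` N \<subseteq> N'"
    using im by (rule fin_genE) blast
  obtain S0 where S0: "finite S0" "S0 \<subseteq> {x \<in> N. \<phi> x = \<zero>\<^bsub>Q'\<^esub>}"
    "\<And>N'. \<lbrakk>lsub L Q N'; S0 \<subseteq> N'\<rbrakk> \<Longrightarrow> {x \<in> N. \<phi> x = \<zero>\<^bsub>Q'\<^esub>} \<subseteq> N'"
    using ker by (rule fin_genE) blast
  obtain T where T: "finite T" "T \<subseteq> N" "S = \<phi> ` T" using finite_subset_image[OF S(1,2)] by blast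
  show ?thesis
  proof (rule fin_genI[of "S0 \<union> T"])
    show "finite (S0 \<union> T)" using S0(1) T(1) by simp
    show "S0 \<union> T \<subseteq> N" using S0(2) T(2) by blast
    fix N' assume N': "lsub L Q N'" "S0 \<union> T \<subseteq> N'"
    have i: "lsub L Q (N \<inter> N')" by (rule lsub_Int[OF N N'(1)])
    have "lsub L Q' (\<phi> ` (N \<inter> N'))" by (rule lsub_image[OF Q Q' \<phi> i])
    moreover have "S \<subseteq> \<phi> ` (N \<inter> N')" unfolding T(3) using T(2) N'(2) by blast
    ultimately have le: "\<phi> ` N \<subseteq> \<phi> ` (N \<inter> N')" by (rule S(3))
    have k: "{x \<in> N. \<phi> x = \<zero>\<^bsub>Q'\<^esub>} \<subseteq> N'" by (rule S0(3)) (use N' in auto)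
    show "N \<subseteq> N'"
    proof
      fix z assume z: "z \<in> N"
      then have "\<phi> z \<in> \<phi> ` (N \<inter> N')" using le by blast
      then obtain y where y: "y \<in> N" "y \<in> N'" "\<phi> z = \<phi> y" by blast
      have cl: "z \<in> carrier Q" "y \<in> carrier Q" using z y lsub_subset[OF N] by blast+
      have "\<phi> (z \<ominus>\<^bsub>Q\<^esub> y) = \<zero>\<^bsub>Q'\<^esub>"
        using lin_maps_minus[OF Q Q' \<phi> cl] y(3) lin_maps_closed[OF \<phi> cl(2)] by (simp add: a_minus_def Q'.M.r_neg)
      then have "z \<ominus>\<^bsub>Q\<^esub> y \<in> N'" using k Q.lsub_diff[OF N z y(1)] by blast
      then have "(z \<ominus>\<^bsub>Q\<^esub> y) \<oplus>\<^bsub>Q\<^esub> y \<in> N'" using lsub_add[OF N'(1)] y(2) by blast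
      then show "z \<in> N'" using cl by (simp add: a_minus_def Q.M.a_assoc Q.M.l_neg)
    qed
  qed
qed

lemma fin_gen_jointly_injective:
  assumes Q: "left_module L Q" and Q': "left_module L Q'"
    and noeth: "\<And>N'. lsub L Q' N' \<Longrightarrow> fin_gen L Q' N'"
  shows "\<lbrakk>lsub L Q N; \<And>\<phi>. \<phi> \<in> set \<phi>s \<Longrightarrow> \<phi> \<in> lin_maps L Q Q';
    \<And>x. \<lbrakk>x \<in> N; \<And>\<phi>. \<phi> \<in> set \<phi>s \<Longrightarrow> \<phi> x = \<zero>\<^bsub>Q'\<^esub>\<rbrakk> \<Longrightarrow> x = \<zero>\<^bsub>Q\<^esub>\<rbrakk> \<Longrightarrow> fin_gen L Q N"
proof (induction \<phi>s arbitrary: N)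
  case Nil
  then have "N \<subseteq> {\<zero>\<^bsub>Q\<^esub>}" by auto
  then show ?case using lsub_zero[of L Q] by (intro fin_genI[of "{}"]) blast+
next
  case (Cons \<phi> \<phi>s)
  have \<phi>: "\<phi> \<in> lin_maps L Q Q'" using Cons.prems(2) by simp
  have "{x \<in> N. \<phi> x = \<zero>\<^bsub>Q'\<^esub>} = N \<inter> {x \<in> carrier Q. \<phi> x = \<zero>\<^bsub>Q'\<^esub>}"
    using lsub_subset[OF Cons.prems(1)] by blast
  then have "lsub L Q {x \<in> N. \<phi> x = \<zero>\<^bsub>Q'\<^esub>}"
    using lsub_Int[OF Cons.prems(1) lsub_kernel[OF Q Q' \<phi>]] by simp
  then have "fin_gen L Q {x \<in> N. \<phi> x = \<zero>\<^bsub>Q'\<^esub>}"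
  proof (rule Cons.IH)
    show "\<psi> \<in> lin_maps L Q Q'" if "\<psi> \<in> set \<phi>s" for \<psi> using Cons.prems(2) that by simp
    fix x assume x: "x \<in> {x \<in> N. \<phi> x = \<zero>\<^bsub>Q'\<^esub>}" and z: "\<And>\<psi>. \<psi> \<in> set \<phi>s \<Longrightarrow> \<psi> x = \<zero>\<^bsub>Q'\<^esub>"
    show "x = \<zero>\<^bsub>Q\<^esub>"
    proof (rule Cons.prems(3))
      show "x \<in> N" using x by simp
      show "\<psi> x = \<zero>\<^bsub>Q'\<^esub>" if "\<psi> \<in> set (\<phi> # \<phi>s)" for \<psi> using that x z by auto
    qed
  qed
  then show ?case
    using fin_gen_extension[OF Q Q' Cons.prems(1) \<phi> noeth[OF lsub_image[OF Q Q' \<phi> Cons.prems(1)]]] by blast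
qed

text \<open>Maximal submodules of a finitely generated module, by Zorn's lemma.\<close>

definition max_sub :: "('l, 'k) ring_scheme \<Rightarrow> ('l, 'x, 'c) module_scheme \<Rightarrow> 'x set \<Rightarrow> 'x set \<Rightarrow> bool" where
  "max_sub L Q P N \<longleftrightarrow> lsub L Q N \<and> N \<subseteq> P \<and> N \<noteq> P \<and>
    (\<forall>N'. lsub L Q N' \<longrightarrow> N \<subseteq> N' \<longrightarrow> N' \<subseteq> P \<longrightarrow> N' \<noteq> P \<longrightarrow> N' = N)"

lemma max_sub_exists:
  assumes fg: "fin_gen L Q P" and N: "lsub L Q N" "N \<subseteq> P" "N \<noteq> P"
  shows "\<exists>N'. max_sub L Q P N' \<and> N \<subseteq> N'"
proof -
  obtain S where S: "finite S" "S \<subseteq> P" "\<And>N'. \<lbrakk>lsub L Q N'; S \<subseteq> N'\<rbrakk> \<Longrightarrow> P \<subseteq> N'"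
    using fg by (rule fin_genE) blast
  define A where "A = {N'. lsub L Q N' \<and> N \<subseteq> N' \<and> N' \<subseteq> P \<and> N' \<noteq> P}"
  have "\<exists>N' \<in> A. \<forall>U \<in> A. N' \<subseteq> U \<longrightarrow> U = N'"
  proof (rule subset_Zorn_nonempty)
    show "A \<noteq> {}" using N unfolding A_def by blast
    fix C assume C: "C \<noteq> {}" "subset.chain A C"
    have CA: "lsub L Q U" "N \<subseteq> U" "U \<subseteq> P" "U \<noteq> P" if "U \<in> C" for U
      using C(2) that unfolding subset_chain_def A_def by blast+
    have tot: "U \<subseteq> V \<or> V \<subseteq> U" if "U \<in> C" "V \<in> C" for U V
      using C(2) that unfolding subset_chain_def by blast
    have "lsub L Q (\<Union>C)"
      unfolding lsub_def
    proof (intro conjI ballI)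
      show "\<Union>C \<subseteq> carrier Q"
      proof
        fix x assume "x \<in> \<Union>C"
        then obtain U where "U \<in> C" "x \<in> U" by blast
        then show "x \<in> carrier Q" using lsub_subset[OF CA(1)] by simp
      qed
      obtain U where "U \<in> C" using C(1) by blast
      then show "\<zero>\<^bsub>Q\<^esub> \<in> \<Union>C" using lsub_zero[OF CA(1)] by (intro UnionI)
      show "a \<odot>\<^bsub>Q\<^esub> x \<in> \<Union>C" if a: "a \<in> carrier L" and x: "x \<in> \<Union>C" for a x
      proof -
        obtain U where U: "U \<in> C" "x \<in> U" using x by blast
        then show ?thesis using lsub_smult[OF CA(1)[OF U(1)] a U(2)] by (intro UnionI)
      qed
      fix x y assume "x \<in> \<Union>C" "y \<in> \<Union>C"
      then obtain U V where UV: "U \<in> C" "V \<in> C" "x \<in> U" "y \<in> V" by blast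
      then obtain W where W: "W \<in> C" "x \<in> W" "y \<in> W" using tot[OF UV(1,2)] by blast
      then show "x \<oplus>\<^bsub>Q\<^esub> y \<in> \<Union>C" using lsub_add[OF CA(1)[OF W(1)] W(2,3)] by (intro UnionI)
    qed
    moreover have "\<Union>C \<noteq> P"
    proof
      assume "\<Union>C = P"
      then have "S \<subseteq> \<Union>C" using S(2) by simp
      have "\<exists>U \<in> C. S' \<subseteq> U" if "finite S'" "S' \<subseteq> \<Union>C" for S'
        using that
      proof (induction S' rule: finite_induct)
        case empty then show ?case using C(1) by blast
      next
        case (insert s S')
        then obtain U V where "U \<in> C" "S' \<subseteq> U" "V \<in> C" "s \<in> V" by blast
        then show ?case using tot[of U V] by blast
      qed
      then obtain U where "U \<in> C" "S \<subseteq> U" using S(1) \<open>S \<subseteq> \<Union>C\<close> by blast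
      then show False using S(3)[OF CA(1), of U] CA(3,4)[of U] by simp
    qed
    ultimately show "\<Union>C \<in> A" using CA C(1) unfolding A_def by blast
  qed
  then obtain N' where "N' \<in> A" and mx: "\<forall>U \<in> A. N' \<subseteq> U \<longrightarrow> U = N'" by (elim bexE)
  then have N': "lsub L Q N'" "N \<subseteq> N'" "N' \<subseteq> P" "N' \<noteq> P" unfolding A_def by simp_all
  show ?thesis
    unfolding max_sub_def
  proof (intro exI[of _ N'] conjI allI impI N')
    fix U assume U: "lsub L Q U" "N' \<subseteq> U" "U \<subseteq> P" "U \<noteq> P"
    then have "U \<in> A" using N'(2) unfolding A_def by simp
    then show "U = N'" using mx U(2) by simp
  qed
qed

context faithful_fg_module
begin

lemma idealI_mult:
  assumes J: "J \<subseteq> carrier R" "\<zero> \<in> J" "\<And>a b. \<lbrakk>a \<in> J; b \<in> J\<rbrakk> \<Longrightarrow> a \<oplus> b \<in> J"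
    "\<And>r a. \<lbrakk>r \<in> carrier R; a \<in> J\<rbrakk> \<Longrightarrow> r \<otimes> a \<in> J"
  shows "ideal J R"
proof (rule idealI[OF ring_axioms])
  show "subgroup J (add_monoid R)"
  proof (rule add.subgroupI)
    show "\<ominus> a \<in> J" if a: "a \<in> J" for a
    proof -
      have "\<ominus> \<one> \<otimes> a \<in> J" using J(4) a by simp
      moreover have "a \<in> carrier R" using J(1) a by blast
      ultimately show ?thesis by (simp add: l_minus)
    qed
  qed (use J in auto)
  show "r \<otimes> a \<in> J" "a \<otimes> r \<in> J" if ar: "a \<in> J" "r \<in> carrier R" for a r
  proof -
    have "a \<in> carrier R" using J(1) ar by blast
    then show "r \<otimes> a \<in> J" "a \<otimes> r \<in> J" using J(4)[OF ar(2,1)] m_comm[of a r] ar by simp_all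
  qed
qed

lemma finite_ideal_generators:
  assumes "ideal I R"
  obtains S where "finite S" "S \<subseteq> I" "\<And>J. \<lbrakk>ideal J R; S \<subseteq> J\<rbrakk> \<Longrightarrow> I \<subseteq> J"
proof -
  obtain A where A: "A \<subseteq> carrier R" "finite A" "I = Idl A" using finetely_gen[OF assms] by blast
  show ?thesis
  proof (rule that[OF A(2)])
    show "A \<subseteq> I" unfolding A(3) by (rule genideal_self[OF A(1)])
    show "I \<subseteq> J" if "ideal J R" "A \<subseteq> J" for J unfolding A(3) by (rule genideal_minimal[OF that])
  qed
qed

definition span_list :: "'m list \<Rightarrow> 'm set" where
  "span_list xs = {combs xs c | c. \<forall>i. c i \<in> carrier R}"

lemma lsub_span_list:
  assumes xs: "set xs \<subseteq> carrier M" shows "lsub R M (span_list xs)"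
  unfolding lsub_def
proof (intro conjI ballI)
  show "span_list xs \<subseteq> carrier M" using combs_closed[OF xs] unfolding span_list_def by blast
  have "combs xs (\<lambda>_. \<zero> \<otimes> \<zero>) = \<zero> \<odot>\<^bsub>M\<^esub> combs xs (\<lambda>_. \<zero>)" by (rule combs_smult[OF xs]) simp_all
  then have "combs xs (\<lambda>_. \<zero>) = \<zero>\<^bsub>M\<^esub>" using combs_closed[OF xs, of "\<lambda>_. \<zero>"] by (simp add: Mod.smult_zero_left)
  then have "\<zero>\<^bsub>M\<^esub> = combs xs (\<lambda>_. \<zero>)" "\<forall>i::nat. \<zero> \<in> carrier R" by simp_all
  then show "\<zero>\<^bsub>M\<^esub> \<in> span_list xs" unfolding span_list_def by (intro CollectI exI[of _ "\<lambda>_. \<zero>"]) simp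
  fix x assume "x \<in> span_list xs"
  then obtain c where c: "x = combs xs c" "\<forall>i. c i \<in> carrier R" unfolding span_list_def by blast
  {
    fix a assume a: "a \<in> carrier R"
    have "a \<odot>\<^bsub>M\<^esub> x = combs xs (\<lambda>i. a \<otimes> c i)" unfolding c(1) using a c(2) by (intro combs_smult[OF xs, symmetric]) auto
    then show "a \<odot>\<^bsub>M\<^esub> x \<in> span_list xs" unfolding span_list_def using a c(2) by (intro CollectI exI[of _ "\<lambda>i. a \<otimes> c i"]) simp
  }
  fix y assume "y \<in> span_list xs"
  then obtain d where d: "y = combs xs d" "\<forall>i. d i \<in> carrier R" unfolding span_list_def by blast
  have "x \<oplus>\<^bsub>M\<^esub> y = combs xs (\<lambda>i. c i \<oplus> d i)" unfolding c(1) d(1) using c(2) d(2) by (intro combs_add[OF xs, symmetric]) auto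
  then show "x \<oplus>\<^bsub>M\<^esub> y \<in> span_list xs" unfolding span_list_def using c(2) d(2) by (intro CollectI exI[of _ "\<lambda>i. c i \<oplus> d i"]) simp
qed

text \<open>By induction on the number of generators, where the coefficients of the last one form an ideal of \<open>R\<close>.\<close>

lemma fin_gen_in_span_list:
  "\<lbrakk>set xs \<subseteq> carrier M; lsub R M N; N \<subseteq> span_list xs\<rbrakk> \<Longrightarrow> fin_gen R M N"
proof (induction xs arbitrary: N rule: rev_induct)
  case Nil
  have "span_list [] \<subseteq> {\<zero>\<^bsub>M\<^esub>}" by (auto simp: span_list_def combs_def)
  then show ?case using Nil.prems lsub_zero[of R M] by (intro fin_genI[of "{}"]) blast+
next
  case (snoc x xs)
  note N = snoc.prems(2)
  have xs: "set xs \<subseteq> carrier M" and x: "x \<in> carrier M" using snoc.prems by auto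
  note sp = lsub_span_list[OF xs]
  have Nc: "y \<in> carrier M" if "y \<in> N" for y using lsub_subset[OF N that] .
  define lead where "lead N' = {a \<in> carrier R. \<exists>y \<in> N'. \<exists>s \<in> span_list xs. y = a \<odot>\<^bsub>M\<^esub> x \<oplus>\<^bsub>M\<^esub> s}" for N'
  have lead_sub: "lead N' \<subseteq> carrier R" for N' unfolding lead_def by blast
  have leadI: "a \<in> lead N'" if "a \<in> carrier R" "y \<in> N'" "s \<in> span_list xs" "y = a \<odot>\<^bsub>M\<^esub> x \<oplus>\<^bsub>M\<^esub> s" for a y s N'
    unfolding lead_def using that by (intro CollectI conjI bexI[of _ y] bexI[of _ s])
  have lead_ideal: "ideal (lead N') R" if N': "lsub R M N'" for N'
  proof (rule idealI_mult)
    show "lead N' \<subseteq> carrier R" unfolding lead_def by blast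
    show "\<zero> \<in> lead N'" unfolding lead_def using lsub_zero[OF N'] lsub_zero[OF sp] x
      by (intro CollectI conjI bexI[of _ "\<zero>\<^bsub>M\<^esub>"]) (simp_all add: Mod.smult_zero_left)
    show "r \<otimes> a \<in> lead N'" if r: "r \<in> carrier R" and "a \<in> lead N'" for r a
    proof -
      obtain y s where y: "a \<in> carrier R" "y \<in> N'" "s \<in> span_list xs" "y = a \<odot>\<^bsub>M\<^esub> x \<oplus>\<^bsub>M\<^esub> s"
        using \<open>a \<in> lead N'\<close> unfolding lead_def by blast
      have "r \<odot>\<^bsub>M\<^esub> y = (r \<otimes> a) \<odot>\<^bsub>M\<^esub> x \<oplus>\<^bsub>M\<^esub> r \<odot>\<^bsub>M\<^esub> s"
        using r y x lsub_subset[OF sp y(3)] by (simp add: Mod.smult_r_distr Mod.smult_assoc Mod.smult_closed)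
      then show ?thesis by (rule leadI[OF m_closed[OF r y(1)] lsub_smult[OF N' r y(2)] lsub_smult[OF sp r y(3)]])
    qed
    show "a \<oplus> b \<in> lead N'" if "a \<in> lead N'" "b \<in> lead N'" for a b
    proof -
      obtain y s where y: "a \<in> carrier R" "y \<in> N'" "s \<in> span_list xs" "y = a \<odot>\<^bsub>M\<^esub> x \<oplus>\<^bsub>M\<^esub> s"
        using \<open>a \<in> lead N'\<close> unfolding lead_def by blast
      obtain z t where z: "b \<in> carrier R" "z \<in> N'" "t \<in> span_list xs" "z = b \<odot>\<^bsub>M\<^esub> x \<oplus>\<^bsub>M\<^esub> t"
        using \<open>b \<in> lead N'\<close> unfolding lead_def by blast
      have "y \<oplus>\<^bsub>M\<^esub> z = (a \<oplus> b) \<odot>\<^bsub>M\<^esub> x \<oplus>\<^bsub>M\<^esub> (s \<oplus>\<^bsub>M\<^esub> t)"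
        using y z x lsub_subset[OF sp y(3)] lsub_subset[OF sp z(3)]
        by (simp add: Mod.smult_l_distr Mod.smult_closed Mod.M.a_ac)
      then show ?thesis by (rule leadI[OF add.m_closed[OF y(1) z(1)] lsub_add[OF N' y(2) z(2)] lsub_add[OF sp y(3) z(3)]])
    qed
  qed
  obtain S where S: "finite S" "S \<subseteq> lead N" "\<And>J. \<lbrakk>ideal J R; S \<subseteq> J\<rbrakk> \<Longrightarrow> lead N \<subseteq> J"
    by (rule finite_ideal_generators[OF lead_ideal[OF N]]) blast
  have "\<forall>a \<in> S. \<exists>y \<in> N. \<exists>s \<in> span_list xs. y = a \<odot>\<^bsub>M\<^esub> x \<oplus>\<^bsub>M\<^esub> s" using S(2) unfolding lead_def by blast
  then obtain y where y: "\<forall>a \<in> S. y a \<in> N \<and> (\<exists>s \<in> span_list xs. y a = a \<odot>\<^bsub>M\<^esub> x \<oplus>\<^bsub>M\<^esub> s)" by metis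
  have "fin_gen R M (N \<inter> span_list xs)" by (rule snoc.IH[OF xs lsub_Int[OF N sp]]) simp
  then obtain S0 where S0: "finite S0" "S0 \<subseteq> N \<inter> span_list xs"
    "\<And>N'. \<lbrakk>lsub R M N'; S0 \<subseteq> N'\<rbrakk> \<Longrightarrow> N \<inter> span_list xs \<subseteq> N'" by (rule fin_genE) blast
  show ?case
  proof (rule fin_genI[of "S0 \<union> y ` S"])
    show "finite (S0 \<union> y ` S)" using S0(1) S(1) by simp
    show "S0 \<union> y ` S \<subseteq> N" using S0(2) y by blast
    fix N' assume N': "lsub R M N'" "S0 \<union> y ` S \<subseteq> N'"
    note NN' = lsub_Int[OF N N'(1)]
    have k: "N \<inter> span_list xs \<subseteq> N'" by (rule S0(3)[OF N'(1)]) (use N'(2) in blast)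
    have "S \<subseteq> lead (N \<inter> N')"
    proof
      fix a assume a: "a \<in> S"
      then obtain s where "y a \<in> N" "s \<in> span_list xs" "y a = a \<odot>\<^bsub>M\<^esub> x \<oplus>\<^bsub>M\<^esub> s" using y by blast
      moreover have "a \<in> carrier R" using a S(2) lead_sub by blast
      moreover have "y a \<in> N'" using N'(2) a by blast
      ultimately show "a \<in> lead (N \<inter> N')" by (intro leadI[of a "y a" "N \<inter> N'" s]) simp_all
    qed
    then have le: "lead N \<subseteq> lead (N \<inter> N')"
      by (rule S(3)[OF lead_ideal[OF NN']])
    show "N \<subseteq> N'"
    proof
      fix z assume z: "z \<in> N"
      then have "z \<in> span_list (xs @ [x])" using snoc.prems(3) by blast
      then obtain c where c: "z = combs (xs @ [x]) c" "\<forall>i. c i \<in> carrier R" unfolding span_list_def by blast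
      then have zc: "z = c (length xs) \<odot>\<^bsub>M\<^esub> x \<oplus>\<^bsub>M\<^esub> combs xs c" using combs_snoc[OF xs x, of c] by simp
      have s: "combs xs c \<in> span_list xs" unfolding span_list_def using c(2) by blast
      have "c (length xs) \<in> lead N" by (rule leadI[OF _ z s zc]) (use c(2) in simp)
      then have "c (length xs) \<in> lead (N \<inter> N')" using le by blast
      then obtain u t where u: "u \<in> N" "u \<in> N'" "t \<in> span_list xs" "u = c (length xs) \<odot>\<^bsub>M\<^esub> x \<oplus>\<^bsub>M\<^esub> t"
        unfolding lead_def by blast
      have cl: "c (length xs) \<odot>\<^bsub>M\<^esub> x \<in> carrier M" "t \<in> carrier M" "combs xs c \<in> carrier M" "z \<in> carrier M" "u \<in> carrier M"
        using c(2) x lsub_subset[OF sp u(3)] lsub_subset[OF sp s] Nc[OF z] Nc[OF u(1)] by (auto simp: Mod.smult_closed)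
      have "z = u \<oplus>\<^bsub>M\<^esub> (combs xs c \<ominus>\<^bsub>M\<^esub> t)"
        unfolding zc u(4) using cl by (simp add: a_minus_def Mod.M.a_ac Mod.M.r_neg Mod.M.r_neg1 Mod.M.r_neg2)
      moreover have "combs xs c \<ominus>\<^bsub>M\<^esub> t \<in> carrier M" using cl by simp
      ultimately have "z \<ominus>\<^bsub>M\<^esub> u = combs xs c \<ominus>\<^bsub>M\<^esub> t"
        using cl(5) by (simp add: a_minus_def[of M _ u] Mod.M.a_comm[of u] Mod.M.a_assoc Mod.M.r_neg)
      then have "combs xs c \<ominus>\<^bsub>M\<^esub> t \<in> N" using Mod.lsub_diff[OF N z u(1)] by simp
      then have "combs xs c \<ominus>\<^bsub>M\<^esub> t \<in> N'" using k Mod.lsub_diff[OF sp s u(3)] by blast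
      then show "z \<in> N'" unfolding \<open>z = u \<oplus>\<^bsub>M\<^esub> (combs xs c \<ominus>\<^bsub>M\<^esub> t)\<close> using lsub_add[OF N'(1) u(2)] by blast
    qed
  qed
qed

lemma M_noetherian:
  assumes N: "lsub R M N" shows "fin_gen R M N"
proof -
  have "x \<in> span_list gens" if x: "x \<in> carrier M" for x
  proof (rule gens_span[OF lsub_span_list[OF gens(1)] _ x])
    show "set gens \<subseteq> span_list gens"
    proof
      fix g assume "g \<in> set gens"
      then obtain j where j: "j < length gens" "gens ! j = g" by (metis in_set_conv_nth)
      have n: "gens ! i \<in> carrier M" if "i < length gens" for i using gens(1) that nth_mem by blast
      define c where "c = (\<lambda>i. if j = i then \<one> else \<zero>)"
      have "combs gens c = (\<Oplus>\<^bsub>M\<^esub>i\<in>{..<length gens}. if j = i then gens ! i else \<zero>\<^bsub>M\<^esub>)"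
        unfolding combs_def c_def using n by (intro Mod.M.finsum_cong') (auto simp: Mod.smult_one Mod.smult_zero_left)
      also have "\<dots> = g" using n j by (simp add: Mod.M.finsum_singleton[of j "{..<length gens}" "(!) gens"] Pi_def)
      finally have "g = combs gens c" by simp
      moreover have "\<forall>i. c i \<in> carrier R" by (simp add: c_def)
      ultimately show "g \<in> span_list gens" unfolding span_list_def by blast
    qed
  qed
  then show ?thesis using lsub_subset[OF N] by (intro fin_gen_in_span_list[OF gens(1) N]) blast
qed

text \<open>The rows over \<open>\<Lambda>\<close>, as an \<open>R\<close>-module.\<close>

definition scalar :: "'a \<Rightarrow> 'm \<Rightarrow> 'm" where
  "scalar a = (\<lambda>x \<in> carrier M. a \<odot>\<^bsub>M\<^esub> x)"

definition R_rows :: "('a, (nat \<Rightarrow> 'm \<Rightarrow> 'm) set) module" where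
  "R_rows = \<lparr>carrier = carrier (rows \<Lambda>), monoid.mult = (\<lambda>_ _. {}), monoid.one = {},
    ring.zero = \<zero>\<^bsub>rows \<Lambda>\<^esub>, ring.add = (\<lambda>u v. u \<oplus>\<^bsub>rows \<Lambda>\<^esub> v),
    module.smult = (\<lambda>a u. scalar a \<odot>\<^bsub>rows \<Lambda>\<^esub> u)\<rparr>"

lemma R_rows_simps [simp]:
  "carrier R_rows = carrier (rows \<Lambda>)" "\<zero>\<^bsub>R_rows\<^esub> = \<zero>\<^bsub>rows \<Lambda>\<^esub>"
  "u \<oplus>\<^bsub>R_rows\<^esub> v = u \<oplus>\<^bsub>rows \<Lambda>\<^esub> v" "a \<odot>\<^bsub>R_rows\<^esub> u = scalar a \<odot>\<^bsub>rows \<Lambda>\<^esub> u"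
  by (simp_all add: R_rows_def)

lemma scalar_in_End: "a \<in> carrier R \<Longrightarrow> scalar a \<in> carrier \<Lambda>"
  unfolding scalar_def by (rule scalar_closed)

lemma scalar_apply: "x \<in> carrier M \<Longrightarrow> scalar a x = a \<odot>\<^bsub>M\<^esub> x"
  by (simp add: scalar_def)

lemma scalar_add: "\<lbrakk>a \<in> carrier R; b \<in> carrier R\<rbrakk> \<Longrightarrow> scalar (a \<oplus> b) = scalar a \<oplus>\<^bsub>\<Lambda>\<^esub> scalar b"
  by (rule End_eqI) (simp_all add: scalar_in_End scalar_apply End_add_apply Mod.smult_l_distr)

lemma scalar_mult: "\<lbrakk>a \<in> carrier R; b \<in> carrier R\<rbrakk> \<Longrightarrow> scalar (a \<otimes> b) = scalar a \<otimes>\<^bsub>\<Lambda>\<^esub> scalar b"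
  by (rule End_eqI) (simp_all add: scalar_in_End scalar_apply End_mult_apply Mod.smult_assoc Mod.smult_closed)

lemma scalar_one: "scalar \<one> = \<one>\<^bsub>\<Lambda>\<^esub>"
  by (rule End_eqI) (simp_all add: scalar_in_End scalar_apply End_one_apply Mod.smult_one)

lemma scalar_central: "\<lbrakk>a \<in> carrier R; f \<in> carrier \<Lambda>\<rbrakk> \<Longrightarrow> scalar a \<otimes>\<^bsub>\<Lambda>\<^esub> f = f \<otimes>\<^bsub>\<Lambda>\<^esub> scalar a"
  by (rule End_eqI) (simp_all add: scalar_in_End scalar_apply End_mult_apply End_closed End_smult)

lemma R_rows_module: "left_module R R_rows"
proof -
  have "abelian_group R_rows"
  proof (rule abelian_groupI)
    fix u assume u: "u \<in> carrier R_rows"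
    show "\<exists>v \<in> carrier R_rows. v \<oplus>\<^bsub>R_rows\<^esub> u = \<zero>\<^bsub>R_rows\<^esub>"
      using u by (intro bexI[of _ "\<ominus>\<^bsub>rows \<Lambda>\<^esub> u"]) (simp_all add: \<Lambda>.rows.M.l_neg del: rows_simps)
  qed (simp_all add: \<Lambda>.rows.M.a_ac del: rows_simps)
  then show ?thesis
    unfolding left_module_def left_module_axioms_def
    by (simp add: ring_axioms scalar_in_End scalar_add scalar_mult scalar_one \<Lambda>.rows.smult_closed
        \<Lambda>.rows.smult_l_distr \<Lambda>.rows.smult_r_distr \<Lambda>.rows.smult_assoc \<Lambda>.rows.smult_one del: rows_simps)
qed

lemma lsub_imp_R_lsub: "lsub \<Lambda> (rows \<Lambda>) Z \<Longrightarrow> lsub R R_rows Z"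
  unfolding lsub_def by (simp add: scalar_in_End del: rows_simps)

text \<open>Evaluating the coordinates of a row at generators of \<open>M\<close> embeds the rows of length \<open>k\<close> into a finite
  power of the noetherian module \<open>M\<close>.\<close>

lemma R_lsub_free_fin_gen:
  assumes Z: "lsub R R_rows Z" "Z \<subseteq> free_carrier \<Lambda> k"
  shows "fin_gen R R_rows Z"
proof -
  define \<phi>s :: "((nat \<Rightarrow> 'm \<Rightarrow> 'm) set \<Rightarrow> 'm) list" where "\<phi>s = concat (map (\<lambda>i. map (\<lambda>g u. co u i g) gens) [0..<k])"
  have in_\<phi>s: "(\<lambda>u. co u i g) \<in> set \<phi>s" if "i < k" "g \<in> set gens" for i g
    unfolding \<phi>s_def using that by auto
  have lin: "\<phi> \<in> lin_maps R R_rows M" if \<phi>: "\<phi> \<in> set \<phi>s" for \<phi>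
  proof -
    obtain i g where g: "\<phi> = (\<lambda>u. co u i g)" "g \<in> set gens" using \<phi> unfolding \<phi>s_def by auto
    have gc: "g \<in> carrier M" using g(2) gens(1) by blast
    show ?thesis
    proof (rule lin_mapsI)
      fix u assume "u \<in> carrier R_rows"
      then have u: "co u i \<in> carrier \<Lambda>" by (simp add: rows_co)
      show "\<phi> u \<in> carrier M" unfolding g(1) using End_closed[OF u gc] .
      show "\<phi> (a \<odot>\<^bsub>R_rows\<^esub> u) = a \<odot>\<^bsub>M\<^esub> \<phi> u" if "a \<in> carrier R" for a
        unfolding g(1) using that gc u by (simp add: End_mult_apply scalar_apply End_closed)
      fix v assume "v \<in> carrier R_rows"
      show "\<phi> (u \<oplus>\<^bsub>R_rows\<^esub> v) = \<phi> u \<oplus>\<^bsub>M\<^esub> \<phi> v" unfolding g(1) using gc by (simp add: End_add_apply)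
    qed
  qed
  have inj: "u = \<zero>\<^bsub>R_rows\<^esub>" if u: "u \<in> Z" and z: "\<And>\<phi>. \<phi> \<in> set \<phi>s \<Longrightarrow> \<phi> u = \<zero>\<^bsub>M\<^esub>" for u
  proof -
  have uf: "u \<in> carrier (rows \<Lambda>)" "\<And>i. i \<ge> k \<Longrightarrow> co u i = \<zero>\<^bsub>\<Lambda>\<^esub>"
    using u Z(2) mem_free_carrier[of u \<Lambda> k] by blast+
  have "co u i = \<zero>\<^bsub>\<Lambda>\<^esub>" for i
  proof (cases "i < k")
    case True
    have uc: "co u i \<in> carrier \<Lambda>" using uf(1) by (rule rows_co)
    have "lsub R M {x \<in> carrier M. co u i x = \<zero>\<^bsub>M\<^esub>}"
    proof (rule lsub_kernel[OF Mod.left_module_axioms Mod.left_module_axioms])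
      show "co u i \<in> lin_maps R M M" using uc by (simp add: End_carrier)
    qed
    moreover have "set gens \<subseteq> {x \<in> carrier M. co u i x = \<zero>\<^bsub>M\<^esub>}" using z in_\<phi>s[OF True] gens(1) by auto
    ultimately have "co u i x = \<zero>\<^bsub>M\<^esub>" if "x \<in> carrier M" for x using gens_span that by blast
    then show ?thesis by (intro End_eqI uc End_zero_closed) (simp add: End_zero_apply)
  qed (use uf(2) in simp)
  then have "u = \<zero>\<^bsub>rows \<Lambda>\<^esub>"
    using uf(1) lsub_subset[OF \<Lambda>.rows.lsub_carrier lsub_zero[OF \<Lambda>.rows.lsub_carrier]] by (intro rows_eqI[of u \<Lambda>]) auto
  then show ?thesis by simp
  qed
  show ?thesis
    by (rule fin_gen_jointly_injective[OF R_rows_module Mod.left_module_axioms M_noetherian Z(1) lin inj])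
qed

lemma free_fin_gen:
  assumes Z: "lsub \<Lambda> (rows \<Lambda>) Z" "Z \<subseteq> free_carrier \<Lambda> k"
  shows "fin_gen \<Lambda> (rows \<Lambda>) Z"
proof -
  obtain S where S: "finite S" "S \<subseteq> Z" "\<And>N'. \<lbrakk>lsub R R_rows N'; S \<subseteq> N'\<rbrakk> \<Longrightarrow> Z \<subseteq> N'"
    using R_lsub_free_fin_gen[OF lsub_imp_R_lsub[OF Z(1)] Z(2)] by (rule fin_genE) blast
  show ?thesis
  proof (rule fin_genI[OF S(1,2)])
    fix N' assume "lsub \<Lambda> (rows \<Lambda>) N'" "S \<subseteq> N'"
    then show "Z \<subseteq> N'" by (intro S(3) lsub_imp_R_lsub)
  qed
qed

lemma free_cover:
  assumes Z: "lsub \<Lambda> (rows \<Lambda>) Z" "Z \<subseteq> free_carrier \<Lambda> k"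
  shows "\<exists>k' F. F \<in> lin_maps \<Lambda> (free \<Lambda> k') (free \<Lambda> k) \<and> F ` free_carrier \<Lambda> k' = Z"
proof -
  obtain S where S: "finite S" "S \<subseteq> Z" "\<And>N'. \<lbrakk>lsub \<Lambda> (rows \<Lambda>) N'; S \<subseteq> N'\<rbrakk> \<Longrightarrow> Z \<subseteq> N'"
    using free_fin_gen[OF Z] by (rule fin_genE) blast
  obtain zs where zs: "set zs = S" using finite_list[OF S(1)] by blast
  have zsZ: "zs ! i \<in> Z" if "i < length zs" for i using that zs S(2) nth_mem by blast
  note Zm = \<Lambda>.sub_rows_module[OF Z(1)]
  define F where "F = free_map (sub_rows \<Lambda> Z) (length zs) ((!) zs)"
  have FZ: "F \<in> lin_maps \<Lambda> (free \<Lambda> (length zs)) (sub_rows \<Lambda> Z)"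
    unfolding F_def by (rule lin_maps_restrict_dom[OF \<Lambda>.free_map_linear[OF Zm] free_carrier_subset]) (use zsZ in simp)
  have Frows: "F \<in> lin_maps \<Lambda> (free \<Lambda> (length zs)) (rows \<Lambda>)"
    by (rule lin_maps_extend_cod[OF FZ]) (use Z(2) free_carrier_subset in blast)
  have im: "F u \<in> Z" if "u \<in> free_carrier \<Lambda> (length zs)" for u using lin_maps_closed[OF FZ, of u] that by simp
  have "lsub \<Lambda> (rows \<Lambda>) (F ` carrier (free \<Lambda> (length zs)))"
    by (rule lsub_image[OF \<Lambda>.free_module \<Lambda>.rows_left_module Frows left_module.lsub_carrier[OF \<Lambda>.free_module]])
  then have "lsub \<Lambda> (rows \<Lambda>) (F ` free_carrier \<Lambda> (length zs))" by simp
  moreover have "S \<subseteq> F ` free_carrier \<Lambda> (length zs)"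
  proof
    fix s assume "s \<in> S"
    then obtain j where j: "j < length zs" "zs ! j = s" using zs by (metis in_set_conv_nth)
    have "F (unit_row \<Lambda> j) = zs ! j"
      unfolding F_def by (rule \<Lambda>.free_map_unit[OF Zm _ j(1)]) (use zsZ in simp)
    then show "s \<in> F ` free_carrier \<Lambda> (length zs)" using j \<Lambda>.unit_row_free[OF j(1)] by (metis image_eqI)
  qed
  ultimately have "Z \<subseteq> F ` free_carrier \<Lambda> (length zs)" by (rule S(3))
  then have "F ` free_carrier \<Lambda> (length zs) = Z" using im by blast
  moreover have "F \<in> lin_maps \<Lambda> (free \<Lambda> (length zs)) (free \<Lambda> k)"
    by (rule lin_maps_restrict_cod[OF Frows]) (use im Z(2) in auto)
  ultimately show ?thesis by blast
qed

end

section \<open>Simple quotients\<close>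

lemma (in left_module) lsub_plus:
  assumes N: "lsub L M N" and K: "lsub L M K"
  shows "lsub L M {n \<oplus>\<^bsub>M\<^esub> k | n k. n \<in> N \<and> k \<in> K}"
  unfolding lsub_def
proof (intro conjI ballI)
  note c = lsub_subset[OF N] lsub_subset[OF K]
  show "{n \<oplus>\<^bsub>M\<^esub> k | n k. n \<in> N \<and> k \<in> K} \<subseteq> carrier M" using c by auto
  show "\<zero>\<^bsub>M\<^esub> \<in> {n \<oplus>\<^bsub>M\<^esub> k | n k. n \<in> N \<and> k \<in> K}"
    by (intro CollectI exI[of _ "\<zero>\<^bsub>M\<^esub>"]) (simp add: lsub_zero[OF N] lsub_zero[OF K])
  fix x assume "x \<in> {n \<oplus>\<^bsub>M\<^esub> k | n k. n \<in> N \<and> k \<in> K}"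
  then obtain n k where x: "x = n \<oplus>\<^bsub>M\<^esub> k" "n \<in> N" "k \<in> K" by blast
  show "a \<odot>\<^bsub>M\<^esub> x \<in> {n \<oplus>\<^bsub>M\<^esub> k | n k. n \<in> N \<and> k \<in> K}" if a: "a \<in> carrier L" for a
    using a c x(2,3) lsub_smult[OF N a x(2)] lsub_smult[OF K a x(3)]
    by (intro CollectI exI[of _ "a \<odot>\<^bsub>M\<^esub> n"] exI[of _ "a \<odot>\<^bsub>M\<^esub> k"]) (simp add: x(1) smult_r_distr)
  fix y assume "y \<in> {n \<oplus>\<^bsub>M\<^esub> k | n k. n \<in> N \<and> k \<in> K}"
  then obtain n' k' where y: "y = n' \<oplus>\<^bsub>M\<^esub> k'" "n' \<in> N" "k' \<in> K" by blast
  have "x \<oplus>\<^bsub>M\<^esub> y = (n \<oplus>\<^bsub>M\<^esub> n') \<oplus>\<^bsub>M\<^esub> (k \<oplus>\<^bsub>M\<^esub> k')"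
    unfolding x(1) y(1) using c x(2,3) y(2,3) by (simp add: M.a_ac)
  then show "x \<oplus>\<^bsub>M\<^esub> y \<in> {n \<oplus>\<^bsub>M\<^esub> k | n k. n \<in> N \<and> k \<in> K}"
    using lsub_add[OF N x(2) y(2)] lsub_add[OF K x(3) y(3)] by blast
qed

lemma (in left_module) lsub_cyclic:
  assumes x: "x \<in> carrier M" shows "lsub L M {a \<odot>\<^bsub>M\<^esub> x | a. a \<in> carrier L}"
  unfolding lsub_def
proof (intro conjI ballI)
  show "{a \<odot>\<^bsub>M\<^esub> x | a. a \<in> carrier L} \<subseteq> carrier M" using x smult_closed by auto
  show "\<zero>\<^bsub>M\<^esub> \<in> {a \<odot>\<^bsub>M\<^esub> x | a. a \<in> carrier L}"
    by (intro CollectI exI[of _ "\<zero>\<^bsub>L\<^esub>"]) (simp add: x smult_zero_left)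
  fix y assume "y \<in> {a \<odot>\<^bsub>M\<^esub> x | a. a \<in> carrier L}"
  then obtain a where a: "y = a \<odot>\<^bsub>M\<^esub> x" "a \<in> carrier L" by blast
  show "b \<odot>\<^bsub>M\<^esub> y \<in> {a \<odot>\<^bsub>M\<^esub> x | a. a \<in> carrier L}" if b: "b \<in> carrier L" for b
    by (intro CollectI exI[of _ "b \<otimes>\<^bsub>L\<^esub> a"]) (simp add: a b x smult_assoc)
  fix z assume "z \<in> {a \<odot>\<^bsub>M\<^esub> x | a. a \<in> carrier L}"
  then obtain b where b: "z = b \<odot>\<^bsub>M\<^esub> x" "b \<in> carrier L" by blast
  show "y \<oplus>\<^bsub>M\<^esub> z \<in> {a \<odot>\<^bsub>M\<^esub> x | a. a \<in> carrier L}"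
    by (intro CollectI exI[of _ "a \<oplus>\<^bsub>L\<^esub> b"]) (simp add: a b x smult_l_distr)
qed

lemma (in left_module) max_sub_plus:
  assumes P: "lsub L M P" and N: "max_sub L M P N" and K: "lsub L M K" "K \<subseteq> P" "\<not> K \<subseteq> N" and x: "x \<in> P"
  obtains n k where "n \<in> N" "k \<in> K" "x = n \<oplus>\<^bsub>M\<^esub> k"
proof -
  have N': "lsub L M N" "N \<subseteq> P" "\<And>N'. \<lbrakk>lsub L M N'; N \<subseteq> N'; N' \<subseteq> P; N' \<noteq> P\<rbrakk> \<Longrightarrow> N' = N"
    using N unfolding max_sub_def by simp_all
  define W where "W = {n \<oplus>\<^bsub>M\<^esub> k | n k. n \<in> N \<and> k \<in> K}"
  have W: "lsub L M W" unfolding W_def by (rule lsub_plus[OF N'(1) K(1)])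
  have NW: "N \<subseteq> W"
  proof
    fix n assume n: "n \<in> N"
    then have "n = n \<oplus>\<^bsub>M\<^esub> \<zero>\<^bsub>M\<^esub>" using lsub_subset[OF N'(1)] by simp
    then show "n \<in> W" unfolding W_def using n lsub_zero[OF K(1)] by blast
  qed
  have KW: "K \<subseteq> W"
  proof
    fix k assume k: "k \<in> K"
    then have "k = \<zero>\<^bsub>M\<^esub> \<oplus>\<^bsub>M\<^esub> k" using lsub_subset[OF K(1)] by simp
    then show "k \<in> W" unfolding W_def using k lsub_zero[OF N'(1)] by blast
  qed
  have WP: "W \<subseteq> P" unfolding W_def using lsub_add[OF P] N'(2) K(2) by blast
  have "W = P"
  proof (rule ccontr)
    assume "W \<noteq> P"
    then have "W = N" by (rule N'(3)[OF W NW WP])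
    then show False using KW K(3) by simp
  qed
  then have "x \<in> W" using x by simp
  then show ?thesis using that unfolding W_def by blast
qed

lemma max_sub_lsub: "max_sub L Q P N \<Longrightarrow> lsub L Q N" and max_sub_subset: "max_sub L Q P N \<Longrightarrow> N \<subseteq> P"
  and max_sub_proper: "max_sub L Q P N \<Longrightarrow> N \<noteq> P"
  and max_sub_max: "\<lbrakk>max_sub L Q P N; lsub L Q N'; N \<subseteq> N'; N' \<subseteq> P; N' \<noteq> P\<rbrakk> \<Longrightarrow> N' = N"
  by (simp_all add: max_sub_def)

definition lspan :: "('l, 'k) ring_scheme \<Rightarrow> ('l, 'x, 'c) module_scheme \<Rightarrow> 'x set \<Rightarrow> 'x set" where
  "lspan L Q T = \<Inter>{N. lsub L Q N \<and> T \<subseteq> N}"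

lemma lspan_least: "\<lbrakk>lsub L Q N; T \<subseteq> N\<rbrakk> \<Longrightarrow> lspan L Q T \<subseteq> N"
  unfolding lspan_def by blast

lemma lspan_superset: "T \<subseteq> lspan L Q T"
  unfolding lspan_def by blast

lemma lspanI: "(\<And>N. \<lbrakk>lsub L Q N; T \<subseteq> N\<rbrakk> \<Longrightarrow> x \<in> N) \<Longrightarrow> x \<in> lspan L Q T"
  unfolding lspan_def by (intro InterI) (elim CollectE conjE)

lemma lspanD: "\<lbrakk>x \<in> lspan L Q T; lsub L Q N; T \<subseteq> N\<rbrakk> \<Longrightarrow> x \<in> N"
  using lspan_least by (rule subsetD)

lemma lspan_mono: "T \<subseteq> T' \<Longrightarrow> lspan L Q T \<subseteq> lspan L Q T'"
  unfolding lspan_def by blast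

lemma (in left_module) lspan_lsub: "T \<subseteq> carrier M \<Longrightarrow> lsub L M (lspan L M T)"
  unfolding lsub_def[of L M "lspan L M T"]
proof (intro conjI ballI)
  assume T: "T \<subseteq> carrier M"
  show "lspan L M T \<subseteq> carrier M" by (rule lspan_least[OF lsub_carrier T])
  show "\<zero>\<^bsub>M\<^esub> \<in> lspan L M T" by (rule lspanI) (rule lsub_zero)
  show "x \<oplus>\<^bsub>M\<^esub> y \<in> lspan L M T" if "x \<in> lspan L M T" "y \<in> lspan L M T" for x y
    by (rule lspanI) (rule lsub_add, assumption, (rule lspanD[OF that(1)] lspanD[OF that(2)], assumption+)+)
  show "a \<odot>\<^bsub>M\<^esub> x \<in> lspan L M T" if "a \<in> carrier L" "x \<in> lspan L M T" for a x
    by (rule lspanI) (rule lsub_smult[OF _ that(1)], assumption, rule lspanD[OF that(2)], assumption+)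
qed

lemma (in left_module) sequence_in_span_of_predecessors:
  fixes p :: "nat \<Rightarrow> 'x"
  assumes p: "\<And>i. p i \<in> carrier M" and fg: "fin_gen L M (lspan L M (range p))"
  shows "\<exists>n. p n \<in> lspan L M (p ` {..<n})"
proof -
  define V where "V n = lspan L M (p ` {..<n})" for n
  have V: "lsub L M (V n)" for n unfolding V_def using p by (intro lspan_lsub) blast
  have mono: "V i \<subseteq> V j" if "i \<le> j" for i j unfolding V_def using that by (intro lspan_mono) auto
  have U: "lsub L M (\<Union>n. V n)"
    unfolding lsub_def
  proof (intro conjI ballI)
    show "(\<Union>n. V n) \<subseteq> carrier M" using lsub_subset[OF V] by blast
    show "\<zero>\<^bsub>M\<^esub> \<in> (\<Union>n. V n)" using lsub_zero[OF V] by blast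
    show "a \<odot>\<^bsub>M\<^esub> x \<in> (\<Union>n. V n)" if "a \<in> carrier L" "x \<in> (\<Union>n. V n)" for a x
      using that lsub_smult[OF V] by blast
    fix x y assume "x \<in> (\<Union>n. V n)" "y \<in> (\<Union>n. V n)"
    then obtain i j where "x \<in> V i" "y \<in> V j" by blast
    then have "x \<in> V (max i j)" "y \<in> V (max i j)" using mono[of i "max i j"] mono[of j "max i j"] by auto
    then have "x \<oplus>\<^bsub>M\<^esub> y \<in> V (max i j)" by (rule lsub_add[OF V])
    then show "x \<oplus>\<^bsub>M\<^esub> y \<in> (\<Union>n. V n)" by blast
  qed
  have pV: "p i \<in> V (Suc i)" for i unfolding V_def using lspan_superset[of "p ` {..<Suc i}" L M] by blast
  have AU: "lspan L M (range p) \<subseteq> (\<Union>n. V n)" by (rule lspan_least[OF U]) (use pV in blast)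
  obtain S where S: "finite S" "S \<subseteq> lspan L M (range p)" "\<And>N'. \<lbrakk>lsub L M N'; S \<subseteq> N'\<rbrakk> \<Longrightarrow> lspan L M (range p) \<subseteq> N'"
    using fg by (rule fin_genE) blast
  have "\<exists>n. S' \<subseteq> V n" if "finite S'" "S' \<subseteq> (\<Union>n. V n)" for S'
    using that
  proof (induction S' rule: finite_induct)
    case (insert s S')
    then obtain i j where "S' \<subseteq> V i" "s \<in> V j" by blast
    then have "insert s S' \<subseteq> V (max i j)" using mono[of i "max i j"] mono[of j "max i j"] by auto
    then show ?case by blast
  qed simp
  moreover have "S \<subseteq> (\<Union>n. V n)" using S(2) AU by (rule subset_trans)
  ultimately obtain n where "S \<subseteq> V n" using S(1) by blast
  then have "lspan L M (range p) \<subseteq> V n" by (rule S(3)[OF V])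
  moreover have "p n \<in> lspan L M (range p)" using lspan_superset[of "range p" L M] by blast
  ultimately show ?thesis unfolding V_def by blast
qed

declare rows_simps [simp del]

context faithful_fg_module
begin

abbreviation "E \<equiv> rows \<Lambda>"

abbreviation max_in :: "(nat \<Rightarrow> 'm \<Rightarrow> 'm) set set \<Rightarrow> (nat \<Rightarrow> 'm \<Rightarrow> 'm) set set \<Rightarrow> bool" where
  "max_in \<equiv> max_sub \<Lambda> E"

text \<open>Nakayama's lemma in the form needed here: a simple quotient of \<open>P\<close> is killed by a maximal
  ideal of \<open>R\<close>, because over \<open>R\<close> it has a simple quotient.\<close>

lemma max_in_residue:
  assumes P: "lsub \<Lambda> E P" "P \<subseteq> free_carrier \<Lambda> k" and N: "max_in P N"
  obtains \<mm> where "maximalideal \<mm> R" "\<And>a x. \<lbrakk>a \<in> \<mm>; x \<in> P\<rbrakk> \<Longrightarrow> scalar a \<odot>\<^bsub>E\<^esub> x \<in> N"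
proof -
  interpret RR: left_module R R_rows by (rule R_rows_module)
  note Nl = max_sub_lsub[OF N]
  have PR: "lsub R R_rows P" by (rule lsub_imp_R_lsub[OF P(1)])
  obtain N'' where N'': "max_sub R R_rows P N''" "N \<subseteq> N''"
    using max_sub_exists[OF R_lsub_free_fin_gen[OF PR P(2)] lsub_imp_R_lsub[OF Nl] max_sub_subset[OF N] max_sub_proper[OF N]]
    by blast
  note Nr = max_sub_lsub[OF N''(1)]
  obtain x where x: "x \<in> P" "x \<notin> N''" using max_sub_subset[OF N''(1)] max_sub_proper[OF N''(1)] by blast
  have xE: "x \<in> carrier E" by (rule lsub_subset[OF P(1) x(1)])
  define \<mm> where "\<mm> = {a \<in> carrier R. scalar a \<odot>\<^bsub>E\<^esub> x \<in> N''}"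
  have decomp: "\<exists>n r. n \<in> N'' \<and> r \<in> carrier R \<and> y = n \<oplus>\<^bsub>E\<^esub> scalar r \<odot>\<^bsub>E\<^esub> z"
    if y: "y \<in> P" and z: "z \<in> P" "z \<notin> N''" for y z
  proof -
    have zE: "z \<in> carrier R_rows" using lsub_subset[OF PR z(1)] .
    have c: "lsub R R_rows {r \<odot>\<^bsub>R_rows\<^esub> z | r. r \<in> carrier R}" by (rule RR.lsub_cyclic[OF zE])
    have cP: "{r \<odot>\<^bsub>R_rows\<^esub> z | r. r \<in> carrier R} \<subseteq> P" using lsub_smult[OF PR _ z(1)] by blast
    have "z = \<one> \<odot>\<^bsub>R_rows\<^esub> z" using RR.smult_one[OF zE] by simp
    then have cN: "\<not> {r \<odot>\<^bsub>R_rows\<^esub> z | r. r \<in> carrier R} \<subseteq> N''" using z(2) one_closed by blast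
    show ?thesis by (rule RR.max_sub_plus[OF PR N''(1) c cP cN y]) auto
  qed
  have id: "ideal \<mm> R"
  proof (rule idealI_mult)
    show "\<mm> \<subseteq> carrier R" unfolding \<mm>_def by blast
    have "scalar \<zero> \<odot>\<^bsub>E\<^esub> x = \<zero>\<^bsub>E\<^esub>" using RR.smult_zero_left[of x] xE by simp
    then show "\<zero> \<in> \<mm>" unfolding \<mm>_def using lsub_zero[OF Nr] by simp
    show "a \<oplus> b \<in> \<mm>" if "a \<in> \<mm>" "b \<in> \<mm>" for a b
      using that RR.smult_l_distr[of a b x] xE lsub_add[OF Nr, of "scalar a \<odot>\<^bsub>E\<^esub> x" "scalar b \<odot>\<^bsub>E\<^esub> x"]
      unfolding \<mm>_def by simp
    show "r \<otimes> a \<in> \<mm>" if "r \<in> carrier R" "a \<in> \<mm>" for r a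
      using that RR.smult_assoc[of r a x] xE lsub_smult[OF Nr, of r "scalar a \<odot>\<^bsub>E\<^esub> x"]
      unfolding \<mm>_def by simp
  qed
  have one: "\<one> \<notin> \<mm>" unfolding \<mm>_def using x(2) RR.smult_one[of x] xE by simp
  have "maximalideal \<mm> R"
  proof (rule maximalidealI[OF id])
    show "carrier R \<noteq> \<mm>" using one by blast
    fix J assume J: "ideal J R" "\<mm> \<subseteq> J" "J \<subseteq> carrier R"
    interpret J: ideal J R by (rule J(1))
    show "J = \<mm> \<or> J = carrier R"
    proof (rule ccontr)
      assume neq: "\<not> (J = \<mm> \<or> J = carrier R)"
      then obtain a where a: "a \<in> J" "a \<notin> \<mm>" using J(2) by blast
      have ac: "a \<in> carrier R" using a(1) J(3) by blast
      have "scalar a \<odot>\<^bsub>E\<^esub> x \<in> P" "scalar a \<odot>\<^bsub>E\<^esub> x \<notin> N''"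
        using lsub_smult[OF PR ac x(1)] a(2) ac unfolding \<mm>_def by simp_all
      from decomp[OF x(1) this] obtain n r where n: "n \<in> N''" "r \<in> carrier R" "x = n \<oplus>\<^bsub>E\<^esub> scalar r \<odot>\<^bsub>E\<^esub> (scalar a \<odot>\<^bsub>E\<^esub> x)"
        by blast
      have nE: "n \<in> carrier R_rows" by (rule lsub_subset[OF Nr n(1)])
      have "(\<one> \<oplus> \<ominus> (r \<otimes> a)) \<odot>\<^bsub>R_rows\<^esub> x = x \<oplus>\<^bsub>R_rows\<^esub> \<ominus>\<^bsub>R_rows\<^esub> ((r \<otimes> a) \<odot>\<^bsub>R_rows\<^esub> x)"
        using xE n(2) ac RR.smult_l_distr[of \<one> "\<ominus> (r \<otimes> a)" x] RR.smult_one[of x] RR.smult_minus_left[of "r \<otimes> a" x]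
        by simp
      also have "(r \<otimes> a) \<odot>\<^bsub>R_rows\<^esub> x = r \<odot>\<^bsub>R_rows\<^esub> (a \<odot>\<^bsub>R_rows\<^esub> x)" using xE n(2) ac RR.smult_assoc[of r a x] by simp
      also have "x \<oplus>\<^bsub>R_rows\<^esub> \<ominus>\<^bsub>R_rows\<^esub> (r \<odot>\<^bsub>R_rows\<^esub> (a \<odot>\<^bsub>R_rows\<^esub> x)) = n"
      proof -
        define t where "t = r \<odot>\<^bsub>R_rows\<^esub> (a \<odot>\<^bsub>R_rows\<^esub> x)"
        have t: "t \<in> carrier R_rows" unfolding t_def using xE n(2) ac RR.smult_closed[of a x] RR.smult_closed[of r "a \<odot>\<^bsub>R_rows\<^esub> x"] by simp
        have "x = n \<oplus>\<^bsub>R_rows\<^esub> t" using n(3) unfolding t_def by simp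
        then show ?thesis unfolding t_def[symmetric] using nE t by (simp only: RR.M.a_assoc RR.M.a_inv_closed RR.M.r_neg RR.M.r_zero)
      qed
      finally have "scalar (\<one> \<oplus> \<ominus> (r \<otimes> a)) \<odot>\<^bsub>E\<^esub> x \<in> N''" using n(1) by simp
      then have "\<one> \<oplus> \<ominus> (r \<otimes> a) \<in> \<mm>" unfolding \<mm>_def using n(2) ac by simp
      then have "\<one> \<oplus> \<ominus> (r \<otimes> a) \<in> J" using J(2) by blast
      then have "(\<one> \<oplus> \<ominus> (r \<otimes> a)) \<oplus> r \<otimes> a \<in> J" using J.I_l_closed[OF a(1) n(2)] by simp
      then have "\<one> \<in> J" using n(2) ac by (simp add: a_assoc l_neg)
      then have "J = carrier R" by (rule J.one_imp_carrier)
      then show False using neq by simp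
    qed
  qed
  moreover have "scalar a \<odot>\<^bsub>E\<^esub> y \<in> N" if a: "a \<in> \<mm>" and y: "y \<in> P" for a y
  proof -
    have ac: "a \<in> carrier R" using a unfolding \<mm>_def by blast
    have aN'': "scalar a \<odot>\<^bsub>E\<^esub> z \<in> N''" if z: "z \<in> P" for z
    proof -
      obtain n r where n: "n \<in> N''" "r \<in> carrier R" "z = n \<oplus>\<^bsub>E\<^esub> scalar r \<odot>\<^bsub>E\<^esub> x" using decomp[OF z x] by blast
      have nE: "n \<in> carrier R_rows" by (rule lsub_subset[OF Nr n(1)])
      have "a \<odot>\<^bsub>R_rows\<^esub> z = a \<odot>\<^bsub>R_rows\<^esub> n \<oplus>\<^bsub>R_rows\<^esub> a \<odot>\<^bsub>R_rows\<^esub> (r \<odot>\<^bsub>R_rows\<^esub> x)"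
        using n nE ac xE RR.smult_r_distr[of a n "r \<odot>\<^bsub>R_rows\<^esub> x"] RR.smult_closed[of r x] by simp
      also have "a \<odot>\<^bsub>R_rows\<^esub> (r \<odot>\<^bsub>R_rows\<^esub> x) = r \<odot>\<^bsub>R_rows\<^esub> (a \<odot>\<^bsub>R_rows\<^esub> x)"
        using ac n(2) xE RR.smult_assoc[of a r x] RR.smult_assoc[of r a x] m_comm[of a r] by simp
      finally have eq: "a \<odot>\<^bsub>R_rows\<^esub> z = a \<odot>\<^bsub>R_rows\<^esub> n \<oplus>\<^bsub>R_rows\<^esub> r \<odot>\<^bsub>R_rows\<^esub> (a \<odot>\<^bsub>R_rows\<^esub> x)" .
      have "a \<odot>\<^bsub>R_rows\<^esub> x \<in> N''" using a unfolding \<mm>_def by simp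
      then have "a \<odot>\<^bsub>R_rows\<^esub> z \<in> N''"
        unfolding eq by (intro lsub_add[OF Nr] lsub_smult[OF Nr ac n(1)] lsub_smult[OF Nr n(2)])
      then show ?thesis by simp
    qed
    define K where "K = {scalar a \<odot>\<^bsub>E\<^esub> z | z. z \<in> P}"
    have K: "lsub \<Lambda> E K"
    proof -
      have "(\<lambda>z. scalar a \<odot>\<^bsub>E\<^esub> z) \<in> lin_maps \<Lambda> E E"
        using scalar_in_End[OF ac]
        by (intro lin_mapsI) (simp_all add: \<Lambda>.rows.smult_closed \<Lambda>.rows.smult_r_distr scalar_central[OF ac] flip: \<Lambda>.rows.smult_assoc)
      from lsub_image[OF \<Lambda>.rows_left_module \<Lambda>.rows_left_module this P(1)] show ?thesis
        unfolding K_def by (simp add: setcompr_eq_image)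
    qed
    have KP: "K \<subseteq> P" unfolding K_def using lsub_smult[OF P(1) scalar_in_End[OF ac]] by blast
    have "K \<subseteq> N"
    proof (rule ccontr)
      assume KN: "\<not> K \<subseteq> N"
      obtain n u where n: "n \<in> N" "u \<in> K" "x = n \<oplus>\<^bsub>E\<^esub> u"
        by (rule \<Lambda>.rows.max_sub_plus[OF P(1) N K KP KN x(1)])
      have "u \<in> N''" using n(2) aN'' unfolding K_def by blast
      moreover have "n \<in> N''" using n(1) N''(2) by blast
      ultimately have "x \<in> N''" unfolding n(3) using lsub_add[OF Nr, of n u] by simp
      then show False using x(2) by simp
    qed
    then show ?thesis using y unfolding K_def by blast
  qed
  ultimately show ?thesis using that by blast
qed

text \<open>A strictly descending sequence of intersections of maximal submodules, all killed by the same
  maximal ideal \<open>\<mm>\<close>, contradicts noetherianity: some \<open>p\<^sub>n\<close> is a combination of its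
  predecessors, and \<open>N\<^sub>0, N\<^sub>1, \<dots>\<close> force the coefficients into \<open>\<mm>\<close> one after another.\<close>

lemma no_descending_sequence_fixed:
  fixes N :: "nat \<Rightarrow> (nat \<Rightarrow> 'm \<Rightarrow> 'm) set set" and p :: "nat \<Rightarrow> (nat \<Rightarrow> 'm \<Rightarrow> 'm) set"
  assumes P: "lsub \<Lambda> E P" "P \<subseteq> free_carrier \<Lambda> k" and \<mm>: "maximalideal \<mm> R"
    and N: "\<And>i. max_in P (N i)" and kill: "\<And>i a x. \<lbrakk>a \<in> \<mm>; x \<in> P\<rbrakk> \<Longrightarrow> scalar a \<odot>\<^bsub>E\<^esub> x \<in> N i"
    and p: "\<And>i. p i \<in> P" "\<And>i. p i \<notin> N i" "\<And>i j. j < i \<Longrightarrow> p i \<in> N j"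
  shows False
proof -
  interpret RR: left_module R R_rows by (rule R_rows_module)
  interpret \<mm>: maximalideal \<mm> R by (rule \<mm>)
  have PR: "lsub R R_rows P" by (rule lsub_imp_R_lsub[OF P(1)])
  have NR: "lsub R R_rows (N i)" for i by (rule lsub_imp_R_lsub[OF max_sub_lsub[OF N]])
  have pE: "p i \<in> carrier R_rows" for i by (rule lsub_subset[OF PR p(1)])
  have "fin_gen R R_rows (lspan R R_rows (range p))"
  proof (rule R_lsub_free_fin_gen)
    show "lsub R R_rows (lspan R R_rows (range p))" by (rule RR.lspan_lsub) (use pE in blast)
    have "lspan R R_rows (range p) \<subseteq> P" by (rule lspan_least[OF PR]) (use p(1) in blast)
    then show "lspan R R_rows (range p) \<subseteq> free_carrier \<Lambda> k" using P(2) by (rule subset_trans)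
  qed
  from RR.sequence_in_span_of_predecessors[OF pE this] obtain n where
    n: "p n \<in> lspan R R_rows (p ` {..<n})" by blast
  define D where "D = {x \<in> P. \<forall>i \<le> n. x \<in> N i}"
  have D: "lsub R R_rows D"
    unfolding lsub_def[of R R_rows D]
  proof (intro conjI ballI)
    show "D \<subseteq> carrier R_rows" unfolding D_def using lsub_subset[OF PR] by (intro subsetI) (elim CollectE conjE)
    show "\<zero>\<^bsub>R_rows\<^esub> \<in> D" unfolding D_def by (intro CollectI conjI allI impI lsub_zero[OF PR] lsub_zero[OF NR])
    show "x \<oplus>\<^bsub>R_rows\<^esub> y \<in> D" if "x \<in> D" "y \<in> D" for x y
      using that unfolding D_def mem_Collect_eq
      by (intro conjI allI impI lsub_add[OF PR] lsub_add[OF NR]) simp_all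
    show "a \<odot>\<^bsub>R_rows\<^esub> x \<in> D" if "a \<in> carrier R" "x \<in> D" for a x
      using that unfolding D_def mem_Collect_eq
      by (intro conjI allI impI lsub_smult[OF PR] lsub_smult[OF NR]) simp_all
  qed
  have coeff: "a \<in> \<mm>" if a: "a \<in> carrier R" "a \<odot>\<^bsub>R_rows\<^esub> p j \<in> N j" for a j
  proof (rule ccontr)
    assume "a \<notin> \<mm>"
    define J where "J = {b \<in> carrier R. b \<odot>\<^bsub>R_rows\<^esub> p j \<in> N j}"
    have "ideal J R"
    proof (rule idealI_mult)
      show "\<zero> \<in> J" unfolding J_def using RR.smult_zero_left[OF pE] lsub_zero[OF NR] by (simp del: R_rows_simps)
      show "b \<oplus> c \<in> J" if "b \<in> J" "c \<in> J" for b c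
        using that lsub_add[OF NR] unfolding J_def by (simp add: RR.smult_l_distr[OF _ _ pE] del: R_rows_simps)
      show "r \<otimes> b \<in> J" if "r \<in> carrier R" "b \<in> J" for r b
        using that lsub_smult[OF NR] unfolding J_def by (simp add: RR.smult_assoc[OF _ _ pE] del: R_rows_simps)
    qed (auto simp: J_def)
    moreover have "\<mm> \<subseteq> J"
    proof
      fix b assume b: "b \<in> \<mm>"
      then have "b \<in> carrier R" using \<mm>.a_subset by blast
      then show "b \<in> J" unfolding J_def using kill[OF b p(1), of j j] by simp
    qed
    moreover have "J \<subseteq> carrier R" unfolding J_def by blast
    ultimately have "J = \<mm> \<or> J = carrier R" by (rule \<mm>.I_maximal)
    moreover have "a \<in> J" unfolding J_def using a by simp
    ultimately have "\<one> \<in> J" using \<open>a \<notin> \<mm>\<close> by auto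
    then have "p j \<in> N j" unfolding J_def using RR.smult_one[OF pE] by (simp del: R_rows_simps)
    then show False using p(2) by simp
  qed
  have "p n \<in> N'" if "j \<le> n" "lsub R R_rows N'" "D \<subseteq> N'" "p ` {j..<n} \<subseteq> N'" for j N'
    using that
  proof (induction j arbitrary: N')
    case 0
    then have "lspan R R_rows (p ` {..<n}) \<subseteq> N'" by (intro lspan_least) (auto simp: lessThan_atLeast0)
    then show ?case using n by blast
  next
    case (Suc j)
    define N1 where "N1 = N' \<inter> (N j \<inter> P)"
    have N1: "lsub R R_rows N1" unfolding N1_def by (intro lsub_Int Suc.prems(2) NR PR)
    define W where "W = {y \<oplus>\<^bsub>R_rows\<^esub> z | y z. y \<in> N1 \<and> z \<in> {a \<odot>\<^bsub>R_rows\<^esub> p j | a. a \<in> carrier R}}"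
    have W: "lsub R R_rows W" unfolding W_def by (rule RR.lsub_plus[OF N1 RR.lsub_cyclic[OF pE]])
    have N1W: "N1 \<subseteq> W"
    proof
      fix y assume y: "y \<in> N1"
      have "y = y \<oplus>\<^bsub>R_rows\<^esub> \<zero>\<^bsub>R_rows\<^esub>" using RR.M.r_zero[OF lsub_subset[OF N1 y]] by simp
      moreover have "\<zero>\<^bsub>R_rows\<^esub> \<in> {a \<odot>\<^bsub>R_rows\<^esub> p j | a. a \<in> carrier R}" by (rule lsub_zero[OF RR.lsub_cyclic[OF pE]])
      ultimately show "y \<in> W" unfolding W_def using y by blast
    qed
    have "p n \<in> W"
    proof (rule Suc.IH[OF _ W])
      show "j \<le> n" using Suc.prems(1) by simp
      have "D \<subseteq> N1" unfolding N1_def using Suc.prems(1,3) unfolding D_def by auto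
      then show "D \<subseteq> W" using N1W by (rule subset_trans)
      show "p ` {j..<n} \<subseteq> W"
      proof
        fix z assume "z \<in> p ` {j..<n}"
        then obtain i where i: "i \<in> {j..<n}" "z = p i" by blast
        show "z \<in> W"
        proof (cases "i = j")
          case True
          have "p j = \<zero>\<^bsub>R_rows\<^esub> \<oplus>\<^bsub>R_rows\<^esub> \<one> \<odot>\<^bsub>R_rows\<^esub> p j" using RR.smult_one[OF pE] RR.M.l_zero[OF pE] by (simp del: R_rows_simps)
          then show ?thesis unfolding W_def i(2) True using lsub_zero[OF N1] one_closed by blast
        next
          case False
          then have "p i \<in> N'" "p i \<in> N j" using Suc.prems(4) i(1) p(3)[of j i] by auto
          then have "p i \<in> N1" unfolding N1_def using p(1) by blast
          then show ?thesis unfolding i(2) using N1W by blast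
        qed
      qed
    qed
    then obtain y a where ya: "y \<in> N1" "a \<in> carrier R" "p n = y \<oplus>\<^bsub>R_rows\<^esub> a \<odot>\<^bsub>R_rows\<^esub> p j"
      unfolding W_def by blast
    have yE: "y \<in> carrier R_rows" by (rule lsub_subset[OF N1 ya(1)])
    have "a \<odot>\<^bsub>R_rows\<^esub> p j = p n \<ominus>\<^bsub>R_rows\<^esub> y"
      using RR.smult_closed[OF ya(2) pE, of j] yE unfolding ya(3)
      by (simp add: a_minus_def RR.M.a_ac RR.M.r_neg RR.M.r_neg1 RR.M.r_neg2 del: R_rows_simps)
    moreover have "p n \<in> N j" using p(3) Suc.prems(1) by simp
    moreover have "y \<in> N j" using ya(1) unfolding N1_def by blast
    ultimately have "a \<odot>\<^bsub>R_rows\<^esub> p j \<in> N j" using RR.lsub_diff[OF NR, of "p n" j y] by simp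
    then have am: "a \<in> \<mm>" by (rule coeff[OF ya(2)])
    have "a \<odot>\<^bsub>R_rows\<^esub> p j \<in> D" unfolding D_def using kill[OF am p(1)] lsub_smult[OF PR ya(2) p(1)] by simp
    then have "a \<odot>\<^bsub>R_rows\<^esub> p j \<in> N'" using Suc.prems(3) by blast
    moreover have "y \<in> N'" using ya(1) unfolding N1_def by blast
    ultimately show ?case unfolding ya(3) using lsub_add[OF Suc.prems(2)] by blast
  qed
  from this[of n D] have "p n \<in> D" using D by simp
  then show False using p(2)[of n] unfolding D_def by blast
qed

text \<open>Pigeonhole principle: infinitely many of the quotients are killed by the same maximal ideal.\<close>

lemma no_descending_sequence:
  fixes N :: "nat \<Rightarrow> (nat \<Rightarrow> 'm \<Rightarrow> 'm) set set" and p :: "nat \<Rightarrow> (nat \<Rightarrow> 'm \<Rightarrow> 'm) set"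
  assumes sl: "semilocal R" and P: "lsub \<Lambda> E P" "P \<subseteq> free_carrier \<Lambda> k"
    and N: "\<And>i. max_in P (N i)"
    and p: "\<And>i. p i \<in> P" "\<And>i. p i \<notin> N i" "\<And>i j. j < i \<Longrightarrow> p i \<in> N j"
  shows False
proof -
  have "\<exists>\<mm>. maximalideal \<mm> R \<and> (\<forall>a x. a \<in> \<mm> \<longrightarrow> x \<in> P \<longrightarrow> scalar a \<odot>\<^bsub>E\<^esub> x \<in> N i)" for i
    by (rule max_in_residue[OF P N[of i]]) blast
  then obtain \<mm> where \<mm>: "\<And>i. maximalideal (\<mm> i) R" "\<And>i a x. \<lbrakk>a \<in> \<mm> i; x \<in> P\<rbrakk> \<Longrightarrow> scalar a \<odot>\<^bsub>E\<^esub> x \<in> N i"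
    by metis
  have "finite (range \<mm>)"
    by (rule finite_subset[OF _ sl[unfolded semilocal_def]]) (use \<mm>(1) in blast)
  then obtain i0 where inf: "infinite {i. \<mm> i = \<mm> i0}"
    using pigeonhole_infinite[of "UNIV :: nat set" \<mm>] by auto
  define s where "s = enumerate {i. \<mm> i = \<mm> i0}"
  have s: "\<mm> (s i) = \<mm> i0" for i unfolding s_def using enumerate_in_set[OF inf, of i] by simp
  have sm: "s i < s j" if "i < j" for i j unfolding s_def by (rule enumerate_mono[OF that inf])
  show False
  proof (rule no_descending_sequence_fixed[OF P \<mm>(1)[of i0], of "\<lambda>i. N (s i)" "\<lambda>i. p (s i)"])
    show "scalar a \<odot>\<^bsub>E\<^esub> x \<in> N (s i)" if "a \<in> \<mm> i0" "x \<in> P" for i a x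
      using \<mm>(2)[of a "s i" x] s[of i] that by simp
  qed (use N p sm in auto)
qed

end

section \<open>Congruences modulo maximal submodules\<close>

definition cong_mod :: "('l, 'x, 'c) module_scheme \<Rightarrow> 'x set \<Rightarrow> 'x \<Rightarrow> 'x \<Rightarrow> bool" where
  "cong_mod Q N x y \<longleftrightarrow> x \<in> carrier Q \<and> y \<in> carrier Q \<and> x \<ominus>\<^bsub>Q\<^esub> y \<in> N"

text \<open>The intersections \<open>N 0 \<inter> \<dots> \<inter> N i\<close> descend strictly. For the Chinese remainder theorem it would not
  suffice that the \<open>N i\<close> are distinct, as three lines in a plane show.\<close>

definition irredundant ::
  "('l, 'k) ring_scheme \<Rightarrow> ('l, 'x, 'c) module_scheme \<Rightarrow> 'x set \<Rightarrow> nat \<Rightarrow> (nat \<Rightarrow> 'x set) \<Rightarrow> bool" where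
  "irredundant L Q P n N \<longleftrightarrow> (\<forall>i < n. max_sub L Q P (N i) \<and> (\<exists>p \<in> P. p \<notin> N i \<and> (\<forall>j < i. p \<in> N j)))"

definition dominating ::
  "('l, 'k) ring_scheme \<Rightarrow> ('l, 'x, 'c) module_scheme \<Rightarrow> 'x set \<Rightarrow> nat \<Rightarrow> (nat \<Rightarrow> 'x set) \<Rightarrow> bool" where
  "dominating L Q P n N \<longleftrightarrow> (\<forall>N'. max_sub L Q P N' \<longrightarrow> (\<forall>x \<in> P. (\<forall>i < n. x \<in> N i) \<longrightarrow> x \<in> N'))"

lemma irredundant_max: "irredundant L Q P n N \<Longrightarrow> i < n \<Longrightarrow> max_sub L Q P (N i)"
  by (simp add: irredundant_def)

lemma dominatingD: "\<lbrakk>dominating L Q P n N; max_sub L Q P N'; x \<in> P; \<And>i. i < n \<Longrightarrow> x \<in> N i\<rbrakk> \<Longrightarrow> x \<in> N'"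
  by (simp add: dominating_def)

context left_module
begin

lemma cong_modI: "\<lbrakk>lsub L M N; x \<in> carrier M; y \<in> N\<rbrakk> \<Longrightarrow> cong_mod M N (x \<oplus>\<^bsub>M\<^esub> y) x"
  unfolding cong_mod_def using lsub_subset[of L M N y]
  by (simp add: a_minus_def M.a_comm[of x y] M.a_assoc M.r_neg)

lemma cong_modE: 
  assumes "cong_mod M N x y" obtains u where "u \<in> N" "x = y \<oplus>\<^bsub>M\<^esub> u"
proof (rule that[of "x \<ominus>\<^bsub>M\<^esub> y"])
  have c: "x \<in> carrier M" "y \<in> carrier M" using assms by (simp_all add: cong_mod_def)
  then show "x = y \<oplus>\<^bsub>M\<^esub> (x \<ominus>\<^bsub>M\<^esub> y)" by (simp add: a_minus_def M.a_comm[of x] M.r_neg2)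
qed (use assms in \<open>simp add: cong_mod_def\<close>)

lemma cong_mod_refl: "\<lbrakk>lsub L M N; x \<in> carrier M\<rbrakk> \<Longrightarrow> cong_mod M N x x"
  unfolding cong_mod_def by (simp add: a_minus_def M.r_neg lsub_zero)

lemma cong_mod_trans:
  assumes N: "lsub L M N" and xy: "cong_mod M N x y" and yz: "cong_mod M N y z"
  shows "cong_mod M N x z"
proof -
  obtain u where u: "u \<in> N" "x = y \<oplus>\<^bsub>M\<^esub> u" using xy by (rule cong_modE)
  obtain v where v: "v \<in> N" "y = z \<oplus>\<^bsub>M\<^esub> v" using yz by (rule cong_modE)
  have z: "z \<in> carrier M" using yz by (simp add: cong_mod_def)
  have "x = z \<oplus>\<^bsub>M\<^esub> (v \<oplus>\<^bsub>M\<^esub> u)" unfolding u(2) v(2) using z lsub_subset[OF N u(1)] lsub_subset[OF N v(1)]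
    by (simp add: M.a_assoc)
  then show ?thesis using cong_modI[OF N z lsub_add[OF N v(1) u(1)]] by simp
qed

lemma cong_mod_sym:
  assumes N: "lsub L M N" and xy: "cong_mod M N x y"
  shows "cong_mod M N y x"
proof -
  obtain u where u: "u \<in> N" "x = y \<oplus>\<^bsub>M\<^esub> u" using xy by (rule cong_modE)
  have y: "y \<in> carrier M" and x: "x \<in> carrier M" using xy by (simp_all add: cong_mod_def)
  have uc: "u \<in> carrier M" by (rule lsub_subset[OF N u(1)])
  have "y = x \<oplus>\<^bsub>M\<^esub> \<ominus>\<^bsub>M\<^esub> u" unfolding u(2) using y uc by (simp add: M.a_assoc M.r_neg)
  then show ?thesis using cong_modI[OF N x lsub_uminus[OF N u(1)]] by simp
qed

lemma cong_mod_add: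
  assumes N: "lsub L M N" and xy: "cong_mod M N x y" and xy': "cong_mod M N x' y'"
  shows "cong_mod M N (x \<oplus>\<^bsub>M\<^esub> x') (y \<oplus>\<^bsub>M\<^esub> y')"
proof -
  obtain u where u: "u \<in> N" "x = y \<oplus>\<^bsub>M\<^esub> u" using xy by (rule cong_modE)
  obtain v where v: "v \<in> N" "x' = y' \<oplus>\<^bsub>M\<^esub> v" using xy' by (rule cong_modE)
  have y: "y \<in> carrier M" "y' \<in> carrier M" using xy xy' by (simp_all add: cong_mod_def)
  have "x \<oplus>\<^bsub>M\<^esub> x' = (y \<oplus>\<^bsub>M\<^esub> y') \<oplus>\<^bsub>M\<^esub> (u \<oplus>\<^bsub>M\<^esub> v)"
    unfolding u(2) v(2) using y lsub_subset[OF N u(1)] lsub_subset[OF N v(1)] by (simp add: M.a_ac)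
  then show ?thesis using cong_modI[OF N _ lsub_add[OF N u(1) v(1)], of "y \<oplus>\<^bsub>M\<^esub> y'"] y by simp
qed

lemma cong_mod_smult:
  assumes N: "lsub L M N" and a: "a \<in> carrier L" and xy: "cong_mod M N x y"
  shows "cong_mod M N (a \<odot>\<^bsub>M\<^esub> x) (a \<odot>\<^bsub>M\<^esub> y)"
proof -
  obtain u where u: "u \<in> N" "x = y \<oplus>\<^bsub>M\<^esub> u" using xy by (rule cong_modE)
  have y: "y \<in> carrier M" using xy by (simp add: cong_mod_def)
  have "a \<odot>\<^bsub>M\<^esub> x = a \<odot>\<^bsub>M\<^esub> y \<oplus>\<^bsub>M\<^esub> a \<odot>\<^bsub>M\<^esub> u" unfolding u(2) by (rule smult_r_distr[OF a y lsub_subset[OF N u(1)]])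
  then show ?thesis using cong_modI[OF N smult_closed[OF a y] lsub_smult[OF N a u(1)]] by simp
qed

lemma cong_mod_smult_diff:
  assumes N: "lsub L M N" and a: "a \<in> carrier L" "b \<in> carrier L" and x: "x \<in> carrier M"
  shows "cong_mod M N (a \<odot>\<^bsub>M\<^esub> x) (b \<odot>\<^bsub>M\<^esub> x) \<longleftrightarrow> (a \<ominus>\<^bsub>L\<^esub> b) \<odot>\<^bsub>M\<^esub> x \<in> N"
  unfolding cong_mod_def using a x by (simp add: smult_closed a_minus_def smult_l_distr smult_minus_left)

lemma lsub_Inter: "lsub L M P \<Longrightarrow> (\<And>j. j < i \<Longrightarrow> lsub L M (N j)) \<Longrightarrow> lsub L M {x \<in> P. \<forall>j < (i::nat). x \<in> N j}"
  unfolding lsub_def[of L M "{x \<in> P. \<forall>j < i. x \<in> N j}"]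
  by (intro conjI ballI subsetI CollectI allI impI)
    (simp_all add: lsub_subset[of L M P] lsub_zero[of L] lsub_add[of L] lsub_smult[of L])

lemma max_sub_cyclic:
  assumes P: "lsub L M P" and N: "max_sub L M P N" and p: "p \<in> P" "p \<notin> N" and x: "x \<in> P"
  obtains a where "a \<in> carrier L" "cong_mod M N x (a \<odot>\<^bsub>M\<^esub> p)"
proof -
  have pc: "p \<in> carrier M" by (rule lsub_subset[OF P p(1)])
  have sub: "{a \<odot>\<^bsub>M\<^esub> p | a. a \<in> carrier L} \<subseteq> P" using lsub_smult[OF P _ p(1)] by blast
  have "\<one>\<^bsub>L\<^esub> \<odot>\<^bsub>M\<^esub> p \<in> {a \<odot>\<^bsub>M\<^esub> p | a. a \<in> carrier L}" by (intro CollectI exI[of _ "\<one>\<^bsub>L\<^esub>"] conjI refl one_closed)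
  then have nsub: "\<not> {a \<odot>\<^bsub>M\<^esub> p | a. a \<in> carrier L} \<subseteq> N" using p(2) smult_one[OF pc] by (intro notI) (drule (1) subsetD, simp)
  obtain n k where nk: "n \<in> N" "k \<in> {a \<odot>\<^bsub>M\<^esub> p | a. a \<in> carrier L}" "x = n \<oplus>\<^bsub>M\<^esub> k"
    by (rule max_sub_plus[OF P N lsub_cyclic[OF pc] sub nsub x])
  from nk(2) obtain a where a: "k = a \<odot>\<^bsub>M\<^esub> p" "a \<in> carrier L" by (elim CollectE exE conjE)
  have "cong_mod M N (k \<oplus>\<^bsub>M\<^esub> n) k" 
    using a by (intro cong_modI max_sub_lsub[OF N] nk(1)) (simp add: smult_closed pc)
  moreover have "k \<oplus>\<^bsub>M\<^esub> n = x" unfolding nk(3) using lsub_subset[OF max_sub_lsub[OF N] nk(1)] a by (simp add: M.a_comm smult_closed pc)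
  ultimately show ?thesis using that[OF a(2)] a(1) by simp
qed

text \<open>In the step from \<open>n\<close> to \<open>n + 1\<close>, the intersection of the first \<open>n\<close> submodules is not contained in the next,
  hence together with it spans \<open>P\<close>.\<close>

lemma chinese_remainder:
  assumes P: "lsub L M P"
  shows "\<lbrakk>irredundant L M P n N; \<And>i. i < n \<Longrightarrow> y i \<in> P\<rbrakk> \<Longrightarrow> \<exists>x \<in> P. \<forall>i < n. cong_mod M (N i) x (y i)"
proof (induction n)
  case 0
  then show ?case using lsub_zero[OF P] by (intro bexI[of _ "\<zero>\<^bsub>M\<^esub>"]) simp_all
next
  case (Suc n)
  have ir: "irredundant L M P n N" using Suc.prems(1) by (simp add: irredundant_def)
  obtain x0 where x0: "x0 \<in> P" "\<And>i. i < n \<Longrightarrow> cong_mod M (N i) x0 (y i)" using Suc.IH[OF ir] Suc.prems(2) by (auto simp: less_Suc_eq)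
  have mx: "max_sub L M P (N i)" if "i < Suc n" for i by (rule irredundant_max[OF Suc.prems(1) that])
  note ls = max_sub_lsub[OF mx]
  define K where "K = {x \<in> P. \<forall>j < n. x \<in> N j}"
  have K: "lsub L M K" unfolding K_def by (rule lsub_Inter[OF P ls]) simp
  have KP: "K \<subseteq> P" unfolding K_def by (rule Collect_subset)
  obtain p where p: "p \<in> P" "p \<notin> N n" "\<forall>j < n. p \<in> N j" using Suc.prems(1) unfolding irredundant_def by blast
  then have KN: "\<not> K \<subseteq> N n" unfolding K_def by (intro notI) (drule subsetD[of _ _ p], simp_all)
  have yn: "y n \<in> P" using Suc.prems(2) by simp
  have x0c: "x0 \<in> carrier M" and ync: "y n \<in> carrier M" using lsub_subset[OF P] x0(1) yn by simp_all
  obtain u k where uk: "u \<in> N n" "k \<in> K" "y n \<ominus>\<^bsub>M\<^esub> x0 = u \<oplus>\<^bsub>M\<^esub> k"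
    by (rule max_sub_plus[OF P mx[of n] K KP KN lsub_diff[OF P yn x0(1)]]) simp
  have uc: "u \<in> carrier M" and kc: "k \<in> carrier M" using lsub_subset[OF ls[of n] uk(1)] lsub_subset[OF K uk(2)] by simp_all
  show ?case
  proof (intro bexI[of _ "x0 \<oplus>\<^bsub>M\<^esub> k"] allI impI)
    show "x0 \<oplus>\<^bsub>M\<^esub> k \<in> P" using lsub_add[OF P x0(1)] KP uk(2) by blast
    fix i assume i: "i < Suc n"
    show "cong_mod M (N i) (x0 \<oplus>\<^bsub>M\<^esub> k) (y i)"
    proof (cases "i = n")
      case True
      have "y n = (y n \<ominus>\<^bsub>M\<^esub> x0) \<oplus>\<^bsub>M\<^esub> x0" using x0c ync by (simp add: a_minus_def M.a_assoc M.l_neg)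
      then have "y n = (x0 \<oplus>\<^bsub>M\<^esub> k) \<oplus>\<^bsub>M\<^esub> u" unfolding uk(3) using x0c uc kc by (simp add: M.a_ac)
      then have "cong_mod M (N n) (y n) (x0 \<oplus>\<^bsub>M\<^esub> k)" using cong_modI[OF ls[of n] _ uk(1), of "x0 \<oplus>\<^bsub>M\<^esub> k"] x0c kc by simp
      then show ?thesis unfolding True by (rule cong_mod_sym[OF ls, rotated]) simp
    next
      case False
      then have "i < n" using i by simp
      moreover have "k \<in> N i" using uk(2) \<open>i < n\<close> unfolding K_def by simp
      ultimately show ?thesis using cong_mod_trans[OF ls[OF i] cong_modI[OF ls[OF i] x0c] x0(2)] by simp
    qed
  qed
qed

end

text \<open>An irredundant family that does not dominate can be prolonged. The hypothesis excludes that this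
  goes on forever.\<close>

lemma dominating_family_exists:
  assumes nds: "\<And>(N :: nat \<Rightarrow> _) p. \<lbrakk>\<And>i. max_sub L Q P (N i); \<And>i. p i \<in> P; \<And>i. p i \<notin> N i; \<And>i j. j < i \<Longrightarrow> p i \<in> N j\<rbrakk> \<Longrightarrow> False"
  obtains n N where "irredundant L Q P n N" "dominating L Q P n N"
proof (rule ccontr)
  note conv = that
  assume "\<not> thesis"
  then have none: "\<not> dominating L Q P n N" if "irredundant L Q P n N" for n N using conv that by blast
  have "\<exists>f. \<forall>n. irredundant L Q P n (f n) \<and> (\<forall>i < n. f (Suc n) i = f n i)"
  proof (rule dependent_nat_choice)
    show "\<exists>N. irredundant L Q P 0 N" by (simp add: irredundant_def)
    fix N n assume ir: "irredundant L Q P n N"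
    from none[OF this] obtain N' x where N': "max_sub L Q P N'" "x \<in> P" "\<forall>i < n. x \<in> N i" "x \<notin> N'"
      unfolding dominating_def by blast
    show "\<exists>N''. irredundant L Q P (Suc n) N'' \<and> (\<forall>i < n. N'' i = N i)"
    proof (intro exI[of _ "N(n := N')"] conjI)
      show "irredundant L Q P (Suc n) (N(n := N'))"
        unfolding irredundant_def
      proof (intro allI impI)
        fix i assume "i < Suc n"
        then consider "i < n" | "i = n" by linarith
        then show "max_sub L Q P ((N(n := N')) i) \<and> (\<exists>p \<in> P. p \<notin> (N(n := N')) i \<and> (\<forall>j < i. p \<in> (N(n := N')) j))"
        proof cases
          case 1
          then show ?thesis using ir[unfolded irredundant_def, rule_format, OF 1] by simp
        next
          case 2
          show ?thesis unfolding 2 by (intro conjI bexI[of _ x]) (use N' in simp_all)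
        qed
      qed
    qed simp
  qed
  then obtain f where f: "\<And>n. irredundant L Q P n (f n)" "\<And>n i. i < n \<Longrightarrow> f (Suc n) i = f n i" by blast
  have stable: "f n i = f (Suc i) i" if "Suc i \<le> n" for i n
    using that by (induction n rule: dec_induct) (simp_all add: f(2))
  have "\<exists>p \<in> P. p \<notin> f (Suc i) i \<and> (\<forall>j < i. p \<in> f (Suc j) j)" for i
    using f(1)[of "Suc i"] stable[of _ "Suc i"] unfolding irredundant_def by (metis Suc_leI less_Suc_eq lessI)
  then obtain p where p: "\<And>i. p i \<in> P" "\<And>i. p i \<notin> f (Suc i) i" "\<And>i j. j < i \<Longrightarrow> p i \<in> f (Suc j) j" by metis
  have "max_sub L Q P (f (Suc i) i)" for i by (rule irredundant_max[OF f(1)]) simp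
  from nds[of "\<lambda>i. f (Suc i) i" p, OF this p] show False .
qed

section \<open>Projective modules modulo the radical\<close>

context ring
begin

text \<open>The annihilator, a left ideal, of the generator of the module \<open>free 1 / N\<close>.\<close>

definition ann :: "(nat \<Rightarrow> 'a) set set \<Rightarrow> 'a set" where
  "ann N = {a \<in> carrier R. a \<odot>\<^bsub>rows R\<^esub> unit_row R 0 \<in> N}"

lemma free_one_cyclic:
  assumes "u \<in> free_carrier R 1"
  shows "co u 0 \<odot>\<^bsub>rows R\<^esub> unit_row R 0 = u"
  using free_expansion[OF assms] rows_co[of u R 0] assms unit_row_free[of 0 1] free_carrier_subset[of R 1]
  by (simp add: subset_iff rows.smult_closed lessThan_Suc)

lemma cyclic_map_linear:
  assumes y: "y \<in> carrier (rows R)"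
  shows "(\<lambda>u. co u 0 \<odot>\<^bsub>rows R\<^esub> y) \<in> lin_maps R (rows R) (rows R)"
proof (rule lin_mapsI)
  have co_add: "co (u \<oplus>\<^bsub>rows R\<^esub> v) 0 = co u 0 \<oplus> co v 0" for u v by (simp add: rows_simps)
  have co_smult: "co (a \<odot>\<^bsub>rows R\<^esub> u) 0 = a \<otimes> co u 0" for a u by (simp add: rows_simps)
  show "co u 0 \<odot>\<^bsub>rows R\<^esub> y \<in> carrier (rows R)" if "u \<in> carrier (rows R)" for u
    by (rule rows.smult_closed[OF rows_co[OF that] y])
  show "co (u \<oplus>\<^bsub>rows R\<^esub> v) 0 \<odot>\<^bsub>rows R\<^esub> y = co u 0 \<odot>\<^bsub>rows R\<^esub> y \<oplus>\<^bsub>rows R\<^esub> co v 0 \<odot>\<^bsub>rows R\<^esub> y"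
    if "u \<in> carrier (rows R)" "v \<in> carrier (rows R)" for u v
    unfolding co_add by (rule rows.smult_l_distr[OF rows_co[OF that(1)] rows_co[OF that(2)] y])
  show "co (a \<odot>\<^bsub>rows R\<^esub> u) 0 \<odot>\<^bsub>rows R\<^esub> y = a \<odot>\<^bsub>rows R\<^esub> (co u 0 \<odot>\<^bsub>rows R\<^esub> y)"
    if "a \<in> carrier R" "u \<in> carrier (rows R)" for a u
    unfolding co_smult by (rule rows.smult_assoc[OF that(1) rows_co[OF that(2)] y])
qed

text \<open>The annihilator of a nonzero element of a simple module is a maximal left ideal.\<close>

lemma colon_max:
  assumes P: "lsub R (rows R) P" and N: "max_sub R (rows R) P N" and y: "y \<in> P" "y \<notin> N"
  shows "max_sub R (rows R) (free_carrier R 1) {u \<in> free_carrier R 1. co u 0 \<odot>\<^bsub>rows R\<^esub> y \<in> N}"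
    (is "max_sub _ _ ?F ?L")
proof -
  note Nl = max_sub_lsub[OF N]
  have yc: "y \<in> carrier (rows R)" by (rule lsub_subset[OF P y(1)])
  have Fc: "u \<in> carrier (rows R)" if "u \<in> ?F" for u using that free_carrier_subset by (rule subsetD[rotated])
  define h where "h u = co u 0 \<odot>\<^bsub>rows R\<^esub> y" for u
  have h: "h \<in> lin_maps R (rows R) (rows R)" unfolding h_def by (rule cyclic_map_linear[OF yc])
  have h0: "h \<zero>\<^bsub>rows R\<^esub> = \<zero>\<^bsub>rows R\<^esub>" by (rule lin_maps_zero[OF rows_left_module rows_left_module h])
  have hP: "h u \<in> P" if "u \<in> ?F" for u unfolding h_def by (rule lsub_smult[OF P rows_co[OF Fc[OF that]] y(1)])
  have unit: "unit_row R 0 \<in> ?F" by (rule unit_row_free) simp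
  have hunit: "h (unit_row R 0) = y" unfolding h_def by (simp add: unit_row_def rows.smult_one[OF yc])
  have L: "lsub R (rows R) {u \<in> ?F. h u \<in> N}"
    unfolding lsub_def[of R "rows R" "{u \<in> ?F. h u \<in> N}"]
  proof (intro conjI ballI)
    show "{u \<in> ?F. h u \<in> N} \<subseteq> carrier (rows R)" using Fc by (intro subsetI) simp
    show "\<zero>\<^bsub>rows R\<^esub> \<in> {u \<in> ?F. h u \<in> N}"
      by (intro CollectI conjI lsub_zero[OF lsub_free]) (simp only: h0 lsub_zero[OF Nl])
    show "u \<oplus>\<^bsub>rows R\<^esub> v \<in> {u \<in> ?F. h u \<in> N}" if "u \<in> {u \<in> ?F. h u \<in> N}" "v \<in> {u \<in> ?F. h u \<in> N}" for u v
      using that lsub_add[OF lsub_free, of u 1 v] lin_maps_add[OF h Fc Fc, of u v] lsub_add[OF Nl, of "h u" "h v"] by simp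
    show "a \<odot>\<^bsub>rows R\<^esub> u \<in> {u \<in> ?F. h u \<in> N}" if "a \<in> carrier R" "u \<in> {u \<in> ?F. h u \<in> N}" for a u
      using that lsub_smult[OF lsub_free, of a u 1] lin_maps_smult[OF h, of a u] Fc[of u] lsub_smult[OF Nl, of a "h u"] by simp
  qed
  have max: "L' = ?F" if L': "lsub R (rows R) L'" "L' \<subseteq> ?F" and u0: "u0 \<in> L'" "h u0 \<notin> N" and LL: "{u \<in> ?F. h u \<in> N} \<subseteq> L'" for L' u0
  proof (rule subset_antisym[OF L'(2)], rule subsetI)
    fix v assume v: "v \<in> ?F"
    have K: "lsub R (rows R) (h ` L')" by (rule lsub_image[OF rows_left_module rows_left_module h L'(1)])
    have KP: "h ` L' \<subseteq> P" using hP L'(2) by (intro image_subsetI) (drule (1) subsetD[rotated], simp)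
    have KN: "\<not> h ` L' \<subseteq> N" using u0 by (intro notI) (drule subsetD[OF _ imageI[OF u0(1)]], simp)
    obtain n k where nk: "n \<in> N" "k \<in> h ` L'" "y = n \<oplus>\<^bsub>rows R\<^esub> k"
      by (rule rows.max_sub_plus[OF P N K KP KN y(1)])
    from nk(2) obtain u where u: "u \<in> L'" "k = h u" by (elim imageE)
    have uF: "u \<in> ?F" using L'(2) u(1) by (rule subsetD)
    have nc: "n \<in> carrier (rows R)" by (rule lsub_subset[OF Nl nk(1)])
    have vc: "co v 0 \<in> carrier R" by (rule rows_co[OF Fc[OF v]])
    define w where "w = co v 0 \<odot>\<^bsub>rows R\<^esub> u"
    have w: "w \<in> L'" unfolding w_def by (rule lsub_smult[OF L'(1) vc u(1)])
    have wF: "w \<in> ?F" using L'(2) w by (rule subsetD)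
    have hw: "h w = co v 0 \<odot>\<^bsub>rows R\<^esub> h u" unfolding w_def by (rule lin_maps_smult[OF h vc Fc[OF uF]])
    have huc: "h u \<in> carrier (rows R)" by (rule lin_maps_closed[OF h Fc[OF uF]])
    have "h v = co v 0 \<odot>\<^bsub>rows R\<^esub> n \<oplus>\<^bsub>rows R\<^esub> h w"
      unfolding hw h_def[of v] nk(3) u(2) by (rule rows.smult_r_distr[OF vc nc huc])
    also have "\<dots> \<ominus>\<^bsub>rows R\<^esub> h w = co v 0 \<odot>\<^bsub>rows R\<^esub> n"
      using rows.smult_closed[OF vc nc] lin_maps_closed[OF h Fc[OF wF]] by (simp add: a_minus_def rows.M.a_assoc rows.M.r_neg)
    finally have "h v \<ominus>\<^bsub>rows R\<^esub> h w = co v 0 \<odot>\<^bsub>rows R\<^esub> n" .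
    then have "h (v \<ominus>\<^bsub>rows R\<^esub> w) \<in> N"
      unfolding lin_maps_minus[OF rows_left_module rows_left_module h Fc[OF v] Fc[OF wF]] using lsub_smult[OF Nl vc nk(1)] by simp
    moreover have "v \<ominus>\<^bsub>rows R\<^esub> w \<in> ?F" by (rule rows.lsub_diff[OF lsub_free v wF])
    ultimately have "v \<ominus>\<^bsub>rows R\<^esub> w \<in> L'" using LL by (intro subsetD[OF LL] CollectI conjI)
    then have "(v \<ominus>\<^bsub>rows R\<^esub> w) \<oplus>\<^bsub>rows R\<^esub> w \<in> L'" by (rule lsub_add[OF L'(1) _ w])
    then show "v \<in> L'" using Fc[OF v] Fc[OF wF] by (simp add: a_minus_def rows.M.a_assoc rows.M.l_neg)
  qed
  show ?thesis unfolding h_def[symmetric] max_sub_def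
  proof (intro conjI allI impI)
    show "lsub R (rows R) {u \<in> ?F. h u \<in> N}" by (rule L)
    show "{u \<in> ?F. h u \<in> N} \<subseteq> ?F" by (intro subsetI) simp
    show "{u \<in> ?F. h u \<in> N} \<noteq> ?F" 
    proof
      assume eq: "{u \<in> ?F. h u \<in> N} = ?F"
      have "unit_row R 0 \<in> {u \<in> ?F. h u \<in> N}" unfolding eq by (rule unit)
      then show False using hunit y(2) by simp
    qed
    fix L' assume L': "lsub R (rows R) L'" "{u \<in> ?F. h u \<in> N} \<subseteq> L'" "L' \<subseteq> ?F" "L' \<noteq> ?F"
    show "L' = {u \<in> ?F. h u \<in> N}"
    proof (rule subset_antisym[OF subsetI L'(2)])
      fix u assume u: "u \<in> L'"
      have "h u \<in> N" by (rule ccontr) (use max[OF L'(1,3) u _ L'(2)] L'(4) in simp)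
      then show "u \<in> {u \<in> ?F. h u \<in> N}" using subsetD[OF L'(3) u] by simp
    qed
  qed
qed

text \<open>The simple module \<open>P / N\<close> is isomorphic to one of finitely many, although its annihilators, for the
  various generators, may be infinitely many maximal left ideals. Given one of them, say \<open>L0\<close>, take the
  first \<open>i\<close> such that \<open>L 0 \<inter> \<dots> \<inter> L i\<close> lies in \<open>L0\<close>. An element of \<open>L 0 \<inter> \<dots> \<inter> L (i - 1)\<close> that is
  congruent to \<open>1\<close> modulo \<open>L i\<close> moves the generator to one whose annihilator is \<open>L i\<close>.\<close>

lemma simple_quotient_type:
  assumes L: "irredundant R (rows R) (free_carrier R 1) m L" "dominating R (rows R) (free_carrier R 1) m L"
    and P: "lsub R (rows R) P" and N: "max_sub R (rows R) P N"
  shows "\<exists>i < m. \<exists>p \<in> P. p \<notin> N \<and> (\<forall>a \<in> carrier R. a \<odot>\<^bsub>rows R\<^esub> p \<in> N \<longleftrightarrow> a \<in> ann (L i))"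
proof -
  let ?F = "free_carrier R 1"
  have Fc: "u \<in> carrier (rows R)" if "u \<in> ?F" for u using that free_carrier_subset by (rule subsetD[rotated])
  have unit: "unit_row R 0 \<in> ?F" by (rule unit_row_free) simp
  note Nl = max_sub_lsub[OF N]
  obtain p0 where p0: "p0 \<in> P" "p0 \<notin> N" using max_sub_subset[OF N] max_sub_proper[OF N] by blast
  have p0c: "p0 \<in> carrier (rows R)" by (rule lsub_subset[OF P p0(1)])
  define L0 where "L0 = {u \<in> ?F. co u 0 \<odot>\<^bsub>rows R\<^esub> p0 \<in> N}"
  have L0: "max_sub R (rows R) ?F L0" unfolding L0_def by (rule colon_max[OF P N p0])
  note L0l = max_sub_lsub[OF L0]
  define W where "W i = {u \<in> ?F. \<forall>j < i. u \<in> L j}" for i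
  have Lm: "max_sub R (rows R) ?F (L i)" if "i < m" for i by (rule irredundant_max[OF L(1) that])
  define r where "r = (LEAST i. W i \<subseteq> L0)"
  have Wm: "W m \<subseteq> L0" unfolding W_def by (intro subsetI) (elim CollectE conjE, rule dominatingD[OF L(2) L0], simp_all)
  have r: "W r \<subseteq> L0" unfolding r_def by (rule LeastI[of "\<lambda>i. W i \<subseteq> L0" m, OF Wm])
  have rm: "r \<le> m" unfolding r_def by (rule Least_le[of "\<lambda>i. W i \<subseteq> L0" m, OF Wm])
  have "W 0 = ?F" unfolding W_def by simp
  then have "r \<noteq> 0" using r max_sub_subset[OF L0] max_sub_proper[OF L0] by (intro notI) simp
  then obtain i where i: "r = Suc i" by (cases r) simp_all
  have im: "i < m" using rm i by simp
  have Wi: "\<not> W i \<subseteq> L0" by (rule not_less_Least[of i "\<lambda>i. W i \<subseteq> L0"]) (use i in \<open>simp add: r_def\<close>)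
  have WL: "u \<in> L0" if "u \<in> W i" "u \<in> L i" for u
    by (rule subsetD[OF r]) (use that i in \<open>simp add: W_def less_Suc_eq\<close>)
  have Wl: "lsub R (rows R) (W i)" unfolding W_def by (rule rows.lsub_Inter[OF lsub_free max_sub_lsub[OF Lm]]) (use im in simp)
  have WF: "W i \<subseteq> ?F" unfolding W_def by (rule Collect_subset)
  obtain q where q: "q \<in> ?F" "q \<notin> L i" "\<forall>j < i. q \<in> L j" using L(1) im unfolding irredundant_def by blast
  then have WnL: "\<not> W i \<subseteq> L i" unfolding W_def by (intro notI) (drule subsetD[of _ _ q], simp_all)
  note Ll = max_sub_lsub[OF Lm[OF im]]
  obtain n x where nx: "n \<in> L i" "x \<in> W i" "unit_row R 0 = n \<oplus>\<^bsub>rows R\<^esub> x"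
    by (rule rows.max_sub_plus[OF lsub_free Lm[OF im] Wl WF WnL unit])
  have nc: "n \<in> carrier (rows R)" and xF: "x \<in> ?F" using lsub_subset[OF Ll nx(1)] subsetD[OF WF nx(2)] by simp_all
  have xc: "x \<in> carrier (rows R)" by (rule Fc[OF xF])
  have split: "u = co u 0 \<odot>\<^bsub>rows R\<^esub> n \<oplus>\<^bsub>rows R\<^esub> co u 0 \<odot>\<^bsub>rows R\<^esub> x" if u: "u \<in> ?F" for u
    using free_one_cyclic[OF u] rows.smult_r_distr[OF rows_co[OF Fc[OF u], of 0] nc xc] nx(3) by simp
  have co_smult: "co (a \<odot>\<^bsub>rows R\<^esub> x) 0 = a \<otimes> co x 0" if "a \<in> carrier R" for a
    by (simp add: rows_simps)
  have xL0: "x \<notin> L0"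
  proof
    assume x: "x \<in> L0"
    have "w \<in> L0" if w: "w \<in> W i" for w
    proof -
      have wF: "w \<in> ?F" using WF w by (rule subsetD)
      have wc: "co w 0 \<in> carrier R" by (rule rows_co[OF Fc[OF wF]])
      let ?n = "co w 0 \<odot>\<^bsub>rows R\<^esub> n" and ?x = "co w 0 \<odot>\<^bsub>rows R\<^esub> x"
      have "?n = w \<ominus>\<^bsub>rows R\<^esub> ?x"
        using rows.smult_closed[OF wc nc] rows.smult_closed[OF wc xc]
        by (subst split[OF wF]) (simp add: a_minus_def rows.M.a_assoc rows.M.r_neg)
      then have "?n \<in> W i" using rows.lsub_diff[OF Wl w lsub_smult[OF Wl wc nx(2)]] by simp
      then have "?n \<in> L0" by (rule WL) (rule lsub_smult[OF Ll wc nx(1)])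
      then have "?n \<oplus>\<^bsub>rows R\<^esub> ?x \<in> L0" by (rule lsub_add[OF L0l _ lsub_smult[OF L0l wc x]])
      then show ?thesis using split[OF wF] by simp
    qed
    then show False using Wi by (elim notE) (rule subsetI)
  qed
  define p where "p = co x 0 \<odot>\<^bsub>rows R\<^esub> p0"
  have pP: "p \<in> P" unfolding p_def by (rule lsub_smult[OF P rows_co[OF xc] p0(1)])
  have pN: "p \<notin> N" using xL0 xF unfolding L0_def p_def by simp
  define L1 where "L1 = {u \<in> ?F. co u 0 \<odot>\<^bsub>rows R\<^esub> p \<in> N}"
  have L1: "max_sub R (rows R) ?F L1" unfolding L1_def by (rule colon_max[OF P N pP pN])
  have "L i \<subseteq> L1"
  proof
    fix u assume u: "u \<in> L i"
    have uF: "u \<in> ?F" by (rule subsetD[OF max_sub_subset[OF Lm[OF im]] u])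
    have uc: "co u 0 \<in> carrier R" by (rule rows_co[OF Fc[OF uF]])
    let ?n = "co u 0 \<odot>\<^bsub>rows R\<^esub> n" and ?x = "co u 0 \<odot>\<^bsub>rows R\<^esub> x"
    have xe: "?x = u \<ominus>\<^bsub>rows R\<^esub> ?n"
      using rows.smult_closed[OF uc nc] rows.smult_closed[OF uc xc]
      by (subst (2) split[OF uF]) (simp add: a_minus_def rows.M.a_comm[of ?n] rows.M.a_assoc rows.M.r_neg)
    have "?x \<in> L i" unfolding xe by (rule rows.lsub_diff[OF Ll u lsub_smult[OF Ll uc nx(1)]])
    then have "?x \<in> L0" by (rule WL[OF lsub_smult[OF Wl uc nx(2)]])
    then have "(co u 0 \<otimes> co x 0) \<odot>\<^bsub>rows R\<^esub> p0 \<in> N" unfolding L0_def using co_smult[OF uc] by simp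
    then show "u \<in> L1" unfolding L1_def p_def
      using uF rows.smult_assoc[OF uc rows_co[OF xc] p0c, of 0] by simp
  qed
  then have eq: "L1 = L i"
    by (rule max_sub_max[OF Lm[OF im] max_sub_lsub[OF L1] _ max_sub_subset[OF L1] max_sub_proper[OF L1]])
  have "a \<odot>\<^bsub>rows R\<^esub> p \<in> N \<longleftrightarrow> a \<in> ann (L i)" if a: "a \<in> carrier R" for a
  proof -
    have "a \<odot>\<^bsub>rows R\<^esub> unit_row R 0 \<in> ?F" by (rule lsub_smult[OF lsub_free a unit])
    moreover have "co (a \<odot>\<^bsub>rows R\<^esub> unit_row R 0) 0 = a" using a by (simp add: unit_row_def rows_simps)
    ultimately show ?thesis unfolding ann_def eq[symmetric] L1_def using a by simp
  qed
  then show ?thesis using im pP pN by (intro exI[of _ i] conjI bexI[of _ p] ballI)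
qed

end

section \<open>Comparing projective modules by their simple quotients\<close>

context ring
begin

text \<open>A frame records a dominating family of simple quotients \<open>P / N i\<close>, the isomorphism type
  \<open>\<tau> i\<close> of each, and a generator \<open>p i\<close> that exhibits it.\<close>

definition frame where
  "frame m L P n N \<tau> p \<longleftrightarrow> irredundant R (rows R) P n N \<and> dominating R (rows R) P n N \<and>
    (\<forall>i < n. \<tau> i < m \<and> p i \<in> P \<and> p i \<notin> N i \<and> (\<forall>a \<in> carrier R. a \<odot>\<^bsub>rows R\<^esub> p i \<in> N i \<longleftrightarrow> a \<in> ann (L (\<tau> i))))"

lemma frame_exists:
  fixes m :: nat
  assumes L: "irredundant R (rows R) (free_carrier R 1) m L" "dominating R (rows R) (free_carrier R 1) m L"
    and P: "lsub R (rows R) P" and N: "irredundant R (rows R) P n N" "dominating R (rows R) P n N"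
  shows "\<exists>\<tau> p. frame m L P n N \<tau> p"
proof -
  define T where "T i t p \<longleftrightarrow> t < m \<and> p \<in> P \<and> p \<notin> N i \<and> (\<forall>a \<in> carrier R. a \<odot>\<^bsub>rows R\<^esub> p \<in> N i \<longleftrightarrow> a \<in> ann (L t))" for i t p
  have "\<exists>t p. T i t p" if i: "i < n" for i
    using simple_quotient_type[OF L P irredundant_max[OF N(1) i]] unfolding T_def by (elim exE bexE conjE) (intro exI conjI)
  then have "\<exists>\<tau> p. \<forall>i < n. T i (\<tau> i) (p i)" by metis
  then obtain \<tau> p where \<tau>: "\<forall>i < n. T i (\<tau> i) (p i)" by (elim exE)
  show ?thesis
    unfolding frame_def by (rule exI[of _ \<tau>], rule exI[of _ p], intro conjI N) (use \<tau> in \<open>simp only: T_def\<close>)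
qed

text \<open>The projective module \<open>P\<close> maps onto \<open>Q\<close> if every simple module occurs in \<open>P\<close> at least as
  often as in \<open>Q\<close>: a map with prescribed effect on the simple quotients exists because \<open>P\<close> is
  projective, and it is onto because no maximal submodule of \<open>Q\<close> contains its image.\<close>

lemma frame_surjection:
  assumes P: "retract k P" and Q: "lsub R (rows R) Q" "Q \<subseteq> free_carrier R l" and fg: "fin_gen R (rows R) Q"
    and fP: "frame m L P n N \<tau> p" and fQ: "frame m L Q n' N' \<tau>' q"
    and \<pi>: "inj_on \<pi> {..<n'}" "\<And>i. i < n' \<Longrightarrow> \<pi> i < n" "\<And>i. i < n' \<Longrightarrow> \<tau> (\<pi> i) = \<tau>' i"
  shows "\<exists>F \<in> lin_maps R (free R k) (free R l). F ` P = Q"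
proof -
  from P obtain e where Pl: "lsub R (rows R) P" and PF: "P \<subseteq> free_carrier R k"
    and e: "e \<in> lin_maps R (free R k) (free R k)" "e ` free_carrier R k \<subseteq> P" "\<And>x. x \<in> P \<Longrightarrow> e x = x"
    unfolding retract_def by (elim conjE bexE) blast
  have eP: "e x \<in> P" if "x \<in> free_carrier R k" for x by (rule subsetD[OF e(2) imageI[OF that]])
  have irP: "irredundant R (rows R) P n N" and irQ: "irredundant R (rows R) Q n' N'" and dQ: "dominating R (rows R) Q n' N'"
    using fP fQ by (simp_all add: frame_def)
  have p: "p i \<in> P" "p i \<notin> N i" if "i < n" for i using fP that by (simp_all add: frame_def)
  have q: "q i \<in> Q" "q i \<notin> N' i" if "i < n'" for i using fQ that by (simp_all add: frame_def)
  have ann: "a \<odot>\<^bsub>rows R\<^esub> p (\<pi> i) \<in> N (\<pi> i) \<longleftrightarrow> a \<odot>\<^bsub>rows R\<^esub> q i \<in> N' i" if "i < n'" "a \<in> carrier R" for i a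
    using fP fQ \<pi>(2,3)[OF that(1)] that by (simp add: frame_def)
  have mP: "max_sub R (rows R) P (N i)" if "i < n" for i by (rule irredundant_max[OF irP that])
  have mQ: "max_sub R (rows R) Q (N' i)" if "i < n'" for i by (rule irredundant_max[OF irQ that])
  note lN = max_sub_lsub[OF mP] and lN' = max_sub_lsub[OF mQ]
  note lN\<pi> = lN[OF \<pi>(2)] and p\<pi> = p[OF \<pi>(2)]
  have pc: "p i \<in> carrier (rows R)" if "i < n" for i by (rule lsub_subset[OF Pl p(1)[OF that]])
  have qc: "q i \<in> carrier (rows R)" if "i < n'" for i by (rule lsub_subset[OF Q(1) q(1)[OF that]])
  define c where "c a i = (SOME b. b \<in> carrier R \<and> cong_mod (rows R) (N (\<pi> i)) (e (unit_row R a)) (b \<odot>\<^bsub>rows R\<^esub> p (\<pi> i)))" for a i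
  have c: "c a i \<in> carrier R" "cong_mod (rows R) (N (\<pi> i)) (e (unit_row R a)) (c a i \<odot>\<^bsub>rows R\<^esub> p (\<pi> i))"
    if "a < k" "i < n'" for a i
  proof -
    have "\<exists>b. b \<in> carrier R \<and> cong_mod (rows R) (N (\<pi> i)) (e (unit_row R a)) (b \<odot>\<^bsub>rows R\<^esub> p (\<pi> i))"
      by (rule rows.max_sub_cyclic[OF Pl mP[OF \<pi>(2)[OF that(2)]] p\<pi>[OF that(2)] eP[OF unit_row_free[OF that(1)]]])
        (intro exI conjI)
    from someI_ex[OF this] show "c a i \<in> carrier R" "cong_mod (rows R) (N (\<pi> i)) (e (unit_row R a)) (c a i \<odot>\<^bsub>rows R\<^esub> p (\<pi> i))"
      unfolding c_def by simp_all
  qed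
  define y where "y a = (SOME y. y \<in> Q \<and> (\<forall>i < n'. cong_mod (rows R) (N' i) y (c a i \<odot>\<^bsub>rows R\<^esub> q i)))" for a
  have y: "y a \<in> Q" "\<And>i. i < n' \<Longrightarrow> cong_mod (rows R) (N' i) (y a) (c a i \<odot>\<^bsub>rows R\<^esub> q i)" if "a < k" for a
  proof -
    have "\<exists>y. y \<in> Q \<and> (\<forall>i < n'. cong_mod (rows R) (N' i) y (c a i \<odot>\<^bsub>rows R\<^esub> q i))"
      by (rule rows.chinese_remainder[OF Q(1) irQ, unfolded Bex_def]) (rule lsub_smult[OF Q(1) c(1)[OF that] q(1)])
    from someI_ex[OF this] show "y a \<in> Q" "\<And>i. i < n' \<Longrightarrow> cong_mod (rows R) (N' i) (y a) (c a i \<odot>\<^bsub>rows R\<^esub> q i)"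
      unfolding y_def by simp_all
  qed
  have yc: "y a \<in> carrier (rows R)" if "a < k" for a by (rule lsub_subset[OF Q(1) y(1)[OF that]])
  define F where "F = free_map (rows R) k y"
  have F: "F \<in> lin_maps R (rows R) (rows R)" unfolding F_def by (rule free_map_linear[OF rows_left_module yc])
  have Funit: "F (unit_row R a) = y a" if "a < k" for a unfolding F_def by (rule free_map_unit[OF rows_left_module yc that])
  have FQ: "F x \<in> Q" if "x \<in> carrier (rows R)" for x
    unfolding F_def free_map_def by (rule rows.lsub_finsum[OF Q(1)]) (auto intro!: lsub_smult[OF Q(1)] rows_co[OF that] y(1))
  have Fkl: "F \<in> lin_maps R (free R k) (free R l)"
    using lin_maps_restrict_cod[OF lin_maps_restrict_dom[OF F free_carrier_subset[of R k]], of "free_carrier R l"] FQ Q(2) free_carrier_subset[of R k]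
    by (simp add: subset_iff)
  have Fc: "x \<in> carrier (rows R)" if "x \<in> free_carrier R k" for x by (rule subsetD[OF free_carrier_subset that])
  have e_add: "e (x \<oplus>\<^bsub>rows R\<^esub> z) = e x \<oplus>\<^bsub>rows R\<^esub> e z" if "x \<in> free_carrier R k" "z \<in> free_carrier R k" for x z
    using lin_maps_add[OF e(1), of x z] that by simp
  have e_smult: "e (a \<odot>\<^bsub>rows R\<^esub> x) = a \<odot>\<^bsub>rows R\<^esub> e x" if "a \<in> carrier R" "x \<in> free_carrier R k" for a x
    using lin_maps_smult[OF e(1), of a x] that by simp
  have key: "\<exists>v \<in> carrier R. cong_mod (rows R) (N (\<pi> i)) (e x) (v \<odot>\<^bsub>rows R\<^esub> p (\<pi> i)) \<and> cong_mod (rows R) (N' i) (F x) (v \<odot>\<^bsub>rows R\<^esub> q i)"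
    if i: "i < n'" and x: "x \<in> free_carrier R k" for i x
  proof -
    define S where "S = {x \<in> free_carrier R k. \<exists>v \<in> carrier R. cong_mod (rows R) (N (\<pi> i)) (e x) (v \<odot>\<^bsub>rows R\<^esub> p (\<pi> i)) \<and>
      cong_mod (rows R) (N' i) (F x) (v \<odot>\<^bsub>rows R\<^esub> q i)}"
    note lNi = lN\<pi>[OF i] and lN'i = lN'[OF i] and pci = pc[OF \<pi>(2)[OF i]] and qci = qc[OF i]
    have S_smult: "a \<odot>\<^bsub>rows R\<^esub> x \<in> S" if a: "a \<in> carrier R" and x: "x \<in> S" for a x
    proof -
      from x obtain v where v: "v \<in> carrier R" "cong_mod (rows R) (N (\<pi> i)) (e x) (v \<odot>\<^bsub>rows R\<^esub> p (\<pi> i))"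
          "cong_mod (rows R) (N' i) (F x) (v \<odot>\<^bsub>rows R\<^esub> q i)" and xF: "x \<in> free_carrier R k"
        unfolding S_def by (elim CollectE conjE bexE)
      show ?thesis unfolding S_def
      proof (intro CollectI conjI bexI[of _ "a \<otimes> v"])
        show "a \<odot>\<^bsub>rows R\<^esub> x \<in> free_carrier R k" by (rule lsub_smult[OF lsub_free a xF])
        show "cong_mod (rows R) (N (\<pi> i)) (e (a \<odot>\<^bsub>rows R\<^esub> x)) ((a \<otimes> v) \<odot>\<^bsub>rows R\<^esub> p (\<pi> i))"
          unfolding e_smult[OF a xF] rows.smult_assoc[OF a v(1) pci] by (rule rows.cong_mod_smult[OF lNi a v(2)])
        show "cong_mod (rows R) (N' i) (F (a \<odot>\<^bsub>rows R\<^esub> x)) ((a \<otimes> v) \<odot>\<^bsub>rows R\<^esub> q i)"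
          unfolding lin_maps_smult[OF F a Fc[OF xF]] rows.smult_assoc[OF a v(1) qci] by (rule rows.cong_mod_smult[OF lN'i a v(3)])
      qed (use a v(1) in simp)
    qed
    have S_add: "x \<oplus>\<^bsub>rows R\<^esub> x' \<in> S" if x: "x \<in> S" and x': "x' \<in> S" for x x'
    proof -
      from x obtain v where v: "v \<in> carrier R" "cong_mod (rows R) (N (\<pi> i)) (e x) (v \<odot>\<^bsub>rows R\<^esub> p (\<pi> i))"
          "cong_mod (rows R) (N' i) (F x) (v \<odot>\<^bsub>rows R\<^esub> q i)" and xF: "x \<in> free_carrier R k"
        unfolding S_def by (elim CollectE conjE bexE)
      from x' obtain v' where v': "v' \<in> carrier R" "cong_mod (rows R) (N (\<pi> i)) (e x') (v' \<odot>\<^bsub>rows R\<^esub> p (\<pi> i))"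
          "cong_mod (rows R) (N' i) (F x') (v' \<odot>\<^bsub>rows R\<^esub> q i)" and x'F: "x' \<in> free_carrier R k"
        unfolding S_def by (elim CollectE conjE bexE)
      show ?thesis unfolding S_def
      proof (intro CollectI conjI bexI[of _ "v \<oplus> v'"])
        show "x \<oplus>\<^bsub>rows R\<^esub> x' \<in> free_carrier R k" by (rule lsub_add[OF lsub_free xF x'F])
        show "cong_mod (rows R) (N (\<pi> i)) (e (x \<oplus>\<^bsub>rows R\<^esub> x')) ((v \<oplus> v') \<odot>\<^bsub>rows R\<^esub> p (\<pi> i))"
          unfolding e_add[OF xF x'F] rows.smult_l_distr[OF v(1) v'(1) pci] by (rule rows.cong_mod_add[OF lNi v(2) v'(2)])
        show "cong_mod (rows R) (N' i) (F (x \<oplus>\<^bsub>rows R\<^esub> x')) ((v \<oplus> v') \<odot>\<^bsub>rows R\<^esub> q i)"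
          unfolding lin_maps_add[OF F Fc[OF xF] Fc[OF x'F]] rows.smult_l_distr[OF v(1) v'(1) qci] by (rule rows.cong_mod_add[OF lN'i v(3) v'(3)])
      qed (use v(1) v'(1) in simp)
    qed
    have zF: "\<zero>\<^bsub>rows R\<^esub> \<in> free_carrier R k" by (rule lsub_zero[OF lsub_free])
    have "e \<zero>\<^bsub>rows R\<^esub> = \<zero>\<^bsub>rows R\<^esub>" by (rule e(3)[OF lsub_zero[OF Pl]])
    moreover have "F \<zero>\<^bsub>rows R\<^esub> = \<zero>\<^bsub>rows R\<^esub>" by (rule lin_maps_zero[OF rows_left_module rows_left_module F])
    ultimately have zS: "\<zero>\<^bsub>rows R\<^esub> \<in> S"
      unfolding S_def
      by (intro CollectI conjI bexI[of _ \<zero>] zF)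
        (simp_all add: rows.smult_zero_left pci qci rows.cong_mod_refl[OF lNi] rows.cong_mod_refl[OF lN'i])
    have Sl: "lsub R (rows R) S"
      unfolding lsub_def[of R "rows R" S]
      by (intro conjI ballI zS S_add S_smult subsetI) (simp_all add: S_def Fc)
    have unitS: "unit_row R a \<in> S" if "a < k" for a
      unfolding S_def
      by (intro CollectI conjI bexI[of _ "c a i"] unit_row_free[OF that] c[OF that i]) (simp add: Funit[OF that] y(2)[OF that i])
    have "x \<in> S"
      by (subst free_expansion[OF x, symmetric], rule rows.lsub_finsum[OF Sl]) (auto intro!: S_smult unitS rows_co[OF Fc[OF x]])
    then show ?thesis unfolding S_def by (elim CollectE conjE)
  qed
  have "F ` P = Q"
  proof (rule ccontr)
    assume neq: "F ` P \<noteq> Q"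
    have FPl: "lsub R (rows R) (F ` P)" by (rule lsub_image[OF rows_left_module rows_left_module F Pl])
    have FPQ: "F ` P \<subseteq> Q" by (rule image_subsetI) (rule FQ[OF lsub_subset[OF Pl]])
    obtain N'' where N'': "max_sub R (rows R) Q N''" "F ` P \<subseteq> N''" using max_sub_exists[OF fg FPl FPQ neq] by (elim exE conjE)
    note lN'' = max_sub_lsub[OF N''(1)]
    have "z \<in> N''" if z: "z \<in> Q" for z
    proof -
      have zc: "z \<in> carrier (rows R)" by (rule lsub_subset[OF Q(1) z])
      define b where "b i = (SOME b. b \<in> carrier R \<and> cong_mod (rows R) (N' i) z (b \<odot>\<^bsub>rows R\<^esub> q i))" for i
      have b: "b i \<in> carrier R" "cong_mod (rows R) (N' i) z (b i \<odot>\<^bsub>rows R\<^esub> q i)" if i: "i < n'" for i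
      proof -
        have "\<exists>b. b \<in> carrier R \<and> cong_mod (rows R) (N' i) z (b \<odot>\<^bsub>rows R\<^esub> q i)"
          by (rule rows.max_sub_cyclic[OF Q(1) mQ[OF i] q[OF i] z]) (intro exI conjI)
        from someI_ex[OF this] show "b i \<in> carrier R" "cong_mod (rows R) (N' i) z (b i \<odot>\<^bsub>rows R\<^esub> q i)"
          unfolding b_def by simp_all
      qed
      define t where "t j = (if j \<in> \<pi> ` {..<n'} then b (inv_into {..<n'} \<pi> j) \<odot>\<^bsub>rows R\<^esub> p j else \<zero>\<^bsub>rows R\<^esub>)" for j
      have tP: "t j \<in> P" if j: "j < n" for j
      proof (cases "j \<in> \<pi> ` {..<n'}")
        case True
        then have "inv_into {..<n'} \<pi> j < n'" using inv_into_into[OF True] by simp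
        then show ?thesis unfolding t_def using True by (simp add: lsub_smult[OF Pl b(1) p(1)[OF j]])
      qed (simp add: t_def lsub_zero[OF Pl])
      have t\<pi>: "t (\<pi> i) = b i \<odot>\<^bsub>rows R\<^esub> p (\<pi> i)" if "i < n'" for i
        unfolding t_def using that inv_into_f_f[OF \<pi>(1), of i] by simp
      obtain x where x: "x \<in> P" "\<forall>j < n. cong_mod (rows R) (N j) x (t j)"
        by (rule bexE[OF rows.chinese_remainder[OF Pl irP, of t]]) (rule tP)
      have xF: "x \<in> free_carrier R k" by (rule subsetD[OF PF x(1)])
      have "z \<ominus>\<^bsub>rows R\<^esub> F x \<in> N' i" if i: "i < n'" for i
      proof -
        note lNi = lN\<pi>[OF i] and lN'i = lN'[OF i] and pci = pc[OF \<pi>(2)[OF i]] and qci = qc[OF i]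
        obtain v where v: "v \<in> carrier R" "cong_mod (rows R) (N (\<pi> i)) x (v \<odot>\<^bsub>rows R\<^esub> p (\<pi> i))"
          "cong_mod (rows R) (N' i) (F x) (v \<odot>\<^bsub>rows R\<^esub> q i)"
          using key[OF i xF] unfolding e(3)[OF x(1)] by (elim bexE conjE)
        have xb: "cong_mod (rows R) (N (\<pi> i)) x (b i \<odot>\<^bsub>rows R\<^esub> p (\<pi> i))" using x(2) \<pi>(2)[OF i] by (simp flip: t\<pi>[OF i])
        have "cong_mod (rows R) (N (\<pi> i)) (b i \<odot>\<^bsub>rows R\<^esub> p (\<pi> i)) (v \<odot>\<^bsub>rows R\<^esub> p (\<pi> i))"
          by (rule rows.cong_mod_trans[OF lNi rows.cong_mod_sym[OF lNi xb] v(2)])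
        then have "(b i \<ominus> v) \<odot>\<^bsub>rows R\<^esub> p (\<pi> i) \<in> N (\<pi> i)" by (simp only: rows.cong_mod_smult_diff[OF lNi b(1)[OF i] v(1) pci])
        then have "(b i \<ominus> v) \<odot>\<^bsub>rows R\<^esub> q i \<in> N' i" by (simp only: ann[OF i minus_closed[OF b(1)[OF i] v(1)]])
        then have "cong_mod (rows R) (N' i) (b i \<odot>\<^bsub>rows R\<^esub> q i) (v \<odot>\<^bsub>rows R\<^esub> q i)"
          by (simp only: rows.cong_mod_smult_diff[OF lN'i b(1)[OF i] v(1) qci])
        then have "cong_mod (rows R) (N' i) z (F x)"
          by (rule rows.cong_mod_trans[OF lN'i b(2)[OF i] rows.cong_mod_trans[OF lN'i _ rows.cong_mod_sym[OF lN'i v(3)]]])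
        then show ?thesis by (simp add: cong_mod_def)
      qed
      moreover have "z \<ominus>\<^bsub>rows R\<^esub> F x \<in> Q" by (rule rows.lsub_diff[OF Q(1) z FQ[OF Fc[OF xF]]])
      ultimately have "z \<ominus>\<^bsub>rows R\<^esub> F x \<in> N''" by (intro dominatingD[OF dQ N''(1)])
      then have "(z \<ominus>\<^bsub>rows R\<^esub> F x) \<oplus>\<^bsub>rows R\<^esub> F x \<in> N''"
        by (rule lsub_add[OF lN'' _ subsetD[OF N''(2) imageI[OF x(1)]]])
      then show "z \<in> N''" using zc lin_maps_closed[OF F Fc[OF xF]] by (simp add: a_minus_def rows.M.a_assoc rows.M.l_neg)
    qed
    then have "Q \<subseteq> N''" by (rule subsetI)
    then show False using max_sub_subset[OF N''(1)] max_sub_proper[OF N''(1)] by simp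
  qed
  then show ?thesis by (intro bexI[of _ F] Fkl)
qed

text \<open>The multiplicities decide whether the simple quotients of \<open>Q\<close> can be matched with those of \<open>P\<close>.\<close>

lemma frame_surjection_count:
  assumes P: "retract k P" and Q: "lsub R (rows R) Q" "Q \<subseteq> free_carrier R l" and fg: "fin_gen R (rows R) Q"
    and fP: "frame m L P n N \<tau> p" and fQ: "frame m L Q n' N' \<tau>' q"
    and count: "\<And>t. t < m \<Longrightarrow> card {i. i < n' \<and> \<tau>' i = t} \<le> card {i. i < n \<and> \<tau> i = t}"
  shows "\<exists>F \<in> lin_maps R (free R k) (free R l). F ` P = Q"
proof -
  define f where "f t = (SOME f. f ` {i. i < n' \<and> \<tau>' i = t} \<subseteq> {i. i < n \<and> \<tau> i = t} \<and> inj_on f {i. i < n' \<and> \<tau>' i = t})" for t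
  have f: "f t ` {i. i < n' \<and> \<tau>' i = t} \<subseteq> {i. i < n \<and> \<tau> i = t}" "inj_on (f t) {i. i < n' \<and> \<tau>' i = t}" if "t < m" for t
  proof -
    have "\<exists>f. f ` {i. i < n' \<and> \<tau>' i = t} \<subseteq> {i. i < n \<and> \<tau> i = t} \<and> inj_on f {i. i < n' \<and> \<tau>' i = t}"
      by (rule card_le_inj) (use count[OF that] in simp_all)
    from someI_ex[OF this] show "f t ` {i. i < n' \<and> \<tau>' i = t} \<subseteq> {i. i < n \<and> \<tau> i = t}" "inj_on (f t) {i. i < n' \<and> \<tau>' i = t}"
      unfolding f_def by simp_all
  qed
  have \<tau>': "\<tau>' i < m" if "i < n'" for i using fQ that by (simp add: frame_def)
  have f': "f (\<tau>' i) i < n" "\<tau> (f (\<tau>' i) i) = \<tau>' i" if "i < n'" for i using subsetD[OF f(1)[OF \<tau>'[OF that]] imageI[of i]] that by simp_all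
  have "inj_on (\<lambda>i. f (\<tau>' i) i) {..<n'}"
  proof (rule inj_onI)
    fix i j assume ij: "i \<in> {..<n'}" "j \<in> {..<n'}" "f (\<tau>' i) i = f (\<tau>' j) j"
    then have eq: "\<tau>' i = \<tau>' j" using f'(2)[of i] f'(2)[of j] by simp
    show "i = j" by (rule inj_onD[OF f(2)[OF \<tau>'[of j]]]) (use ij eq in simp_all)
  qed
  from frame_surjection[OF P Q fg fP fQ this f'] show ?thesis .
qed

text \<open>A surjection onto a projective module splits, so the kernel is a summand.\<close>

lemma retract_kernel:
  assumes P: "retract k P" and Q: "retract l Q" and F: "F \<in> lin_maps R (free R k) (free R l)" and FP: "F ` P = Q"
  shows "retract k {x \<in> P. F x = \<zero>\<^bsub>rows R\<^esub>}"
proof -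
  from P obtain e where Pl: "lsub R (rows R) P" and PF: "P \<subseteq> free_carrier R k"
    and e: "e \<in> lin_maps R (free R k) (free R k)" "e ` free_carrier R k \<subseteq> P" "\<forall>x \<in> P. e x = x"
    unfolding retract_def by (elim conjE bexE)
  from Q obtain e' where Ql: "lsub R (rows R) Q" and QF: "Q \<subseteq> free_carrier R l"
    and e': "e' \<in> lin_maps R (free R l) (free R l)" "e' ` free_carrier R l \<subseteq> Q" "\<forall>x \<in> Q. e' x = x"
    unfolding retract_def by (elim conjE bexE)
  have eP: "e x \<in> P" if "x \<in> free_carrier R k" for x by (rule subsetD[OF e(2) imageI[OF that]])
  have eQ: "e' x \<in> Q" if "x \<in> free_carrier R l" for x by (rule subsetD[OF e'(2) imageI[OF that]])
  have Fkl: "F x \<in> free_carrier R l" if "x \<in> free_carrier R k" for x using lin_maps_closed[OF F, of x] that by simp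
  have FP': "F \<in> lin_maps R (sub_rows R P) (free R l)" using lin_maps_restrict_dom[OF F, of P] PF by simp
  obtain s where s: "s \<in> lin_maps R (free R l) (sub_rows R P)" "\<And>u. u \<in> free_carrier R l \<Longrightarrow> F (s u) = e' u"
    by (rule free_lift[OF free_module sub_rows_module[OF Pl] e'(1) FP']) (use eQ in \<open>simp_all add: FP\<close>)
  have sP: "s u \<in> P" if "u \<in> free_carrier R l" for u using lin_maps_closed[OF s(1), of u] that by simp
  define g where "g x = s (F x)" for x
  have sF: "s \<in> lin_maps R (free R l) (free R k)"
    using lin_maps_restrict_cod[OF lin_maps_extend_cod[OF s(1)], of "free_carrier R k"] lsub_subset[OF Pl] sP PF by auto
  have g: "g \<in> lin_maps R (free R k) (free R k)" unfolding g_def by (rule lin_maps_comp[OF F sF])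
  have gP: "g x \<in> P" if "x \<in> free_carrier R k" for x unfolding g_def by (rule sP[OF Fkl[OF that]])
  have Fg: "F (g x) = F x" if "x \<in> P" for x
  proof -
    have "F x \<in> Q" unfolding FP[symmetric] by (rule imageI[OF that])
    then show ?thesis unfolding g_def using s(2)[OF subsetD[OF QF]] e'(3) by simp
  qed
  define d where "d x = e x \<oplus>\<^bsub>rows R\<^esub> (\<ominus> \<one>) \<odot>\<^bsub>rows R\<^esub> g (e x)" for x
  have ge: "(\<lambda>x. g (e x)) \<in> lin_maps R (free R k) (free R k)" by (rule lin_maps_comp[OF e(1) g])
  have d: "d \<in> lin_maps R (free R k) (free R k)"
    using lin_maps_diff[OF free_module free_module e(1) ge] unfolding d_def by simp
  have F0: "F \<zero>\<^bsub>rows R\<^esub> = \<zero>\<^bsub>rows R\<^esub>" using lin_maps_zero[OF free_module free_module F] by simp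
  have kl: "lsub R (rows R) {x \<in> P. F x = \<zero>\<^bsub>rows R\<^esub>}"
    unfolding lsub_def[of R "rows R" "{x \<in> P. F x = \<zero>\<^bsub>rows R\<^esub>}"]
  proof (intro conjI ballI)
    have PFd: "x \<in> free_carrier R k" if "x \<in> P" for x by (rule subsetD[OF PF that])
    show "{x \<in> P. F x = \<zero>\<^bsub>rows R\<^esub>} \<subseteq> carrier (rows R)" using lsub_subset[OF Pl] by (intro subsetI) simp
    show "\<zero>\<^bsub>rows R\<^esub> \<in> {x \<in> P. F x = \<zero>\<^bsub>rows R\<^esub>}" using F0 lsub_zero[OF Pl] by simp
    show "x \<oplus>\<^bsub>rows R\<^esub> z \<in> {x \<in> P. F x = \<zero>\<^bsub>rows R\<^esub>}"
      if "x \<in> {x \<in> P. F x = \<zero>\<^bsub>rows R\<^esub>}" "z \<in> {x \<in> P. F x = \<zero>\<^bsub>rows R\<^esub>}" for x z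
      using that lin_maps_add[OF F, of x z] PFd lsub_add[OF Pl, of x z] by simp
    show "a \<odot>\<^bsub>rows R\<^esub> x \<in> {x \<in> P. F x = \<zero>\<^bsub>rows R\<^esub>}" if "a \<in> carrier R" "x \<in> {x \<in> P. F x = \<zero>\<^bsub>rows R\<^esub>}" for a x
      using that lin_maps_smult[OF F, of a x] PFd lsub_smult[OF Pl, of a x] by (simp add: rows.smult_zero_right)
  qed
  have PFd: "x \<in> free_carrier R k" if "x \<in> P" for x by (rule subsetD[OF PF that])
  have dker: "d x \<in> P \<and> F (d x) = \<zero>\<^bsub>rows R\<^esub>" if x: "x \<in> free_carrier R k" for x
  proof
    have ex: "e x \<in> P" and gex: "g (e x) \<in> P" using eP[OF x] gP[OF PFd[OF eP[OF x]]] by simp_all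
    have m: "(\<ominus> \<one>) \<odot>\<^bsub>rows R\<^esub> g (e x) \<in> P" by (rule lsub_smult[OF Pl _ gex]) simp
    show "d x \<in> P" unfolding d_def by (rule lsub_add[OF Pl ex m])
    have c: "F (e x) \<in> carrier (rows R)" by (rule subsetD[OF free_carrier_subset Fkl[OF PFd[OF ex]]])
    have "F (d x) = F (e x) \<oplus>\<^bsub>rows R\<^esub> F ((\<ominus> \<one>) \<odot>\<^bsub>rows R\<^esub> g (e x))"
      unfolding d_def using lin_maps_add[OF F, of "e x"] PFd[OF ex] PFd[OF m] by simp
    also have "F ((\<ominus> \<one>) \<odot>\<^bsub>rows R\<^esub> g (e x)) = (\<ominus> \<one>) \<odot>\<^bsub>rows R\<^esub> F (e x)"
      using lin_maps_smult[OF F, of "\<ominus> \<one>" "g (e x)"] PFd[OF gex] Fg[OF ex] by simp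
    also have "F (e x) \<oplus>\<^bsub>rows R\<^esub> (\<ominus> \<one>) \<odot>\<^bsub>rows R\<^esub> F (e x) = \<zero>\<^bsub>rows R\<^esub>"
      using c by (simp add: rows.smult_minus_one rows.M.r_neg)
    finally show "F (d x) = \<zero>\<^bsub>rows R\<^esub>" .
  qed
  have s0: "s \<zero>\<^bsub>rows R\<^esub> = \<zero>\<^bsub>rows R\<^esub>"
    using lin_maps_zero[OF free_module sub_rows_module[OF Pl] s(1)] by simp
  have dfix: "d x = x" if x: "x \<in> P" "F x = \<zero>\<^bsub>rows R\<^esub>" for x
    unfolding d_def using e(3) x s0 lsub_subset[OF Pl x(1)]
    by (simp add: g_def rows.smult_zero_right)
  show ?thesis
    unfolding retract_def
    by (intro conjI kl bexI[of _ d] d image_subsetI ballI) (use PF dker dfix in auto)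
qed

end

section \<open>Finitely many projective modules generate the class group\<close>

text \<open>Dickson's lemma, by induction on the number of coordinates: the points of \<open>A\<close> not dominated by those
  that suffice for the coordinates in \<open>T\<close> lie in finitely many slices.\<close>

lemma finite_dominating_subset:
  fixes f :: "'x \<Rightarrow> 't \<Rightarrow> nat"
  assumes "finite T"
  shows "\<exists>B. finite B \<and> B \<subseteq> A \<and> (\<forall>a \<in> A. \<exists>b \<in> B. \<forall>t \<in> T. f b t \<le> f a t)"
  using assms
proof (induction T arbitrary: A rule: finite_induct)
  case empty
  then show ?case
  proof (cases "A = {}")
    case False
    then obtain a where "a \<in> A" by blast
    then show ?thesis by (intro exI[of _ "{a}"]) simp
  qed simp
next
  case (insert t T)
  obtain B0 where B0: "finite B0" "B0 \<subseteq> A" "\<forall>a \<in> A. \<exists>b \<in> B0. \<forall>t \<in> T. f b t \<le> f a t"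
    using insert.IH[of A] by blast
  obtain n where n: "\<forall>b \<in> B0. f b t < n" using finite_nat_set_iff_bounded[of "(\<lambda>b. f b t) ` B0"] B0(1) by auto
  have "\<forall>v. \<exists>B. finite B \<and> B \<subseteq> {a \<in> A. f a t = v} \<and> (\<forall>a \<in> {a \<in> A. f a t = v}. \<exists>b \<in> B. \<forall>t \<in> T. f b t \<le> f a t)"
    by (rule allI) (rule insert.IH)
  from choice[OF this] obtain B where
    "\<forall>v. finite (B v) \<and> B v \<subseteq> {a \<in> A. f a t = v} \<and> (\<forall>a \<in> {a \<in> A. f a t = v}. \<exists>b \<in> B v. \<forall>t \<in> T. f b t \<le> f a t)"
    by (elim exE)
  then have B: "\<And>v. finite (B v)" "\<And>v. B v \<subseteq> {a \<in> A. f a t = v}"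
      "\<And>v a. a \<in> {a \<in> A. f a t = v} \<Longrightarrow> \<exists>b \<in> B v. \<forall>t \<in> T. f b t \<le> f a t"
    by simp_all
  define C where "C = B0 \<union> (\<Union>v < n. B v)"
  have "\<exists>b \<in> C. \<forall>t \<in> insert t T. f b t \<le> f a t" if a: "a \<in> A" for a
  proof (cases "f a t < n")
    case True
    obtain b where b: "b \<in> B (f a t)" "\<forall>t \<in> T. f b t \<le> f a t" using B(3)[of a "f a t"] a by auto
    have "f b t = f a t" using subsetD[OF B(2) b(1)] by simp
    moreover have "b \<in> C" unfolding C_def using b(1) True by blast
    ultimately show ?thesis using b(2) by (intro bexI[of _ b]) simp_all
  next
    case False
    obtain b where b: "b \<in> B0" "\<forall>t \<in> T. f b t \<le> f a t" using B0(3) a by blast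
    have "f b t < n" using n b(1) by (rule bspec)
    then have "f b t \<le> f a t" using False by simp
    moreover have "b \<in> C" unfolding C_def using b(1) by blast
    ultimately show ?thesis using b(2) by (intro bexI[of _ b]) simp_all
  qed
  moreover have "finite C" unfolding C_def using B0(1) B(1) by simp
  moreover have "C \<subseteq> A" unfolding C_def using B0(2) B(2) by blast
  ultimately show ?case by (intro exI[of _ C] conjI ballI)
qed

text \<open>The successive intersections of such a family form a composition series of \<open>P\<close> modulo its
  radical.\<close>

lemma (in faithful_fg_module) semilocal_dominating_family:
  assumes sl: "semilocal R" and P: "lsub \<Lambda> (rows \<Lambda>) P" "P \<subseteq> free_carrier \<Lambda> k"
  obtains n N where "irredundant \<Lambda> (rows \<Lambda>) P n N" "dominating \<Lambda> (rows \<Lambda>) P n N"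
  by (rule dominating_family_exists[of \<Lambda> "rows \<Lambda>" P]) (rule no_descending_sequence[OF sl P])

context weighted_module
begin

text \<open>A projective \<open>\<Lambda>\<close>-module can be torsion over \<open>R\<close>; such a module does not reduce the rank when it is
  split off, but it has trivial class.\<close>

lemma module_class_rank_zero:
  assumes P: "lsub \<Lambda> (rows \<Lambda>) P" and zero: "weighted_module.module_class R M additive_nat rank_weight k P = 0"
  shows "module_class k P = \<one>\<^bsub>G\<^esub>"
proof -
  interpret rk: weighted_module R M additive_nat rank_weight
    by (intro weighted_module.intro faithful_fg_module_axioms rank_weight)
  have "partner k P \<noteq> {}" using partner_linear[OF P] by (simp add: linear_on_def)
  from rank_zero_imp_class_one[OF ideal_weight_axioms this, of "evaluations k"] zero show ?thesis
    by (simp add: module_class_def rk.module_class_def)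
qed

text \<open>By Dickson's lemma finitely many projective modules of positive rank suffice to split a nonzero
  summand off every other one, and the rank decreases.\<close>

lemma projective_classes_finitely_generated:
  assumes G: "comm_group G" and sl: "semilocal R"
  obtains S where "finite S" "S \<subseteq> carrier G" "projective_classes \<subseteq> generate G S"
proof -
  interpret G: comm_group G by (rule G)
  interpret rk: weighted_module R M additive_nat rank_weight
    by (intro weighted_module.intro faithful_fg_module_axioms rank_weight)
  have retr: "lsub \<Lambda> (rows \<Lambda>) P" "P \<subseteq> free_carrier \<Lambda> k" if "\<Lambda>.retract k P" for k P
    using that by (simp_all add: \<Lambda>.retract_def)
  have F1: "free_carrier \<Lambda> 1 \<subseteq> free_carrier \<Lambda> 1" by (rule subset_refl)
  obtain m L where L: "irredundant \<Lambda> (rows \<Lambda>) (free_carrier \<Lambda> 1) m L" "dominating \<Lambda> (rows \<Lambda>) (free_carrier \<Lambda> 1) m L"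
    by (rule semilocal_dominating_family[OF sl \<Lambda>.lsub_free F1])
  define is_count where "is_count P c \<longleftrightarrow> (\<exists>n N \<tau> p. \<Lambda>.frame m L P n N \<tau> p \<and> c = (\<lambda>t. card {i. i < n \<and> \<tau> i = t}))" for P c
  define count where "count P = (SOME c. is_count P c)" for P
  have count: "is_count P (count P)" if P: "\<Lambda>.retract k P" for k P
  proof -
    obtain n N where N: "irredundant \<Lambda> (rows \<Lambda>) P n N" "dominating \<Lambda> (rows \<Lambda>) P n N"
      by (rule semilocal_dominating_family[OF sl retr[OF P]])
    obtain \<tau> p where "\<Lambda>.frame m L P n N \<tau> p" using \<Lambda>.frame_exists[OF L retr(1)[OF P] N] by (elim exE)
    then have "is_count P (\<lambda>t. card {i. i < n \<and> \<tau> i = t})" unfolding is_count_def by (intro exI[of _ n] exI[of _ N] exI[of _ \<tau>] exI[of _ p] conjI refl)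
    then show ?thesis unfolding count_def by (rule someI[of "is_count P"])
  qed
  have surj: "\<exists>F \<in> lin_maps \<Lambda> (free \<Lambda> k) (free \<Lambda> l). F ` P = Q"
    if P: "\<Lambda>.retract k P" and Q: "\<Lambda>.retract l Q" and le: "\<forall>t \<in> {..<m}. count Q t \<le> count P t" for k P l Q
  proof -
    obtain n N \<tau> p where f: "\<Lambda>.frame m L P n N \<tau> p" "count P = (\<lambda>t. card {i. i < n \<and> \<tau> i = t})"
      using count[OF P] unfolding is_count_def by (elim exE conjE)
    obtain n' N' \<tau>' q where f': "\<Lambda>.frame m L Q n' N' \<tau>' q" "count Q = (\<lambda>t. card {i. i < n' \<and> \<tau>' i = t})"
      using count[OF Q] unfolding is_count_def by (elim exE conjE)
    show ?thesis
      by (rule \<Lambda>.frame_surjection_count[OF P retr[OF Q] free_fin_gen[OF retr[OF Q]] f(1) f'(1)])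
        (use le f(2) f'(2) in simp)
  qed
  define A where "A = {(k, P). \<Lambda>.retract k P \<and> rk.module_class k P \<noteq> 0}"
  obtain B where B: "finite B" "B \<subseteq> A" "\<forall>a \<in> A. \<exists>b \<in> B. \<forall>t \<in> {..<m}. count (snd b) t \<le> count (snd a) t"
    using finite_dominating_subset[OF finite_lessThan, of A m "\<lambda>a. count (snd a)"] by (elim exE conjE)
  define S where "S = (\<lambda>(k, P). module_class k P) ` B"
  have SG: "S \<subseteq> carrier G"
  proof
    fix s assume "s \<in> S"
    then obtain l Q where lQ: "(l, Q) \<in> B" "s = module_class l Q" unfolding S_def by (elim imageE) (auto split: prod.splits)
    then have "\<Lambda>.retract l Q" using B(2) unfolding A_def by blast
    then show "s \<in> carrier G" unfolding lQ(2) by (rule module_class_closed[OF retr(1)])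
  qed
  have gen: "module_class k P \<in> generate G S" if "\<Lambda>.retract k P" "rk.module_class k P = r" for k P r
    using that
  proof (induction r arbitrary: P rule: less_induct)
    case (less r)
    show ?case
    proof (cases "r = 0")
      case True
      then have "module_class k P = \<one>\<^bsub>G\<^esub>" using module_class_rank_zero[OF retr(1)[OF less.prems(1)]] less.prems(2) by simp
      then show ?thesis by (simp add: generate.one)
    next
      case False
      then have "(k, P) \<in> A" unfolding A_def using less.prems by simp
      then obtain b where b: "b \<in> B" "\<forall>t \<in> {..<m}. count (snd b) t \<le> count P t" using B(3) by fastforce
      obtain l Q where lQ: "b = (l, Q)" by (cases b)
      have Q: "\<Lambda>.retract l Q" "rk.module_class l Q \<noteq> 0" using b(1) B(2) unfolding A_def lQ by blast+
      have le: "\<forall>t \<in> {..<m}. count Q t \<le> count P t" using b(2) by (simp add: lQ)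
      obtain F where F: "F \<in> lin_maps \<Lambda> (free \<Lambda> k) (free \<Lambda> l)" "F ` P = Q"
        using surj[OF less.prems(1) Q(1) le] by (elim bexE)
      define K where "K = {x \<in> P. F x = \<zero>\<^bsub>rows \<Lambda>\<^esub>}"
      have K: "\<Lambda>.retract k K" unfolding K_def by (rule \<Lambda>.retract_kernel[OF less.prems(1) Q(1) F])
      have "rk.module_class k P = rk.module_class l Q + rk.module_class k K"
        using rk.module_class_exact[OF F(1) retr[OF less.prems(1)]] unfolding F(2) K_def by simp
      then have "rk.module_class k K < r" using less.prems(2) Q(2) by simp
      then have "module_class k K \<in> generate G S" by (rule less.IH[OF _ K refl])
      moreover have "module_class l Q \<in> generate G S"
        by (rule generate.incl) (use imageI[OF b(1), of "\<lambda>(k, P). module_class k P"] in \<open>simp add: S_def lQ\<close>)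
      moreover have "module_class k P = module_class l Q \<otimes>\<^bsub>G\<^esub> module_class k K"
        using module_class_exact[OF F(1) retr[OF less.prems(1)]] unfolding F(2) K_def by simp
      ultimately show ?thesis by (simp add: generate.eng)
    qed
  qed
  show ?thesis
  proof (rule that[of S])
    show "finite S" unfolding S_def using B(1) by (rule finite_imageI)
    show "projective_classes \<subseteq> generate G S"
    proof
      fix c assume "c \<in> projective_classes"
      then obtain k P where "c = module_class k P" "\<Lambda>.retract k P" unfolding projective_classes_def by (elim CollectE exE conjE)
      then show "c \<in> generate G S" using gen by simp
    qed
  qed (rule SG)
qed

end

text \<open>A left ideal with the given class is compared with itself, by identity maps and the zero homotopy.\<close>

theorem corollary2p1:
  fixes R :: "('r, 'k) ring_scheme" and M :: "('r, 'm, 'c) module_scheme"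
  assumes "cring R" and "noetherian_ring R" and "semilocal R" and "normal_domain R"
    and "gives_NCR R M"
  shows "fg_abelian_group (class_group R)"
proof -
  have dom: "domain R" using assms(4) by (simp add: normal_domain_def)
  have M: "module R M" "fg_module R M" "faithful_module R M" and gl: "gl_dim (End_ring R M) < \<infinity>"
    using assms(5) by (simp_all add: gives_NCR_def)
  interpret faithful_fg_module R M
    by (intro faithful_fg_module.intro noetherian_normal_domain.intro noetherian_domain.intro
        noetherian_normal_domain_axioms.intro faithful_fg_module_axioms.intro assms(2,4) dom M)
  interpret weighted_module R M "class_group R" class_weight
    by (intro weighted_module.intro faithful_fg_module_axioms class_weight)
  have G: "comm_group (class_group R)" by (rule Cl.comm_group_axioms)
  obtain S where S: "finite S" "S \<subseteq> carrier (class_group R)" "projective_classes \<subseteq> generate (class_group R) S"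
    by (rule projective_classes_finitely_generated[OF G assms(3)])
  obtain \<alpha>0 x0 where \<alpha>0: "\<alpha>0 \<in> dual" "x0 \<in> carrier M" "\<alpha>0 x0 \<noteq> \<zero>\<^bsub>R\<^esub>" by (rule exists_nonzero_functional)
  have "C \<in> generate (class_group R) projective_classes" if C: "C \<in> carrier (class_group R)" for C
  proof -
    obtain I where I: "ideal I R" "has_nonzero I" "C = cl I" using C by (rule class_group_carrierE)
    interpret I: ideal I R by (rule I(1))
    have "\<not> I \<subseteq> {\<zero>\<^bsub>R\<^esub>}" using I(2) by (auto simp: has_nonzero_def)
    then have CI: "C = class_weight I" by (simp add: class_weight_def I(3))
    define Z where "Z = ideal_submodule \<alpha>0 I"
    have "class_weight ((\<lambda>s. \<alpha>0 x0 \<otimes>\<^bsub>R\<^esub> s) ` I) = class_weight I"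
      using \<alpha>0 by (intro class_weight_scale) (auto simp: dual_def)
    then have CZ: "module_class 1 Z = C" unfolding Z_def CI by (rule module_class_ideal_submodule[OF \<alpha>0 I(1)])
    have Z: "lsub \<Lambda> (rows \<Lambda>) Z" unfolding Z_def by (rule ideal_submodule_lsub[OF \<alpha>0(1) I(1)])
    have Zf: "Z \<subseteq> free_carrier \<Lambda> 1" unfolding Z_def ideal_submodule_def by (intro subsetI) simp
    have Zm: "left_module \<Lambda> (sub_rows \<Lambda> Z)" by (rule \<Lambda>.sub_rows_module[OF Z])
    have id: "(\<lambda>x. x) \<in> lin_maps \<Lambda> (sub_rows \<Lambda> Z) (sub_rows \<Lambda> Z)" by (rule lin_mapsI) simp_all
    have zero: "(\<lambda>x. \<zero>\<^bsub>rows \<Lambda>\<^esub>) \<in> lin_maps \<Lambda> (free \<Lambda> 1) (sub_rows \<Lambda> Z)"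
      by (rule lin_mapsI) (simp_all add: lsub_zero[OF Z] \<Lambda>.rows.smult_zero_right)
    have c: "\<Lambda>.comparison 1 Z (sub_rows \<Lambda> Z)"
      unfolding \<Lambda>.comparison_def
      by (intro conjI Z Zf Zm bexI[OF _ id] bexI[OF _ zero] ballI) (simp add: lsub_subset[OF Z])
    obtain n where n: "pd_below \<Lambda> n (sub_rows \<Lambda> Z)" using pd_below_if_gl_dim[OF gl Zm] by (elim exE)
    show ?thesis unfolding CZ[symmetric] by (rule syzygy_class[OF G free_cover n c])
  qed
  moreover have "generate (class_group R) projective_classes \<subseteq> generate (class_group R) S"
    by (rule Cl.generate_subgroup_incl[OF S(3) Cl.generate_is_subgroup[OF S(2)]])
  moreover have "generate (class_group R) S \<subseteq> carrier (class_group R)" by (rule Cl.generate_incl[OF S(2)])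
  ultimately have "generate (class_group R) S = carrier (class_group R)" by (intro subset_antisym subsetI) auto
  then show ?thesis unfolding fg_abelian_group_def using G S(1,2) by (intro conjI exI[of _ S])
qed

end
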